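(* Let $\{u\}_{\nu>0}=\{u^\nu\}_{\nu>0}$ be a sequence of homogeneous and stationary martingale solutions to the stochastically forced Navier–Stokes equations on $\mathbb{T}^3$ with viscosity $\nu$ and forcing $\partial_tW$ (with coefficients $\sigma_k$ independent of $\nu$), which satisfy weak anomalous dissipation: $$\lim_{\nu\to 0}\nu\,\mathbf{E}\|u\|_{L^2(\mathbb{T}^3)}^2=0 .$$ Then the following hold. (i) (4/3 law) There exists $\ell_D=\ell_D(\nu)$ with $\lim_{\nu\to0}\ell_D=0$ such that $$\lim_{\ell_I\to0}\limsup_{\nu\to0}\sup_{\ell\in[\ell_D,\ell_I]}\left|\mathbf{E}\frac{1}{4\pi\ell}\int_{\mathbb{S}^2}|\delta_{\ell\hat n}u|^2\,\delta_{\ell\hat n}u\cdot\hat n\,dS(\hat n)+\frac43\varepsilon\right|=0 .$$ (ii) (4/5 law) There exists $\ell_D=\ell_D(\nu)$ with $\lim_{\nu\to0}\ell_D=0$ such that $$\lim_{\ell_I\to0}\limsup_{\nu\to0}\sup_{\ell\in[\ell_D,\ell_I]}\left|\mathbf{E}\frac{1}{4\pi\ell}\int_{\mathbb{S}^2}(\delta_{\ell\hat n}u\cdot\hat n)^3\,dS(\hat n)+\frac45\varepsilon\right|=0 .$$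
   Context: Equations. On the periodic box $\mathbb{T}^3$, with Lebesgue measure $dx$ normalized so that $|\mathbb{T}^3|=1$, consider $\partial_t u+u\cdot\nabla u+\nabla p-\nu\Delta u=\partial_t W$, $\mathrm{div}\,u=0$, with $\nu>0$ and $\partial_tW(t,x)=\sum_{k\ge1}\sigma_ke_k(x)\,d\beta_k(t)$, where $\{\beta_k\}$ are independent one-dimensional Brownian motions, $\{e_k\}$ are orthonormal (in $L^2(\mathbb{T}^3,dx)$) eigenfunctions of the Stokes operator on $\mathbb{T}^3$, and $\{\sigma_k\}$ are fixed constants (independent of $\nu$) with $\varepsilon:=\frac12\sum_k|\sigma_k|^2<\infty$. $L^2_{\mathrm{div}}$ and $H^1_{\mathrm{div}}$ are the completions of $C^\infty_{\mathrm{div}}$ (smooth divergence-free zero-average vector fields on $\mathbb{T}^3$) in the $L^2$ and $H^1$ norms; $\dot H^\alpha_x$ are homogeneous Sobolev spaces. Stationary martingale solution on $[0,\infty)$: a stochastic basis $(\Omega,(\mathcal F_t)_{t\ge0},\mathbf P,\{\beta_k\})$ with complete right-continuous filtration and an $\mathcal F_t$-progressively measurable process $u:[0,\infty)\times\Omega\to L^2_{\mathrm{div}}$ such that: for each $T\ge0$ the restriction $u|_{[0,T]}$ has sample paths in $C_t(\dot H^\alpha_x)\cap L^\infty_tL^2_{\mathrm{div}}\cap L^2_tH^1_{\mathrm{div}}$ for some $\alpha<0$; the law of the path $u(\cdot+\tau)$ is the same as that of $u(\cdot)$ for each $\tau\ge0$; and for all $t\ge0$, $\varphi\in C^\infty_{\mathrm{div}}$,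 $\mathbf P$-almost surely $$\int u(t)\cdot\varphi\,dx+\nu\int_0^t\!\!\int\nabla u:\nabla\varphi\,dx\,ds+\int_0^t\!\!\int[(u\cdot\nabla)u]\cdot\varphi\,dx\,ds=\int u(0)\cdot\varphi\,dx+\sum_k\int_0^t\!\!\int\sigma_ke_k\cdot\varphi\,dx\,d\beta_k(s).$$ It is homogeneous if in addition $u(t,\cdot+h)$ is equal in law to $u(t,\cdot)$ for every $h\in\mathbb R^3$. The stochastic basis may depend on $\nu$. Standing properties: stationary martingale solutions satisfy the energy inequality $\nu\,\mathbf E\|\nabla u\|_{L^2_x}^2\le\varepsilon$ and $\mathbf E\|u\|^r_{L^\infty(0,T;L^2_x)}<\infty$ for all $r\in[1,\infty)$, $T<\infty$. Notation: $\delta_hu(x)=u(x+h)-u(x)$ for $h\in\mathbb R^3$. By stationarity and homogeneity, the expectations in the claim are evaluated at a point $(t,x)$ and do not depend on it (as $u(t,\cdot)$ is only defined almost everywhere, this is understood for almost every $x$, equivalently as the integral of the expectation over the unit-volume torus); $(t,x)$ is suppressed. *)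

theory Defs
  imports "HOL-Probability.Probability"
begin

section \<open>Fields on the unit torus\<close>

text \<open>The torus is $\mathbb{R}^3/\mathbb{Z}^3$.  A function on it is a function on
  \<^typ>\<open>real^3\<close> that is periodic under the integer lattice; integrals over the torus
  are integrals over the unit cube.\<close>

type_synonym vfield = "real^3 \<Rightarrow> real^3"

definition lattice :: "(real^3) set" where
  "lattice = {k. \<forall>i. k $ i \<in> \<int>}"

definition torus :: "(real^3) measure" where
  "torus = restrict_space lborel (cbox 0 1)"

definition periodic :: "(real^3 \<Rightarrow> 'b) \<Rightarrow> bool" where
  "periodic v \<longleftrightarrow> (\<forall>x. \<forall>k\<in>lattice. v (x + k) = v x)"

definition pderiv_at :: "3 \<Rightarrow> (real^3 \<Rightarrow> 'b::real_normed_vector) \<Rightarrow> real^3 \<Rightarrow> 'b" where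
  "pderiv_at i f x = frechet_derivative f (at x) (axis i 1)"

primrec C_k :: "nat \<Rightarrow> (real^3 \<Rightarrow> 'b::real_normed_vector) \<Rightarrow> bool" where
  "C_k 0 f \<longleftrightarrow> continuous_on UNIV f"
| "C_k (Suc k) f \<longleftrightarrow> (\<forall>x. f differentiable (at x)) \<and> (\<forall>i. C_k k (pderiv_at i f))"

definition smooth :: "(real^3 \<Rightarrow> 'b::real_normed_vector) \<Rightarrow> bool" where
  "smooth f \<longleftrightarrow> (\<forall>k. C_k k f)"

definition gradient :: "(real^3 \<Rightarrow> real) \<Rightarrow> vfield" where
  "gradient q x = (\<chi> i. pderiv_at i q x)"

definition divergence :: "vfield \<Rightarrow> real^3 \<Rightarrow> real" where
  "divergence v x = (\<Sum>i\<in>UNIV. pderiv_at i v x $ i)"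

definition laplacian :: "vfield \<Rightarrow> vfield" where
  "laplacian v x = (\<Sum>i\<in>UNIV. pderiv_at i (pderiv_at i v) x)"

definition Cinf_div :: "vfield set" where
  "Cinf_div = {v. periodic v \<and> smooth v \<and> (\<forall>x. divergence v x = 0) \<and> (LINT x|torus. v x) = 0}"

text \<open>Elements of $L^2$ are everywhere defined, Borel measurable representatives.\<close>

definition L2 :: "(real^3 \<Rightarrow> 'b::{real_inner, second_countable_topology}) set" where
  "L2 = {v. periodic v \<and> v \<in> borel_measurable borel \<and> integrable torus (\<lambda>x. (norm (v x))\<^sup>2)}"

definition L2_inner :: "(real^3 \<Rightarrow> 'b::real_inner) \<Rightarrow> (real^3 \<Rightarrow> 'b) \<Rightarrow> real" where
  "L2_inner v w = (LINT x|torus. v x \<bullet> w x)"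

definition L2_norm :: "(real^3 \<Rightarrow> 'b::real_inner) \<Rightarrow> real" where
  "L2_norm v = sqrt (LINT x|torus. (norm (v x))\<^sup>2)"

definition L2_div :: "vfield set" where
  "L2_div = {v \<in> L2. \<exists>\<phi>. (\<forall>n. \<phi> n \<in> Cinf_div) \<and> (\<lambda>n. L2_norm (\<lambda>x. \<phi> n x - v x)) \<longlonglongrightarrow> 0}"

text \<open>The completion of \<^const>\<open>Cinf_div\<close> in the $H^1$ norm, realised inside $L^2$: \<open>v\<close> is the
  $L^2$ limit of fields $\varphi_n$ whose gradients converge in $L^2$, and the limit \<open>G\<close> of the
  gradients is $\nabla v$.  Here $G_{ij} = \partial_j v_i$, and norm and inner product of
  \<^typ>\<open>real^3^3\<close> are those of Frobenius.\<close>

definition has_H1_gradient :: "vfield \<Rightarrow> (real^3 \<Rightarrow> real^3^3) \<Rightarrow> bool" where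
  "has_H1_gradient v G \<longleftrightarrow> v \<in> L2 \<and> G \<in> L2 \<and>
     (\<exists>\<phi>. (\<forall>n. \<phi> n \<in> Cinf_div) \<and>
          (\<lambda>n. L2_norm (\<lambda>x. \<phi> n x - v x)) \<longlonglongrightarrow> 0 \<and>
          (\<lambda>n. L2_norm (\<lambda>x. jacobian (\<phi> n) (at x) - G x)) \<longlonglongrightarrow> 0)"

definition H1_div :: "vfield set" where
  "H1_div = {v. \<exists>G. has_H1_gradient v G}"

text \<open>The gradient of \<open>v \<in> H1_div\<close> is unique up to null sets.  Off \<^term>\<open>H1_div\<close> it is set to
  zero, which only matters on null sets of times or of sample points.\<close>

definition grad :: "vfield \<Rightarrow> real^3 \<Rightarrow> real^3^3" where
  "grad v = (if v \<in> H1_div then (SOME G. has_H1_gradient v G) else (\<lambda>_. 0))"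

text \<open>$\|\nabla v\|_{L^2}^2$, infinite if $v \notin H^1$.\<close>

definition grad_normsq :: "vfield \<Rightarrow> ennreal" where
  "grad_normsq v = (if v \<in> H1_div then ennreal ((L2_norm (grad v))\<^sup>2) else \<infinity>)"

definition fourier_coeff :: "vfield \<Rightarrow> real^3 \<Rightarrow> complex^3" where
  "fourier_coeff v k = (\<chi> j. LINT x|torus. complex_of_real (v x $ j) * cis (- 2 * pi * (k \<bullet> x)))"

text \<open>The square of the homogeneous Sobolev norm of $\dot H^\alpha$.\<close>

definition sobolev_normsq :: "real \<Rightarrow> vfield \<Rightarrow> ennreal" where
  "sobolev_normsq \<alpha> v =
     (\<Sum>\<^sub>\<infinity>k\<in>lattice - {0}. ennreal ((2 * pi * norm k) powr (2 * \<alpha>) * (norm (fourier_coeff v k))\<^sup>2))"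

text \<open>The Borel sigma-algebra of the metric space $L^2_{\mathrm{div}}$, generated by its open sets.\<close>

definition L2_div_borel :: "vfield measure" where
  "L2_div_borel = sigma L2_div
     {U. U \<subseteq> L2_div \<and>
         (\<forall>v\<in>U. \<exists>r>0. \<forall>w\<in>L2_div. L2_norm (\<lambda>x. w x - v x) < r \<longrightarrow> w \<in> U)}"


section \<open>The forcing\<close>

text \<open>Eigenfunctions of the Stokes operator are smooth after correction on a null set; \<open>q\<close> is
  the pressure removed by the Leray projection.\<close>

definition stokes_eigenfunction :: "vfield \<Rightarrow> bool" where
  "stokes_eigenfunction v \<longleftrightarrow> v \<in> Cinf_div \<and> (\<exists>x. v x \<noteq> 0) \<and>
     (\<exists>(\<mu>::real) q. periodic q \<and> smooth q \<and> (\<forall>x. - laplacian v x + gradient q x = \<mu> *\<^sub>R v x))"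

definition noise_coefficients :: "(nat \<Rightarrow> real) \<Rightarrow> (nat \<Rightarrow> vfield) \<Rightarrow> bool" where
  "noise_coefficients \<sigma> e \<longleftrightarrow>
     (\<forall>k. stokes_eigenfunction (e k)) \<and>
     (\<forall>j k. L2_inner (e j) (e k) = (if j = k then 1 else 0)) \<and>
     summable (\<lambda>k. \<bar>\<sigma> k\<bar>\<^sup>2)"

definition energy_input :: "(nat \<Rightarrow> real) \<Rightarrow> real" where
  "energy_input \<sigma> = 1/2 * (\<Sum>k. \<bar>\<sigma> k\<bar>\<^sup>2)"

text \<open>Times are the nonnegative reals; values at negative times are irrelevant throughout.\<close>

definition usual_filtration :: "'w measure \<Rightarrow> (real \<Rightarrow> 'w measure) \<Rightarrow> bool" where
  "usual_filtration M F \<longleftrightarrow>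
     (\<forall>t\<ge>0. subalgebra M (F t)) \<and>
     (\<forall>s t. 0 \<le> s \<and> s \<le> t \<longrightarrow> sets (F s) \<subseteq> sets (F t)) \<and>
     (\<forall>t\<ge>0. sets (F t) = (\<Inter>s\<in>{t<..}. sets (F s))) \<and>
     complete_measure M \<and> null_sets M \<subseteq> sets (F 0)"

text \<open>Independent one-dimensional Brownian motions relative to the filtration: the joint
  increments of the whole family after time \<open>s\<close> are independent of \<open>F s\<close>.\<close>

definition brownian_family ::
  "'w measure \<Rightarrow> (real \<Rightarrow> 'w measure) \<Rightarrow> (nat \<Rightarrow> real \<Rightarrow> 'w \<Rightarrow> real) \<Rightarrow> bool" where
  "brownian_family M F \<beta> \<longleftrightarrow>
     (\<forall>k. \<forall>t\<ge>0. \<beta> k t \<in> borel_measurable (F t)) \<and>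
     (\<forall>k. AE \<omega> in M. \<beta> k 0 \<omega> = 0) \<and>
     (\<forall>k. AE \<omega> in M. continuous_on {0..} (\<lambda>t. \<beta> k t \<omega>)) \<and>
     (\<forall>k s t. 0 \<le> s \<and> s < t \<longrightarrow>
        distributed M lborel (\<lambda>\<omega>. \<beta> k t \<omega> - \<beta> k s \<omega>) (normal_density 0 (sqrt (t - s)))) \<and>
     (\<forall>s t. 0 \<le> s \<and> s < t \<longrightarrow>
        prob_space.indep_set M (sets (F s))
          (sets (vimage_algebra (space M) (\<lambda>\<omega> k. \<beta> k t \<omega> - \<beta> k s \<omega>) (\<Pi>\<^sub>M k\<in>UNIV. borel)))) \<and>
     prob_space.indep_vars M (\<lambda>_. \<Pi>\<^sub>M t\<in>{0..}. borel) (\<lambda>k \<omega>. \<lambda>t\<in>{0..}. \<beta> k t \<omega>) UNIV"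

definition stochastic_basis ::
  "'w measure \<Rightarrow> (real \<Rightarrow> 'w measure) \<Rightarrow> (nat \<Rightarrow> real \<Rightarrow> 'w \<Rightarrow> real) \<Rightarrow> bool" where
  "stochastic_basis M F \<beta> \<longleftrightarrow> prob_space M \<and> usual_filtration M F \<and> brownian_family M F \<beta>"


section \<open>Stationary martingale solutions\<close>

text \<open>Besides progressive measurability as an $L^2_{\mathrm{div}}$-valued process we require the
  representatives \<open>u t \<omega>\<close> to be chosen jointly measurable in \<open>(t, \<omega>, x)\<close>.  A progressively
  measurable process in the separable space $L^2_{\mathrm{div}}$ always has such representatives;
  they give the expectation at a point $x$ a meaning for almost every $x$.\<close>

definition progressive_process ::
  "(real \<Rightarrow> 'w measure) \<Rightarrow> (real \<Rightarrow> 'w \<Rightarrow> vfield) \<Rightarrow> bool" where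
  "progressive_process F u \<longleftrightarrow>
     (\<forall>T\<ge>0. (\<lambda>(t, \<omega>). u t \<omega>) \<in> restrict_space borel {0..T} \<Otimes>\<^sub>M F T \<rightarrow>\<^sub>M L2_div_borel) \<and>
     (\<forall>T\<ge>0. (\<lambda>((t, \<omega>), x). u t \<omega> x) \<in>
               (restrict_space borel {0..T} \<Otimes>\<^sub>M F T) \<Otimes>\<^sub>M borel \<rightarrow>\<^sub>M borel)"

definition Linf_L2_norm :: "real \<Rightarrow> (real \<Rightarrow> vfield) \<Rightarrow> ennreal" where
  "Linf_L2_norm T f = esssup (restrict_space lborel {0..T}) (\<lambda>s. ennreal (L2_norm (f s)))"

definition solution_path :: "real \<Rightarrow> real \<Rightarrow> (real \<Rightarrow> vfield) \<Rightarrow> bool" where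
  "solution_path \<alpha> T f \<longleftrightarrow>
     (\<forall>t\<in>{0..T}. ((\<lambda>s. sobolev_normsq \<alpha> (\<lambda>x. f s x - f t x)) \<longlongrightarrow> 0) (at t within {0..T})) \<and>
     Linf_L2_norm T f < \<infinity> \<and>
     (\<integral>\<^sup>+ s\<in>{0..T}. (ennreal ((L2_norm (f s))\<^sup>2) + grad_normsq (f s)) \<partial>lborel) < \<infinity>"

definition stationary_process :: "'w measure \<Rightarrow> (real \<Rightarrow> 'w \<Rightarrow> vfield) \<Rightarrow> bool" where
  "stationary_process M u \<longleftrightarrow>
     (\<forall>\<tau>\<ge>0. distr M (\<Pi>\<^sub>M t\<in>{0..}. L2_div_borel) (\<lambda>\<omega>. \<lambda>t\<in>{0..}. u (t + \<tau>) \<omega>)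
            = distr M (\<Pi>\<^sub>M t\<in>{0..}. L2_div_borel) (\<lambda>\<omega>. \<lambda>t\<in>{0..}. u t \<omega>))"

text \<open>The integrand of the stochastic integral is constant in time and deterministic, so
  $\int_0^t \int \sigma_k e_k \cdot \varphi \, dx \, d\beta_k(s)
    = \sigma_k \langle e_k, \varphi\rangle (\beta_k(t) - \beta_k(0))$.
  The $i$-th component of $(u \cdot \nabla) u$ is $\sum_j (\nabla u)_{ij} u_j$.\<close>

definition weak_navier_stokes ::
  "(nat \<Rightarrow> real) \<Rightarrow> (nat \<Rightarrow> vfield) \<Rightarrow> real \<Rightarrow> 'w measure \<Rightarrow> (nat \<Rightarrow> real \<Rightarrow> 'w \<Rightarrow> real) \<Rightarrow>
   (real \<Rightarrow> 'w \<Rightarrow> vfield) \<Rightarrow> bool" where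
  "weak_navier_stokes \<sigma> e \<nu> M \<beta> u \<longleftrightarrow>
     (\<forall>t\<ge>0. \<forall>\<phi>\<in>Cinf_div. AE \<omega> in M.
        (\<lambda>k. \<sigma> k * L2_inner (e k) \<phi> * (\<beta> k t \<omega> - \<beta> k 0 \<omega>)) sums
          (L2_inner (u t \<omega>) \<phi>
           + \<nu> * (LINT s:{0..t}|lborel. L2_inner (grad (u s \<omega>)) (\<lambda>x. jacobian \<phi> (at x)))
           + (LINT s:{0..t}|lborel. L2_inner (\<lambda>x. grad (u s \<omega>) x *v u s \<omega> x) \<phi>)
           - L2_inner (u 0 \<omega>) \<phi>))"

definition stationary_martingale_solution ::
  "(nat \<Rightarrow> real) \<Rightarrow> (nat \<Rightarrow> vfield) \<Rightarrow> real \<Rightarrow> 'w measure \<Rightarrow> (real \<Rightarrow> 'w measure) \<Rightarrow>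
   (nat \<Rightarrow> real \<Rightarrow> 'w \<Rightarrow> real) \<Rightarrow> (real \<Rightarrow> 'w \<Rightarrow> vfield) \<Rightarrow> bool" where
  "stationary_martingale_solution \<sigma> e \<nu> M F \<beta> u \<longleftrightarrow>
     stochastic_basis M F \<beta> \<and>
     progressive_process F u \<and>
     (\<forall>T\<ge>0. \<exists>\<alpha><0. AE \<omega> in M. solution_path \<alpha> T (\<lambda>t. u t \<omega>)) \<and>
     stationary_process M u \<and>
     weak_navier_stokes \<sigma> e \<nu> M \<beta> u"

definition homogeneous :: "'w measure \<Rightarrow> (real \<Rightarrow> 'w \<Rightarrow> vfield) \<Rightarrow> bool" where
  "homogeneous M u \<longleftrightarrow>
     (\<forall>t\<ge>0. \<forall>h. distr M L2_div_borel (\<lambda>\<omega> x. u t \<omega> (x + h)) = distr M L2_div_borel (u t))"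

definition ennreal_power :: "ennreal \<Rightarrow> real \<Rightarrow> ennreal" where
  "ennreal_power x r = (if x = \<infinity> then \<infinity> else ennreal (enn2real x powr r))"

text \<open>The a priori bounds which stationary martingale solutions are understood to satisfy; for
  Leray-type weak solutions they are not a consequence of the weak formulation.\<close>

definition energy_bounds ::
  "(nat \<Rightarrow> real) \<Rightarrow> real \<Rightarrow> 'w measure \<Rightarrow> (real \<Rightarrow> 'w \<Rightarrow> vfield) \<Rightarrow> bool" where
  "energy_bounds \<sigma> \<nu> M u \<longleftrightarrow>
     (\<forall>t\<ge>0. ennreal \<nu> * (\<integral>\<^sup>+ \<omega>. grad_normsq (u t \<omega>) \<partial>M) \<le> ennreal (energy_input \<sigma>)) \<and>
     (\<forall>r\<ge>1. \<forall>T\<ge>0. (\<integral>\<^sup>+ \<omega>. ennreal_power (Linf_L2_norm T (\<lambda>t. u t \<omega>)) r \<partial>M) < \<infinity>)"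

definition mean_L2_normsq :: "'w measure \<Rightarrow> (real \<Rightarrow> 'w \<Rightarrow> vfield) \<Rightarrow> real \<Rightarrow> ennreal" where
  "mean_L2_normsq M u t = (\<integral>\<^sup>+ \<omega>. ennreal ((L2_norm (u t \<omega>))\<^sup>2) \<partial>M)"


section \<open>Structure functions\<close>

text \<open>Surface measure on the unit sphere $S$ of $\mathbb{R}^3$:
  $|A| = 3 \, |\{r n : 0 < r < 1, n \in A\}|$ for $A \subseteq S$, of total mass $4\pi$.\<close>

definition sphere_measure :: "(real^3) measure" where
  "sphere_measure =
     scale_measure 3 (distr (restrict_space lborel (ball 0 1 - {0})) borel (\<lambda>x. x /\<^sub>R norm x))"

definition increment :: "real^3 \<Rightarrow> vfield \<Rightarrow> vfield" where
  "increment h v x = v (x + h) - v x"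

text \<open>The expectations below, defined for almost every $x$ and independent of it, are integrated
  over the torus, which has unit volume.\<close>

definition structure_43 :: "'w measure \<Rightarrow> (real \<Rightarrow> 'w \<Rightarrow> vfield) \<Rightarrow> real \<Rightarrow> real \<Rightarrow> real" where
  "structure_43 M u t l =
     (LINT x|torus. LINT \<omega>|M. 1 / (4 * pi * l) *
        (LINT n|sphere_measure.
           (norm (increment (l *\<^sub>R n) (u t \<omega>) x))\<^sup>2 * (increment (l *\<^sub>R n) (u t \<omega>) x \<bullet> n)))"

definition structure_45 :: "'w measure \<Rightarrow> (real \<Rightarrow> 'w \<Rightarrow> vfield) \<Rightarrow> real \<Rightarrow> real \<Rightarrow> real" where
  "structure_45 M u t l =
     (LINT x|torus. LINT \<omega>|M. 1 / (4 * pi * l) *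
        (LINT n|sphere_measure. (increment (l *\<^sub>R n) (u t \<omega>) x \<bullet> n) ^ 3))"

end

theory Submission
  imports Defs
begin

text \<open>Fix \<open>\<nu>\<close> and \<open>t\<close>.  For the projection \<open>X\<close> of \<open>u\<close> onto a divergence-free Fourier mode, Ito's formula and
 stationarity balance the mean of \<open>X\<close> times its drift against the variance of the forcing.  Summed over the
 modes of a wave number, this identifies the Fourier coefficients, in the separation \<open>h\<close>, of the
 Karman--Howarth--Monin relation between \<open>D(h) = E \<integral> |\<delta>|\<^sup>2 \<delta> dx\<close>, where \<open>\<delta> = u(x + h) - u(x)\<close>, the correlation
 \<open>\<Gamma>(h) = E \<integral> u(x) \<bullet> u(x + h) dx\<close> and the correlation of the forcing, which is \<open>2\<epsilon>\<close> at \<open>h = 0\<close>.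
 Almost every \<open>u\<close> lies in $H^1 \subseteq L^3$, so \<open>D\<close> is continuous, and by uniqueness of Fourier coefficients the
 relation holds against every \<open>C\<^sup>2\<close> kernel with compact support.  Radial kernels concentrating on a shell give the
 4/3 law at separation \<open>l\<close>, with an error from the modulus of continuity of the forcing correlation at \<open>0\<close>
 and one from the viscous term.  As \<open>\<Gamma>\<close> is Lipschitz with constant \<open>\<Lambda> = E \<parallel>u\<parallel> \<parallel>\<nabla>u\<parallel>\<close>, the latter is at most a
 multiple of \<open>\<nu>\<Lambda> / l \<le> sqrt (\<nu> E \<parallel>u\<parallel>\<^sup>2 \<epsilon>) / l\<close>, which tends to zero uniformly in \<open>l \<ge> (\<nu> E \<parallel>u\<parallel>\<^sup>2)^(1/4) + \<nu>\<close>.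
 The 4/5 law follows from the same estimates, since incompressibility expresses integrals of \<open>(h \<bullet> \<delta>)\<^sup>3\<close>
 against radial kernels by integrals of \<open>|\<delta>|\<^sup>2 (h \<bullet> \<delta>)\<close>.\<close>

text \<open>The paths of \<open>u\<close> are continuous only in a negative Sobolev norm, so a
  two-point energy balance for the field itself would have to go through a regularization and its
  commutators. A projection onto a smooth field is instead a scalar process driven by additive noise
  with deterministic coefficients. For it stationarity gives an exact second-moment balance,
  although for the full field only an energy inequality is known. Uniqueness of Fourier coefficients
  puts the modes together again because all three terms are continuous in \<open>h\<close>; for the
  cubic term this is where L^3 enters.

  The constants come from integration by parts in dimension 3. If the profile \<open>th\<close> has
  derivative \<open>- ka\<close>, then 3 \<integral> th = 2 \<integral> ka |h|^2, so the value 2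
  \<epsilon> of the forcing correlation at 0 turns into 4/3 \<epsilon>. The next moment has 5 in
  place of 3, and the kinematic factor 3/2 leads to 4/5 \<epsilon>. The fourth root in the lower
  scale is the balance point: the viscous error at scale l is a square root divided by l, hence
  still small for l down to the root of that square root.\<close>

abbreviation torus_mean :: "(real^3 => 'b::{banach, second_countable_topology}) => 'b" (binder "AV " 60) where
 "torus_mean f \<equiv> integral\<^sup>L torus f"

abbreviation space_integral :: "(real^3 => 'b::{banach, second_countable_topology}) => 'b" (binder "LI " 60) where
 "space_integral f \<equiv> integral\<^sup>L lborel f"

abbreviation usum :: "('i => 'b::comm_monoid_add) => 'b" (binder "SU " 10) where
 "usum f \<equiv> sum f UNIV"

abbreviation "cts \<equiv> continuous_on UNIV"

abbreviation sq :: "'b::real_inner => real" where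
 "sq h \<equiv> h \<bullet> h"

abbreviation phase :: "real^3 => real^3 => real" where
 "phase k x \<equiv> 2 * pi * (k \<bullet> x)"

abbreviation jac :: "vfield => real^3 => real^3^3" where
 "jac ph \<equiv> %x. jacobian ph (at x)"

abbreviation L2_tendsto :: "(nat => real^3 => 'b::real_inner) => (real^3 => 'b) => bool" where
 "L2_tendsto f g \<equiv> (%n. L2_norm (%x. f n x - g x)) \<longlonglongrightarrow> 0"

type_synonym sfield = "real^3 => real"

section \<open>The torus\<close>

lemmas lint_cong = Bochner_Integration.integral_cong
 and lint_bound = Bochner_Integration.integrable_bound
 and lint_sum = Bochner_Integration.integral_sum
 and cts_measurable = borel_measurable_continuous_onI
 and cts_compose = continuous_on_compose2

lemma measurable_torusI: "f \<in> measurable borel N ==> f \<in> measurable torus N"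
 unfolding torus_def by (rule measurable_restrict_space1) simp

lemma space_torus: "space torus = cbox 0 1"
 by (simp add: torus_def space_restrict_space)

lemma emeasure_torus_space: "emeasure torus (space torus) = 1"
proof -
 have "emeasure lborel (cbox 0 (1::real^3)) = (\<Prod>b\<in>Basis. (1 - 0) \<bullet> (b::real^3))"
  by (subst emeasure_lborel_cbox) (auto simp: Basis_vec_def inner_axis)
 also have "... = 1"
  by (auto simp: Basis_vec_def inner_axis intro!: prod.neutral)
 finally show ?thesis
  unfolding space_torus by (simp add: torus_def emeasure_restrict_space)
qed

interpretation torus: prob_space torus
 by standard (rule emeasure_torus_space)

text \<open>Half-open, unlike the closed cube behind \<open>torus\<close>, so that its lattice
  translates cover every point exactly once; the two cubes differ by a null set.\<close>

definition unit_cell :: "(real^3) set" where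
 "unit_cell = {x. \<forall>i. 0 <= x $ i \<and> x $ i < 1}"

lemma unit_cell_borel [measurable]: "unit_cell \<in> sets borel"
 unfolding unit_cell_def by measurable

lemma AE_unit_cell: "AE x in lborel. indicator (cbox 0 (1::real^3)) x = (indicator unit_cell x :: ennreal)"
proof -
 have "emeasure lborel (cbox 0 (1::real^3) - box 0 1) = 0"
  by (subst emeasure_Diff) (auto simp: box_subset_cbox Basis_vec_def inner_axis emeasure_lborel_box_eq emeasure_lborel_cbox_eq)
 then have "cbox 0 (1::real^3) - box 0 1 \<in> null_sets lborel"
  by (auto simp: null_sets_def)
 then have "AE x in lborel. x \<notin> cbox 0 (1::real^3) - box 0 1"
  by (rule AE_not_in)
 then show ?thesis
 proof eventually_elim
  case (elim x)
  have "x \<in> box 0 1 ==> x \<in> unit_cell" "x \<in> unit_cell ==> x \<in> cbox 0 1"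
   by (auto simp: unit_cell_def mem_box_cart less_imp_le)
  with elim show ?case by (auto split: split_indicator)
 qed
qed

lemma nn_integral_torus_unit_cell:
 assumes [measurable]: "f \<in> borel_measurable borel"
 shows "(\<integral>\<^sup>+x. f x \<partial>torus) = (\<integral>\<^sup>+x. f x * indicator unit_cell x \<partial>lborel)"
proof -
 have "(\<integral>\<^sup>+x. f x \<partial>torus) = (\<integral>\<^sup>+x. f x * indicator (cbox 0 1) x \<partial>lborel)"
  unfolding torus_def by (subst nn_integral_restrict_space) auto
 also have "... = (\<integral>\<^sup>+x. f x * indicator unit_cell x \<partial>lborel)"
  using AE_unit_cell by (intro nn_integral_cong_AE) auto
 finally show ?thesis .
qed

section \<open>Tiling by lattice translates and translation invariance on the torus\<close>

lemma countable_lattice: "countable lattice"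
proof -
 have "lattice \<subseteq> (%(a,b,c). vector [of_int a, of_int b, of_int c]) ` (UNIV :: (int\<times>int\<times>int) set)"
 proof
  fix k :: "real^3" assume k: "k \<in> lattice"
  then obtain a b c where "k $ 1 = of_int a" "k $ 2 = of_int b" "k $ 3 = of_int c"
   unfolding lattice_def by (auto elim!: Ints_cases) (metis Ints_cases)
  then have "k = vector [of_int a, of_int b, of_int c]"
   by (auto simp: vec_eq_iff forall_3 vector_3)
  then show "k \<in> (%(a,b,c). vector [of_int a, of_int b, of_int c]) ` (UNIV :: (int\<times>int\<times>int) set)"
   by (intro image_eqI[of _ _ "(a,b,c)"]) auto
 qed
 then show ?thesis by (rule countable_subset) auto
qed

lemma lattice_uminus: "k \<in> lattice ==> - k \<in> lattice"
 and lattice_add: "k \<in> lattice ==> l \<in> lattice ==> k + l \<in> lattice"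
 and lattice_0 [simp]: "0 \<in> lattice"
 by (auto simp: lattice_def)

lemma lattice_diff: "k \<in> lattice ==> l \<in> lattice ==> k - l \<in> lattice"
 by (auto simp: lattice_def)

text \<open>The only lattice vector that moves \<open>x\<close> into the cell is minus its
  componentwise floor.\<close>

lemma unit_cell_tiling: "(\<integral>\<^sup>+k. indicator unit_cell (x + k) \<partial>count_space lattice) = 1"
proof -
 define k0 :: "real^3" where "k0 = (\<chi> i. - of_int \<lfloor>x $ i\<rfloor>)"
 have "indicator unit_cell (x + k) = (indicator {k0} k :: ennreal)" if kl: "k \<in> lattice" for k
 proof -
  have "x + k \<in> unit_cell \<longleftrightarrow> k = k0"
  proof
   assume a: "x + k \<in> unit_cell"
   show "k = k0"
    unfolding vec_eq_iff k0_def
   proof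
    fix i
    obtain m where m: "k $ i = of_int m"
     using kl unfolding lattice_def Ints_def by blast
    have "0 <= x $ i + of_int m" "x $ i + of_int m < 1"
     using a m unfolding unit_cell_def by (auto dest: spec[of _ i])
    then have "\<lfloor>x $ i\<rfloor> = - m" by (intro floor_unique) auto
    then show "k $ i = (\<chi> i. - of_int \<lfloor>x $ i\<rfloor>) $ i" using m by simp
   qed
  next
   assume "k = k0"
   then show "x + k \<in> unit_cell" unfolding unit_cell_def k0_def
    by (auto; linarith)
  qed
  then show ?thesis by (auto split: split_indicator)
 qed
 then have "(\<integral>\<^sup>+k. indicator unit_cell (x + k) \<partial>count_space lattice)
   = (\<integral>\<^sup>+k. indicator {k0} k \<partial>count_space lattice)"
  by (intro nn_integral_cong) auto
 also have "... = 1"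
 proof -
  have "k0 \<in> lattice" by (auto simp: k0_def lattice_def)
  then show ?thesis
   by (subst nn_integral_indicator) (auto simp: )
 qed
 finally show ?thesis .
qed

lemma nn_integral_lborel_shift:
 fixes f :: "'a::euclidean_space => ennreal"
 assumes [measurable]: "f \<in> borel_measurable borel"
 shows "(\<integral>\<^sup>+x. f (x + h) \<partial>lborel) = (\<integral>\<^sup>+x. f x \<partial>lborel)"
proof -
 have "(\<integral>\<^sup>+x. f x \<partial>lborel) = (\<integral>\<^sup>+x. f x \<partial>distr lborel borel ((+) h))"
  by (simp add: lborel_distr_plus)
 also have "... = (\<integral>\<^sup>+x. f (h + x) \<partial>lborel)"
  by (subst nn_integral_distr) auto
 finally show ?thesis by (simp add: add.commute)
qed

lemma periodicD: "periodic f ==> k \<in> lattice ==> f (x + k) = f x"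
 by (auto simp: periodic_def)

text \<open>Unfolding and folding: the tiling identity is inserted into the integral over the
  shifted cell, each summand is translated by its lattice vector, which \<open>f\<close> does not
  see, and the sum is folded the other way round. The two cells have then exchanged their
  roles.\<close>

lemma nn_integral_torus_shift:
 assumes [measurable]: "f \<in> borel_measurable borel" and per: "periodic f"
 shows "(\<integral>\<^sup>+x. f (x + h) \<partial>torus) = (\<integral>\<^sup>+x. f x \<partial>torus)"
proof -
 let ?Q = "indicator unit_cell :: real^3 => ennreal"
 have "(\<integral>\<^sup>+x. f (x + h) \<partial>torus) = (\<integral>\<^sup>+x. f (x + h) * ?Q ((x + h) - h) \<partial>lborel)"
  by (subst nn_integral_torus_unit_cell) auto
 also have "... = (\<integral>\<^sup>+x. f x * ?Q (x - h) \<partial>lborel)"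
  by (rule nn_integral_lborel_shift[where f="%x. f x * ?Q (x - h)"]) auto
 also have "... = (\<integral>\<^sup>+x. \<integral>\<^sup>+k. f x * ?Q (x - h) * ?Q (x + k) \<partial>count_space lattice \<partial>lborel)"
  by (subst nn_integral_cmult) (auto simp: unit_cell_tiling)
 also have "... = (\<integral>\<^sup>+k. \<integral>\<^sup>+x. f x * ?Q (x - h) * ?Q (x + k) \<partial>lborel \<partial>count_space lattice)"
  by (rule nn_integral_count_space_nn_integral) (auto intro: countable_lattice)
 also have "... = (\<integral>\<^sup>+k. \<integral>\<^sup>+x. f x * ?Q x * ?Q (x + - h + - k) \<partial>lborel \<partial>count_space lattice)"
 proof (rule nn_integral_cong)
  fix k assume "k \<in> space (count_space lattice)"
  then have k: "- k \<in> lattice" by (auto intro: lattice_uminus)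
  have "(\<integral>\<^sup>+x. f x * ?Q (x - h) * ?Q (x + k) \<partial>lborel)
    = (\<integral>\<^sup>+x. f (x + -k) * ?Q (x + -k - h) * ?Q (x + -k + k) \<partial>lborel)"
   by (rule nn_integral_lborel_shift[symmetric, where f="%x. f x * ?Q (x - h) * ?Q (x + k)"]) auto
  also have "... = (\<integral>\<^sup>+x. f x * ?Q x * ?Q (x + - h + - k) \<partial>lborel)"
   using periodicD[OF per k]
   by (intro nn_integral_cong) (simp add: mult_ac algebra_simps)
  finally show "(\<integral>\<^sup>+x. f x * ?Q (x - h) * ?Q (x + k) \<partial>lborel) = (\<integral>\<^sup>+x. f x * ?Q x * ?Q (x + - h + - k) \<partial>lborel)" .
 qed
 also have "... = (\<integral>\<^sup>+x. \<integral>\<^sup>+k. f x * ?Q x * ?Q (x + -h + - k) \<partial>count_space lattice \<partial>lborel)"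
  by (rule nn_integral_count_space_nn_integral[symmetric]) (auto intro: countable_lattice)
 also have "... = (\<integral>\<^sup>+x. f x * ?Q x \<partial>lborel)"
 proof (rule nn_integral_cong)
  fix x
  have "(\<integral>\<^sup>+k. ?Q (x + -h + - k) \<partial>count_space lattice) = (\<integral>\<^sup>+k. ?Q (x + - h + k) \<partial>count_space lattice)"
   by (rule nn_integral_bij_count_space[where g=uminus])
     (auto simp: bij_betw_def inj_on_def lattice_uminus intro!: image_eqI[of _ _ "- x" for x])
  then show "(\<integral>\<^sup>+k. f x * ?Q x * ?Q (x + -h + - k) \<partial>count_space lattice) = f x * ?Q x"
   by (subst nn_integral_cmult) (auto simp: unit_cell_tiling)
 qed
 also have "... = (\<integral>\<^sup>+x. f x \<partial>torus)"
  by (subst nn_integral_torus_unit_cell) auto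
 finally show ?thesis .
qed

text \<open>Reduction modulo the lattice. A periodic \<open>f\<close> equals \<open>f\<close>
  composed with \<open>vfrac\<close>, so its integral depends only on the image of the torus measure
  under \<open>vfrac\<close>.\<close>

definition vfrac :: "real^3 => real^3" where
 "vfrac x = (\<chi> i. frac (x $ i))"

lemma frac_measurable: "(frac :: real => real) \<in> borel_measurable borel"
 unfolding frac_def by measurable

lemma vfrac_measurable [measurable]: "vfrac \<in> borel_measurable borel"
 unfolding vfrac_def
 by (rule borel_measurable_euclidean_space[THEN iffD2])
   (auto simp: Basis_vec_def inner_axis intro!: measurable_compose[OF _ frac_measurable])

lemma periodic_vfrac: "periodic f ==> f (vfrac x) = f x"
proof -
 assume per: "periodic f"
 have "vfrac x = x + (\<chi> i. - of_int \<lfloor>x $ i\<rfloor>)"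
  by (auto simp: vec_eq_iff vfrac_def frac_def)
 moreover have "(\<chi> i. - of_int \<lfloor>x $ i\<rfloor>) \<in> lattice"
  by (auto simp: lattice_def)
 ultimately show ?thesis using per by (metis periodicD)
qed

lemma vfrac_add_lattice: "k \<in> lattice ==> vfrac (x + k) = vfrac x"
 by (auto simp: vfrac_def lattice_def vec_eq_iff intro!: frac_add_int_right)

text \<open>Invariance as an equality of image measures: in this form it carries over from
  nonnegative integrands to integrability and to Bochner integrals with values in any Banach
  space.\<close>

lemma distr_torus_shift: "distr torus borel (%x. vfrac (x + h)) = distr torus borel vfrac"
proof (rule measure_eqI)
 fix A :: "(real^3) set" assume "A \<in> sets (distr torus borel (%x. vfrac (x + h)))"
 then have [measurable]: "A \<in> sets borel" by simp
 have m: "(%x. vfrac (x + h)) \<in> torus \<rightarrow>\<^sub>M borel" "vfrac \<in> torus \<rightarrow>\<^sub>M borel"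
  by (rule measurable_torusI; measurable)+
 have per: "periodic (%x. indicator A (vfrac x) :: ennreal)"
  by (auto simp: periodic_def vfrac_add_lattice)
 have "emeasure (distr torus borel (%x. vfrac (x + h))) A = (\<integral>\<^sup>+x. indicator A x \<partial>distr torus borel (%x. vfrac (x + h)))"
  by simp
 also have "... = (\<integral>\<^sup>+x. indicator A (vfrac (x + h)) \<partial>torus)"
  by (subst nn_integral_distr[OF m(1)]) auto
 also have "... = (\<integral>\<^sup>+x. indicator A (vfrac x) \<partial>torus)"
  by (rule nn_integral_torus_shift[OF _ per]) measurable
 also have "... = (\<integral>\<^sup>+x. indicator A x \<partial>distr torus borel vfrac)"
  by (subst nn_integral_distr[OF m(2)]) auto
 finally show "emeasure (distr torus borel (%x. vfrac (x + h))) A = emeasure (distr torus borel vfrac) A"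
  by simp
qed simp

lemma
 fixes f :: "real^3 => 'b::{banach, second_countable_topology}"
 assumes [measurable]: "f \<in> borel_measurable borel" and per: "periodic f"
 shows integral_torus_shift: "(AV x. f (x + h)) = (AV x. f x)"
  and integrable_torus_shift: "integrable torus (%x. f (x + h)) \<longleftrightarrow> integrable torus f"
proof -
 have m: "(%x. vfrac (x + h)) \<in> torus \<rightarrow>\<^sub>M borel" "vfrac \<in> torus \<rightarrow>\<^sub>M borel"
  by (rule measurable_torusI; measurable)+
 have "(AV x. f (x + h)) = (AV x. f (vfrac (x + h)))"
  by (simp add: periodic_vfrac[OF per])
 also have "... = (LINT x|distr torus borel (%x. vfrac (x + h)). f x)"
  by (rule integral_distr[OF m(1), symmetric]) measurable
 also have "... = (AV x. f (vfrac x))"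
  unfolding distr_torus_shift by (rule integral_distr[OF m(2)]) measurable
 finally show "(AV x. f (x + h)) = (AV x. f x)"
  by (simp add: periodic_vfrac[OF per])
 have "integrable torus (%x. f (x + h)) \<longleftrightarrow> integrable torus (%x. f (vfrac (x + h)))"
  by (simp add: periodic_vfrac[OF per])
 also have "... \<longleftrightarrow> integrable (distr torus borel (%x. vfrac (x + h))) f"
  by (rule integrable_distr_eq[OF m(1), symmetric]) measurable
 also have "... \<longleftrightarrow> integrable torus (%x. f (vfrac x))"
  unfolding distr_torus_shift by (rule integrable_distr_eq[OF m(2)]) measurable
 finally show "integrable torus (%x. f (x + h)) \<longleftrightarrow> integrable torus f"
  by (simp add: periodic_vfrac[OF per])
qed

lemma torus_integrable:
 fixes f :: "real^3 => 'b::{banach, second_countable_topology}"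
 assumes "cts f"
 shows "integrable torus f"
proof -
 have "compact (cbox 0 (1::real^3))" by simp
 then have "compact (f ` cbox 0 1)"
  using assms by (intro compact_continuous_image continuous_on_subset[OF assms]) auto
 then obtain B where "!!x. x \<in> cbox 0 1 ==> norm (f x) <= B"
  by (meson bounded_iff compact_imp_bounded image_eqI)
 then show "integrable torus f"
  by (intro torus.integrable_const_bound[of _ B] measurable_torusI cts_measurable assms)
    (auto simp: space_torus)
qed

lemma integral_torus_cbox:
 fixes f :: "real^3 => 'b::euclidean_space"
 assumes "cts f"
 shows "(AV x. f x) = integral (cbox 0 1) f"
proof -
 have "(AV x. f x) = (LINT x:cbox 0 1|lborel. f x)"
  unfolding torus_def set_lebesgue_integral_def
  by (subst integral_restrict_space) auto
 also have "... = integral (cbox 0 1) f"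
  by (intro set_borel_integral_eq_integral)
    (auto simp: set_integrable_def intro!: borel_integrable_compact continuous_on_subset[OF assms])
 finally show ?thesis .
qed

section \<open>Square-integrable fields\<close>

lemma
 fixes f g :: "'a => real"
 assumes [measurable]: "f \<in> borel_measurable M" "g \<in> borel_measurable M"
  and f: "integrable M (%x. (f x)^2)" and g: "integrable M (%x. (g x)^2)"
 shows integrable_mult_of_squares: "integrable M (%x. f x * g x)"
  and integral_Cauchy_Schwarz_sq: "(LINT x|M. f x * g x)^2 <= (LINT x|M. (f x)^2) * (LINT x|M. (g x)^2)"
proof -
 show fg: "integrable M (%x. f x * g x)"
 proof (rule lint_bound)
  show "integrable M (%x. (f x)^2 + (g x)^2)" using f g by simp
  have "\<bar>f x * g x\<bar> <= (f x)^2 + (g x)^2" for x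
   using sum_squares_bound[of "\<bar>f x\<bar>" "\<bar>g x\<bar>"] mult_nonneg_nonneg[of "\<bar>f x\<bar>" "\<bar>g x\<bar>"]
   by (simp add: abs_mult del: mult_nonneg_nonneg)
  then show "AE x in M. norm (f x * g x) <= norm ((f x)^2 + (g x)^2)"
   by simp
 qed measurable
 let ?a = "LINT x|M. (g x)^2" and ?b = "LINT x|M. f x * g x" and ?c = "LINT x|M. (f x)^2"
 show "?b^2 <= ?c * ?a"
 proof (cases "?a = 0")
  case True
  then have "AE x in M. (g x)^2 = 0"
   using g by (subst (asm) integral_nonneg_eq_0_iff_AE) auto
  then have "?b = (LINT x|M. 0)"
   by (intro integral_cong_AE) (auto elim!: eventually_mono)
  then show ?thesis using True by simp
 next
  case False
  then have a: "?a > 0" by (simp add: order.strict_iff_order)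
  \<comment> \<open>With a, b, c the three integrals, expanding this square gives a (c a - b^2), and
    a is positive in this case.\<close>
  have "0 <= (LINT x|M. (f x * ?a - g x * ?b)^2)" by simp
  also have "... = (LINT x|M. ?a^2 * (f x)^2 - 2 * ?a * ?b * (f x * g x) + ?b^2 * (g x)^2)"
   by (intro lint_cong) (auto simp: power2_eq_square algebra_simps)
  also have "... = ?a^2 * ?c - 2 * ?a * ?b * ?b + ?b^2 * ?a"
   using f g fg by simp
  also have "... = ?a * (?c * ?a - ?b^2)" by (simp add: power2_eq_square algebra_simps)
  finally show ?thesis using a by (simp add: zero_le_mult_iff)
 qed
qed

lemma integral_Cauchy_Schwarz:
 fixes f g :: "'a => real"
 assumes "f \<in> borel_measurable M" "g \<in> borel_measurable M"
  and "integrable M (%x. (f x)^2)" "integrable M (%x. (g x)^2)"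
 shows "\<bar>LINT x|M. f x * g x\<bar> <= sqrt (LINT x|M. (f x)^2) * sqrt (LINT x|M. (g x)^2)"
 using integral_Cauchy_Schwarz_sq[OF assms] real_sqrt_le_mono by (fastforce simp: real_sqrt_mult)

lemma L2_norm_nonneg [simp]: "0 <= L2_norm v"
 by (simp add: L2_norm_def)

lemma L2_norm_sq: "(L2_norm v)^2 = (AV x. (norm (v x))^2)"
 by (simp add: L2_norm_def)

lemma L2D:
 assumes "v \<in> L2"
 shows "periodic v" "v \<in> borel_measurable borel" "integrable torus (%x. (norm (v x))^2)"
 using assms by (auto simp: L2_def)

lemma
 fixes v w :: "real^3 => 'b::{real_inner, second_countable_topology}"
 assumes v: "v \<in> L2" and w: "w \<in> L2"
 shows L2_norm_mult_integrable: "integrable torus (%x. norm (v x) * norm (w x))"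
  and L2_norm_mult_le: "(AV x. norm (v x) * norm (w x)) <= L2_norm v * L2_norm w"
  and L2_inner_integrable: "integrable torus (%x. v x \<bullet> w x)"
  and L2_inner_le: "\<bar>L2_inner v w\<bar> <= L2_norm v * L2_norm w"
proof -
 note [measurable] = L2D(2)[OF v] L2D(2)[OF w]
 have m [measurable]: "(%x. norm (v x)) \<in> borel_measurable torus" "(%x. norm (w x)) \<in> borel_measurable torus"
   "(%x. v x \<bullet> w x) \<in> borel_measurable torus"
  by (rule measurable_torusI; measurable)+
 show i: "integrable torus (%x. norm (v x) * norm (w x))"
  using L2D(3)[OF v] L2D(3)[OF w] by (rule integrable_mult_of_squares[OF m(1,2)])
 show le: "(AV x. norm (v x) * norm (w x)) <= L2_norm v * L2_norm w"
  using integral_Cauchy_Schwarz[OF m(1,2) L2D(3)[OF v] L2D(3)[OF w]] by (simp add: L2_norm_def)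
 show ii: "integrable torus (%x. v x \<bullet> w x)"
  by (rule lint_bound[OF i m(3)]) (auto simp: Cauchy_Schwarz_ineq2)
 have "\<bar>L2_inner v w\<bar> <= (AV x. \<bar>v x \<bullet> w x\<bar>)"
  unfolding L2_inner_def by (rule integral_abs_bound)
 also have "... <= (AV x. norm (v x) * norm (w x))"
  using i ii by (intro integral_mono) (auto simp: Cauchy_Schwarz_ineq2)
 finally show "\<bar>L2_inner v w\<bar> <= L2_norm v * L2_norm w" using le by simp
qed

lemma L2_add [intro]:
 fixes v w :: "real^3 => 'b::{real_inner, second_countable_topology}"
 assumes v: "v \<in> L2" and w: "w \<in> L2"
 shows "(%x. v x + w x) \<in> L2"
proof -
 note [measurable] = L2D(2)[OF v] L2D(2)[OF w]
 have [measurable]: "(%x. v x + w x) \<in> borel_measurable borel" by measurable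
 have "integrable torus (%x. (norm (v x + w x))^2)"
 proof (rule lint_bound)
  show "integrable torus (%x. 2 * (norm (v x))^2 + 2 * (norm (w x))^2)"
   using L2D(3)[OF v] L2D(3)[OF w] by simp
  have "(norm (v x + w x))^2 <= 2 * (norm (v x))^2 + 2 * (norm (w x))^2" for x
  proof -
   have "(norm (v x + w x))^2 <= (norm (v x) + norm (w x))^2"
    by (intro power_mono norm_triangle_ineq) auto
   also have "... <= 2 * (norm (v x))^2 + 2 * (norm (w x))^2"
    using sum_squares_bound[of "norm (v x)" "norm (w x)"] by (simp add: power2_sum)
   finally show ?thesis .
  qed
  then show "AE x in torus. norm ((norm (v x + w x))^2) <= norm (2 * (norm (v x))^2 + 2 * (norm (w x))^2)"
   by simp
  show "(%x. (norm (v x + w x))^2) \<in> borel_measurable torus"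
   by (rule measurable_torusI) measurable
 qed
 then show ?thesis
  using L2D(1)[OF v] L2D(1)[OF w] by (auto simp: L2_def periodic_def)
qed

lemma L2_scaleR [intro]:
 fixes v :: "real^3 => 'b::{real_inner, second_countable_topology}"
 assumes v: "v \<in> L2"
 shows "(%x. c *\<^sub>R v x) \<in> L2"
proof -
 note [measurable] = L2D(2)[OF v]
 have "(%x. c *\<^sub>R v x) \<in> borel_measurable borel" by measurable
 then show ?thesis
  using L2D(1,3)[OF v] by (auto simp: L2_def periodic_def power_mult_distrib)
qed

lemma L2_diff [intro]:
 fixes v w :: "real^3 => 'b::{real_inner, second_countable_topology}"
 assumes v: "v \<in> L2" and w: "w \<in> L2"
 shows "(%x. v x - w x) \<in> L2"
 using L2_add[OF v L2_scaleR[OF w, of "-1"]] by simp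

lemma L2_continuous:
 assumes "cts v" "periodic v"
 shows "v \<in> L2"
 unfolding L2_def using assms
 by (auto intro!: torus_integrable continuous_intros cts_measurable)

lemma L2_norm_triangle:
 fixes v w :: "real^3 => 'b::{real_inner, second_countable_topology}"
 assumes v: "v \<in> L2" and w: "w \<in> L2"
 shows "L2_norm (%x. v x + w x) <= L2_norm v + L2_norm w"
proof (rule power2_le_imp_le)
 have "(L2_norm (%x. v x + w x))^2 <= (AV x. (norm (v x))^2 + 2 * (norm (v x) * norm (w x)) + (norm (w x))^2)"
  unfolding L2_norm_sq
 proof (rule integral_mono)
  fix x
  have "(norm (v x + w x))^2 <= (norm (v x) + norm (w x))^2"
   by (intro power_mono norm_triangle_ineq) auto
  then show "(norm (v x + w x))^2 <= (norm (v x))^2 + 2 * (norm (v x) * norm (w x)) + (norm (w x))^2"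
   by (simp add: power2_sum)
 qed (use L2D(3)[OF v] L2D(3)[OF w] L2D(3)[OF L2_add[OF v w]] L2_norm_mult_integrable[OF v w] in auto)
 also have "... = (L2_norm v)^2 + 2 * (AV x. norm (v x) * norm (w x)) + (L2_norm w)^2"
  using L2D(3)[OF v] L2D(3)[OF w] L2_norm_mult_integrable[OF v w] by (simp add: L2_norm_sq)
 also have "... <= (L2_norm v + L2_norm w)^2"
  using L2_norm_mult_le[OF v w] by (simp add: power2_sum)
 finally show "(L2_norm (%x. v x + w x))^2 <= (L2_norm v + L2_norm w)^2" .
qed simp

lemma L2_norm_scaleR: "L2_norm (%x. c *\<^sub>R v x) = \<bar>c\<bar> * L2_norm v"
 by (simp add: L2_norm_def power_mult_distrib real_sqrt_mult)

lemma L2_norm_minus_commute: "L2_norm (%x. v x - w x) = L2_norm (%x. w x - v x)"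
 by (simp add: L2_norm_def norm_minus_commute)

lemma L2_norm_triangle_sub:
 fixes v w :: "real^3 => 'b::{real_inner, second_countable_topology}"
 assumes v: "v \<in> L2" and w: "w \<in> L2"
 shows "\<bar>L2_norm v - L2_norm w\<bar> <= L2_norm (%x. v x - w x)"
 using L2_norm_triangle[OF L2_diff[OF v w] w] L2_norm_triangle[OF L2_diff[OF w v] v]
  L2_norm_minus_commute[of v w] by simp

lemma L2_norm_triangle3:
 fixes v w z :: "real^3 => 'b::{real_inner, second_countable_topology}"
 assumes "v \<in> L2" "w \<in> L2" "z \<in> L2"
 shows "L2_norm (%x. v x - z x) <= L2_norm (%x. v x - w x) + L2_norm (%x. w x - z x)"
 using L2_norm_triangle[OF L2_diff[OF assms(1,2)] L2_diff[OF assms(2,3)]] by simp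

lemma
 fixes v :: "real^3 => 'b::{real_inner, second_countable_topology}"
 assumes v: "v \<in> L2"
 shows L2_shift: "(%x. v (x + h)) \<in> L2"
  and L2_norm_shift: "L2_norm (%x. v (x + h)) = L2_norm v"
proof -
 note [measurable] = L2D(2)[OF v]
 have m: "(%x. (norm (v x))^2) \<in> borel_measurable borel" by measurable
 have p: "periodic (%x. (norm (v x))^2)" using L2D(1)[OF v] by (simp add: periodic_def)
 have "periodic (%x. v (x + h))"
  using L2D(1)[OF v] by (simp add: periodic_def) (metis add.assoc add.commute)
 then show "(%x. v (x + h)) \<in> L2"
  using L2D(3)[OF v] integrable_torus_shift[OF m p, of h] unfolding L2_def by simp
 show "L2_norm (%x. v (x + h)) = L2_norm v"
  using integral_torus_shift[OF m p, of h] by (simp add: L2_norm_def)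
qed

section \<open>Smooth functions\<close>

lemma pderiv_at_eqI: "(f has_derivative f') (at x) ==> pderiv_at i f x = f' (axis i 1)"
 unfolding pderiv_at_def by (simp add: frechet_derivative_at[symmetric])

lemma smooth_differentiable: "smooth f ==> f differentiable (at x)"
 unfolding smooth_def by (metis C_k.simps(2))

lemma smooth_pderiv_at: "smooth f ==> smooth (pderiv_at i f)"
 unfolding smooth_def by (metis C_k.simps(2))

lemma smooth_continuous: "smooth f ==> continuous_on S f"
 unfolding smooth_def by (metis C_k.simps(1) continuous_on_subset subset_UNIV)

lemma pderiv_at_add:
 "f differentiable (at x) ==> g differentiable (at x) ==>
  pderiv_at i (%x. f x + g x) x = pderiv_at i f x + pderiv_at i g x"
 by (rule pderiv_at_eqI[THEN trans])
   (auto simp: pderiv_at_def frechet_derivative_works[symmetric] intro!: has_derivative_add)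

lemma pderiv_at_scaleR:
 "f differentiable (at x) ==> pderiv_at i (%x. c *\<^sub>R f x) x = c *\<^sub>R pderiv_at i f x"
 by (rule pderiv_at_eqI[THEN trans])
   (auto simp: pderiv_at_def frechet_derivative_works[symmetric] intro!: has_derivative_scaleR_right)

lemma pderiv_at_shift:
 "f differentiable (at (x + h)) ==> pderiv_at i (%x. f (x + h)) x = pderiv_at i f (x + h)"
proof -
 assume f: "f differentiable (at (x + h))"
 have "((%x. f (x + h)) has_derivative (%y. frechet_derivative f (at (x + h)) y)) (at x)"
  by (rule has_derivative_compose[where f="%x. x + h"])
    (use f in \<open>auto simp: frechet_derivative_works[symmetric] intro!: derivative_eq_intros\<close>)
 then show ?thesis
  by (subst pderiv_at_eqI) (auto simp: pderiv_at_def)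
qed

lemma C_k_add: "C_k n f ==> C_k n g ==> C_k n (%x. f x + g x)"
proof (induction n arbitrary: f g)
 case (Suc n)
 then have "pderiv_at i (%x. f x + g x) = (%x. pderiv_at i f x + pderiv_at i g x)" for i
  by (auto simp: pderiv_at_add)
 with Suc show ?case by (auto intro: differentiable_add)
qed (auto intro: continuous_on_add)

lemma C_k_scaleR: "C_k n f ==> C_k n (%x. c *\<^sub>R f x)"
proof (induction n arbitrary: f)
 case (Suc n)
 then have "pderiv_at i (%x. c *\<^sub>R f x) = (%x. c *\<^sub>R pderiv_at i f x)" for i
  by (auto simp: pderiv_at_scaleR)
 with Suc show ?case by (auto intro: differentiable_scaleR)
qed (auto intro: continuous_on_scaleR)

lemma smooth_add: "smooth f ==> smooth g ==> smooth (%x. f x + g x)"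
 by (simp add: smooth_def C_k_add)

lemma smooth_scaleR: "smooth f ==> smooth (%x. c *\<^sub>R f x)"
 by (simp add: smooth_def C_k_scaleR)

lemma periodic_pderiv_at:
 fixes f :: "real^3 => 'b::real_normed_vector"
 assumes "periodic f" "!!x. f differentiable (at x)"
 shows "periodic (pderiv_at i f)"
 unfolding periodic_def
proof (intro allI ballI)
 fix x k :: "real^3" assume "k \<in> lattice"
 then have "(%x. f (x + k)) = f" using assms(1) by (auto simp: periodic_def)
 then show "pderiv_at i f (x + k) = pderiv_at i f x"
  using pderiv_at_shift[of f x k i] assms(2) by simp
qed

text \<open>Two amplitudes keep the family closed under differentiation, so smoothness is a plain
  induction. It serves both for scalar and for vector modes.\<close>

definition trig :: "real^3 => 'b::real_normed_vector => 'b => real^3 => 'b" where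
 "trig k a b x = cos (phase k x) *\<^sub>R a + sin (phase k x) *\<^sub>R b"

lemma has_derivative_trig:
 "(trig k a b has_derivative (%h. (phase k h) *\<^sub>R trig k b (- a) x)) (at x)"
 unfolding trig_def
 by (auto intro!: derivative_eq_intros simp: algebra_simps fun_eq_iff scaleR_minus_right)

lemma pderiv_at_trig: "pderiv_at i (trig k a b) = trig k ((2 * pi * k $ i) *\<^sub>R b) (- ((2 * pi * k $ i) *\<^sub>R a))"
 by (rule ext, subst pderiv_at_eqI[OF has_derivative_trig])
   (simp add: trig_def inner_axis algebra_simps)

lemma smooth_trig: "smooth (trig k a b)"
proof -
 have "C_k n (trig k a b)" for n
 proof (induction n arbitrary: a b)
  case 0
  then show ?case by (auto simp: trig_def intro!: continuous_intros)
 next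
  case (Suc n)
  then show ?case
   by (simp add: pderiv_at_trig) (metis has_derivative_trig differentiable_def)
 qed
 then show ?thesis by (simp add: smooth_def)
qed

lemma lattice_inner_Ints:
 assumes "k \<in> lattice" "l \<in> lattice" shows "k \<bullet> l \<in> \<int>"
 using assms unfolding inner_vec_def lattice_def
 by (auto intro!: Ints_sum Ints_mult)

lemma cos_periodic_lattice:
 assumes "k \<in> lattice" "l \<in> lattice"
 shows "cos (phase k (x + l)) = cos (phase k x)"
  and "sin (phase k (x + l)) = sin (phase k x)"
proof -
 obtain m where m: "k \<bullet> l = of_int m"
  using lattice_inner_Ints[OF assms] by (auto elim: Ints_cases)
 have "2 * pi * (k \<bullet> (x + l)) = 2 * pi * (k \<bullet> x) + of_int m * (2 * pi)"
  by (simp add: inner_add_right m algebra_simps)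
 then show "cos (phase k (x + l)) = cos (phase k x)"
  "sin (phase k (x + l)) = sin (phase k x)"
  by (simp_all add: cos_add sin_add mult.commute[of _ "2 * pi"])
qed

lemma periodic_trig: "k \<in> lattice ==> periodic (trig k a b)"
 by (simp add: periodic_def trig_def cos_periodic_lattice)

section \<open>Integration by parts\<close>

lemma line_derivative:
 fixes f :: "sfield"
 assumes "!!x. f differentiable (at x)"
 shows "((%s. f (x + s *\<^sub>R axis i 1)) has_real_derivative pderiv_at i f (x + s *\<^sub>R axis i 1)) (at s within S)"
proof -
 have d: "(f has_derivative frechet_derivative f (at y)) (at y)" for y
  using assms by (simp add: frechet_derivative_works[symmetric])
 have "((%s. f (x + s *\<^sub>R axis i 1)) has_derivative
   (%t. frechet_derivative f (at (x + s *\<^sub>R axis i 1)) (t *\<^sub>R axis i 1))) (at s within S)"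
  by (rule has_derivative_compose[OF _ d, where f="%s. x + s *\<^sub>R axis i 1"]) (auto intro!: derivative_eq_intros)
 moreover have "frechet_derivative f (at y) (t *\<^sub>R axis i 1) = pderiv_at i f y * t" for y t
  using linear_frechet_derivative[of f "at y"] assms by (simp add: pderiv_at_def linear_scale)
 ultimately show ?thesis
  by (simp add: has_field_derivative_def)
qed

text \<open>The integral of a translate of \<open>f\<close> along the axis does not depend on the
  translation, and differentiating under the integral at translation 0 gives the partial
  derivative.\<close>

lemma integral_pderiv_at_torus:
 fixes f :: "sfield"
 assumes d: "!!x. f differentiable (at x)" and c: "cts (pderiv_at i f)" and p: "periodic f"
 shows "(AV x. pderiv_at i f x) = 0"
proof -
 let ?e = "axis i 1 :: real^3"
 have cf: "cts f"
  using d by (meson continuous_at_imp_continuous_on differentiable_imp_continuous_within)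
 have D: "((%s. integral (cbox 0 1) (%x. f (x + s *\<^sub>R ?e)))
   has_field_derivative integral (cbox 0 1) (%x. pderiv_at i f (x + 0 *\<^sub>R ?e))) (at 0 within UNIV)"
 proof (rule leibniz_rule_field_derivative)
  show "continuous_on (UNIV \<times> cbox 0 1) (%(s, x). pderiv_at i f (x + s *\<^sub>R ?e))"
   unfolding split_def
   by (rule cts_compose[OF c]) (auto intro!: continuous_intros)
  show "(%x. f (x + s *\<^sub>R ?e)) integrable_on cbox 0 1" for s
   by (intro integrable_continuous cts_compose[OF cf]) (auto intro!: continuous_intros)
 qed (auto intro: line_derivative d)
 have "integral (cbox 0 1) (%x. f (x + s *\<^sub>R ?e)) = (AV x. f x)" for s
 proof -
  have "(AV x. f x) = (AV x. f (x + s *\<^sub>R ?e))"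
   by (rule integral_torus_shift[symmetric]) (auto intro: cts_measurable cf p)
  also have "... = integral (cbox 0 1) (%x. f (x + s *\<^sub>R ?e))"
   by (intro integral_torus_cbox cts_compose[OF cf]) (auto intro!: continuous_intros)
  finally show ?thesis ..
 qed
 with D have "((%s. AV x. f x) has_field_derivative (AV x. pderiv_at i f x)) (at 0)"
  by (simp add: integral_torus_cbox c)
 then show ?thesis
  using DERIV_unique[OF _ DERIV_const] by blast
qed

lemma pderiv_at_mult:
 fixes f g :: "sfield"
 assumes "f differentiable (at x)" "g differentiable (at x)"
 shows "pderiv_at i (%x. f x * g x) x = f x * pderiv_at i g x + pderiv_at i f x * g x"
 by (rule pderiv_at_eqI[THEN trans])
   (use assms in \<open>auto simp: pderiv_at_def frechet_derivative_works[symmetric] intro!: has_derivative_mult\<close>)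

lemma torus_integration_by_parts:
 fixes f g :: "sfield"
 assumes f: "!!x. f differentiable (at x)" "cts (pderiv_at i f)" "periodic f"
  and g: "!!x. g differentiable (at x)" "cts (pderiv_at i g)" "periodic g"
 shows "(AV x. pderiv_at i f x * g x) = - (AV x. f x * pderiv_at i g x)"
proof -
 have cf: "cts f" "cts g"
  using f(1) g(1) by (meson continuous_at_imp_continuous_on differentiable_imp_continuous_within)+
 have eq: "pderiv_at i (%x. f x * g x) = (%x. f x * pderiv_at i g x + pderiv_at i f x * g x)"
  using f(1) g(1) by (auto simp: pderiv_at_mult)
 have "(AV x. pderiv_at i (%x. f x * g x) x) = 0"
  by (rule integral_pderiv_at_torus)
    (use f g cf in \<open>auto simp: eq periodic_def intro!: differentiable_mult continuous_intros\<close>)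
 then show ?thesis
  unfolding eq using f g cf
  by (subst (asm) Bochner_Integration.integral_add)
    (auto intro!: torus_integrable continuous_intros)
qed

lemma integral_compact_support_cbox:
 fixes f :: "sfield"
 assumes c: "cts f" and s: "!!x. x \<notin> cbox a b ==> f x = 0"
 shows "integrable lborel f" "(LI x. f x) = integral (cbox a b) f"
proof -
 have "integrable lborel (%x. indicator (cbox a b) x *\<^sub>R f x)"
  by (rule borel_integrable_compact[OF compact_cbox]) (rule continuous_on_subset[OF c], simp)
 moreover have *: "(%x. indicator (cbox a b) x *\<^sub>R f x) = f"
  using s by (auto split: split_indicator)
 ultimately show i: "integrable lborel f" by simp
 have "(LINT x:cbox a b|lborel. f x) = integral (cbox a b) f"
  by (rule set_borel_integral_eq_integral) (simp only: set_integrable_def * i)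
 then show "(LI x. f x) = integral (cbox a b) f"
  by (simp only: set_lebesgue_integral_def *)
qed

lemma integral_lborel_shift:
 fixes f :: "real^3 => 'b::{banach, second_countable_topology}"
 assumes [measurable]: "f \<in> borel_measurable borel"
 shows "(LI x. f (x + h)) = (LI x. f x)"
proof -
 have "(LI x. f x) = (LINT x|distr lborel borel ((+) h). f x)"
  by (simp add: lborel_distr_plus)
 also have "... = (LI x. f (h + x))"
  by (subst integral_distr) auto
 finally show ?thesis by (simp add: add.commute)
qed

lemma not_in_cbox_abs:
 fixes x :: "real^3"
 assumes "x \<notin> cbox (- (\<chi> i. R)) (\<chi> i. R)"
 shows "\<exists>j::3. \<not> \<bar>x $ j\<bar> <= R"
proof (rule ccontr)
 assume "\<nexists>j. \<not> \<bar>x $ j\<bar> <= R"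
 then have "\<bar>x $ j\<bar> <= R" for j by blast
 then have "x \<in> cbox (- (\<chi> i. R)) (\<chi> i. R)" unfolding mem_box_cart by (auto simp: abs_le_iff minus_le_iff)
 then show False using assms by simp
qed

lemma pderiv_at_eq_0_outside:
 assumes s: "!!x. R <= norm x ==> f x = 0" and x: "R < norm x"
 shows "pderiv_at i f x = 0"
proof -
 have "open (- cball 0 R :: (real^3) set)" by auto
 moreover have "x \<in> - cball 0 R" using x by auto
 ultimately have "(f has_derivative (%x. 0)) (at x)"
  by (rule has_derivative_transform_within_open[OF has_derivative_const[of 0]]) (use s in auto)
 then show ?thesis by (simp add: pderiv_at_eqI)
qed

lemma integral_pderiv_at_lborel:
 fixes f :: "sfield"
 assumes d: "!!x. f differentiable (at x)" and c: "cts (pderiv_at i f)"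
  and s: "!!x. R <= norm x ==> f x = 0"
 shows "(LI x. pderiv_at i f x) = 0"
proof -
 let ?e = "axis i 1 :: real^3"
 \<comment> \<open>The margin 1 beyond the support keeps all translates by less than 1 inside the
   same cube, so that the differentiation is over a fixed compact domain.\<close>
 define a :: "real^3" where "a = (\<chi> i. R + 1)"
 have out: "f (x + s *\<^sub>R ?e) = 0" if x: "x \<notin> cbox (-a) a" "\<bar>s\<bar> < 1" for x :: "real^3" and s
 proof -
  obtain j where "\<not> \<bar>x $ j\<bar> <= R + 1"
   using x(1) not_in_cbox_abs unfolding a_def by blast
  then have "norm x > R + 1" using component_le_norm_cart[of x j] by linarith
  moreover have "norm (s *\<^sub>R ?e) < 1" using x(2) by simp
  ultimately have "R <= norm (x + s *\<^sub>R ?e)"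
   using norm_triangle_ineq2[of x "- (s *\<^sub>R ?e)"] by simp
  then show ?thesis by (rule s)
 qed
 have cf: "cts f"
  using d by (meson continuous_at_imp_continuous_on differentiable_imp_continuous_within)
 have D: "((%s. integral (cbox (-a) a) (%x. f (x + s *\<^sub>R ?e)))
   has_field_derivative integral (cbox (-a) a) (%x. pderiv_at i f (x + 0 *\<^sub>R ?e))) (at 0 within ball 0 1)"
 proof (rule leibniz_rule_field_derivative)
  show "continuous_on (ball 0 1 \<times> cbox (-a) a) (%(s, x). pderiv_at i f (x + s *\<^sub>R ?e))"
   unfolding split_def
   by (rule cts_compose[OF c]) (auto intro!: continuous_intros)
  show "(%x. f (x + s *\<^sub>R ?e)) integrable_on cbox (-a) a" for s
   by (intro integrable_continuous cts_compose[OF cf]) (auto intro!: continuous_intros)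
 qed (auto intro: line_derivative d)
 have "integral (cbox (-a) a) (%x. f (x + s *\<^sub>R ?e)) = (LI x. f x)" if "s \<in> ball 0 1" for s
 proof -
  have "(LI x. f x) = (LI x. f (x + s *\<^sub>R ?e))"
   by (rule integral_lborel_shift[symmetric]) (auto intro: cts_measurable cf)
  also have "... = integral (cbox (-a) a) (%x. f (x + s *\<^sub>R ?e))"
   using that by (intro integral_compact_support_cbox cts_compose[OF cf] out) (auto intro!: continuous_intros)
  finally show ?thesis ..
 qed
 note const = this
 have ev: "eventually (%s. integral (cbox (-a) a) (%x. f (x + s *\<^sub>R ?e)) = (LI x. f x)) (at 0 within ball 0 1)"
  and eq0: "integral (cbox (-a) a) (%x. f (x + 0 *\<^sub>R ?e)) = (LI x. f x)"
  unfolding eventually_at_filter using const const[of 0] by (auto intro!: always_eventually)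
 have "((%s. LI x. f x) has_field_derivative integral (cbox (-a) a) (%x. pderiv_at i f x)) (at 0 within ball 0 1)"
  using D has_field_derivative_cong_eventually[OF ev eq0] by simp
 then have "((%s. LI x. f x) has_field_derivative integral (cbox (-a) a) (%x. pderiv_at i f x)) (at 0)"
  by (subst (asm) at_within_open) auto
 then have 0: "integral (cbox (-a) a) (%x. pderiv_at i f x) = 0"
  using DERIV_unique[OF _ DERIV_const] by blast
 have "pderiv_at i f x = 0" if x: "x \<notin> cbox (-a) a" for x
 proof (rule pderiv_at_eq_0_outside[OF s])
  obtain j where "\<not> \<bar>x $ j\<bar> <= R + 1"
   using x not_in_cbox_abs unfolding a_def by blast
  then show "R < norm x" using component_le_norm_cart[of x j] by linarith
 qed
 then show ?thesis
  using integral_compact_support_cbox(2)[OF c] 0 by metis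
qed

lemma lborel_integration_by_parts:
 fixes f g :: "sfield"
 assumes f: "!!x. f differentiable (at x)" "cts (pderiv_at i f)" "!!x. R <= norm x ==> f x = 0"
  and g: "!!x. g differentiable (at x)" "cts (pderiv_at i g)"
 shows "(LI x. pderiv_at i f x * g x) = - (LI x. f x * pderiv_at i g x)"
proof -
 have cf: "cts f" "cts g"
  using f(1) g(1) by (meson continuous_at_imp_continuous_on differentiable_imp_continuous_within)+
 have eq: "pderiv_at i (%x. f x * g x) = (%x. f x * pderiv_at i g x + pderiv_at i f x * g x)"
  using f(1) g(1) by (auto simp: pderiv_at_mult)
 have z: "pderiv_at i f x = 0" if "norm x > R" for x
  by (rule pderiv_at_eq_0_outside[OF f(3) that])
 define b :: "real^3" where "b = (\<chi> i. R)"
 have out: "norm x > R" if x: "x \<notin> cbox (-b) b" for x :: "real^3"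
 proof -
  obtain j where "\<not> \<bar>x $ j\<bar> <= R"
   using x not_in_cbox_abs unfolding b_def by blast
  then show ?thesis using component_le_norm_cart[of x j] by linarith
 qed
 have "(LI x. pderiv_at i (%x. f x * g x) x) = 0"
  by (rule integral_pderiv_at_lborel[where R=R])
    (use f g cf in \<open>auto simp: eq intro!: differentiable_mult continuous_intros\<close>)
 moreover have "integrable lborel (%x. f x * pderiv_at i g x)" "integrable lborel (%x. pderiv_at i f x * g x)"
  by (rule integral_compact_support_cbox[of _ "-b" b]; use f g cf z out in \<open>force intro!: continuous_intros\<close>)+
 ultimately show ?thesis
  unfolding eq by (subst (asm) Bochner_Integration.integral_add) auto
qed

section \<open>Completeness of $L^2$\<close>

lemma norm_sq_eq_sum: "(norm (v::real^'n))^2 = (SU i. (v $ i)^2)"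
 by (simp add: norm_vec_def L2_set_def sum_nonneg)

lemma
 fixes v :: "real^3 => 'b::{real_inner, second_countable_topology, banach}"
 assumes v: "v \<in> L2"
 shows L2_integrable_norm: "integrable torus (%x. norm (v x))"
  and L1_norm_le_L2_norm: "(AV x. norm (v x)) <= L2_norm v"
  and L2_integrable: "integrable torus v"
proof -
 note [measurable] = L2D(2)[OF v]
 have m [measurable]: "(%x. norm (v x)) \<in> borel_measurable torus" "v \<in> borel_measurable torus"
  by (rule measurable_torusI; measurable)+
 have 1: "integrable torus (%x. (1::real)^2)" by simp
 show i: "integrable torus (%x. norm (v x))"
  using integrable_mult_of_squares[OF m(1) _ L2D(3)[OF v] 1] by simp
 have "\<bar>AV x. norm (v x)\<bar> <= L2_norm v"
  using integral_Cauchy_Schwarz[OF m(1) _ L2D(3)[OF v] 1] torus.prob_space by (simp add: L2_norm_def)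
 then show "(AV x. norm (v x)) <= L2_norm v" by simp
 show "integrable torus v"
  by (rule integrable_norm_cancel[OF i m(2)])
qed

lemma L2_fatou:
 fixes f :: "nat => real^3 => 'b::{real_inner, second_countable_topology}"
 assumes f: "!!n. f n \<in> L2" and g: "periodic g" "g \<in> borel_measurable borel"
  and lim: "AE x in torus. (%n. f n x) \<longlonglongrightarrow> g x"
  and bnd: "eventually (%n. L2_norm (f n) <= c) sequentially"
 shows "g \<in> L2" "L2_norm g <= c"
proof -
 note [measurable] = L2D(2)[OF f] g(2)
 have mt [measurable]: "(%x. ennreal ((norm (f n x))^2)) \<in> borel_measurable torus" for n
  by (rule measurable_torusI) measurable
 have mt' [measurable]: "(%x. (norm (g x))^2) \<in> borel_measurable torus"
  by (rule measurable_torusI) measurable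
 have c: "c \<ge> 0"
  using bnd by (auto simp: eventually_sequentially) (meson L2_norm_nonneg order.refl order_trans)
 have eq: "(\<integral>\<^sup>+x. ennreal ((norm (f n x))^2) \<partial>torus) = ennreal ((L2_norm (f n))^2)" for n
  using L2D(3)[OF f] by (subst nn_integral_eq_integral) (auto simp: L2_norm_sq)
 have "(\<integral>\<^sup>+x. ennreal ((norm (g x))^2) \<partial>torus) = (\<integral>\<^sup>+x. liminf (%n. ennreal ((norm (f n x))^2)) \<partial>torus)"
 proof (rule nn_integral_cong_AE)
  show "AE x in torus. ennreal ((norm (g x))^2) = liminf (%n. ennreal ((norm (f n x))^2))"
   using lim
  proof eventually_elim
   case (elim x)
   then have "(%n. ennreal ((norm (f n x))^2)) \<longlonglongrightarrow> ennreal ((norm (g x))^2)"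
    by (intro tendsto_intros)
   then show ?case by (intro lim_imp_Liminf[symmetric]) auto
  qed
 qed
 also have "... <= liminf (%n. \<integral>\<^sup>+x. ennreal ((norm (f n x))^2) \<partial>torus)"
  by (rule nn_integral_liminf) measurable
 also have "... <= ennreal (c^2)"
 proof (rule Liminf_le)
  show "eventually (%n. (\<integral>\<^sup>+x. ennreal ((norm (f n x))^2) \<partial>torus) <= ennreal (c^2)) sequentially"
   using bnd by eventually_elim (auto simp: eq intro!: ennreal_leI power_mono)
 qed simp
 finally have le: "(\<integral>\<^sup>+x. ennreal ((norm (g x))^2) \<partial>torus) <= ennreal (c^2)" .
 then have i: "integrable torus (%x. (norm (g x))^2)"
  by (intro integrableI_bounded mt') (auto intro: le_less_trans)
 then show "g \<in> L2" using g by (auto simp: L2_def)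
 have "(L2_norm g)^2 <= c^2"
  using le i by (subst (asm) nn_integral_eq_integral) (auto simp: L2_norm_sq)
 then show "L2_norm g <= c" using c by (rule power2_le_imp_le)
qed

lemma L2_convergent_AE_subseq:
 fixes f :: "nat => real^3 => 'b::{real_inner, second_countable_topology, banach}"
 assumes f: "!!n. f n \<in> L2" and g: "g \<in> L2" and lim: "L2_tendsto f g"
 obtains r where "strict_mono r" "AE x in torus. (%n. f (r n) x) \<longlonglongrightarrow> g x"
proof -
 have L: "(%x. f n x - g x) \<in> L2" for n by (intro L2_diff f g)
 have "\<exists>r::nat=>nat. strict_mono r \<and> (AE x in torus. (%n. f (r n) x - g x) \<longlonglongrightarrow> 0)"
 proof (rule tendsto_L1_AE_subseq)
  show "integrable torus (%x. f n x - g x)" for n by (rule L2_integrable[OF L])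
  show "(%n. AV x. norm (f n x - g x)) \<longlonglongrightarrow> 0"
   by (rule tendsto_sandwich[OF _ _ tendsto_const lim])
     (auto intro!: always_eventually L1_norm_le_L2_norm[OF L])
 qed
 then obtain r :: "nat => nat" where r: "strict_mono r" "AE x in torus. (%n. f (r n) x - g x) \<longlonglongrightarrow> 0" by blast
 then show thesis by (intro that[of r]) (auto simp: LIM_zero_iff)
qed

lemma L2_complete:
 fixes f :: "nat => real^3 => 'b::{real_inner, second_countable_topology, banach}"
 assumes f: "!!n. f n \<in> L2"
  and Cauchy: "!!e. e > 0 ==> \<exists>N. \<forall>m\<ge>N. \<forall>n\<ge>N. L2_norm (%x. f m x - f n x) <= e"
 obtains g where "g \<in> L2" "L2_tendsto f g"
proof -
 obtain N where N: "!!k m n. m \<ge> N k ==> n \<ge> N k ==> L2_norm (%x. f m x - f n x) <= (1/2)^k"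
  using Cauchy[of "(1/2)^k" for k] by (metis zero_less_divide_1_iff zero_less_numeral zero_less_power)
 \<comment> \<open>The partial sums make \<open>r k\<close> and \<open>r (Suc k)\<close> both exceed
   \<open>N k\<close>, so consecutive differences along \<open>r\<close> are at most (1/2)^k; the
   summand \<open>k\<close> makes \<open>r\<close> tend to infinity.\<close>
 define r where "r k = k + (\<Sum>j\<le>k. N j)" for k
 have rN: "r k \<ge> N k" and rk: "r k \<ge> k" and rS: "r (Suc k) \<ge> N k" for k
  unfolding r_def using member_le_sum[of k "{..k}" N] member_le_sum[of k "{..Suc k}" N] by (simp_all add: trans_le_add2)
 have [measurable]: "f n \<in> borel_measurable borel" for n by (rule L2D(2)[OF f])
 define d where "d k x = norm (f (r (Suc k)) x - f (r k) x)" for k x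
 have dL: "(%x. f (r (Suc k)) x - f (r k) x) \<in> L2" for k by (intro L2_diff f)
 have md [measurable]: "(%x. ennreal (d k x)) \<in> borel_measurable torus" for k
  unfolding d_def by (rule measurable_torusI) measurable
 have "(\<integral>\<^sup>+x. (\<Sum>k. ennreal (d k x)) \<partial>torus) = (\<Sum>k. \<integral>\<^sup>+x. ennreal (d k x) \<partial>torus)"
  by (rule nn_integral_suminf) measurable
 also have "... <= (\<Sum>k. ennreal ((1/2)^k))"
 proof (rule suminf_le)
  fix k
  have "(\<integral>\<^sup>+x. ennreal (d k x) \<partial>torus) = ennreal (AV x. d k x)"
   unfolding d_def using L2_integrable_norm[OF dL[of k]] by (rule nn_integral_eq_integral) simp
  also have "(AV x. d k x) <= (1/2)^k"
   unfolding d_def using L1_norm_le_L2_norm[OF dL[of k]] N[OF rS rN, of k] by simp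
  finally show "(\<integral>\<^sup>+x. ennreal (d k x) \<partial>torus) <= ennreal ((1/2)^k)" by (simp add: ennreal_leI)
 qed auto
 also have "... = ennreal (\<Sum>k. (1/2)^k)" by (rule suminf_ennreal2) (auto intro: summable_geometric)
 finally have "(\<integral>\<^sup>+x. (\<Sum>k. ennreal (d k x)) \<partial>torus) \<noteq> \<infinity>"
  by (metis ennreal_less_top infinity_ennreal_def less_irrefl order_le_less_trans)
 then have "AE x in torus. (\<Sum>k. ennreal (d k x)) \<noteq> \<infinity>"
  by (intro nn_integral_PInf_AE) measurable
 then have ae: "AE x in torus. (%k. f (r k) x) \<longlonglongrightarrow> lim (%k. f (r k) x)"
 proof eventually_elim
  case (elim x)
  have "summable (%k. d k x)"
   using elim by (intro summable_suminf_not_top) (auto simp: d_def)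
  then have "summable (%k. f (r (Suc k)) x - f (r k) x)"
   unfolding d_def by (rule summable_norm_cancel)
  then have "convergent (%n. \<Sum>k<n. f (r (Suc k)) x - f (r k) x)"
   by (simp add: summable_iff_convergent)
  then have "convergent (%n. f (r n) x - f (r 0) x)"
   by (simp only: sum_lessThan_telescope[of "%k. f (r k) x"])
  then have "convergent (%n. (f (r n) x - f (r 0) x) + f (r 0) x)"
   by (intro convergent_add convergent_const)
  then show ?case by (simp add: convergent_LIMSEQ_iff)
 qed
 \<comment> \<open>Taken as \<open>lim\<close> at every point, so that it is Borel and exactly
   periodic; no exceptional null set has to be removed.\<close>
 define g where "g x = lim (%k. f (r k) x)" for x
 have gm [measurable]: "g \<in> borel_measurable borel" unfolding g_def by measurable
 have gp: "periodic g"
  using L2D(1)[OF f] by (simp add: periodic_def g_def)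
 \<comment> \<open>Fatou's lemma for the differences of \<open>f n\<close> and the subsequence: a
   Cauchy bound on them is inherited by the difference to the pointwise limit.\<close>
 have *: "(%x. f n x - g x) \<in> L2 \<and> L2_norm (%x. f n x - g x) <= e"
  if e: "!!m. m \<ge> N0 ==> L2_norm (%x. f n x - f m x) <= e" for n e N0
 proof -
  have "AE x in torus. (%k. f n x - f (r k) x) \<longlonglongrightarrow> f n x - g x"
   using ae unfolding g_def[symmetric] by eventually_elim (intro tendsto_intros)
  moreover have "eventually (%k. L2_norm (%x. f n x - f (r k) x) <= e) sequentially"
   using rk by (auto simp: eventually_sequentially intro!: exI[of _ N0] e intro: le_trans)
  moreover have "periodic (%x. f n x - g x)" using gp L2D(1)[OF f] by (simp add: periodic_def)
  moreover have "(%x. f n x - f (r k) x) \<in> L2" for k by (intro L2_diff f)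
  moreover have "(%x. f n x - g x) \<in> borel_measurable borel" by measurable
  ultimately show ?thesis
   using L2_fatou[of "%k x. f n x - f (r k) x" "%x. f n x - g x" e] by blast
 qed
 have gL: "g \<in> L2"
 proof -
  obtain N1 where "\<forall>m\<ge>N1. \<forall>n\<ge>N1. L2_norm (%x. f m x - f n x) <= 1" using Cauchy[of 1] by auto
  then have "(%x. f N1 x - g x) \<in> L2" using *[of N1 N1 1] by auto
  then show ?thesis using L2_diff[OF f[of N1], of "%x. f N1 x - g x"] by simp
 qed
 moreover have "L2_tendsto f g"
 proof (rule LIMSEQ_I)
  fix e :: real assume "e > 0"
  then obtain N1 where "\<forall>m\<ge>N1. \<forall>n\<ge>N1. L2_norm (%x. f m x - f n x) <= e/2" using Cauchy[of "e/2"] by auto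
  then have le: "L2_norm (%x. f n x - g x) <= e/2" if "n \<ge> N1" for n using *[of N1 n "e/2"] that by auto
  have "norm (L2_norm (%x. f n x - g x) - 0) < e" if "n \<ge> N1" for n
   using le[OF that] \<open>e > 0\<close> by simp
  then show "\<exists>no. \<forall>n\<ge>no. norm (L2_norm (%x. f n x - g x) - 0) < e" by blast
 qed
 ultimately show thesis by (rule that)
qed

section \<open>Weak gradients\<close>

lemma Cinf_divD:
 assumes "ph \<in> Cinf_div"
 shows "periodic ph" "smooth ph" "divergence ph x = 0" "(AV x. ph x) = 0"
 using assms by (auto simp: Cinf_div_def)

lemma jacobian_nth: "jacobian f (at x) $ i $ j = pderiv_at j f x $ i"
 by (simp add: jacobian_def matrix_def pderiv_at_def)

lemma pderiv_at_nth:
 fixes f :: "real^3 => real^'n"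
 assumes "f differentiable (at x)"
 shows "pderiv_at j (%x. f x $ i) x = pderiv_at j f x $ i" "(%x. f x $ i) differentiable (at x)"
proof -
 have "((%x. f x $ i) has_derivative (%h. frechet_derivative f (at x) h $ i)) (at x)"
  using assms by (intro bounded_linear.has_derivative[OF bounded_linear_vec_nth]) (simp add: frechet_derivative_works[symmetric])
 then show "pderiv_at j (%x. f x $ i) x = pderiv_at j f x $ i" "(%x. f x $ i) differentiable (at x)"
  by (auto simp: pderiv_at_eqI pderiv_at_def[of _ f] differentiable_def)
qed

lemma smooth_nth:
 fixes f :: "real^3 => real^'n"
 shows "smooth f ==> smooth (%x. f x $ i)"
proof -
 have "C_k n f ==> C_k n (%x. f x $ i)" for n
 proof (induction n arbitrary: f)
  case (Suc n)
  then have "pderiv_at j (%x. f x $ i) = (%x. pderiv_at j f x $ i)" for j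
   by (auto simp: pderiv_at_nth)
  with Suc show ?case by (auto simp: pderiv_at_nth)
 qed (auto intro!: continuous_intros)
 then show "smooth f ==> smooth (%x. f x $ i)" by (simp add: smooth_def)
qed

lemma smooth_jacobian_L2:
 fixes ph :: vfield
 assumes "periodic ph" "smooth ph"
 shows "(jac ph) \<in> L2" "cts (jac ph)"
proof -
 have eq: "(jac ph) = (%x. \<chi> i j. pderiv_at j ph x $ i)"
  by (simp add: fun_eq_iff vec_eq_iff jacobian_nth)
 show c: "cts (jac ph)"
  unfolding eq
  by (intro continuous_intros smooth_continuous smooth_pderiv_at assms)
 have "periodic (pderiv_at j ph)" for j
  by (intro periodic_pderiv_at smooth_differentiable assms)
 then have "periodic (jac ph)"
  unfolding eq by (simp add: periodic_def)
 then show "(jac ph) \<in> L2" using c by (intro L2_continuous)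
qed

lemma smooth_L2:
 fixes ph :: vfield
 assumes "periodic ph" "smooth ph" shows "ph \<in> L2"
 using assms by (intro L2_continuous smooth_continuous)

lemma laplacian_nth: "laplacian ph x $ i = (SU j. pderiv_at j (pderiv_at j ph) x $ i)"
 by (simp add: laplacian_def)

lemma
 assumes "periodic ph" "smooth ph"
 shows smooth_laplacian: "smooth (laplacian ph)"
  and periodic_laplacian: "periodic (laplacian ph)"
proof -
 show "smooth (laplacian ph)"
  unfolding laplacian_def[abs_def] sum_3 by (intro smooth_add smooth_pderiv_at assms)
 show "periodic (laplacian ph)"
  using periodic_pderiv_at[OF periodic_pderiv_at[OF assms(1)], of i j for i j]
   smooth_differentiable[OF smooth_pderiv_at[OF assms(2)]] smooth_differentiable[OF assms(2)]
  by (simp add: periodic_def laplacian_def)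
qed

lemma L2_inner_jacobian:
 fixes ph psi :: vfield
 assumes p: "periodic ph" "smooth ph" and q: "periodic psi" "smooth psi"
 shows "L2_inner (jac ph) (jac psi) = - L2_inner ph (laplacian psi)"
proof -
 note c = smooth_continuous[OF smooth_pderiv_at] smooth_continuous
 have "L2_inner (jac ph) (jac psi)
   = (AV x. (SU i. SU j. pderiv_at j (%x. ph x $ i) x * pderiv_at j (%x. psi x $ i) x))"
  by (simp add: L2_inner_def inner_vec_def jacobian_nth pderiv_at_nth smooth_differentiable p q)
 also have "... = (SU i. SU j. AV x. pderiv_at j (%x. ph x $ i) x * pderiv_at j (%x. psi x $ i) x)"
  using p q
  by (subst lint_sum, intro Bochner_Integration.integrable_sum torus_integrable continuous_intros c smooth_nth; simp?)
    (subst lint_sum, intro torus_integrable continuous_intros c smooth_nth; simp?)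
 also have "... = (SU i. SU j. - (AV x. ph x $ i * pderiv_at j (pderiv_at j (%x. psi x $ i)) x))"
  using p q
  by (intro sum.cong refl torus_integration_by_parts smooth_differentiable smooth_nth smooth_pderiv_at c periodic_pderiv_at)
    (auto simp: periodic_def)
 also have "... = - (SU i. SU j. (AV x. ph x $ i * pderiv_at j (pderiv_at j (%x. psi x $ i)) x))"
  by (simp add: sum_negf)
 also have "(SU i. SU j. (AV x. ph x $ i * pderiv_at j (pderiv_at j (%x. psi x $ i)) x))
   = (AV x. (SU i. SU j. ph x $ i * pderiv_at j (pderiv_at j (%x. psi x $ i)) x))"
  using p q
  by (subst lint_sum, intro Bochner_Integration.integrable_sum torus_integrable continuous_intros c smooth_nth smooth_pderiv_at; simp?)
    (subst lint_sum, intro torus_integrable continuous_intros c smooth_nth smooth_pderiv_at; simp?)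
 also have "... = L2_inner ph (laplacian psi)"
 proof -
  have "pderiv_at j (%x. psi x $ i) = (%x. pderiv_at j psi x $ i)" for i j
   using q by (auto simp: pderiv_at_nth smooth_differentiable)
  then show ?thesis using q
   by (simp add: L2_inner_def inner_vec_def laplacian_nth sum_distrib_left pderiv_at_nth smooth_differentiable smooth_pderiv_at)
 qed
 finally show ?thesis .
qed

lemma Cinf_div_add: "ph \<in> Cinf_div ==> psi \<in> Cinf_div ==> (%x. ph x + psi x) \<in> Cinf_div"
 and Cinf_div_scaleR: "ph \<in> Cinf_div ==> (%x. c *\<^sub>R ph x) \<in> Cinf_div"
proof -
 assume p: "ph \<in> Cinf_div"
 note pd = Cinf_divD[OF p]
 have "(AV x. c *\<^sub>R ph x) = 0" using pd by simp
 then show "(%x. c *\<^sub>R ph x) \<in> Cinf_div"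
  using pd by (simp add: Cinf_div_def periodic_def smooth_scaleR divergence_def pderiv_at_scaleR smooth_differentiable
   sum_distrib_left[symmetric])
 assume q: "psi \<in> Cinf_div"
 note qd = Cinf_divD[OF q]
 have "(AV x. ph x + psi x) = 0"
  using pd qd by (subst Bochner_Integration.integral_add) (auto intro!: torus_integrable smooth_continuous)
 then show "(%x. ph x + psi x) \<in> Cinf_div"
  using pd qd by (simp add: Cinf_div_def periodic_def smooth_add divergence_def pderiv_at_add smooth_differentiable sum.distrib)
qed

lemma Cinf_div_diff: "ph \<in> Cinf_div ==> psi \<in> Cinf_div ==> (%x. ph x - psi x) \<in> Cinf_div"
 using Cinf_div_add[OF _ Cinf_div_scaleR[of psi "-1"], of ph] by simp

lemma jacobian_scaleR:
 fixes ph :: vfield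
 shows "smooth ph ==> jacobian (%x. c *\<^sub>R ph x) (at x) = c *\<^sub>R jacobian ph (at x)"
 by (simp add: vec_eq_iff jacobian_nth pderiv_at_scaleR smooth_differentiable)

lemma jacobian_add:
 fixes ph psi :: vfield
 assumes "smooth ph" "smooth psi"
 shows "jacobian (%x. ph x + psi x) (at x) = jacobian ph (at x) + jacobian psi (at x)"
  and "jacobian (%x. ph x - psi x) (at x) = jacobian ph (at x) - jacobian psi (at x)"
proof -
 show "jacobian (%x. ph x + psi x) (at x) = jacobian ph (at x) + jacobian psi (at x)"
  using assms by (simp add: vec_eq_iff jacobian_nth pderiv_at_add smooth_differentiable)
 have "pderiv_at j (%x. ph x + (-1) *\<^sub>R psi x) x = pderiv_at j ph x + (-1) *\<^sub>R pderiv_at j psi x" for j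
  using assms smooth_scaleR[OF assms(2), of "-1"] pderiv_at_scaleR[of psi x j "-1"]
  by (subst pderiv_at_add) (simp_all add: smooth_differentiable)
 then show "jacobian (%x. ph x - psi x) (at x) = jacobian ph (at x) - jacobian psi (at x)"
  by (simp add: vec_eq_iff jacobian_nth)
qed

lemma has_H1_gradientD:
 assumes "has_H1_gradient v G"
 obtains ph where "!!n. ph n \<in> Cinf_div" "L2_tendsto ph v"
  "(%n. L2_norm (%x. jacobian (ph n) (at x) - G x)) \<longlonglongrightarrow> 0" "v \<in> L2" "G \<in> L2"
 using assms unfolding has_H1_gradient_def by blast

lemma Cinf_div_L2: "ph \<in> Cinf_div ==> ph \<in> L2" "ph \<in> Cinf_div ==> (jac ph) \<in> L2"
 by (auto dest: Cinf_divD intro!: smooth_L2 smooth_jacobian_L2)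

lemma L2_norm_tendsto:
 fixes f :: "nat => real^3 => 'b::{real_inner, second_countable_topology}"
 assumes f: "!!n. f n \<in> L2" and g: "g \<in> L2" and lim: "L2_tendsto f g"
 shows "(%n. L2_norm (f n)) \<longlonglongrightarrow> L2_norm g"
 unfolding LIMSEQ_iff_nz
proof -
 have "(%n. L2_norm (f n) - L2_norm g) \<longlonglongrightarrow> 0"
  by (rule tendsto_rabs_zero_cancel, rule tendsto_sandwich[OF _ _ tendsto_const lim])
    (auto intro!: always_eventually L2_norm_triangle_sub f g)
 then have "(%n. L2_norm (f n)) \<longlonglongrightarrow> L2_norm g" by (simp add: LIM_zero_iff)
 then show "\<forall>r>0. \<exists>no>0. \<forall>n\<ge>no. dist (L2_norm (f n)) (L2_norm g) < r"
  unfolding LIMSEQ_iff_nz[symmetric] by (simp add: lim_sequentially)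
qed

lemma L2_inner_tendsto:
 fixes f :: "nat => real^3 => 'b::{real_inner, second_countable_topology}"
 assumes f: "!!n. f n \<in> L2" and g: "g \<in> L2" and h: "h \<in> L2"
  and lim: "L2_tendsto f g"
 shows "(%n. L2_inner (f n) h) \<longlonglongrightarrow> L2_inner g h"
proof -
 have *: "L2_inner (f n) h - L2_inner g h = L2_inner (%x. f n x - g x) h" for n
  unfolding L2_inner_def inner_diff_left
  by (rule Bochner_Integration.integral_diff[symmetric]) (intro L2_inner_integrable f g h)+
 have "(%n. L2_inner (f n) h - L2_inner g h) \<longlonglongrightarrow> 0"
  unfolding *
 proof (rule tendsto_rabs_zero_cancel, rule tendsto_sandwich[OF _ _ tendsto_const])
  show "(%n. L2_norm (%x. f n x - g x) * L2_norm h) \<longlonglongrightarrow> 0"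
   using tendsto_mult_left_zero[OF lim] .
 qed (auto intro!: always_eventually L2_inner_le L2_diff f g h)
 then show ?thesis by (simp add: LIM_zero_iff)
qed

lemma L2_inner_commute: "L2_inner v w = L2_inner w v"
 by (simp add: L2_inner_def inner_commute)

lemma L2_inner_self: "L2_inner v v = (L2_norm v)^2"
 by (simp add: L2_inner_def L2_norm_sq power2_norm_eq_inner)

lemma H1_gradient_inner_jacobian:
 assumes G: "has_H1_gradient v G" and p: "periodic ph" "smooth ph"
 shows "L2_inner G (jac ph) = - L2_inner v (laplacian ph)"
proof -
 obtain psi where psi: "!!n. psi n \<in> Cinf_div" "L2_tendsto psi v"
  "(%n. L2_norm (%x. jacobian (psi n) (at x) - G x)) \<longlonglongrightarrow> 0" and L: "v \<in> L2" "G \<in> L2"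
  by (rule has_H1_gradientD[OF G]) blast
 have lap: "laplacian ph \<in> L2" by (intro smooth_L2 smooth_laplacian periodic_laplacian p)
 have "(%n. L2_inner (jac (psi n)) (jac ph)) \<longlonglongrightarrow> L2_inner G (jac ph)"
  by (rule L2_inner_tendsto[OF Cinf_div_L2(2)[OF psi(1)] L(2) smooth_jacobian_L2(1)[OF p] psi(3)])
 moreover have "(%n. - L2_inner (psi n) (laplacian ph)) \<longlonglongrightarrow> - L2_inner v (laplacian ph)"
  by (intro tendsto_minus L2_inner_tendsto[OF Cinf_div_L2(1)[OF psi(1)] L(1) lap psi(2)])
 moreover have "L2_inner (jac (psi n)) (jac ph) = - L2_inner (psi n) (laplacian ph)" for n
  using Cinf_divD[OF psi(1)] p by (intro L2_inner_jacobian)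
 ultimately show ?thesis by (auto intro: LIMSEQ_unique)
qed

lemma has_H1_gradient_diff:
 assumes v: "has_H1_gradient v G" and w: "has_H1_gradient w H"
 shows "has_H1_gradient (%x. v x - w x) (%x. G x - H x)"
proof -
 obtain ph where ph: "!!n. ph n \<in> Cinf_div" "L2_tendsto ph v"
  "(%n. L2_norm (%x. jacobian (ph n) (at x) - G x)) \<longlonglongrightarrow> 0" and Lv: "v \<in> L2" "G \<in> L2"
  by (rule has_H1_gradientD[OF v]) blast
 obtain psi where psi: "!!n. psi n \<in> Cinf_div" "L2_tendsto psi w"
  "(%n. L2_norm (%x. jacobian (psi n) (at x) - H x)) \<longlonglongrightarrow> 0" and Lw: "w \<in> L2" "H \<in> L2"
  by (rule has_H1_gradientD[OF w]) blast
 note P = Cinf_div_L2[OF ph(1)] and Q = Cinf_div_L2[OF psi(1)]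
 have le: "L2_norm (%x. (a x - b x) - (c x - d x)) <= L2_norm (%x. a x - c x) + L2_norm (%x. b x - d x)"
  if "a \<in> L2" "b \<in> L2" "c \<in> L2" "d \<in> L2" for a b c d :: "real^3 => 'b::{real_inner, second_countable_topology}"
  using L2_norm_triangle[OF L2_diff[OF that(1,3)] L2_diff[OF that(4,2)]] L2_norm_minus_commute[of b d]
  by (simp add: algebra_simps)
 have "(%n. L2_norm (%x. (ph n x - psi n x) - (v x - w x))) \<longlonglongrightarrow> 0"
  by (rule tendsto_sandwich[OF _ _ tendsto_const tendsto_add_zero[OF ph(2) psi(2)]])
    (auto intro!: always_eventually le P Q Lv Lw)
 moreover have "(%n. L2_norm (%x. jacobian (%x. ph n x - psi n x) (at x) - (G x - H x))) \<longlonglongrightarrow> 0"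
  using Cinf_divD(2)[OF ph(1)] Cinf_divD(2)[OF psi(1)] unfolding jacobian_add
  by (intro tendsto_sandwich[OF _ _ tendsto_const tendsto_add_zero[OF ph(3) psi(3)]])
    (auto simp: jacobian_add intro!: always_eventually le P Q Lv Lw)
 ultimately show ?thesis
  unfolding has_H1_gradient_def using Lv Lw ph(1) psi(1)
  by (auto intro!: L2_diff exI[of _ "%n x. ph n x - psi n x"] Cinf_div_diff)
qed

lemma has_H1_gradient_Cinf_div:
 "ph \<in> Cinf_div ==> has_H1_gradient ph (jac ph)"
 unfolding has_H1_gradient_def by (auto simp: Cinf_div_L2 L2_norm_def intro!: exI[of _ "%_. ph"])

text \<open>Testing the gradient of the difference against the approximants of the difference.\<close>

lemma has_H1_gradient_unique:
 assumes G: "has_H1_gradient v G" and H: "has_H1_gradient v H"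
 shows "L2_norm (%x. G x - H x) = 0"
proof -
 have D: "has_H1_gradient (%x. 0) (%x. G x - H x)"
  using has_H1_gradient_diff[OF G H] by simp
 obtain psi where psi: "!!n. psi n \<in> Cinf_div"
  "(%n. L2_norm (%x. psi n x - 0)) \<longlonglongrightarrow> 0" "(%n. L2_norm (%x. jacobian (psi n) (at x) - (G x - H x))) \<longlonglongrightarrow> 0"
  and L0: "(%x. 0::real^3) \<in> L2" and L: "(%x. G x - H x) \<in> L2"
  by (rule has_H1_gradientD[OF D]) blast
 have "L2_inner (jac (psi n)) (%x. G x - H x) = 0" for n
  using H1_gradient_inner_jacobian[OF D, of "psi n"] Cinf_divD[OF psi(1)]
  by (simp add: L2_inner_commute[of "%x. jacobian (psi n) (at x)"]) (simp add: L2_inner_def)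
 moreover have "(%n. L2_inner (jac (psi n)) (%x. G x - H x)) \<longlonglongrightarrow> L2_inner (%x. G x - H x) (%x. G x - H x)"
  by (rule L2_inner_tendsto[OF Cinf_div_L2(2)[OF psi(1)] L L psi(3)])
 ultimately have "L2_inner (%x. G x - H x) (%x. G x - H x) = 0"
  using LIMSEQ_unique[OF _ tendsto_const] by fastforce
 then show ?thesis by (simp add: L2_inner_self)
qed

lemma has_H1_gradient_grad: "v \<in> H1_div ==> has_H1_gradient v (grad v)"
 unfolding grad_def H1_div_def by (simp add: someI_ex)

lemma L2_norm_grad:
 assumes "has_H1_gradient v G"
 shows "v \<in> H1_div" "L2_norm (grad v) = L2_norm G"
proof -
 show v: "v \<in> H1_div" using assms by (auto simp: H1_div_def)
 have "L2_norm (%x. grad v x - G x) = 0"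
  by (rule has_H1_gradient_unique[OF has_H1_gradient_grad[OF v] assms])
 moreover have "grad v \<in> L2" "G \<in> L2"
  using assms has_H1_gradient_grad[OF v] by (auto simp: has_H1_gradient_def)
 ultimately show "L2_norm (grad v) = L2_norm G"
  using L2_norm_triangle_sub[of "grad v" G] by simp
qed

text \<open>Describes the sublevel sets without the chosen representative \<open>grad v\<close>,
  which reduces the measurability of \<open>grad_normsq\<close> to closedness of balls.\<close>

lemma grad_normsq_le_iff:
 assumes "c \<ge> 0"
 shows "grad_normsq v <= ennreal (c^2) \<longleftrightarrow> (\<exists>G. has_H1_gradient v G \<and> L2_norm G <= c)"
proof
 assume "grad_normsq v <= ennreal (c^2)"
 then have v: "v \<in> H1_div" and "ennreal ((L2_norm (grad v))^2) <= ennreal (c^2)"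
  unfolding grad_normsq_def by (auto split: if_splits simp: top_unique)
 then have "L2_norm (grad v) <= c" using assms by (auto intro: power2_le_imp_le)
 then show "\<exists>G. has_H1_gradient v G \<and> L2_norm G <= c" using has_H1_gradient_grad[OF v] by blast
next
 assume "\<exists>G. has_H1_gradient v G \<and> L2_norm G <= c"
 then obtain G where G: "has_H1_gradient v G" "L2_norm G <= c" by blast
 then show "grad_normsq v <= ennreal (c^2)"
  using L2_norm_grad[OF G(1)] by (auto simp: grad_normsq_def intro!: ennreal_leI power_mono)
qed

text \<open>Uniform convexity in the form used for nearest-point arguments; it yields strong
  convergence of gradients directly, in place of weak compactness.\<close>

lemma L2_parallelogram:
 fixes v w :: "real^3 => 'b::{real_inner, second_countable_topology}"
 assumes v: "v \<in> L2" and w: "w \<in> L2"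
 shows "(L2_norm (%x. v x - w x))^2 = 2 * (L2_norm v)^2 + 2 * (L2_norm w)^2 - 4 * (L2_norm (%x. (1/2) *\<^sub>R (v x + w x)))^2"
proof -
 have "(L2_norm (%x. v x - w x))^2 + (L2_norm (%x. v x + w x))^2 = (AV x. 2 * (norm (v x))^2 + 2 * (norm (w x))^2)"
  unfolding L2_norm_sq
  by (subst Bochner_Integration.integral_add[symmetric], intro L2D(3) L2_diff v w, intro L2D(3) L2_add v w)
    (auto intro!: lint_cong
     simp: power2_norm_eq_inner inner_add inner_diff inner_commute algebra_simps)
 also have "... = 2 * (L2_norm v)^2 + 2 * (L2_norm w)^2"
  unfolding L2_norm_sq using L2D(3)[OF v] L2D(3)[OF w] by simp
 finally show ?thesis by (simp add: L2_norm_scaleR power_divide)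
qed

text \<open>Almost minimal elements of the nested convex sets \<open>C n\<close> have Cauchy gradients.\<close>

lemma H1_ball_closed:
 assumes v: "v \<in> L2" and c: "c \<ge> 0"
  and app: "!!n::nat. \<exists>w. (\<exists>G. has_H1_gradient w G \<and> L2_norm G <= c) \<and> L2_norm (%x. w x - v x) <= 1 / Suc n"
 shows "\<exists>G. has_H1_gradient v G \<and> L2_norm G <= c"
proof -
 define C where "C n = {w\<in>Cinf_div. L2_norm (%x. w x - v x) <= 1 / Suc n \<and> L2_norm (jac w) <= c + 1 / Suc n}" for n :: nat
 have ne: "C n \<noteq> {}" for n
 proof -
  \<comment> \<open>Index 2n+1, because the error of \<open>w\<close> and that of its smooth
    approximant, each at most 1/(2n+2), have to add up to 1/(n+1).\<close>
  obtain w G where w: "has_H1_gradient w G" "L2_norm G <= c" "L2_norm (%x. w x - v x) <= 1 / Suc (2 * n + 1)"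
   using app by blast
  obtain ph where ph: "!!n. ph n \<in> Cinf_div" "L2_tendsto ph w"
   "(%n. L2_norm (%x. jacobian (ph n) (at x) - G x)) \<longlonglongrightarrow> 0" and L: "w \<in> L2" "G \<in> L2"
   by (rule has_H1_gradientD[OF w(1)]) blast
  have pos: "(0::real) < 1 / Suc (2 * n + 1)" by simp
  from order_tendstoD(2)[OF ph(2) pos] order_tendstoD(2)[OF ph(3) pos]
  have "eventually (%m. L2_norm (%x. ph m x - w x) < 1 / Suc (2*n+1) \<and> L2_norm (%x. jacobian (ph m) (at x) - G x) < 1 / Suc (2*n+1)) sequentially"
   by (rule eventually_conj)
  then obtain m where m: "L2_norm (%x. ph m x - w x) < 1 / Suc (2*n+1)" "L2_norm (%x. jacobian (ph m) (at x) - G x) < 1 / Suc (2*n+1)"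
   by (auto simp: eventually_sequentially)
  have two: "1 / Suc (2*n+1) + 1 / Suc (2*n+1) = (1 / Suc n :: real)" by (simp add: field_simps)
  have "L2_norm (%x. ph m x - v x) <= 1 / Suc n"
   using L2_norm_triangle3[OF Cinf_div_L2(1)[OF ph(1)] L(1) v, of m] m(1) w(3) two by linarith
  moreover have "L2_norm (jac (ph m)) <= c + 1 / Suc n"
   using L2_norm_triangle_sub[OF Cinf_div_L2(2)[OF ph(1)] L(2), of m] m(2) w(2) two pos by linarith
  ultimately have "ph m \<in> C n" using ph(1) by (simp add: C_def)
  then show ?thesis by blast
 qed
 have mid: "(%x. (1/2) *\<^sub>R (a x + b x)) \<in> C n" if a: "a \<in> C n" and b: "b \<in> C n" for a b n
 proof -
  have A: "a \<in> Cinf_div" "b \<in> Cinf_div" using a b by (auto simp: C_def)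
  note L = Cinf_div_L2[OF A(1)] Cinf_div_L2[OF A(2)]
  have "(%x. (1/2) *\<^sub>R (a x + b x)) \<in> Cinf_div" by (intro Cinf_div_scaleR Cinf_div_add A)
  moreover have "L2_norm (%x. (1/2) *\<^sub>R (a x + b x) - v x) <= 1 / Suc n"
  proof -
   have "L2_norm (%x. (1/2) *\<^sub>R (a x + b x) - v x) = L2_norm (%x. (1/2) *\<^sub>R (a x - v x) + (1/2) *\<^sub>R (b x - v x))"
    by (intro arg_cong[where f=L2_norm] ext) (simp add: algebra_simps flip: scaleR_left.add)
   also have "... <= (1/2) * L2_norm (%x. a x - v x) + (1/2) * L2_norm (%x. b x - v x)"
    using L2_norm_triangle[OF L2_scaleR[OF L2_diff[OF L(1) v], of "1/2"] L2_scaleR[OF L2_diff[OF L(3) v], of "1/2"]]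
    by (simp add: L2_norm_scaleR)
   also have "... <= (1/2) * (1 / Suc n) + (1/2) * (1 / Suc n)"
    using a b by (intro add_mono mult_left_mono) (auto simp: C_def)
   also have "... = 1 / Suc n" by (simp only: field_sum_of_halves mult.commute[of "1/2"] times_divide_eq_right mult_1_right)
   finally show ?thesis .
  qed
  moreover have "L2_norm (%x. jacobian (%x. (1/2) *\<^sub>R (a x + b x)) (at x)) <= c + 1 / Suc n"
  proof -
   have "L2_norm (%x. jacobian (%x. (1/2) *\<^sub>R (a x + b x)) (at x)) = (1/2) * L2_norm (%x. jacobian a (at x) + jacobian b (at x))"
    using A by (simp add: jacobian_add(1) jacobian_scaleR smooth_add Cinf_divD L2_norm_scaleR)
   also have "... <= (1/2) * ((c + 1 / Suc n) + (c + 1 / Suc n))"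
    using a b L2_norm_triangle[OF L(2,4)] by (intro mult_left_mono) (auto simp: C_def)
   finally show ?thesis by simp
  qed
  ultimately show ?thesis by (simp add: C_def)
 qed
 have anti: "C m \<subseteq> C n" if "n <= m" for m n
 proof -
  have "(1::real) / Suc m <= 1 / Suc n" using that by (simp add: frac_le)
  then show ?thesis unfolding C_def by auto
 qed
 \<comment> \<open>The sets \<open>C n\<close> decrease, so these infima increase; they are bounded
   by \<open>c + 1\<close> and hence converge.\<close>
 define d where "d n = (INF w\<in>C n. L2_norm (jac w))" for n
 have bdd: "bdd_below ((%w. L2_norm (jac w)) ` C n)" for n
  by (intro bdd_belowI[of _ 0]) auto
 have d_le: "d n <= L2_norm (jac w)" if "w \<in> C n" for w n
  unfolding d_def using bdd that by (intro cINF_lower) auto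
 have d0: "0 <= d n" for n unfolding d_def using ne by (intro cINF_greatest) auto
 have d_mono: "d n <= d m" if "n <= m" for n m
  unfolding d_def using ne[of m] bdd anti[OF that] by (intro cINF_superset_mono) auto
 have d_bdd: "d n <= c + 1" for n
 proof -
  obtain w where "w \<in> C n" using ne by blast
  then have "d n <= c + 1 / Suc n" using d_le[of w n] by (auto simp: C_def)
  also have "... <= c + 1" by simp
  finally show ?thesis .
 qed
 have "\<exists>w\<in>C n. L2_norm (jac w) < d n + 1 / Suc n" for n
  using cINF_less_iff[OF ne bdd, of n "d n + 1 / Suc n"] unfolding d_def by simp
 then obtain H where H: "!!n. H n \<in> C n" "!!n. L2_norm (jac (H n)) < d n + 1 / Suc n"
  by metis
 have HC: "H n \<in> Cinf_div" for n using H(1) by (auto simp: C_def)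
 note HL = Cinf_div_L2[OF HC]
 have "incseq d" using d_mono by (simp add: incseq_def)
 then obtain D where D: "d \<longlonglongrightarrow> D" using incseq_convergent[of d "c + 1"] d_bdd by metis
 \<comment> \<open>The parallelogram bound for two almost minimizers: both gradients have norm at
   most \<open>D + 1 / Suc n\<close>, while their midpoint lies in \<open>C n\<close> and has norm
   at least \<open>d n\<close>.\<close>
 define b where "b n = 4 * ((D + 1 / Suc n)^2 - (d n)^2)" for n
 have dD: "d n <= D" for n using D \<open>incseq d\<close> by (rule incseq_le[rotated])
 have b: "b \<longlonglongrightarrow> 0"
 proof -
  have "(%n. 4 * ((D + 1 / real (Suc n))^2 - (d n)^2)) \<longlonglongrightarrow> 4 * ((D + 0)^2 - D^2)"
   by (intro tendsto_intros D LIMSEQ_Suc[OF lim_1_over_n])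
  then show ?thesis by (simp add: b_def[abs_def])
 qed
 have HH: "(L2_norm (%x. jacobian (H n) (at x) - jacobian (H m) (at x)))^2 <= b n" if "n <= m" for n m
 proof -
  have "(%x. (1/2) *\<^sub>R (H n x + H m x)) \<in> C n" using H(1) anti[OF that] by (intro mid) auto
  then have "d n <= L2_norm (%x. jacobian (%x. (1/2) *\<^sub>R (H n x + H m x)) (at x))" by (rule d_le)
  also have "(%x. jacobian (%x. (1/2) *\<^sub>R (H n x + H m x)) (at x)) = (%x. (1/2) *\<^sub>R (jacobian (H n) (at x) + jacobian (H m) (at x)))"
   using HC by (simp add: jacobian_add(1) jacobian_scaleR smooth_add Cinf_divD)
  finally have 1: "(d n)^2 <= (L2_norm (%x. (1/2) *\<^sub>R (jacobian (H n) (at x) + jacobian (H m) (at x))))^2"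
   using d0 by (intro power_mono) auto
  have nm: "1 / real (Suc m) <= 1 / real (Suc n)" using that by (simp add: frac_le)
  have 2: "(L2_norm (jac (H n)))^2 <= (D + 1 / Suc n)^2"
   using H(2)[of n] dD[of n] by (intro power_mono) auto
  have 3: "(L2_norm (jac (H m)))^2 <= (D + 1 / Suc n)^2"
   using H(2)[of m] dD[of m] nm by (intro power_mono) auto
  have "2 * p + 2 * q - 4 * r <= 4 * (u - t)" if "t <= r" "p <= u" "q <= u" for p q r t u :: real
   using that by simp
  from this[OF 1 2 3] show ?thesis
   unfolding L2_parallelogram[OF HL(2) HL(2)] b_def .
 qed
 obtain G where G: "G \<in> L2" "(%n. L2_norm (%x. jacobian (H n) (at x) - G x)) \<longlonglongrightarrow> 0"
 proof (rule L2_complete[OF HL(2)])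
  fix e :: real assume e: "e > 0"
  then obtain N where N: "!!n. n \<ge> N ==> b n < e^2"
   using order_tendstoD(2)[OF b, of "e^2"] by (auto simp: eventually_sequentially)
  have le: "L2_norm (%x. jacobian (H n) (at x) - jacobian (H m) (at x)) <= e" if "n \<ge> N" "n <= m" for m n
   by (rule power2_le_imp_le) (use HH[OF that(2)] N[OF that(1)] e in linarith)+
  have "L2_norm (%x. jacobian (H m) (at x) - jacobian (H n) (at x)) <= e" if "m \<ge> N" "n \<ge> N" for m n
  proof (cases "n <= m")
   case True
   then show ?thesis
    using le[OF that(2) True] by (subst L2_norm_minus_commute)
  next
   case False
   then show ?thesis using le[OF that(1), of n] by simp
  qed
  then show "\<exists>N. \<forall>m\<ge>N. \<forall>n\<ge>N. L2_norm (%x. jacobian (H m) (at x) - jacobian (H n) (at x)) <= e"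
   by blast
 qed
 have lim1: "L2_tendsto H v"
  by (rule tendsto_sandwich[OF _ _ tendsto_const LIMSEQ_Suc[OF lim_1_over_n]])
    (use H(1) in \<open>auto simp: C_def intro!: always_eventually\<close>)
 have "has_H1_gradient v G"
  unfolding has_H1_gradient_def using v G HC lim1 by blast
 moreover have "L2_norm G <= c + 0"
 proof (rule LIMSEQ_le)
  show "(%n. L2_norm (jac (H n))) \<longlonglongrightarrow> L2_norm G"
   by (rule L2_norm_tendsto[OF HL(2) G])
  show "(%n. c + 1 / Suc n) \<longlonglongrightarrow> c + 0"
   by (intro tendsto_intros LIMSEQ_Suc[OF lim_1_over_n])
  show "\<exists>N. \<forall>n\<ge>N. L2_norm (jac (H n)) <= c + 1 / Suc n"
   using H(1) by (auto simp: C_def)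
 qed
 ultimately show ?thesis by auto
qed

section \<open>Measurability with respect to the Borel sets of the L^2 metric\<close>

lemma L2_divD: "v \<in> L2_div ==> v \<in> L2"
 by (simp add: L2_div_def)

lemma L2_div_approx:
 assumes "v \<in> L2_div"
 obtains ph where "!!n. ph n \<in> Cinf_div" "L2_tendsto ph v"
 using assms unfolding L2_div_def by blast

lemma H1_div_subset_L2_div: "has_H1_gradient v G ==> v \<in> L2_div"
 unfolding has_H1_gradient_def L2_div_def by blast

lemma space_L2_div_borel: "space L2_div_borel = L2_div"
 unfolding L2_div_borel_def by (rule space_measure_of) auto

lemma sets_L2_div_borel_open:
 assumes "U \<subseteq> L2_div"
  and "!!v. v \<in> U ==> \<exists>r>0. \<forall>w\<in>L2_div. L2_norm (%x. w x - v x) < r \<longrightarrow> w \<in> U"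
 shows "U \<in> sets L2_div_borel"
 unfolding L2_div_borel_def using assms by (subst sets_measure_of) auto

lemma sets_L2_div_borel_closed:
 assumes C: "C \<subseteq> L2_div"
  and cl: "!!v. v \<in> L2_div ==> (!!n::nat. \<exists>w\<in>C. L2_norm (%x. w x - v x) <= 1 / Suc n) ==> v \<in> C"
 shows "C \<in> sets L2_div_borel"
proof -
 have "L2_div - C \<in> sets L2_div_borel"
 proof (rule sets_L2_div_borel_open)
  fix v assume v: "v \<in> L2_div - C"
  then obtain n :: nat where n: "!!w. w \<in> C ==> \<not> L2_norm (%x. w x - v x) <= 1 / Suc n" using cl by blast
  show "\<exists>r>0. \<forall>w\<in>L2_div. L2_norm (%x. w x - v x) < r \<longrightarrow> w \<in> L2_div - C"
   by (intro exI[of _ "1 / Suc n"]) (auto dest: n)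
 qed auto
 then have "space L2_div_borel - (L2_div - C) \<in> sets L2_div_borel" by auto
 moreover have "space L2_div_borel - (L2_div - C) = C" using C by (auto simp: space_L2_div_borel)
 ultimately show ?thesis by simp
qed

lemma L2_continuous_measurable:
 fixes f :: "vfield => real"
 assumes cont: "!!v w. v \<in> L2_div ==> (!!n. w n \<in> L2_div) ==>
   L2_tendsto w v ==> (%n. f (w n)) \<longlonglongrightarrow> f v"
 shows "f \<in> borel_measurable L2_div_borel"
proof (rule borel_measurableI)
 fix S :: "real set" assume S: "open S"
 show "f -` S \<inter> space L2_div_borel \<in> sets L2_div_borel"
  unfolding space_L2_div_borel
 proof (rule sets_L2_div_borel_open)
  fix v assume v: "v \<in> f -` S \<inter> L2_div"
  show "\<exists>r>0. \<forall>w\<in>L2_div. L2_norm (%x. w x - v x) < r \<longrightarrow> w \<in> f -` S \<inter> L2_div"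
  proof (rule ccontr)
   assume neg: "\<not> ?thesis"
   have "\<exists>w\<in>L2_div. L2_norm (%x. w x - v x) < 1 / Suc n \<and> f w \<notin> S" for n :: nat
   proof -
    have "(0::real) < 1 / Suc n" by simp
    with neg show ?thesis by blast
   qed
   then obtain w where w: "!!n. w n \<in> L2_div" "!!n. L2_norm (%x. w n x - v x) < 1 / Suc n" "!!n. f (w n) \<notin> S"
    by metis
   have "L2_tendsto w v"
    by (rule tendsto_sandwich[OF _ _ tendsto_const LIMSEQ_Suc[OF lim_1_over_n]])
      (use w(2) in \<open>auto intro!: always_eventually less_imp_le\<close>)
   then have "(%n. f (w n)) \<longlonglongrightarrow> f v" using v w(1) by (intro cont) auto
   then have "eventually (%n. f (w n) \<in> S) sequentially" using S v by (intro topological_tendstoD) auto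
   then show False using w(3) by (auto simp: eventually_sequentially)
  qed
 qed auto
qed

text \<open>Lower semicontinuity: by \<open>H1_ball_closed\<close> the finite sublevel sets are
  closed in L^2.\<close>

lemma grad_normsq_measurable: "grad_normsq \<in> borel_measurable L2_div_borel"
proof (rule borel_measurableI_le)
 fix y :: ennreal
 show "{v \<in> space L2_div_borel. grad_normsq v <= y} \<in> sets L2_div_borel"
 proof (cases y)
  case (real z)
  then have y: "y = ennreal ((sqrt z)^2)" "0 <= sqrt z" by auto
  show ?thesis
   unfolding space_L2_div_borel y(1) grad_normsq_le_iff[OF y(2)]
  proof (rule sets_L2_div_borel_closed)
   fix v assume "v \<in> L2_div"
    and "!!n::nat. \<exists>w\<in>{v \<in> L2_div. \<exists>G. has_H1_gradient v G \<and> L2_norm G <= sqrt z}. L2_norm (%x. w x - v x) <= 1 / Suc n"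
   then show "v \<in> {v \<in> L2_div. \<exists>G. has_H1_gradient v G \<and> L2_norm G <= sqrt z}"
    using H1_ball_closed[of v "sqrt z"] y(2) L2_divD[of v] by blast
  qed auto
 next
  case top
  then show ?thesis by auto
 qed
qed

section \<open>Bilinear functionals\<close>

lemma L2_inner_tendsto2:
 fixes f h :: "nat => real^3 => 'b::{real_inner, second_countable_topology}"
 assumes f: "!!n. f n \<in> L2" and g: "g \<in> L2" and fl: "L2_tendsto f g"
  and h: "!!n. h n \<in> L2" and k: "k \<in> L2" and hl: "L2_tendsto h k"
 shows "(%n. L2_inner (f n) (h n)) \<longlonglongrightarrow> L2_inner g k"
proof -
 have *: "L2_inner (f n) (h n) - L2_inner (f n) k = L2_inner (f n) (%x. h n x - k x)" for n
  unfolding L2_inner_def inner_diff_right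
  by (rule Bochner_Integration.integral_diff[symmetric]) (intro L2_inner_integrable f h k)+
 have "(%n. L2_inner (f n) (h n) - L2_inner (f n) k) \<longlonglongrightarrow> 0"
  unfolding *
 proof (rule tendsto_rabs_zero_cancel, rule tendsto_sandwich[OF _ _ tendsto_const])
  show "(%n. L2_norm (f n) * L2_norm (%x. h n x - k x)) \<longlonglongrightarrow> 0"
   using tendsto_mult[OF L2_norm_tendsto[OF f g fl] hl] by simp
 qed (auto intro!: always_eventually L2_inner_le L2_diff f h k)
 from tendsto_add[OF this L2_inner_tendsto[OF f g k fl]] show ?thesis by simp
qed

lemma L2_norm_mono:
 assumes "f \<in> borel_measurable borel" "periodic f" "g \<in> L2" "!!x. norm (f x) <= C * norm (g x)" "0 <= C"
 shows "f \<in> L2" "L2_norm f <= C * L2_norm g"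
proof -
 note [measurable] = assms(1) L2D(2)[OF assms(3)]
 have le: "(norm (f x))^2 <= C^2 * (norm (g x))^2" for x
  using power_mono[OF assms(4), of x 2] by (simp add: power_mult_distrib)
 have [measurable]: "(%x. (norm (f x))^2) \<in> borel_measurable torus" by (rule measurable_torusI) measurable
 have i: "integrable torus (%x. (norm (f x))^2)"
  by (rule lint_bound[of _ "%x. C^2 * (norm (g x))^2"])
    (use L2D(3)[OF assms(3)] le in auto)
 then show "f \<in> L2" using assms by (auto simp: L2_def)
 have "(AV x. (norm (f x))^2) <= (AV x. C^2 * (norm (g x))^2)"
  by (rule integral_mono[OF i _ le]) (use L2D(3)[OF assms(3)] in simp)
 then have "(L2_norm f)^2 <= (C * L2_norm g)^2"
  by (simp add: power_mult_distrib L2_norm_sq)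
 then show "L2_norm f <= C * L2_norm g" by (rule power2_le_imp_le) (simp add: assms(5))
qed

lemma norm_matrix_vector_le: "norm ((A::real^3^3) *v x) <= norm A * norm x"
proof (rule power2_le_imp_le)
 have "(norm (A *v x))^2 = (SU i. (A $ i \<bullet> x)^2)"
  by (simp add: norm_sq_eq_sum matrix_mult_dot)
 also have "... <= (SU i. (norm (A $ i))^2 * (norm x)^2)"
  using power_mono[OF Cauchy_Schwarz_ineq2, of _ _ 2] by (intro sum_mono) (simp add: power_mult_distrib)
 also have "... = (norm A * norm x)^2"
  by (simp add: power_mult_distrib norm_vec_def[of A] L2_set_def sum_nonneg sum_distrib_right)
 finally show "(norm (A *v x))^2 <= (norm A * norm x)^2" .
qed simp

text \<open>By \<open>inner_outer\<close>, the convective term tested with a field becomes the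
  Frobenius pairing of the gradient with an L^2 matrix field, so L^2 convergence of both factors is
  enough to pass to the limit.\<close>

definition outer :: "real^3 => real^3 => real^3^3" where
 "outer a b = (\<chi> i j. a $ i * b $ j)"

lemma inner_outer: "A \<bullet> outer a b = (A *v b) \<bullet> a"
 by (simp add: outer_def inner_vec_def matrix_vector_mult_def sum_distrib_right sum_distrib_left mult_ac)

lemma norm_outer: "norm (outer a b) = norm a * norm b"
proof -
 have "(norm (outer a b))^2 = (norm a * norm b)^2"
  unfolding power2_norm_eq_inner[of "outer a b"] power_mult_distrib norm_sq_eq_sum[of a] norm_sq_eq_sum[of b]
  by (simp add: outer_def inner_vec_def sum_product power2_eq_square mult_ac)
 then show ?thesis by simp
qed

lemma outer_diff: "outer a b - outer a c = outer a (b - c)"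
 by (simp add: outer_def vec_eq_iff algebra_simps)

lemma outer_measurable [measurable (raw)]:
 assumes [measurable]: "f \<in> borel_measurable M" "g \<in> borel_measurable M"
 shows "(%x. outer (f x) (g x)) \<in> borel_measurable M"
proof -
 have "cts (%p. outer (fst p) (snd p))"
  unfolding outer_def by (intro continuous_intros)
 from borel_measurable_continuous_on[OF this, of "%x. (f x, g x)" M]
 show ?thesis by simp
qed

lemma matrix_vector_measurable [measurable (raw)]:
 fixes A :: "'a => real^3^3"
 assumes [measurable]: "A \<in> borel_measurable M" "g \<in> borel_measurable M"
 shows "(%x. A x *v g x) \<in> borel_measurable M"
proof -
 have "cts (%p::(real^3^3) \<times> (real^3). fst p *v snd p)"
  unfolding matrix_vector_mult_def by (intro continuous_intros)
 from borel_measurable_continuous_on[OF this, of "%x. (A x, g x)" M]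
 show ?thesis by simp
qed

lemma periodic_continuous_bounded:
 fixes f :: "real^3 => 'b::real_normed_vector"
 assumes "periodic f" "cts f"
 obtains B where "B > 0" "!!x. norm (f x) <= B"
proof -
 have "compact (f ` cbox 0 1)"
  by (intro compact_continuous_image continuous_on_subset[OF assms(2)]) auto
 then obtain B where B: "B > 0" "!!x. x \<in> cbox 0 1 ==> norm (f x) <= B"
  using bounded_pos compact_imp_bounded by (metis image_eqI)
 have "norm (f x) <= B" for x
 proof -
  have "vfrac x \<in> cbox 0 1"
   by (auto simp: mem_box_cart vfrac_def less_imp_le[OF frac_lt_1])
  then show ?thesis using B(2)[of "vfrac x"] periodic_vfrac[OF assms(1), of x] by simp
 qed
 with B(1) show thesis by (rule that)
qed

text \<open>The convective term with its derivative moved to the test field. In this form it is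
  defined and continuous on all of L^2, hence Borel on \<open>L2_div\<close>.\<close>

definition transport :: "vfield => vfield => real" where
 "transport ph v = L2_inner v (%x. jacobian ph (at x) *v v x)"

lemma bounded_multipliers:
 fixes ph :: vfield
 assumes ph: "periodic ph" "smooth ph"
 obtains B where "B \<ge> 0" "!!v. v \<in> L2 ==> (%x. jacobian ph (at x) *v v x) \<in> L2"
  "!!v. v \<in> L2 ==> L2_norm (%x. jacobian ph (at x) *v v x) <= B * L2_norm v"
  "!!v. v \<in> L2 ==> (%x. outer (ph x) (v x)) \<in> L2"
  "!!v. v \<in> L2 ==> L2_norm (%x. outer (ph x) (v x)) <= B * L2_norm v"
proof -
 have pj: "periodic (jac ph)"
  using L2D(1)[OF smooth_jacobian_L2(1)[OF ph]] .
 obtain B1 where B1: "B1 > 0" "!!x. norm (jacobian ph (at x)) <= B1"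
  using periodic_continuous_bounded[OF pj smooth_jacobian_L2(2)[OF ph]] by blast
 obtain B2 where B2: "B2 > 0" "!!x. norm (ph x) <= B2"
  using periodic_continuous_bounded[OF ph(1) smooth_continuous[OF ph(2)]] by blast
 have [measurable]: "ph \<in> borel_measurable borel" "(jac ph) \<in> borel_measurable borel"
  using smooth_continuous[OF ph(2)] smooth_jacobian_L2(2)[OF ph] by (auto intro: cts_measurable)
 define B where "B = max B1 B2"
 have B: "B \<ge> 0" "B1 <= B" "B2 <= B" using B1 by (auto simp: B_def)
 have 1: "norm (jacobian ph (at x) *v w) <= B * norm w" for x w
  using norm_matrix_vector_le[of "jacobian ph (at x)" w] mult_right_mono[OF order_trans[OF B1(2) B(2)], of "norm w" x]
  by simp
 have 2: "norm (outer (ph x) w) <= B * norm w" for x w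
  using mult_right_mono[OF order_trans[OF B2(2) B(3)], of "norm w" x] by (simp add: norm_outer)
 show thesis
 proof (rule that[OF B(1)])
  fix v :: vfield assume v: "v \<in> L2"
  note [measurable] = L2D(2)[OF v]
  have p: "periodic (%x. jacobian ph (at x) *v v x)" "periodic (%x. outer (ph x) (v x))"
   using pj ph(1) L2D(1)[OF v] by (auto simp: periodic_def)
  have m: "(%x. jacobian ph (at x) *v v x) \<in> borel_measurable borel" "(%x. outer (ph x) (v x)) \<in> borel_measurable borel"
   by measurable
  show "(%x. jacobian ph (at x) *v v x) \<in> L2"
   "L2_norm (%x. jacobian ph (at x) *v v x) <= B * L2_norm v"
   by (rule L2_norm_mono[OF m(1) p(1) v 1 B(1)])+
  show "(%x. outer (ph x) (v x)) \<in> L2" "L2_norm (%x. outer (ph x) (v x)) <= B * L2_norm v"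
   by (rule L2_norm_mono[OF m(2) p(2) v 2 B(1)])+
 qed
qed

lemma transport_tendsto:
 assumes ph: "periodic ph" "smooth ph"
  and w: "!!n. w n \<in> L2" "v \<in> L2" "L2_tendsto w v"
 shows "(%n. transport ph (w n)) \<longlonglongrightarrow> transport ph v"
proof -
 obtain B where B: "B \<ge> 0" "!!v. v \<in> L2 ==> (%x. jacobian ph (at x) *v v x) \<in> L2"
  "!!v. v \<in> L2 ==> L2_norm (%x. jacobian ph (at x) *v v x) <= B * L2_norm v"
  by (rule bounded_multipliers[OF ph]) blast
 have "(%n. L2_norm (%x. jacobian ph (at x) *v w n x - jacobian ph (at x) *v v x)) \<longlonglongrightarrow> 0"
 proof (rule tendsto_sandwich[OF _ _ tendsto_const tendsto_mult_right_zero[OF w(3), of B]])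
  show "\<forall>\<^sub>F n in sequentially. L2_norm (%x. jacobian ph (at x) *v w n x - jacobian ph (at x) *v v x) <= B * L2_norm (%x. w n x - v x)"
   using B(3)[OF L2_diff[OF w(1,2)]] by (auto intro!: always_eventually simp: matrix_vector_mult_diff_distrib)
 qed simp
 then show ?thesis
  unfolding transport_def by (intro L2_inner_tendsto2 w B(2))
qed

lemma transport_bound:
 assumes ph: "periodic ph" "smooth ph"
 obtains B where "B \<ge> 0" "!!v. v \<in> L2 ==> \<bar>transport ph v\<bar> <= B * (L2_norm v)^2"
proof -
 obtain B where B: "B \<ge> 0" "!!v. v \<in> L2 ==> (%x. jacobian ph (at x) *v v x) \<in> L2"
  "!!v. v \<in> L2 ==> L2_norm (%x. jacobian ph (at x) *v v x) <= B * L2_norm v"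
  by (rule bounded_multipliers[OF ph]) blast
 have "\<bar>transport ph v\<bar> <= B * (L2_norm v)^2" if "v \<in> L2" for v
 proof -
  have "\<bar>transport ph v\<bar> <= L2_norm v * L2_norm (%x. jacobian ph (at x) *v v x)"
   unfolding transport_def by (rule L2_inner_le[OF that B(2)[OF that]])
  also have "... <= L2_norm v * (B * L2_norm v)" by (rule mult_left_mono[OF B(3)[OF that]]) simp
  finally show ?thesis by (simp add: power2_eq_square mult_ac)
 qed
 with B(1) show thesis by (rule that)
qed

text \<open>Integration by parts in each pair of components; the term in which the derivative hits
  the transporting velocity adds up to the divergence and vanishes.\<close>

lemma smooth_transport:
 assumes psi: "psi \<in> Cinf_div" and ph: "periodic ph" "smooth ph"
 shows "L2_inner (%x. jacobian psi (at x) *v psi x) ph = - transport ph psi"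
proof -
 note ps = Cinf_divD(1,2)[OF psi]
 note c = smooth_continuous[OF smooth_pderiv_at] smooth_continuous
 let ?p = "%i x. psi x $ i" and ?f = "%i x. ph x $ i"
 have sm: "smooth (?p i)" "smooth (?f i)" for i using ps ph by (auto intro: smooth_nth)
 note cs = c(1)[OF sm(1)] c(1)[OF sm(2)] c(2)[OF sm(1)] c(2)[OF sm(2)]
 have pd: "pderiv_at j (?p i) x = pderiv_at j psi x $ i" "pderiv_at j (?f i) x = pderiv_at j ph x $ i" for i j x
  using ps ph by (auto simp: pderiv_at_nth smooth_differentiable)
 have d: "?p i differentiable (at x)" "?f i differentiable (at x)" for i x using sm by (auto intro: smooth_differentiable)
 have per: "periodic (?p i)" "periodic (?f i)" for i using ps ph by (auto simp: periodic_def)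
 have int: "integrable torus f ==> integrable torus f" for f :: "sfield" .
 have ibp: "(AV x. pderiv_at j (?p i) x * (?p j x * ?f i x)) =
   - (AV x. ?p i x * (?p j x * pderiv_at j (?f i) x + pderiv_at j (?p j) x * ?f i x))" for i j
 proof -
  have "pderiv_at j (%x. ?p j x * ?f i x) = (%x. ?p j x * pderiv_at j (?f i) x + pderiv_at j (?p j) x * ?f i x)"
   by (rule ext) (rule pderiv_at_mult[OF d])
  then show ?thesis
   using torus_integration_by_parts[of "?p i" j "%x. ?p j x * ?f i x"] d per cs
   by (simp add: periodic_def continuous_intros differentiable_mult)
 qed
 have "L2_inner (%x. jacobian psi (at x) *v psi x) ph =
  (AV x. (SU i. SU j. pderiv_at j (?p i) x * (?p j x * ?f i x)))"
  by (simp add: L2_inner_def inner_vec_def matrix_vector_mult_def jacobian_nth pd sum_distrib_right sum_distrib_left mult_ac)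
 also have "... = (SU i. SU j. AV x. pderiv_at j (?p i) x * (?p j x * ?f i x))"
  by (subst lint_sum, intro Bochner_Integration.integrable_sum torus_integrable continuous_intros cs)
    (subst lint_sum, intro torus_integrable continuous_intros cs, simp)
 also have "... = - (SU i. SU j. AV x. ?p i x * (?p j x * pderiv_at j (?f i) x + pderiv_at j (?p j) x * ?f i x))"
  by (simp only: ibp sum_negf)
 also have "(SU i. SU j. AV x. ?p i x * (?p j x * pderiv_at j (?f i) x + pderiv_at j (?p j) x * ?f i x))
  = (AV x. (SU i. SU j. ?p i x * (?p j x * pderiv_at j (?f i) x + pderiv_at j (?p j) x * ?f i x)))"
  by (subst lint_sum, intro Bochner_Integration.integrable_sum torus_integrable continuous_intros cs)
    (subst lint_sum, intro torus_integrable continuous_intros cs, simp)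
 also have "... = transport ph psi"
  unfolding transport_def L2_inner_def
 proof (rule lint_cong[OF refl])
  fix x
  have div: "(SU j. pderiv_at j (?p j) x) = 0"
   using Cinf_divD(3)[OF psi, of x] by (simp add: divergence_def pd)
  have "(SU i. SU j. ?p i x * (?p j x * pderiv_at j (?f i) x + pderiv_at j (?p j) x * ?f i x))
   = (SU i. SU j. ?p i x * ?p j x * pderiv_at j (?f i) x) + (SU i. ?p i x * ?f i x) * (SU j. pderiv_at j (?p j) x)"
   by (simp add: sum_3 algebra_simps)
  also have "... = (SU i. SU j. ?p i x * ?p j x * pderiv_at j (?f i) x)" by (simp add: div)
  also have "... = psi x \<bullet> (jacobian ph (at x) *v psi x)"
   by (simp add: inner_vec_def matrix_vector_mult_def jacobian_nth pd sum_distrib_left mult_ac)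
  finally show "(SU i. SU j. ?p i x * (?p j x * pderiv_at j (?f i) x + pderiv_at j (?p j) x * ?f i x))
   = psi x \<bullet> (jacobian ph (at x) *v psi x)" .
 qed
 finally show ?thesis .
qed

text \<open>Approximating in H^1, the left side converges by strong convergence of gradients and of
  outer products, the right side by strong convergence of the fields alone.\<close>

lemma H1_transport:
 assumes G: "has_H1_gradient v G" and ph: "periodic ph" "smooth ph"
 shows "L2_inner (%x. G x *v v x) ph = - transport ph v"
proof -
 obtain psi where psi: "!!n. psi n \<in> Cinf_div" "L2_tendsto psi v"
  "(%n. L2_norm (%x. jacobian (psi n) (at x) - G x)) \<longlonglongrightarrow> 0" and L: "v \<in> L2" "G \<in> L2"
  by (rule has_H1_gradientD[OF G]) blast
 obtain B where B: "B \<ge> 0" "!!v. v \<in> L2 ==> (%x. outer (ph x) (v x)) \<in> L2"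
  "!!v. v \<in> L2 ==> L2_norm (%x. outer (ph x) (v x)) <= B * L2_norm v"
  by (rule bounded_multipliers[OF ph]) blast
 note PL = Cinf_div_L2[OF psi(1)]
 have "(%n. L2_norm (%x. outer (ph x) (psi n x) - outer (ph x) (v x))) \<longlonglongrightarrow> 0"
 proof (rule tendsto_sandwich[OF _ _ tendsto_const tendsto_mult_right_zero[OF psi(2), of B]])
  show "\<forall>\<^sub>F n in sequentially. L2_norm (%x. outer (ph x) (psi n x) - outer (ph x) (v x)) <= B * L2_norm (%x. psi n x - v x)"
   using B(3)[OF L2_diff[OF PL(1) L(1)]] by (auto intro!: always_eventually simp: outer_diff)
 qed simp
 then have "(%n. L2_inner (jac (psi n)) (%x. outer (ph x) (psi n x))) \<longlonglongrightarrow> L2_inner G (%x. outer (ph x) (v x))"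
  by (intro L2_inner_tendsto2 PL L B(2) psi(3))
 moreover have "L2_inner G (%x. outer (ph x) (v x)) = L2_inner (%x. G x *v v x) ph"
  by (simp add: L2_inner_def inner_outer)
 moreover have "L2_inner (jac (psi n)) (%x. outer (ph x) (psi n x)) = - transport ph (psi n)" for n
  using smooth_transport[OF psi(1) ph, of n] by (simp add: L2_inner_def inner_outer)
 moreover have "(%n. - transport ph (psi n)) \<longlonglongrightarrow> - transport ph v"
  by (intro tendsto_minus transport_tendsto[OF ph PL(1) L(1) psi(2)])
 ultimately show ?thesis using LIMSEQ_unique by fastforce
qed

text \<open>Helmholtz orthogonality. It will force the Fourier coefficients of a solenoidal field to
  be orthogonal to their wave number.\<close>

lemma L2_div_orthogonal_gradient:
 fixes q :: "sfield"
 assumes q: "periodic q" "smooth q" and v: "v \<in> L2_div"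
 shows "L2_inner v (gradient q) = 0"
proof -
 have gr: "gradient q = (%x. \<chi> i. pderiv_at i q x)" by (simp add: gradient_def fun_eq_iff)
 have g: "gradient q \<in> L2"
  unfolding gr using periodic_pderiv_at[OF q(1) smooth_differentiable[OF q(2)]]
  by (intro L2_continuous continuous_intros smooth_continuous smooth_pderiv_at q) (auto simp: periodic_def)
 obtain ph where ph: "!!n. ph n \<in> Cinf_div" "L2_tendsto ph v"
  by (rule L2_div_approx[OF v]) blast
 have "L2_inner (ph n) (gradient q) = 0" for n
 proof -
  note ps = Cinf_divD(1,2)[OF ph(1), of n]
  have sm: "smooth (%x. ph n x $ i)" for i using ps by (auto intro: smooth_nth)
  note cs = smooth_continuous[OF smooth_pderiv_at[OF sm]] smooth_continuous[OF sm]
   smooth_continuous[OF smooth_pderiv_at[OF q(2)]] smooth_continuous[OF q(2)]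
  have "L2_inner (ph n) (gradient q) = (SU i. AV x. ph n x $ i * pderiv_at i q x)"
   unfolding L2_inner_def inner_vec_def gr
   by (subst lint_sum[symmetric], intro torus_integrable continuous_intros cs) simp
  also have "... = - (SU i. AV x. pderiv_at i (%x. ph n x $ i) x * q x)"
   unfolding sum_negf[symmetric]
  proof (rule sum.cong[OF refl])
   fix i
   have "(AV x. pderiv_at i (%x. ph n x $ i) x * q x) = - (AV x. ph n x $ i * pderiv_at i q x)"
    by (rule torus_integration_by_parts)
      (use ps q in \<open>auto intro!: smooth_differentiable sm cs simp: periodic_def\<close>)
   then show "(AV x. ph n x $ i * pderiv_at i q x) = - (AV x. pderiv_at i (%x. ph n x $ i) x * q x)" by simp
  qed
  also have "(SU i. AV x. pderiv_at i (%x. ph n x $ i) x * q x) = (AV x. (SU i. pderiv_at i (%x. ph n x $ i) x * q x))"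
   by (subst lint_sum, intro torus_integrable continuous_intros cs) simp
  also have "... = (AV x. divergence (ph n) x * q x)"
   using ps by (simp add: divergence_def pderiv_at_nth smooth_differentiable sum_distrib_right)
  finally show ?thesis using Cinf_divD(3)[OF ph(1)] by simp
 qed
 with L2_inner_tendsto[OF Cinf_div_L2(1)[OF ph(1)] L2_divD[OF v] g ph(2)]
 show "L2_inner v (gradient q) = 0" using LIMSEQ_unique[OF _ tendsto_const] by fastforce
qed

section \<open>The spatial correlation of a single field\<close>

definition correlation :: "vfield => sfield" where
 "correlation v h = L2_inner v (%x. v (x + h))"

lemma correlation_le: "v \<in> L2 ==> \<bar>correlation v h\<bar> <= (L2_norm v)^2"
 unfolding correlation_def
 using L2_inner_le[OF _ L2_shift, of v v h] L2_norm_shift[of v h] by (simp add: power2_eq_square)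

lemma correlation_0: "correlation v 0 = (L2_norm v)^2"
 by (simp add: correlation_def L2_inner_self)

lemma periodic_correlation: "v \<in> L2 ==> periodic (correlation v)"
 using L2D(1)[of v] by (simp add: periodic_def correlation_def add.assoc[symmetric])

text \<open>Differentiation along the segment from \<open>h'\<close> to \<open>h\<close> puts one
  gradient on the shifted factor, and Cauchy-Schwarz bounds the derivative uniformly. Only one norm
  of the gradient is spent, which later leaves half of the viscosity unspent.\<close>

lemma smooth_correlation_lipschitz:
 assumes psi: "periodic psi" "smooth psi"
 shows "\<bar>correlation psi h - correlation psi h'\<bar> <= norm (h - h') * (L2_norm psi * L2_norm (jac psi))"
proof -
 define d where "d = h - h'"
 have cj: "cts (jac psi)" and jL: "(jac psi) \<in> L2"
  by (rule smooth_jacobian_L2[OF psi])+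
 have cp: "cts psi" by (rule smooth_continuous[OF psi(2)])
 let ?F = "%s. integral (cbox 0 1) (%x. psi x \<bullet> psi (x + (h' + s *\<^sub>R d)))"
 let ?F' = "%s. integral (cbox 0 1) (%x. psi x \<bullet> (jacobian psi (at (x + (h' + s *\<^sub>R d))) *v d))"
 have D: "(?F has_real_derivative ?F' s) (at s within UNIV)" for s
 proof (rule leibniz_rule_field_derivative)
  fix t :: real and x :: "real^3"
  have "(psi has_derivative (%k. jacobian psi (at (x + (h' + t *\<^sub>R d))) *v k)) (at (x + (h' + t *\<^sub>R d)))"
   using smooth_differentiable[OF psi(2)] jacobian_works by blast
  then have "((%t. psi (x + (h' + t *\<^sub>R d))) has_derivative (%k. jacobian psi (at (x + (h' + t *\<^sub>R d))) *v (k *\<^sub>R d))) (at t within UNIV)"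
   by (rule has_derivative_compose[rotated, where f="%t. x + (h' + t *\<^sub>R d)"]) (auto intro!: derivative_eq_intros)
  then show "((%t. psi x \<bullet> psi (x + (h' + t *\<^sub>R d))) has_real_derivative psi x \<bullet> (jacobian psi (at (x + (h' + t *\<^sub>R d))) *v d)) (at t within UNIV)"
   unfolding has_field_derivative_def
   by (auto intro!: derivative_eq_intros simp: fun_eq_iff matrix_vector_mult_scaleR inner_commute)
 next
  show "continuous_on (UNIV \<times> cbox 0 1) (%(s, x). psi x \<bullet> (jacobian psi (at (x + (h' + s *\<^sub>R d))) *v d))"
   unfolding split_def matrix_vector_mult_def
   by (intro continuous_intros cts_compose[OF cp] cts_compose[OF cj]) auto
  show "(%x. psi x \<bullet> psi (x + (h' + s *\<^sub>R d))) integrable_on cbox 0 1" for s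
   by (intro integrable_continuous continuous_intros cts_compose[OF cp]) auto
 qed auto
 have F: "?F s = correlation psi (h' + s *\<^sub>R d)" for s
  unfolding correlation_def L2_inner_def
  by (rule integral_torus_cbox[symmetric]) (intro continuous_intros cts_compose[OF cp], auto)
 have F': "\<bar>?F' s\<bar> <= L2_norm psi * (norm d * L2_norm (jac psi))" for s
 proof -
  let ?w = "%x. jacobian psi (at (x + (h' + s *\<^sub>R d))) *v d"
  note sh = L2_shift[OF jL, of "h' + s *\<^sub>R d"] L2_norm_shift[OF jL, of "h' + s *\<^sub>R d"]
  have c: "cts ?w"
   unfolding matrix_vector_mult_def
   by (intro continuous_intros cts_compose[OF cj]) auto
  have pw: "periodic ?w" using L2D(1)[OF sh(1)] by (simp add: periodic_def)
  have w: "?w \<in> L2" "L2_norm ?w <= norm d * L2_norm (%x. jacobian psi (at (x + (h' + s *\<^sub>R d))))"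
   by (rule L2_norm_mono[OF cts_measurable[OF c] pw sh(1) _ norm_ge_zero],
     subst mult.commute, rule norm_matrix_vector_le)+
  have "?F' s = L2_inner psi ?w"
   unfolding L2_inner_def by (rule integral_torus_cbox[symmetric]) (intro continuous_intros c cp)
  also have "\<bar>\<dots>\<bar> <= L2_norm psi * L2_norm ?w" by (rule L2_inner_le[OF smooth_L2[OF psi] w(1)])
  also have "... <= L2_norm psi * (norm d * L2_norm (jac psi))"
   using w(2) sh(2) by (intro mult_left_mono) auto
  finally show ?thesis .
 qed
 have "norm (?F 1 - ?F 0) <= L2_norm psi * (norm d * L2_norm (jac psi)) * norm (1 - 0 :: real)"
  by (rule field_differentiable_bound[OF convex_UNIV D]) (use F' in auto)
 then show ?thesis unfolding F by (simp add: d_def mult_ac)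
qed

lemma correlation_tendsto:
 assumes w: "!!n. w n \<in> L2" "v \<in> L2" "L2_tendsto w v"
 shows "(%n. correlation (w n) h) \<longlonglongrightarrow> correlation v h"
 unfolding correlation_def
 using L2_norm_shift[OF L2_diff[OF w(1,2)], where h=h] w(3)
 by (intro L2_inner_tendsto2 w L2_shift) simp

lemma correlation_lipschitz:
 assumes G: "has_H1_gradient v G"
 shows "\<bar>correlation v h - correlation v h'\<bar> <= norm (h - h') * (L2_norm v * L2_norm G)"
proof -
 obtain psi where psi: "!!n. psi n \<in> Cinf_div" "L2_tendsto psi v"
  "(%n. L2_norm (%x. jacobian (psi n) (at x) - G x)) \<longlonglongrightarrow> 0" and L: "v \<in> L2" "G \<in> L2"
  by (rule has_H1_gradientD[OF G]) blast
 note PL = Cinf_div_L2[OF psi(1)]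
 show ?thesis
 proof (rule LIMSEQ_le)
  show "(%n. \<bar>correlation (psi n) h - correlation (psi n) h'\<bar>) \<longlonglongrightarrow> \<bar>correlation v h - correlation v h'\<bar>"
   by (intro tendsto_intros correlation_tendsto PL L psi)
  show "(%n. norm (h - h') * (L2_norm (psi n) * L2_norm (jac (psi n)))) \<longlonglongrightarrow> norm (h - h') * (L2_norm v * L2_norm G)"
   by (intro tendsto_intros L2_norm_tendsto PL L psi)
  show "\<exists>N. \<forall>n\<ge>N. \<bar>correlation (psi n) h - correlation (psi n) h'\<bar> <= norm (h - h') * (L2_norm (psi n) * L2_norm (jac (psi n)))"
   using smooth_correlation_lipschitz Cinf_divD[OF psi(1)] by blast
 qed
qed

section \<open>The Gagliardo--Nirenberg inequality in $L^3$\<close>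

abbreviation unit_interval :: "real measure" where
 "unit_interval \<equiv> restrict_space lborel {0..1}"

interpretation unit_interval: prob_space unit_interval
 by standard (simp add: space_restrict_space emeasure_restrict_space)

lemma measurable_unit_interval_ident: "(%x. x) \<in> unit_interval \<rightarrow>\<^sub>M borel"
 by (rule measurable_restrict_space1) measurable

lemma integral_unit_interval:
 fixes f :: "real => real"
 assumes "cts f"
 shows "(LINT x|unit_interval. f x) = integral {0..1} f" "integrable unit_interval f"
proof -
 have si: "set_integrable lborel {0..1} f"
  unfolding set_integrable_def
  by (rule borel_integrable_compact[OF compact_Icc continuous_on_subset[OF assms]]) simp
 then show "integrable unit_interval f"
  by (simp add: set_integrable_def integrable_restrict_space)
 show "(LINT x|unit_interval. f x) = integral {0..1} f"
  using set_borel_integral_eq_integral[OF si] unfolding set_lebesgue_integral_def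
  by (subst integral_restrict_space) auto
qed

text \<open>For periodic \<open>f\<close> this is the mean over a closed line of the torus and no
  longer depends on the coordinate \<open>i\<close>. It is kept as a function of all three
  coordinates so that averages in different directions can be multiplied and iterated.\<close>

definition avg :: "3 => (real^3 => real) => sfield" where
 "avg i f x = integral {0..1} (%s. f (x + s *\<^sub>R axis i 1))"

lemma continuous_avg: "cts f ==> cts (avg i f)"
 unfolding avg_def cbox_interval[symmetric]
 by (intro integral_continuous_on_param)
   (auto simp: split_def intro!: continuous_intros elim: cts_compose)

lemma periodic_avg:
 assumes "periodic f"
 shows "periodic (avg i f)"
proof -
 have "f (x + k + s *\<^sub>R axis i 1) = f (x + s *\<^sub>R axis i 1)" if "k \<in> lattice" for x k s
  using periodicD[OF assms that, of "x + s *\<^sub>R axis i 1"] by (simp add: ac_simps)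
 then show ?thesis by (simp add: periodic_def avg_def)
qed

lemma continuous_on_line:
 fixes f :: "real^3 => 'b::topological_space"
 shows "cts f ==> continuous_on S (%s. f (x + s *\<^sub>R axis i 1))"
 by (rule cts_compose[where g=f and t=UNIV]) (auto intro!: continuous_intros)

lemma avg_nonneg: "(!!x. 0 <= f x) ==> 0 <= avg i f x"
 unfolding avg_def
 by (cases "(%s. f (x + s *\<^sub>R axis i 1)) integrable_on {0..1}")
   (auto intro: Henstock_Kurzweil_Integration.integral_nonneg simp: not_integrable_integral)

lemma avg_Cauchy_Schwarz:
 assumes f: "cts f" and g: "cts g"
 shows "avg i (%x. f x * g x) x <= sqrt (avg i (%x. (f x)^2) x) * sqrt (avg i (%x. (g x)^2) x)"
proof -
 let ?f = "%s. f (x + s *\<^sub>R axis i 1)" and ?g = "%s. g (x + s *\<^sub>R axis i 1)"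
 have c: "cts (%s. ?f s * ?g s)" "cts (%s. (?f s)^2)" "cts (%s. (?g s)^2)"
  by (intro continuous_intros continuous_on_line f g)+
 have "?f \<in> borel_measurable unit_interval" "?g \<in> borel_measurable unit_interval"
  by (intro measurable_compose[OF measurable_unit_interval_ident] cts_measurable continuous_on_line f g)+
 from integral_Cauchy_Schwarz[OF this] show ?thesis
  by (simp add: avg_def integral_unit_interval[OF c(1)] integral_unit_interval[OF c(2)] integral_unit_interval[OF c(3)] abs_le_iff)
qed

lemma avg_shift:
 assumes f: "cts f" and p: "periodic f" and t: "t \<in> {0..1}"
 shows "avg i f (x + t *\<^sub>R axis i 1) = avg i f x"
proof -
 let ?g = "%s. f (x + s *\<^sub>R axis i 1)"
 have I: "?g integrable_on {a..b}" for a b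
  by (rule integrable_continuous_interval[OF continuous_on_line[OF f]])
 have "axis i 1 \<in> lattice" by (simp add: lattice_def axis_def)
 then have per: "?g (1 + s) = ?g s" for s
  using periodicD[OF p, of "axis i 1" "x + s *\<^sub>R axis i 1"] by (simp add: algebra_simps)
 have "avg i f (x + t *\<^sub>R axis i 1) = integral {0..1} (?g \<circ> (+) t)"
  by (simp add: avg_def o_def algebra_simps)
 also have "... = integral {t..1+t} ?g"
  by (simp only: integral_shift_Icc_real add_0)
 also have "... = integral {t..1} ?g + integral {1..1+t} ?g"
  using t by (intro Henstock_Kurzweil_Integration.integral_combine[symmetric] I) auto
 also have "integral {1..1+t} ?g = integral {0..t} (?g \<circ> (+) 1)"
  by (simp only: integral_shift_Icc_real add_0 add.commute[of t 1])
 also have "... = integral {0..t} ?g" by (simp only: o_def per)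
 also have "integral {t..1} ?g + \<dots> = integral {0..1} ?g"
  using t by (subst add.commute) (intro Henstock_Kurzweil_Integration.integral_combine I; simp)
 finally show ?thesis by (simp add: avg_def)
qed

lemma avg_invariant:
 assumes "!!x. f (x + t *\<^sub>R axis j 1) = f x"
 shows "avg i f (x + t *\<^sub>R axis j 1) = avg i f x"
proof -
 have "f (x + t *\<^sub>R axis j 1 + s *\<^sub>R axis i 1) = f (x + s *\<^sub>R axis i 1)" for s
  using assms[of "x + s *\<^sub>R axis i 1"] by (simp add: ac_simps)
 then show ?thesis by (simp add: avg_def)
qed

lemma integral_avg:
 assumes f: "cts f" and p: "periodic f"
 shows "(AV x. avg i f x) = (AV x. f x)"
proof -
 have "(AV x. avg i f x) = integral (cbox 0 1) (%x. integral (cbox 0 1) (%s. f (x + s *\<^sub>R axis i 1)))"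
  unfolding integral_torus_cbox[OF continuous_avg[OF f]] by (simp add: avg_def[abs_def])
 also have "... = integral (cbox 0 1) (%s. integral (cbox 0 1) (%x. f (x + s *\<^sub>R axis i 1)))"
  by (rule integral_swap_continuous) (auto simp: split_def intro!: cts_compose[OF f] continuous_intros)
 also have "... = integral {0..1::real} (%s. AV x. f x)"
  using integral_torus_shift[OF cts_measurable[OF f] p] f
  by (subst integral_torus_cbox[symmetric]) (auto intro!: cts_compose[OF f] continuous_intros)
 finally show ?thesis by simp
qed

text \<open>Averaging in direction \<open>i\<close> before integrating over the torus pulls out the
  invariant factor and leaves a one-dimensional Cauchy-Schwarz inequality for the other two.\<close>

lemma integral_avg_le:
 assumes c: "cts f" "cts g" "cts h"
  and p: "periodic f" "periodic g" "periodic h"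
  and f: "!!x. 0 <= f x" "!!x t. t \<in> {0..1} ==> f (x + t *\<^sub>R axis i 1) = f x"
 shows "(AV x. f x * (g x * h x))
  <= (AV x. f x * (sqrt (avg i (%x. (g x)^2) x) * sqrt (avg i (%x. (h x)^2) x)))"
proof -
 have gh: "cts (%x. g x * h x)" by (intro continuous_intros c)
 have "(AV x. f x * (g x * h x)) = (AV x. avg i (%x. f x * (g x * h x)) x)"
  using p by (intro integral_avg[symmetric] continuous_intros c) (simp add: periodic_def)
 also have "... = (AV x. f x * avg i (%x. g x * h x) x)"
 proof (rule lint_cong[OF refl])
  fix x
  show "avg i (%x. f x * (g x * h x)) x = f x * avg i (%x. g x * h x) x"
   unfolding avg_def integral_mult_right[symmetric]
   by (rule Henstock_Kurzweil_Integration.integral_cong) (simp add: f(2))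
 qed
 also have "... <= (AV x. f x * (sqrt (avg i (%x. (g x)^2) x) * sqrt (avg i (%x. (h x)^2) x)))"
  by (intro integral_mono torus_integrable continuous_intros c continuous_avg gh
    mult_left_mono avg_Cauchy_Schwarz f)
 finally show ?thesis .
qed

text \<open>The Loomis--Whitney inequality, for functions that do not depend on one of the coordinates
 because they are averages in that direction.\<close>

lemma Loomis_Whitney:
 assumes k: "cts k" "periodic k" "!!x. 0 <= k x"
 shows "(AV x. sqrt (avg 1 k x) * (sqrt (avg 2 k x) * sqrt (avg 3 k x)))^2 <= (AV x. k x) ^ 3"
proof -
 let ?I = "AV x. k x"
 note c = continuous_avg[OF k(1)] and p = periodic_avg[OF k(2)] and nn = avg_nonneg[OF k(3)]
 note c2 = continuous_avg[OF c] and p2 = periodic_avg[OF p] and nn2 = avg_nonneg[OF nn]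
 note c3 = continuous_avg[OF c2] and p3 = periodic_avg[OF p2] and nn3 = avg_nonneg[OF nn2]
 have I: "(AV x. avg i k x) = ?I" "(AV x. avg j (avg i k) x) = ?I"
  "(AV x. avg l (avg j (avg i k)) x) = ?I" for i j l
  using integral_avg[OF c2 p2] integral_avg[OF c p] integral_avg[OF k(1,2)] by simp_all
 have ps: "periodic (%x. sqrt (f x))" if "periodic f" for f using that by (simp add: periodic_def)
 have cs: "cts (%x. sqrt (f x))" if "cts f" for f
  using that by (intro continuous_intros)
 \<comment> \<open>Averaged in all three directions, hence constant on the torus and equal to the
   integral of \<open>k\<close>.\<close>
 let ?K = "avg 2 (avg 1 (avg 3 k))"
 have K: "?K x = ?I" if x: "x \<in> space torus" for x
 proof -
  have *: "?K y = ?K 0" if "y \<in> space torus" for y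
  proof -
   have y: "y $ i \<in> {0..1}" for i using that by (auto simp: space_torus mem_box_cart)
   have "y = 0 + y$1 *\<^sub>R axis 1 1 + y$3 *\<^sub>R axis 3 1 + y$2 *\<^sub>R axis 2 1"
    by (simp add: vec_eq_iff forall_3 axis_def)
   then have "?K y = ?K (0 + y$1 *\<^sub>R axis 1 1 + y$3 *\<^sub>R axis 3 1 + y$2 *\<^sub>R axis 2 1)" by simp
   also have "... = ?K (0 + y$1 *\<^sub>R axis 1 1 + y$3 *\<^sub>R axis 3 1)" by (rule avg_shift[OF c2 p2 y])
   also have "... = ?K (0 + y$1 *\<^sub>R axis 1 1)" by (intro avg_invariant avg_shift[OF k(1,2) y])
   also have "... = ?K 0" by (intro avg_invariant avg_shift[OF c p y])
   finally show ?thesis .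
  qed
  have "?I = (AV y. ?K 0)"
   unfolding I(3)[of 2 1 3, symmetric] by (rule lint_cong) (use * in auto)
  then show ?thesis using *[OF x] torus.prob_space by simp
 qed
 have inv: "avg i (avg j k) (x + t *\<^sub>R axis j 1) = avg i (avg j k) x" if "t \<in> {0..1}" for i j t x
  by (intro avg_invariant avg_shift[OF k(1,2) that])
 \<comment> \<open>Direction 1 is averaged first, which leaves its own factor unchanged; then
   direction 2, with the factor already free of it pulled out. What remains is a product of two
   functions of integral \<open>?I\<close> and a constant.\<close>
 have "(AV x. sqrt (avg 1 k x) * (sqrt (avg 2 k x) * sqrt (avg 3 k x)))
  <= (AV x. sqrt (avg 1 k x) * (sqrt (avg 1 (avg 2 k) x) * sqrt (avg 1 (avg 3 k) x)))"
  using integral_avg_le[OF cs[OF c] cs[OF c] cs[OF c] ps[OF p] ps[OF p] ps[OF p], of 1 1 2 3]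
  by (simp add: nn avg_shift[OF k(1,2)])
 also have "... = (AV x. sqrt (avg 1 (avg 2 k) x) * (sqrt (avg 1 k x) * sqrt (avg 1 (avg 3 k) x)))"
  by (simp add: mult_ac)
 also have "... <= (AV x. sqrt (avg 1 (avg 2 k) x) * (sqrt (avg 2 (avg 1 k) x) * sqrt (?K x)))"
  using integral_avg_le[OF cs[OF c2] cs[OF c] cs[OF c2] ps[OF p2] ps[OF p] ps[OF p2], of 1 2 2 1 1 3]
  by (simp add: nn nn2 inv)
 also have "... = (AV x. sqrt (avg 1 (avg 2 k) x) * sqrt (avg 2 (avg 1 k) x) * sqrt ?I)"
  by (rule lint_cong) (simp_all add: K)
 also have "... = (AV x. sqrt (avg 1 (avg 2 k) x) * sqrt (avg 2 (avg 1 k) x)) * sqrt ?I"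
  by simp
 also have "... <= (sqrt ?I * sqrt ?I) * sqrt ?I"
 proof (rule mult_right_mono)
  have "\<bar>AV x. sqrt (avg 1 (avg 2 k) x) * sqrt (avg 2 (avg 1 k) x)\<bar>
   <= sqrt (AV x. (sqrt (avg 1 (avg 2 k) x))^2) * sqrt (AV x. (sqrt (avg 2 (avg 1 k) x))^2)"
   by (intro integral_Cauchy_Schwarz measurable_torusI cts_measurable torus_integrable continuous_intros cs c2)
  then show "(AV x. sqrt (avg 1 (avg 2 k) x) * sqrt (avg 2 (avg 1 k) x)) <= sqrt ?I * sqrt ?I"
   by (simp add: nn2 I abs_le_iff del: real_sqrt_mult_self)
 qed (use k in simp)
 finally have "(AV x. sqrt (avg 1 k x) * (sqrt (avg 2 k x) * sqrt (avg 3 k x)))^2 <= (sqrt ?I * sqrt ?I * sqrt ?I)^2"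
  using nn by (intro power_mono) auto
 then show ?thesis using k(3) by (simp add: power_mult_distrib power3_eq_cube del: real_sqrt_mult_self)
qed

text \<open>The one-dimensional Sobolev bound: the value at the end point exceeds the value at
  \<open>s\<close> by at most the total variation, and averaging over \<open>s\<close> in the unit
  interval removes the choice of \<open>s\<close>.\<close>

lemma le_integral_unit_interval:
 fixes g g' d :: "real => real"
 assumes g: "!!s. (g has_real_derivative g' s) (at s)" and g': "!!s. \<bar>g' s\<bar> <= d s"
  and cd: "cts d"
 shows "g 0 <= integral {0..1} (%s. g s + d s)"
proof -
 have di: "d integrable_on {a..b}" for a b
  by (rule integrable_continuous_interval[OF continuous_on_subset[OF cd]]) simp
 have "continuous_on {0..1} g"
  using g by (meson DERIV_isCont continuous_at_imp_continuous_on)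
 then have gi: "g integrable_on {0..1}" by (rule integrable_continuous_interval)
 have pt: "g 0 <= g s + integral {0..1} d" if s: "s \<in> {0..1}" for s
 proof -
  have h: "(g' has_integral (g s - g 0)) {0..s}"
   using g s by (intro fundamental_theorem_of_calculus)
    (auto simp: has_real_derivative_iff_has_vector_derivative[symmetric] intro: has_field_derivative_at_within)
  have "\<bar>g s - g 0\<bar> = norm (integral {0..s} g')" using h by (simp add: integral_unique)
  also have "... <= integral {0..s} d"
   using h g' di by (intro integral_norm_bound_integral) auto
  also have "... <= integral {0..1} d"
   using s di order_trans[OF abs_ge_zero g'] by (intro integral_subset_le) auto
  finally show ?thesis by linarith
 qed
 have "integral {0..1::real} (%s. g 0) <= integral {0..1} (%s. g s + integral {0..1} d)"
  using gi pt by (intro integral_le integrable_add) auto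
 then show ?thesis using gi di by (simp add: Henstock_Kurzweil_Integration.integral_add integrable_const_ivl)
qed

lemma norm_pderiv_at_le_jacobian: "norm (pderiv_at i ph x) <= norm (jacobian ph (at (x::real^3)) :: real^3^3)"
proof (rule power2_le_imp_le)
 have "(norm (pderiv_at i ph x))^2 = (SU j. (pderiv_at i ph x $ j)^2)" by (rule norm_sq_eq_sum)
 also have "... <= (SU j. (norm (jacobian ph (at x) $ j))^2)"
  unfolding norm_sq_eq_sum jacobian_nth
  by (intro sum_mono) (rule member_le_sum[of i UNIV "%k. (pderiv_at k ph x $ _)^2"], auto)
 also have "... = (norm (jacobian ph (at x)))^2"
  by (simp add: norm_vec_def[of "jacobian ph (at x)"] L2_set_def sum_nonneg)
 finally show "(norm (pderiv_at i ph x))^2 <= (norm (jacobian ph (at x)))^2" .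
qed simp

lemma norm_L2:
 fixes v :: "real^3 => 'b::{real_inner, second_countable_topology}"
 assumes "v \<in> L2"
 shows "(%x. norm (v x)) \<in> L2" "L2_norm (%x. norm (v x)) = L2_norm v"
 using assms by (auto simp: L2_def L2_norm_def periodic_def)

text \<open>Gagliardo's argument. The function \<open>k\<close> dominates |ph|^2 after averaging
  along each of the three axes, so |ph|^3 is at most the product of the three square roots in the
  Loomis-Whitney inequality.\<close>

lemma smooth_L3_bound:
 fixes ph :: vfield
 assumes ph: "periodic ph" "smooth ph"
 shows "(AV x. norm (ph x) ^ 3)^2
  <= ((L2_norm ph)^2 + 2 * L2_norm ph * L2_norm (jac ph)) ^ 3"
proof -
 define k where "k x = (norm (ph x))^2 + 2 * (norm (ph x) * norm (jacobian ph (at x)))" for x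
 have cp: "continuous_on S ph" for S by (rule smooth_continuous[OF ph(2)])
 have jL: "(jac ph) \<in> L2" and cj: "cts (jac ph)"
  by (rule smooth_jacobian_L2[OF ph])+
 have pL: "ph \<in> L2" by (rule smooth_L2[OF ph])
 have ck: "cts k" unfolding k_def by (intro continuous_intros cp cj)
 have perk: "periodic k" using ph(1) L2D(1)[OF jL] by (simp add: periodic_def k_def)
 have k0: "0 <= k x" for x by (simp add: k_def)
 have line: "norm (ph x) <= sqrt (avg i k x)" for x i
 proof -
  let ?y = "%s. x + s *\<^sub>R axis i 1"
  have der: "((%s. (norm (ph (?y s)))^2) has_real_derivative 2 * (ph (?y s) \<bullet> pderiv_at i ph (?y s))) (at s)" for s
  proof -
   have "(ph has_derivative frechet_derivative ph (at (?y s))) (at (?y s))"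
    using smooth_differentiable[OF ph(2)] by (simp add: frechet_derivative_works[symmetric])
   then have "((%s. ph (?y s)) has_derivative (%r. frechet_derivative ph (at (?y s)) (r *\<^sub>R axis i 1))) (at s)"
    by (rule has_derivative_compose[rotated, where f="?y"]) (auto intro!: derivative_eq_intros)
   moreover have "frechet_derivative ph (at (?y s)) (r *\<^sub>R axis i 1) = r *\<^sub>R pderiv_at i ph (?y s)" for r
    using linear_frechet_derivative[OF smooth_differentiable[OF ph(2)]] by (simp add: pderiv_at_def linear_scale)
   ultimately show ?thesis
    unfolding has_field_derivative_def power2_norm_eq_inner
    by (auto intro!: derivative_eq_intros simp: fun_eq_iff inner_commute algebra_simps)
  qed
  have "(norm (ph (?y 0)))^2 <= integral {0..1} (%s. (norm (ph (?y s)))^2 + 2 * (norm (ph (?y s)) * norm (jacobian ph (at (?y s)))))"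
  proof (rule le_integral_unit_interval[OF der])
   fix s
   have "\<bar>ph (?y s) \<bullet> pderiv_at i ph (?y s)\<bar> <= norm (ph (?y s)) * norm (pderiv_at i ph (?y s))"
    by (rule Cauchy_Schwarz_ineq2)
   also have "... <= norm (ph (?y s)) * norm (jacobian ph (at (?y s)))"
    by (intro mult_left_mono norm_pderiv_at_le_jacobian) simp
   finally show "\<bar>2 * (ph (?y s) \<bullet> pderiv_at i ph (?y s))\<bar> <= 2 * (norm (ph (?y s)) * norm (jacobian ph (at (?y s))))"
    by (simp add: abs_mult)
  qed (intro continuous_intros continuous_on_line[OF cp] continuous_on_line[OF cj])
  then show ?thesis by (intro real_le_rsqrt) (simp add: avg_def k_def)
 qed
 have "(AV x. norm (ph x) ^ 3) <= (AV x. sqrt (avg 1 k x) * (sqrt (avg 2 k x) * sqrt (avg 3 k x)))"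
 proof (rule integral_mono)
  fix x
  have "norm (ph x) * (norm (ph x) * norm (ph x)) <= sqrt (avg 1 k x) * (sqrt (avg 2 k x) * sqrt (avg 3 k x))"
   by (intro mult_mono line) (auto intro!: mult_nonneg_nonneg avg_nonneg k0)
  then show "norm (ph x) ^ 3 <= sqrt (avg 1 k x) * (sqrt (avg 2 k x) * sqrt (avg 3 k x))"
   by (simp add: power3_eq_cube mult.assoc)
 qed (intro torus_integrable continuous_intros cp continuous_avg ck)+
 then have "(AV x. norm (ph x) ^ 3)^2 <= (AV x. sqrt (avg 1 k x) * (sqrt (avg 2 k x) * sqrt (avg 3 k x)))^2"
  by (intro power_mono) auto
 also have "... <= (AV x. k x) ^ 3" by (rule Loomis_Whitney[OF ck perk k0])
 also have "(AV x. k x) = (L2_norm ph)^2 + 2 * (AV x. norm (ph x) * norm (jacobian ph (at x)))"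
  unfolding k_def L2_norm_sq using L2D(3)[OF pL] L2_norm_mult_integrable[OF norm_L2(1)[OF pL] norm_L2(1)[OF jL]] by simp
 also have "... ^ 3 <= ((L2_norm ph)^2 + 2 * (L2_norm ph * L2_norm (jac ph))) ^ 3"
  using L2_norm_mult_le[OF norm_L2(1)[OF pL] norm_L2(1)[OF jL]] by (intro power_mono add_mono mult_left_mono) (auto simp: norm_L2[OF pL] norm_L2[OF jL])
 finally show ?thesis by (simp add: mult.assoc)
qed

lemma borel_measurable_vec_nth [measurable (raw)]:
 fixes f :: "'a => real^'n"
 assumes "f \<in> borel_measurable M"
 shows "(%x. f x $ i) \<in> borel_measurable M"
 by (rule borel_measurable_continuous_on[OF _ assms]) (intro continuous_intros)

text \<open>The bound for smooth fields passes to \<open>v\<close> by Fatou's lemma along a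
  subsequence of the H^1 approximants that converges almost everywhere.\<close>

lemma H1_L3:
 assumes G: "has_H1_gradient v G"
 shows "integrable torus (%x. norm (v x) ^ 3)"
  and "(AV x. norm (v x) ^ 3)^2 <= ((L2_norm v)^2 + 2 * L2_norm v * L2_norm G) ^ 3"
proof -
 obtain ph where ph: "!!n. ph n \<in> Cinf_div" "L2_tendsto ph v"
  "(%n. L2_norm (%x. jacobian (ph n) (at x) - G x)) \<longlonglongrightarrow> 0" and L: "v \<in> L2" "G \<in> L2"
  by (rule has_H1_gradientD[OF G]) blast
 note PL = Cinf_div_L2[OF ph(1)]
 obtain r where r: "strict_mono r" "AE x in torus. (%n. ph (r n) x) \<longlonglongrightarrow> v x"
  by (rule L2_convergent_AE_subseq[OF PL(1) L(1) ph(2)]) blast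
 note [measurable] = L2D(2)[OF L(1)] L2D(2)[OF PL(1)]
 define c where "c n = ((L2_norm (ph n))^2 + 2 * L2_norm (ph n) * L2_norm (jac (ph n))) ^ 3" for n
 define C where "C = ((L2_norm v)^2 + 2 * L2_norm v * L2_norm G) ^ 3"
 have C0: "0 <= C" by (simp add: C_def)
 have "c \<longlonglongrightarrow> C"
  unfolding c_def[abs_def] C_def
  by (intro tendsto_intros L2_norm_tendsto[OF PL(1) L(1) ph(2)] L2_norm_tendsto[OF PL(2) L(2) ph(3)])
 then have lim: "(%n. ennreal (sqrt (c (r n)))) \<longlonglongrightarrow> ennreal (sqrt C)"
  by (intro tendsto_intros LIMSEQ_subseq_LIMSEQ[OF _ r(1), unfolded o_def])
 have mt [measurable]: "(%x. ennreal (norm (ph (r n) x) ^ 3)) \<in> borel_measurable torus" for n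
  by (rule measurable_torusI) measurable
 have mt' [measurable]: "(%x. norm (v x) ^ 3) \<in> borel_measurable torus"
  by (rule measurable_torusI) measurable
 have le: "(\<integral>\<^sup>+x. ennreal (norm (ph n x) ^ 3) \<partial>torus) <= ennreal (sqrt (c n))" for n
 proof -
  have sm: "periodic (ph n)" "smooth (ph n)" using Cinf_divD[OF ph(1)] by auto
  have i: "integrable torus (%x. norm (ph n x) ^ 3)"
   by (intro torus_integrable continuous_intros smooth_continuous[OF sm(2)])
  have "(\<integral>\<^sup>+x. ennreal (norm (ph n x) ^ 3) \<partial>torus) = ennreal (AV x. norm (ph n x) ^ 3)"
   using i by (rule nn_integral_eq_integral) simp
  also have "... <= ennreal (sqrt (c n))"
   using smooth_L3_bound[OF sm] unfolding c_def[symmetric] by (intro ennreal_leI real_le_rsqrt)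
  finally show ?thesis .
 qed
 have "(\<integral>\<^sup>+x. ennreal (norm (v x) ^ 3) \<partial>torus) = (\<integral>\<^sup>+x. liminf (%n. ennreal (norm (ph (r n) x) ^ 3)) \<partial>torus)"
 proof (rule nn_integral_cong_AE)
  show "AE x in torus. ennreal (norm (v x) ^ 3) = liminf (%n. ennreal (norm (ph (r n) x) ^ 3))"
   using r(2) by eventually_elim (intro lim_imp_Liminf[symmetric] tendsto_intros; simp)
 qed
 also have "... <= liminf (%n. \<integral>\<^sup>+x. ennreal (norm (ph (r n) x) ^ 3) \<partial>torus)"
  by (rule nn_integral_liminf) measurable
 also have "... <= liminf (%n. ennreal (sqrt (c (r n))))"
  by (intro Liminf_mono always_eventually allI le)
 also have "... = ennreal (sqrt C)" using lim by (intro lim_imp_Liminf) simp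
 finally have le: "(\<integral>\<^sup>+x. ennreal (norm (v x) ^ 3) \<partial>torus) <= ennreal (sqrt C)" .
 then show i: "integrable torus (%x. norm (v x) ^ 3)"
  by (intro integrableI_bounded mt') (auto intro: le_less_trans)
 have "(AV x. norm (v x) ^ 3) <= sqrt C"
  using le i C0 by (subst (asm) nn_integral_eq_integral) auto
 then have "(AV x. norm (v x) ^ 3)^2 <= (sqrt C)^2"
  by (intro power_mono integral_nonneg_AE) auto
 then show "(AV x. norm (v x) ^ 3)^2 <= ((L2_norm v)^2 + 2 * L2_norm v * L2_norm G) ^ 3"
  using C0 by (simp add: C_def)
qed

text \<open>The L^3 bound applied to the differences from \<open>v\<close>, whose L^2 norm and
  gradient norm both tend to zero.\<close>

lemma H1_L3_approx:
 assumes G: "has_H1_gradient v G"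
 obtains ph where "!!n. ph n \<in> Cinf_div" "L2_tendsto ph v"
  "!!n. integrable torus (%x. norm (ph n x - v x) ^ 3)" "(%n. AV x. norm (ph n x - v x) ^ 3) \<longlonglongrightarrow> 0"
proof -
 obtain ph where ph: "!!n. ph n \<in> Cinf_div" "L2_tendsto ph v"
  "(%n. L2_norm (%x. jacobian (ph n) (at x) - G x)) \<longlonglongrightarrow> 0" and L: "v \<in> L2" "G \<in> L2"
  by (rule has_H1_gradientD[OF G]) blast
 let ?a = "%n. L2_norm (%x. ph n x - v x)" and ?b = "%n. L2_norm (%x. jacobian (ph n) (at x) - G x)"
 have d: "has_H1_gradient (%x. ph n x - v x) (%x. jacobian (ph n) (at x) - G x)" for n
  by (rule has_H1_gradient_diff[OF has_H1_gradient_Cinf_div[OF ph(1)] G])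
 have "(%n. ((?a n)^2 + 2 * ?a n * ?b n) ^ 3) \<longlonglongrightarrow> (0^2 + 2 * 0 * 0) ^ 3"
  by (intro tendsto_intros ph)
 then have lim: "(%n. sqrt (((?a n)^2 + 2 * ?a n * ?b n) ^ 3)) \<longlonglongrightarrow> 0"
  using tendsto_real_sqrt by fastforce
 have "(%n. AV x. norm (ph n x - v x) ^ 3) \<longlonglongrightarrow> 0"
  by (rule tendsto_sandwich[OF _ _ tendsto_const lim])
    (auto intro!: always_eventually real_le_rsqrt H1_L3[OF d] integral_nonneg_AE)
 with ph(1,2) H1_L3(1)[OF d] show thesis by (intro that)
qed

section \<open>The third-order structure tensor\<close>

definition structure_tensor :: "vfield => 3 => 3 => 3 => sfield" where
 "structure_tensor v i j l h =
   (AV x. increment h v x $ i * increment h v x $ j * increment h v x $ l)"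

lemma norm_cube_triangle: "norm (a - b) ^ 3 <= 4 * (norm a ^ 3 + norm (b::'a::real_normed_vector) ^ 3)"
proof -
 have "norm (a - b) ^ 3 <= (norm a + norm b) ^ 3" by (intro power_mono norm_triangle_ineq4) simp
 also have "... <= 4 * (norm a ^ 3 + norm b ^ 3)"
 proof -
  \<comment> \<open>Convexity of the cube made explicit: this product is the difference of the two
    sides.\<close>
  have "0 <= 3 * ((norm a + norm b) * (norm a - norm b)^2)" by simp
  also have "... = 4 * (norm a ^ 3 + norm b ^ 3) - (norm a + norm b) ^ 3"
   by (simp add: power3_eq_cube power2_eq_square algebra_simps)
  finally show ?thesis by simp
 qed
 finally show ?thesis .
qed

lemma
 assumes v: "v \<in> L2" and i: "integrable torus (%x. norm (v x) ^ 3)"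
 shows increment_L3: "integrable torus (%x. norm (increment h v x) ^ 3)"
  and increment_L3_le: "(AV x. norm (increment h v x) ^ 3) <= 8 * (AV x. norm (v x) ^ 3)"
proof -
 note [measurable] = L2D(2)[OF v]
 have m: "(%x. norm (v x) ^ 3) \<in> borel_measurable borel" by measurable
 have p: "periodic (%x. norm (v x) ^ 3)" using L2D(1)[OF v] by (simp add: periodic_def)
 note sh = integral_torus_shift[OF m p, of h] integrable_torus_shift[OF m p, of h]
 have ish: "integrable torus (%x. norm (v (x + h)) ^ 3)" using sh(2) i by simp
 have is2: "integrable torus (%x. 4 * (norm (v (x + h)) ^ 3 + norm (v x) ^ 3))" using ish i by simp
 show ii: "integrable torus (%x. norm (increment h v x) ^ 3)"
 proof (rule lint_bound[OF is2])
  show "(%x. norm (increment h v x) ^ 3) \<in> borel_measurable torus"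
   unfolding increment_def by (rule measurable_torusI) measurable
  show "AE x in torus. norm (norm (increment h v x) ^ 3) <= norm (4 * (norm (v (x + h)) ^ 3 + norm (v x) ^ 3))"
  proof (rule AE_I2)
   fix x
   show "norm (norm (increment h v x) ^ 3) <= norm (4 * (norm (v (x + h)) ^ 3 + norm (v x) ^ 3))"
    unfolding increment_def using norm_cube_triangle[of "v (x + h)" "v x"] by simp
  qed
 qed
 have "(AV x. norm (increment h v x) ^ 3) <= (AV x. 4 * (norm (v (x + h)) ^ 3 + norm (v x) ^ 3))"
  by (rule integral_mono[OF ii is2]) (unfold increment_def, rule norm_cube_triangle)
 also have "... = 8 * (AV x. norm (v x) ^ 3)"
  using ish i sh(1) by simp
 finally show "(AV x. norm (increment h v x) ^ 3) <= 8 * (AV x. norm (v x) ^ 3)" .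
qed

lemma abs_triple_le: "\<bar>a $ i * a $ j * a $ l\<bar> <= norm (a::real^'n) ^ 3"
 unfolding abs_mult power3_eq_cube
 by (intro mult_mono component_le_norm_cart mult_nonneg_nonneg) auto

lemma
 assumes v: "v \<in> L2" and i: "integrable torus (%x. norm (v x) ^ 3)"
 shows structure_tensor_integrable: "integrable torus (%x. increment h v x $ i * increment h v x $ j * increment h v x $ l)"
  and structure_tensor_bound: "\<bar>structure_tensor v i j l h\<bar> <= 8 * (AV x. norm (v x) ^ 3)"
proof -
 note [measurable] = L2D(2)[OF v]
 show ii: "integrable torus (%x. increment h v x $ i * increment h v x $ j * increment h v x $ l)"
 proof (rule lint_bound[OF increment_L3[OF v i, of h]])
  show "(%x. increment h v x $ i * increment h v x $ j * increment h v x $ l) \<in> borel_measurable torus"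
   unfolding increment_def by (rule measurable_torusI) measurable
 qed (use abs_triple_le[of "increment h v _"] in simp)
 have "\<bar>structure_tensor v i j l h\<bar> <= (AV x. \<bar>increment h v x $ i * increment h v x $ j * increment h v x $ l\<bar>)"
  unfolding structure_tensor_def by (rule integral_abs_bound)
 also have "... <= (AV x. norm (increment h v x) ^ 3)"
  using ii by (intro integral_mono increment_L3[OF v i] abs_triple_le) auto
 also have "... <= 8 * (AV x. norm (v x) ^ 3)" by (rule increment_L3_le[OF v i])
 finally show "\<bar>structure_tensor v i j l h\<bar> <= 8 * (AV x. norm (v x) ^ 3)" .
qed

text \<open>A form of Young's inequality that does the work of Hoelder's inequality in L^3: a small
  multiple of the large term is allowed, at the price of a large factor on the small one. The cases
  compare \<open>d\<close> with \<eta> \<open>a\<close>.\<close>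

lemma square_mult_le_cubes:
 fixes a d \<eta> :: real
 assumes "0 <= a" "0 <= d" "0 < \<eta>"
 shows "a^2 * d <= \<eta> * a ^ 3 + d ^ 3 / \<eta>^2"
proof (cases "d <= \<eta> * a")
 case True
 then have "a^2 * d <= a^2 * (\<eta> * a)" by (intro mult_left_mono) auto
 then have "a^2 * d <= \<eta> * a ^ 3" by (simp add: power2_eq_square power3_eq_cube mult_ac)
 then show ?thesis using assms by (simp add: add_increasing2)
next
 case False
 then have "a <= d / \<eta>" using assms by (simp add: field_simps)
 then have "a^2 * d <= (d / \<eta>)^2 * d" using assms by (intro mult_right_mono power_mono) auto
 also have "... = d ^ 3 / \<eta>^2" by (simp add: power2_eq_square power3_eq_cube)
 finally show ?thesis using assms by (simp add: add_increasing)
qed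

lemma triple_diff_le:
 fixes a b :: "real^'n"
 assumes "0 < \<eta>"
 shows "\<bar>a $ i * a $ j * a $ l - b $ i * b $ j * b $ l\<bar>
  <= 2 * \<eta> * (norm a ^ 3 + norm b ^ 3) + 4 / \<eta>^2 * norm (a - b) ^ 3"
proof -
 let ?m = "norm a" and ?n = "norm b" and ?d = "norm (a - b)"
 have c: "\<bar>a $ k\<bar> <= ?m" "\<bar>b $ k\<bar> <= ?n" "\<bar>a $ k - b $ k\<bar> <= ?d" for k
  using component_le_norm_cart[of a k] component_le_norm_cart[of b k] component_le_norm_cart[of "a - b" k] by auto
 have eq: "a $ i * a $ j * a $ l - b $ i * b $ j * b $ l
  = (a $ i - b $ i) * a $ j * a $ l + b $ i * (a $ j - b $ j) * a $ l + b $ i * b $ j * (a $ l - b $ l)"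
  by (simp add: algebra_simps)
 have t: "\<bar>(a $ i - b $ i) * a $ j * a $ l\<bar> <= ?d * ?m * ?m" "\<bar>b $ i * (a $ j - b $ j) * a $ l\<bar> <= ?n * ?d * ?m"
   "\<bar>b $ i * b $ j * (a $ l - b $ l)\<bar> <= ?n * ?n * ?d"
  unfolding abs_mult by (intro mult_mono c mult_nonneg_nonneg; simp)+
 have "?n * ?m <= (?n^2 + ?m^2) / 2" using sum_squares_bound[of ?n ?m] by simp
 then have "?n * ?m * ?d <= (?n^2 + ?m^2) / 2 * ?d" by (rule mult_right_mono) simp
 then have "\<bar>a $ i * a $ j * a $ l - b $ i * b $ j * b $ l\<bar> <= 3/2 * (?m^2 * ?d) + 3/2 * (?n^2 * ?d)"
  unfolding eq using t by (simp add: power2_eq_square algebra_simps)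
 also have "... <= 2 * (?m^2 * ?d) + 2 * (?n^2 * ?d)" by (intro add_mono mult_right_mono) auto
 also have "... <= 2 * (\<eta> * ?m ^ 3 + ?d ^ 3 / \<eta>^2) + 2 * (\<eta> * ?n ^ 3 + ?d ^ 3 / \<eta>^2)"
  by (intro add_mono mult_left_mono square_mult_le_cubes assms) auto
 finally show ?thesis by (simp add: algebra_simps)
qed

lemma L3_triangle:
 assumes v: "v \<in> L2" "integrable torus (%x. norm (v x) ^ 3)"
  and w: "w \<in> L2" and d: "integrable torus (%x. norm (w x - v x) ^ 3)"
 shows "integrable torus (%x. norm (w x) ^ 3)"
  and "(AV x. norm (w x) ^ 3) <= 4 * ((AV x. norm (w x - v x) ^ 3) + (AV x. norm (v x) ^ 3))"
proof -
 note [measurable] = L2D(2)[OF v(1)] L2D(2)[OF w]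
 have le: "norm (w x) ^ 3 <= 4 * (norm (w x - v x) ^ 3 + norm (v x) ^ 3)" for x
  using norm_cube_triangle[of "w x - v x" "- v x"] by simp
 have m: "(%x. norm (w x) ^ 3) \<in> borel_measurable torus" by (rule measurable_torusI) measurable
 have i: "integrable torus (%x. 4 * (norm (w x - v x) ^ 3 + norm (v x) ^ 3))" using v d by simp
 show i2: "integrable torus (%x. norm (w x) ^ 3)"
  by (rule lint_bound[OF i m]) (use le in \<open>simp add: abs_of_nonneg\<close>)
 show "(AV x. norm (w x) ^ 3) <= 4 * ((AV x. norm (w x - v x) ^ 3) + (AV x. norm (v x) ^ 3))"
  using integral_mono[OF i2 i le] v d by simp
qed

lemma structure_tensor_diff_le:
 assumes v: "v \<in> L2" "integrable torus (%x. norm (v x) ^ 3)"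
  and w: "w \<in> L2" and d: "integrable torus (%x. norm (w x - v x) ^ 3)" and \<eta>: "0 < \<eta>"
 shows "\<bar>structure_tensor w i j l h - structure_tensor v i j l h\<bar>
  <= 16 * \<eta> * ((AV x. norm (w x) ^ 3) + (AV x. norm (v x) ^ 3))
    + 32 / \<eta>^2 * (AV x. norm (w x - v x) ^ 3)"
proof -
 note wi = L3_triangle(1)[OF v w d]
 let ?a = "increment h w" and ?b = "increment h v" and ?d = "increment h (%x. w x - v x)"
 have dd: "?a x - ?b x = ?d x" for x by (simp add: increment_def)
 note ii = structure_tensor_integrable[OF w wi, of h i j l] structure_tensor_integrable[OF v, of h i j l]
 have ir: "integrable torus (%x. 2 * \<eta> * (norm (?a x) ^ 3 + norm (?b x) ^ 3) + 4 / \<eta>^2 * norm (?d x) ^ 3)"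
  using increment_L3[OF w wi] increment_L3[OF v] increment_L3[OF L2_diff[OF w v(1)] d] by simp
 have "\<bar>structure_tensor w i j l h - structure_tensor v i j l h\<bar> =
   \<bar>AV x. ?a x $ i * ?a x $ j * ?a x $ l - ?b x $ i * ?b x $ j * ?b x $ l\<bar>"
  unfolding structure_tensor_def using ii by simp
 also have "... <= (AV x. \<bar>?a x $ i * ?a x $ j * ?a x $ l - ?b x $ i * ?b x $ j * ?b x $ l\<bar>)"
  by (rule integral_abs_bound)
 also have "... <= (AV x. 2 * \<eta> * (norm (?a x) ^ 3 + norm (?b x) ^ 3) + 4 / \<eta>^2 * norm (?d x) ^ 3)"
 proof (intro integral_mono ir)
  show "integrable torus (%x. \<bar>?a x $ i * ?a x $ j * ?a x $ l - ?b x $ i * ?b x $ j * ?b x $ l\<bar>)" using ii by simp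
  show "\<bar>?a x $ i * ?a x $ j * ?a x $ l - ?b x $ i * ?b x $ j * ?b x $ l\<bar>
   <= 2 * \<eta> * (norm (?a x) ^ 3 + norm (?b x) ^ 3) + 4 / \<eta>^2 * norm (?d x) ^ 3" for x
   unfolding dd[symmetric] by (rule triple_diff_le[OF \<eta>])
 qed
 also have "... = 2 * \<eta> * ((AV x. norm (?a x) ^ 3) + (AV x. norm (?b x) ^ 3)) + 4 / \<eta>^2 * (AV x. norm (?d x) ^ 3)"
  using increment_L3[OF w wi] increment_L3[OF v] increment_L3[OF L2_diff[OF w v(1)] d] by simp
 also have "... <= 2 * \<eta> * (8 * (AV x. norm (w x) ^ 3) + 8 * (AV x. norm (v x) ^ 3)) + 4 / \<eta>^2 * (8 * (AV x. norm (w x - v x) ^ 3))"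
  using \<eta> by (intro add_mono mult_left_mono increment_L3_le v w wi d L2_diff) auto
 finally show ?thesis by (simp add: algebra_simps)
qed

text \<open>The bound on the difference is uniform in the separation because the L^3 norms of
  increments are controlled, through translation invariance, by those of the fields.\<close>

lemma structure_tensor_uniform_limit:
 assumes v: "v \<in> L2" "integrable torus (%x. norm (v x) ^ 3)"
  and w: "!!n. w n \<in> L2" "!!n. integrable torus (%x. norm (w n x - v x) ^ 3)"
   "(%n. AV x. norm (w n x - v x) ^ 3) \<longlonglongrightarrow> 0"
 shows "uniform_limit UNIV (%n. structure_tensor (w n) i j l) (structure_tensor v i j l) sequentially"
proof (rule uniform_limitI)
 fix e :: real assume e: "e > 0"
 define A where "A = (AV x. norm (v x) ^ 3)"
 define d where "d n = (AV x. norm (w n x - v x) ^ 3)" for n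
 have A: "0 <= A" unfolding A_def by (intro integral_nonneg_AE) auto
 have d0: "0 <= d n" for n unfolding d_def by (intro integral_nonneg_AE) auto
 \<comment> \<open>Once \<open>d n < 1\<close>, the third moments of \<open>w n\<close> and
   \<open>v\<close> together are at most 4 (1 + A) + A; the choice makes their contribution e /
   2.\<close>
 define \<eta> where "\<eta> = e / (2 * (16 * (5 * A + 4)))"
 have \<eta>: "0 < \<eta>" using e A by (simp add: \<eta>_def)
 have "(%n. 32 / \<eta>^2 * d n) \<longlonglongrightarrow> 32 / \<eta>^2 * 0" unfolding d_def by (intro tendsto_intros w)
 then have 1: "eventually (%n. 32 / \<eta>^2 * d n < e / 2) sequentially" using e by (intro order_tendstoD(2)) auto
 have 2: "eventually (%n. d n < 1) sequentially" using w(3) unfolding d_def[symmetric] by (intro order_tendstoD(2)) auto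
 show "\<forall>\<^sub>F n in sequentially. \<forall>h\<in>UNIV. dist (structure_tensor (w n) i j l h) (structure_tensor v i j l h) < e"
  using 1 2
 proof eventually_elim
  case (elim n)
  have W: "(AV x. norm (w n x) ^ 3) <= 4 * (d n + A)"
   unfolding d_def A_def by (rule L3_triangle(2)[OF v w(1,2)])
  have "16 * \<eta> * ((AV x. norm (w n x) ^ 3) + A) <= 16 * \<eta> * (5 * A + 4)"
   using W elim(2) \<eta> by (intro mult_left_mono) auto
  also have "... = e / 2" using A by (simp add: \<eta>_def field_simps)
  finally have "16 * \<eta> * ((AV x. norm (w n x) ^ 3) + A) + 32 / \<eta>^2 * d n < e"
   using elim(1) by linarith
  then show ?case
   using le_less_trans[OF structure_tensor_diff_le[OF v w(1,2) \<eta>]] unfolding d_def A_def dist_real_def by blast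
 qed
qed

lemma continuous_structure_tensor_smooth:
 assumes "cts v"
 shows "cts (structure_tensor v i j l)"
proof -
 have eq: "structure_tensor v i j l = (%h. integral (cbox 0 1) (%x. increment h v x $ i * increment h v x $ j * increment h v x $ l))"
  unfolding structure_tensor_def increment_def
  by (intro ext integral_torus_cbox continuous_intros cts_compose[OF assms]) auto
 show ?thesis
  unfolding eq increment_def
  by (intro integral_continuous_on_param) (auto simp: split_def intro!: continuous_intros cts_compose[OF assms])
qed

text \<open>Continuity in the separation although \<open>v\<close> need not be continuous: the
  tensors of the smooth approximants converge uniformly.\<close>

lemma continuous_structure_tensor:
 assumes G: "has_H1_gradient v G"
 shows "cts (structure_tensor v i j l)"
proof -
 obtain ph where ph: "!!n. ph n \<in> Cinf_div" "!!n. integrable torus (%x. norm (ph n x - v x) ^ 3)"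
   "(%n. AV x. norm (ph n x - v x) ^ 3) \<longlonglongrightarrow> 0"
  by (rule H1_L3_approx[OF G]) blast
 have v: "v \<in> L2" using G by (simp add: has_H1_gradient_def)
 have "uniform_limit UNIV (%n. structure_tensor (ph n) i j l) (structure_tensor v i j l) sequentially"
  by (rule structure_tensor_uniform_limit[OF v H1_L3(1)[OF G] Cinf_div_L2(1)[OF ph(1)] ph(2,3)])
 then show ?thesis
  using continuous_structure_tensor_smooth[OF smooth_continuous[OF Cinf_divD(2)[OF ph(1)]]]
  by (intro uniform_limit_theorem[rotated]) (auto intro!: always_eventually)
qed

lemma periodic_structure_tensor: "periodic v ==> periodic (structure_tensor v i j l)"
 by (simp add: periodic_def structure_tensor_def increment_def add.assoc[symmetric])

section \<open>Fourier modes\<close>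

lemma continuous_on_pair_compose:
 assumes "cts (%(x, y). f x y)" "continuous_on S g" "continuous_on S h"
 shows "continuous_on S (%z. f (g z) (h z))"
 using cts_compose[OF assms(1) continuous_on_Pair[OF assms(2,3)]] by simp

lemma continuous_on_integral_torus:
 fixes f :: "'a::topological_space => sfield"
 assumes "cts (%(h, x). f h x)"
 shows "cts (%h. AV x. f h x)"
proof -
 have "cts (%x. f h x)" for h
  by (intro continuous_on_pair_compose[OF assms] continuous_intros)
 then have eq: "(%h. AV x. f h x) = (%h. integral (cbox 0 1) (f h))"
  by (intro ext integral_torus_cbox)
 show ?thesis
  unfolding eq by (rule integral_continuous_on_param) (rule continuous_on_subset[OF assms subset_UNIV])
qed

lemma torus_Fubini_continuous:
 fixes f :: "real^3 => sfield"
 assumes c: "cts (%(x, y). f x y)"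
 shows "(AV x. AV y. f x y) = (AV y. AV x. f x y)"
proof -
 have c': "cts (%(y, x). f x y)"
  unfolding split_def by (intro continuous_on_pair_compose[OF c] continuous_intros)
 have c1: "cts (%y. f x y)" "cts (%x. f x y)" for x y
  by (intro continuous_on_pair_compose[OF c] continuous_intros)+
 have "(AV x. AV y. f x y) = integral (cbox 0 1) (%x. integral (cbox 0 1) (%y. f x y))"
  by (subst integral_torus_cbox[OF continuous_on_integral_torus[OF c]]) (simp add: integral_torus_cbox[OF c1(1)])
 also have "... = integral (cbox 0 1) (%y. integral (cbox 0 1) (%x. f x y))"
  by (rule integral_swap_continuous) (rule continuous_on_subset[OF c], simp)
 also have "... = (AV y. AV x. f x y)"
  by (subst integral_torus_cbox[OF continuous_on_integral_torus[OF c']]) (simp add: integral_torus_cbox[OF c1(2)])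
 finally show ?thesis .
qed

lemma torus_Fubini_shift:
 fixes f :: "sfield" and g :: "real^3 => sfield"
 assumes f: "cts f" "periodic f"
  and g: "cts (%(x, y). g x y)" "!!x. periodic (g x)"
 shows "(AV h. f h * (AV x. g x (x + h))) = (AV x. AV y. f (y - x) * g x y)"
proof -
 have c: "cts (%(h, x). f h * g x (x + h))"
  unfolding split_def
  by (intro continuous_on_mult cts_compose[OF f(1)] continuous_on_pair_compose[OF g(1)] continuous_intros subset_UNIV)
 have c2: "cts (%y. f (y - x) * g x y)" for x
  by (intro continuous_on_mult cts_compose[OF f(1)] continuous_on_pair_compose[OF g(1)] continuous_intros subset_UNIV)
 have "(AV h. f h * (AV x. g x (x + h))) = (AV h. AV x. f h * g x (x + h))"
  by simp
 also have "... = (AV x. AV h. f h * g x (x + h))"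
  by (rule torus_Fubini_continuous[OF c])
 also have "... = (AV x. AV y. f (y - x) * g x y)"
 proof (rule lint_cong[OF refl])
  fix x
  have "periodic (%y. f (y - x) * g x y)"
   unfolding periodic_def
  proof (intro allI ballI)
   fix y k :: "real^3" assume "k \<in> lattice"
   then show "f (y + k - x) * g x (y + k) = f (y - x) * g x y"
    using periodicD[OF f(2), of k "y - x"] periodicD[OF g(2), of k x y] by (simp add: algebra_simps)
  qed
  from integral_torus_shift[OF cts_measurable[OF c2] this, of x]
  show "(AV h. f h * g x (x + h)) = (AV y. f (y - x) * g x y)"
   by (simp add: add.commute)
 qed
 finally show ?thesis .
qed

definition fcos :: "real^3 => (real^3 => 'b::{banach, second_countable_topology}) => 'b" where
 "fcos k f = (AV x. cos (phase k x) *\<^sub>R f x)"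

definition fsin :: "real^3 => (real^3 => 'b::{banach, second_countable_topology}) => 'b" where
 "fsin k f = (AV x. sin (phase k x) *\<^sub>R f x)"

lemma
 fixes f :: "real^3 => 'b::{banach, second_countable_topology}"
 assumes "integrable torus f"
 shows integrable_cos: "integrable torus (%x. cos (phase k x) *\<^sub>R f x)"
  and integrable_sin: "integrable torus (%x. sin (phase k x) *\<^sub>R f x)"
proof -
 have m: "(%x. cos (phase k x)) \<in> borel_measurable torus" "(%x. sin (phase k x)) \<in> borel_measurable torus"
  by (rule measurable_torusI; measurable)+
 show "integrable torus (%x. cos (phase k x) *\<^sub>R f x)" "integrable torus (%x. sin (phase k x) *\<^sub>R f x)"
  by (rule lint_bound[OF assms borel_measurable_scaleR[OF m(1) borel_measurable_integrable[OF assms]]],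
    simp add: mult_left_le_one_le)
    (rule lint_bound[OF assms borel_measurable_scaleR[OF m(2) borel_measurable_integrable[OF assms]]],
    simp add: mult_left_le_one_le)
qed

lemma laplacian_trig: "laplacian (trig k a b) = (%x. - (4 * pi^2 * (norm k)^2) *\<^sub>R trig k a b x)"
proof
 fix x
 have "laplacian (trig k a b) x = (SU i. (- (4 * pi^2) * (k $ i)^2) *\<^sub>R trig k a b x)"
  unfolding laplacian_def pderiv_at_trig by (simp add: trig_def power2_eq_square algebra_simps)
 also have "... = - (4 * pi^2 * (norm k)^2) *\<^sub>R trig k a b x"
  by (simp add: norm_sq_eq_sum sum_distrib_left scaleR_sum_left sum_negf)
 finally show "laplacian (trig k a b) x = - (4 * pi^2 * (norm k)^2) *\<^sub>R trig k a b x" .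
qed

text \<open>Such a mode is itself a partial derivative of a mode, taken in a direction in which
  \<open>k\<close> does not vanish.\<close>

lemma integral_trig_eq_0:
 fixes a b :: real
 assumes k: "k \<in> lattice" "k \<noteq> 0"
 shows "(AV x. trig k a b x) = 0"
proof -
 obtain i where i: "k $ i \<noteq> 0" using k(2) by (auto simp: vec_eq_iff)
 define c where "c = 2 * pi * k $ i"
 have c: "c \<noteq> 0" using i by (simp add: c_def)
 have "pderiv_at i (trig k (- b / c) (a / c)) = trig k a b"
  using c by (simp add: pderiv_at_trig c_def[symmetric])
 with integral_pderiv_at_torus[of "trig k (- b / c) (a / c)" i]
 show ?thesis by (simp add: smooth_differentiable smooth_continuous smooth_trig periodic_trig k)
qed

lemma coeff_one:
 assumes "k \<in> lattice" "k \<noteq> 0"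
 shows "fcos k (%_. 1::real) = 0" "fsin k (%_. 1::real) = 0"
 using integral_trig_eq_0[OF assms, of 1 0] integral_trig_eq_0[OF assms, of 0 1]
 by (simp_all add: trig_def fcos_def fsin_def)

lemma trig_Cinf_div:
 assumes k: "k \<in> lattice" "k \<noteq> 0" and ab: "k \<bullet> a = 0" "k \<bullet> b = 0"
 shows "trig k a b \<in> Cinf_div"
proof -
 have "(AV x. trig k a b x) $ i = 0" for i
 proof -
  have "(AV x. trig k a b x) $ i = (AV x. trig k a b x $ i)"
   by (rule integral_bounded_linear[OF bounded_linear_vec_nth, symmetric])
     (intro torus_integrable smooth_continuous smooth_trig)
  also have "(%x. trig k a b x $ i) = trig k (a $ i) (b $ i)" by (simp add: trig_def fun_eq_iff)
  finally show ?thesis by (simp add: integral_trig_eq_0[OF k])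
 qed
 moreover have "divergence (trig k a b) x = 0" for x
 proof -
  have "divergence (trig k a b) x = 2 * pi * (cos (phase k x) * (k \<bullet> b) - sin (phase k x) * (k \<bullet> a))"
  proof -
   define C S where "C = cos (phase k x)" and "S = sin (phase k x)"
   have "divergence (trig k a b) x = (SU i. 2 * pi * (C * (k $ i * b $ i) - S * (k $ i * a $ i)))"
    unfolding divergence_def pderiv_at_trig by (simp add: trig_def C_def S_def algebra_simps)
   also have "... = 2 * pi * (C * (k \<bullet> b) - S * (k \<bullet> a))"
    by (simp add: inner_vec_def sum_distrib_left sum_subtractf right_diff_distrib)
   finally show ?thesis unfolding C_def S_def .
  qed
  then show ?thesis using ab by simp
 qed
 ultimately show ?thesis
  by (simp add: Cinf_div_def periodic_trig k smooth_trig vec_eq_iff)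
qed

lemma L2_inner_trig:
 assumes "v \<in> L2"
 shows "L2_inner v (trig k a b) = fcos k v \<bullet> a + fsin k v \<bullet> b"
proof -
 have v: "integrable torus v" by (rule L2_integrable[OF assms])
 have "fcos k v \<bullet> a = (AV x. (cos (phase k x) *\<^sub>R v x) \<bullet> a)"
    "fsin k v \<bullet> b = (AV x. (sin (phase k x) *\<^sub>R v x) \<bullet> b)"
  unfolding fcos_def fsin_def
  by (rule integral_inner_left[symmetric], use integrable_cos[OF v] integrable_sin[OF v] in simp)+
 moreover have "L2_inner v (trig k a b) = (AV x. (cos (phase k x) *\<^sub>R v x) \<bullet> a + (sin (phase k x) *\<^sub>R v x) \<bullet> b)"
  unfolding L2_inner_def by (simp add: trig_def inner_add_right)
 moreover have "... = (AV x. (cos (phase k x) *\<^sub>R v x) \<bullet> a) + (AV x. (sin (phase k x) *\<^sub>R v x) \<bullet> b)"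
  by (intro Bochner_Integration.integral_add integrable_inner_left integrable_cos[OF v] integrable_sin[OF v])
 ultimately show ?thesis by simp
qed

text \<open>The gradient of a scalar mode is a vector mode with amplitudes along \<open>k\<close>;
  orthogonality to gradients is then tested once with a sine and once with a cosine.\<close>

lemma coeff_orthogonal:
 assumes v: "v \<in> L2_div" and k: "k \<in> lattice"
 shows "k \<bullet> fcos k v = 0" "k \<bullet> fsin k v = 0"
proof -
 have g: "gradient (trig k a b) = trig k ((2 * pi * b) *\<^sub>R k) (- ((2 * pi * a) *\<^sub>R k))" for a b :: real
  by (simp add: fun_eq_iff vec_eq_iff gradient_def pderiv_at_trig trig_def algebra_simps)
 have "L2_inner v (trig k ((2 * pi * b) *\<^sub>R k) (- ((2 * pi * a) *\<^sub>R k))) = 0" for a b :: real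
  using L2_div_orthogonal_gradient[OF periodic_trig[OF k] smooth_trig v, of a b] by (simp add: g)
 from this[of 1 0] this[of 0 1]
 show "k \<bullet> fcos k v = 0" "k \<bullet> fsin k v = 0"
  using L2_divD[OF v] by (simp_all add: L2_inner_trig inner_commute)
qed

lemma integrable_flux:
 fixes v :: vfield
 assumes "v \<in> L2"
 shows "integrable torus (%x. (k \<bullet> v x) *\<^sub>R v x)"
proof (rule lint_bound)
 note [measurable] = L2D(2)[OF assms]
 show "integrable torus (%x. norm k * (norm (v x))^2)" using L2D(3)[OF assms] by simp
 show "(%x. (k \<bullet> v x) *\<^sub>R v x) \<in> borel_measurable torus" by (rule measurable_torusI) measurable
 show "AE x in torus. norm ((k \<bullet> v x) *\<^sub>R v x) <= norm (norm k * (norm (v x))^2)"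
 proof (rule AE_I2)
  fix x
  have "\<bar>k \<bullet> v x\<bar> * norm (v x) <= norm k * norm (v x) * norm (v x)"
   by (rule mult_right_mono[OF Cauchy_Schwarz_ineq2]) simp
  then show "norm ((k \<bullet> v x) *\<^sub>R v x) <= norm (norm k * (norm (v x))^2)"
   by (simp add: power2_eq_square mult_ac)
 qed
qed

text \<open>The Jacobian of a mode applied to w is the phase of w times the mode a quarter period
  later. Hence only the coefficients of the flux field (k \<bullet> v) v appear, with sine and
  cosine exchanged.\<close>

lemma transport_trig:
 assumes v: "v \<in> L2"
 shows "transport (trig k a b) v = 2 * pi * (fcos k (%x. (k \<bullet> v x) *\<^sub>R v x) \<bullet> b - fsin k (%x. (k \<bullet> v x) *\<^sub>R v x) \<bullet> a)"
proof -
 let ?f = "%x. (k \<bullet> v x) *\<^sub>R v x"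
 note fi = integrable_flux[OF v, of k]
 have J: "jacobian (trig k a b) (at x) *v w = (phase k w) *\<^sub>R trig k b (- a) x" for x w
 proof -
  have "(trig k a b has_derivative (%h. jacobian (trig k a b) (at x) *v h)) (at x)"
   using jacobian_works smooth_differentiable[OF smooth_trig] by blast
  from has_derivative_unique[OF this has_derivative_trig] show ?thesis by (simp add: fun_eq_iff)
 qed
 have "transport (trig k a b) v = (AV x. 2 * pi * ((cos (phase k x) *\<^sub>R ?f x) \<bullet> b - (sin (phase k x) *\<^sub>R ?f x) \<bullet> a))"
  unfolding transport_def L2_inner_def J
  by (intro lint_cong) (auto simp: trig_def inner_commute algebra_simps inner_add_left inner_diff_left)
 also have "... = 2 * pi * ((AV x. (cos (phase k x) *\<^sub>R ?f x) \<bullet> b) - (AV x. (sin (phase k x) *\<^sub>R ?f x) \<bullet> a))"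
  using integrable_inner_left[OF integrable_cos[OF fi, of k], of b] integrable_inner_left[OF integrable_sin[OF fi, of k], of a]
  by (simp only: integral_mult_right_zero Bochner_Integration.integral_diff)
 also have "... = 2 * pi * (fcos k ?f \<bullet> b - fsin k ?f \<bullet> a)"
  unfolding fcos_def fsin_def
  using integral_inner_left[of b torus, OF integrable_cos[OF fi, of k]] integral_inner_left[of a torus, OF integrable_sin[OF fi, of k]]
  by simp
 finally show ?thesis .
qed

text \<open>These vectors span the orthogonal complement of \<open>k\<close>: summing over \<open>i\<close> and \<open>j\<close> gives
 \<open>2 |k|\<^sup>2\<close> times the projection.\<close>

definition transversal :: "real^3 => 3 => 3 => real^3" where
 "transversal k i j = k $ i *\<^sub>R axis j 1 - k $ j *\<^sub>R axis i 1"

lemma transversal_orthogonal: "k \<bullet> transversal k i j = 0"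
 by (simp add: transversal_def inner_diff_right inner_axis)

lemma sum_transversal:
 assumes "k \<bullet> X = 0"
 shows "(SU i. SU j. (X \<bullet> transversal k i j) * (Y \<bullet> transversal k i j)) = 2 * (norm k)^2 * (X \<bullet> Y)"
proof -
 have t: "Z \<bullet> transversal k i j = k $ i * Z $ j - k $ j * Z $ i" for Z i j
  by (simp add: transversal_def inner_diff_right inner_axis)
 have "(SU i. SU j. (X \<bullet> transversal k i j) * (Y \<bullet> transversal k i j))
   = 2 * (k \<bullet> k) * (X \<bullet> Y) - 2 * (k \<bullet> X) * (k \<bullet> Y)"
  unfolding t unfolding inner_vec_def sum_3 by (simp add: algebra_simps)
 then show ?thesis using assms by (simp add: power2_norm_eq_inner)
qed

text \<open>Runs over the solenoidal cosine and sine fields of wave number \<open>k\<close>. The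
  redundant family of nine amplitudes replaces an orthonormal basis of the plane orthogonal to
  \<open>k\<close>, which could not be written as a polynomial in \<open>k\<close>.\<close>

definition mode_sum :: "real^3 => (vfield => real) => real" where
 "mode_sum k F = (SU i. SU j. F (trig k (transversal k i j) 0) + F (trig k 0 (transversal k i j)))"

lemma mode_sum_sq:
 assumes v: "v \<in> L2_div" and k: "k \<in> lattice"
 shows "mode_sum k (%ph. (L2_inner v ph)^2) = 2 * (norm k)^2 * (fcos k v \<bullet> fcos k v + fsin k v \<bullet> fsin k v)"
 unfolding mode_sum_def sum.distrib
 using sum_transversal[OF coeff_orthogonal(1)[OF v k], of "fcos k v"] sum_transversal[OF coeff_orthogonal(2)[OF v k], of "fsin k v"]
 by (simp add: L2_inner_trig[OF L2_divD[OF v]] power2_eq_square distrib_left)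

text \<open>The sum over amplitudes would project the flux onto the plane orthogonal to
  \<open>k\<close>; as the coefficients of \<open>v\<close> already lie in that plane, the
  projection disappears from the formula, and the pressure with it.\<close>

lemma mode_sum_transport:
 assumes v: "v \<in> L2_div" and k: "k \<in> lattice"
 shows "mode_sum k (%ph. L2_inner v ph * transport ph v) = 4 * pi * (norm k)^2 *
  (fsin k v \<bullet> fcos k (%x. (k \<bullet> v x) *\<^sub>R v x) - fcos k v \<bullet> fsin k (%x. (k \<bullet> v x) *\<^sub>R v x))"
proof -
 let ?f = "%x. (k \<bullet> v x) *\<^sub>R v x"
 have "mode_sum k (%ph. L2_inner v ph * transport ph v) =
   (SU i. SU j. 2 * pi * ((fsin k v \<bullet> transversal k i j) * (fcos k ?f \<bullet> transversal k i j)
   - (fcos k v \<bullet> transversal k i j) * (fsin k ?f \<bullet> transversal k i j)))"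
  unfolding mode_sum_def
  by (intro sum.cong refl) (simp add: L2_inner_trig[OF L2_divD[OF v]] transport_trig[OF L2_divD[OF v]] algebra_simps)
 also have "... = 2 * pi * (2 * (norm k)^2 * (fsin k v \<bullet> fcos k ?f) - 2 * (norm k)^2 * (fcos k v \<bullet> fsin k ?f))"
  by (simp only: sum_distrib_left[symmetric] sum_subtractf sum_transversal[OF coeff_orthogonal(1)[OF v k]] sum_transversal[OF coeff_orthogonal(2)[OF v k]])
 finally show ?thesis by (simp add: algebra_simps)
qed

text \<open>Wiener-Khinchin: after the substitution y = x + h the addition theorem splits the cosine
  of the phase difference, and the double integral factors into products of coefficients.\<close>

lemma smooth_correlation_mode:
 assumes v: "periodic v" "cts v" and k: "k \<in> lattice"
 shows "(AV h. cos (phase k h) * correlation v h) = fcos k v \<bullet> fcos k v + fsin k v \<bullet> fsin k v"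
proof -
 let ?c = "%x. cos (phase k x)" and ?s = "%x. sin (phase k x)"
 have vi: "integrable torus v" by (rule torus_integrable[OF v(2)])
 have "(AV h. ?c h * correlation v h) = (AV x. AV y. ?c (y - x) * (v x \<bullet> v y))"
  unfolding correlation_def L2_inner_def
 proof (rule torus_Fubini_shift)
  show "cts (%(x, y). v x \<bullet> v y)"
   unfolding split_def by (intro continuous_intros cts_compose[OF v(2)]) auto
 qed (use v(1) k in \<open>auto simp: periodic_def cos_periodic_lattice intro!: continuous_intros\<close>)
 also have "... = (AV x. (?c x *\<^sub>R v x) \<bullet> fcos k v + (?s x *\<^sub>R v x) \<bullet> fsin k v)"
 proof (rule lint_cong[OF refl])
  fix x
  have "(AV y. ?c (y - x) * (v x \<bullet> v y)) = (AV y. (?c x *\<^sub>R v x) \<bullet> (?c y *\<^sub>R v y) + (?s x *\<^sub>R v x) \<bullet> (?s y *\<^sub>R v y))"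
   by (simp add: right_diff_distrib inner_diff_right cos_diff algebra_simps)
  also have "... = (?c x *\<^sub>R v x) \<bullet> fcos k v + (?s x *\<^sub>R v x) \<bullet> fsin k v"
   unfolding fcos_def fsin_def
   using integrable_cos[OF vi, of k] integrable_sin[OF vi, of k]
   by (simp only: Bochner_Integration.integral_add integrable_inner_right integral_inner_right)
  finally show "(AV y. ?c (y - x) * (v x \<bullet> v y)) = (?c x *\<^sub>R v x) \<bullet> fcos k v + (?s x *\<^sub>R v x) \<bullet> fsin k v" .
 qed
 also have "... = fcos k v \<bullet> fcos k v + fsin k v \<bullet> fsin k v"
  using integrable_cos[OF vi, of k] integrable_sin[OF vi, of k]
  by (subst Bochner_Integration.integral_add)
    (auto simp only: integrable_inner_left integral_inner_left fcos_def[symmetric] fsin_def[symmetric])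
 finally show ?thesis .
qed

text \<open>The vector \<open>D(h)\<close> of the overview for one realization, before the
  expectation is taken. It is assembled from the tensor so as to inherit its continuity and uniform
  limits.\<close>

definition third_moment :: "vfield => real^3 => real^3" where
 "third_moment v h = (\<chi> j. SU i. structure_tensor v i i j h)"

lemma inner_third_moment:
 assumes v: "v \<in> L2" "integrable torus (%x. norm (v x) ^ 3)"
 shows "k \<bullet> third_moment v h = (AV x. (norm (increment h v x))^2 * (k \<bullet> increment h v x))"
proof -
 let ?d = "increment h v"
 note ii = structure_tensor_integrable[OF v, of h]
 have "k \<bullet> third_moment v h = (SU j. SU i. AV x. k $ j * (?d x $ i * ?d x $ i * ?d x $ j))"
  by (simp add: third_moment_def inner_vec_def structure_tensor_def sum_distrib_left)
 also have "... = (AV x. (SU j. SU i. k $ j * (?d x $ i * ?d x $ i * ?d x $ j)))"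
  by (subst lint_sum, intro Bochner_Integration.integrable_sum integrable_mult_right ii)
    (subst lint_sum, intro integrable_mult_right ii, simp)
 also have "... = (AV x. (norm (?d x))^2 * (k \<bullet> ?d x))"
 proof (rule lint_cong[OF refl])
  fix x
  show "(SU j. SU i. k $ j * (?d x $ i * ?d x $ i * ?d x $ j)) = (norm (?d x))^2 * (k \<bullet> ?d x)"
   unfolding norm_sq_eq_sum inner_vec_def sum_product by (subst sum.swap) (simp add: power2_eq_square mult_ac)
 qed
 finally show ?thesis .
qed

text \<open>Expanding the increments, all terms with a factor \<open>k \<bullet> v\<close> at one of the two points alone vanish.\<close>

lemma smooth_flux_mode:
 assumes v: "v \<in> Cinf_div" and k: "k \<in> lattice" "k \<noteq> 0"
 defines "R \<equiv> %x. (k \<bullet> v x) *\<^sub>R v x"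
 shows "(AV h. sin (phase k h) * (k \<bullet> third_moment v h))
  = 4 * (fsin k v \<bullet> fcos k R - fcos k v \<bullet> fsin k R)"
proof -
 let ?c = "%x. cos (phase k x)" and ?s = "%x. sin (phase k x)"
 have vp: "periodic v" and cv: "!!S. continuous_on S v"
  using Cinf_divD[OF v] smooth_continuous by auto
 have vL: "v \<in> L2" by (rule Cinf_div_L2(1)[OF v])
 have vD: "v \<in> L2_div" by (rule H1_div_subset_L2_div[OF has_H1_gradient_Cinf_div[OF v]])
 define g where "g x y = (norm (v y - v x))^2 * (k \<bullet> (v y - v x))" for x y
 have cg: "cts (%(x, y). g x y)"
  unfolding g_def split_def by (intro continuous_intros cts_compose[OF cv[of UNIV]]) auto
 have v3: "integrable torus (%x. norm (v x) ^ 3)"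
  by (intro torus_integrable continuous_intros cv)
 have "(AV h. ?s h * (k \<bullet> third_moment v h)) = (AV h. ?s h * (AV x. g x (x + h)))"
  unfolding inner_third_moment[OF vL v3] by (simp add: g_def increment_def)
 also have "... = (AV x. AV y. ?s (y - x) * g x y)"
  by (rule torus_Fubini_shift[OF _ _ cg])
    (use vp k in \<open>auto simp: periodic_def cos_periodic_lattice g_def intro!: continuous_intros\<close>)
 finally have 0: "(AV h. ?s h * (k \<bullet> third_moment v h)) = (AV x. AV y. ?s (y - x) * g x y)" .
 define n2 where "n2 x = (norm (v x))^2" for x
 define f3 where "f3 x = n2 x * (k \<bullet> v x)" for x
 \<comment> \<open>What is left of \<open>g x y\<close> after integration in y against a weight w:
   \<open>A\<close>, \<open>RR\<close>, \<open>E\<close>, \<open>S\<close> are the integrals of w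
   times f3, R, n2, v. The terms with \<integral> w and k \<bullet> \<integral> w v are zero for the
   weights used.\<close>
 define inner where "inner A RR E S (x::real^3) = A - 2 * (v x \<bullet> RR) - E * (k \<bullet> v x) + 2 * (v x \<bullet> S) * (k \<bullet> v x)"
  for A E :: real and RR S :: "real^3" and x
 have iv: "integrable torus v" "integrable torus R" "integrable torus n2" "integrable torus f3" "integrable torus (%_. 1::real)"
  unfolding R_def n2_def f3_def by (intro torus_integrable continuous_intros cv; simp)+
 have gx: "g x y = f3 y - 2 * (v x \<bullet> R y) + n2 x * (k \<bullet> v y) - n2 y * (k \<bullet> v x) + 2 * (v x \<bullet> v y) * (k \<bullet> v x) - f3 x * 1" for x y
  unfolding g_def f3_def n2_def R_def power2_norm_eq_inner
  by (simp add: inner_diff_left inner_diff_right inner_commute algebra_simps)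
 note ic = integrable_cos[where k=k, unfolded real_scaleR_def] integrable_sin[where k=k, unfolded real_scaleR_def]
 have lin: "(AV y. w y * g x y) = inner (AV y. w y *\<^sub>R f3 y) (AV y. w y *\<^sub>R R y) (AV y. w y *\<^sub>R n2 y) (AV y. w y *\<^sub>R v y) x"
  if cw: "cts w" and w1: "(AV y. w y *\<^sub>R (1::real)) = 0" and wk: "k \<bullet> (AV y. w y *\<^sub>R v y) = 0" for w x
 proof -
  have i: "integrable torus (%y. w y *\<^sub>R f3 y)" "integrable torus (%y. w y *\<^sub>R R y)" "integrable torus (%y. w y *\<^sub>R n2 y)" "integrable torus (%y. w y *\<^sub>R v y)"
    "integrable torus (%y. w y *\<^sub>R (1::real))"
   unfolding R_def n2_def f3_def by (intro torus_integrable continuous_intros cv cw)+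
  have "(AV y. w y * g x y) = (AV y. w y *\<^sub>R f3 y - 2 * (v x \<bullet> (w y *\<^sub>R R y)) + n2 x * (k \<bullet> (w y *\<^sub>R v y))
    - (k \<bullet> v x) * (w y *\<^sub>R n2 y) + 2 * (k \<bullet> v x) * (v x \<bullet> (w y *\<^sub>R v y)) - f3 x * (w y *\<^sub>R 1))"
   unfolding gx by (intro lint_cong) (auto simp: algebra_simps)
  also have "... = (AV y. w y *\<^sub>R f3 y) - 2 * (v x \<bullet> (AV y. w y *\<^sub>R R y)) + n2 x * (k \<bullet> (AV y. w y *\<^sub>R v y))
    - (k \<bullet> v x) * (AV y. w y *\<^sub>R n2 y) + 2 * (k \<bullet> v x) * (v x \<bullet> (AV y. w y *\<^sub>R v y)) - f3 x * (AV y. w y *\<^sub>R 1)"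
   by (intro has_bochner_integral_integral_eq has_bochner_integral_add has_bochner_integral_diff has_bochner_integral_mult_right
    has_bochner_integral_inner_right has_bochner_integral_inner_left has_bochner_integral_integrable i)
  finally show ?thesis unfolding w1 wk inner_def by (simp add: algebra_simps)
 qed
 have cs: "cts ?c" "cts ?s" by (intro continuous_intros)+
 have C: "(AV y. ?c y * g x y) = inner (fcos k f3) (fcos k R) (fcos k n2) (fcos k v) x" for x
  using lin[OF cs(1)] coeff_one[OF k] coeff_orthogonal[OF vD k(1)] by (simp add: fcos_def)
 have S: "(AV y. ?s y * g x y) = inner (fsin k f3) (fsin k R) (fsin k n2) (fsin k v) x" for x
  using lin[OF cs(2)] coeff_one[OF k] coeff_orthogonal[OF vD k(1)] by (simp add: fsin_def)
 have cgx: "cts (g x)" for x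
  by (rule continuous_on_pair_compose[OF cg]) (intro continuous_intros)+
 have split: "(AV y. ?s (y - x) * g x y) = ?c x * (AV y. ?s y * g x y) - ?s x * (AV y. ?c y * g x y)" for x
 proof -
  have "(AV y. ?s (y - x) * g x y) = (AV y. ?c x * (?s y * g x y) - ?s x * (?c y * g x y))"
   by (intro lint_cong) (auto simp: right_diff_distrib inner_diff_right sin_diff algebra_simps)
  also have "... = ?c x * (AV y. ?s y * g x y) - ?s x * (AV y. ?c y * g x y)"
   by (subst Bochner_Integration.integral_diff) (auto intro!: torus_integrable continuous_intros cgx)
  finally show ?thesis .
 qed
 \<comment> \<open>The same two cancellations, now in x, remove the terms with \<open>A\<close> and
   \<open>E\<close>, so that only products of coefficients of \<open>v\<close> and \<open>R\<close>
   survive.\<close>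
 have outer: "(AV x. w x * inner A RR E S x) = - 2 * ((AV x. w x *\<^sub>R v x) \<bullet> RR) + 2 * ((AV x. w x *\<^sub>R R x) \<bullet> S)"
  if cw: "cts w" and w1: "(AV y. w y *\<^sub>R (1::real)) = 0" and wk: "k \<bullet> (AV y. w y *\<^sub>R v y) = 0" for w A RR E S
 proof -
  have i: "integrable torus (%y. w y *\<^sub>R R y)" "integrable torus (%y. w y *\<^sub>R v y)" "integrable torus (%y. w y *\<^sub>R (1::real))"
   unfolding R_def by (intro torus_integrable continuous_intros cv cw)+
  have "(AV x. w x * inner A RR E S x) = (AV x. A * (w x *\<^sub>R 1) - 2 * ((w x *\<^sub>R v x) \<bullet> RR) - E * (k \<bullet> (w x *\<^sub>R v x)) + 2 * ((w x *\<^sub>R R x) \<bullet> S))"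
   by (intro lint_cong) (auto simp: inner_def R_def algebra_simps)
  also have "... = A * (AV x. w x *\<^sub>R 1) - 2 * ((AV x. w x *\<^sub>R v x) \<bullet> RR) - E * (k \<bullet> (AV x. w x *\<^sub>R v x)) + 2 * ((AV x. w x *\<^sub>R R x) \<bullet> S)"
   by (intro has_bochner_integral_integral_eq has_bochner_integral_add has_bochner_integral_diff has_bochner_integral_mult_right
    has_bochner_integral_inner_right has_bochner_integral_inner_left has_bochner_integral_integrable i)
  finally show ?thesis unfolding w1 wk by simp
 qed
 have ci: "cts (inner A RR E S)" for A RR E S
  unfolding inner_def by (intro continuous_intros cv)
 have "(AV x. AV y. ?s (y - x) * g x y) =
   (AV x. ?c x * inner (fsin k f3) (fsin k R) (fsin k n2) (fsin k v) x)
   - (AV x. ?s x * inner (fcos k f3) (fcos k R) (fcos k n2) (fcos k v) x)"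
  unfolding split C S
  by (rule Bochner_Integration.integral_diff) (intro torus_integrable continuous_intros ci)+
 also have "... = (- 2 * (fcos k v \<bullet> fsin k R) + 2 * (fcos k R \<bullet> fsin k v))
  - (- 2 * (fsin k v \<bullet> fcos k R) + 2 * (fsin k R \<bullet> fcos k v))"
  using outer[OF cs(1)] outer[OF cs(2)] coeff_one[OF k] coeff_orthogonal[OF vD k(1)]
  by (simp only: fcos_def fsin_def)
 finally show ?thesis unfolding 0 by (simp add: inner_commute algebra_simps)
qed

lemma continuous_third_moment:
 assumes "has_H1_gradient v G"
 shows "cts (third_moment v)"
 unfolding third_moment_def by (intro continuous_intros continuous_structure_tensor[OF assms])

lemma norm_third_moment_le:
 assumes v: "v \<in> L2" "integrable torus (%x. norm (v x) ^ 3)"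
 shows "norm (third_moment v h) <= 72 * (AV x. norm (v x) ^ 3)"
proof -
 have "norm (third_moment v h) <= (SU j. \<bar>third_moment v h $ j\<bar>)" by (rule norm_le_l1_cart)
 also have "... <= (\<Sum>j\<in>(UNIV::3 set). \<Sum>i\<in>(UNIV::3 set). 8 * (AV x. norm (v x) ^ 3))"
  unfolding third_moment_def vec_lambda_beta by (intro sum_mono order_trans[OF sum_abs] structure_tensor_bound v)
 finally show ?thesis by simp
qed

text \<open>Approximation in L^2. The correlations of the approximants converge pointwise and are
  bounded by their squared norms, so dominated convergence applies on the torus.\<close>

lemma correlation_mode:
 assumes v: "v \<in> L2_div" and k: "k \<in> lattice"
 shows "mode_sum k (%ph. (L2_inner v ph)^2) = 2 * (norm k)^2 * (AV h. cos (phase k h) * correlation v h)"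
proof -
 obtain ph where ph: "!!n. ph n \<in> Cinf_div" "L2_tendsto ph v"
  by (rule L2_div_approx[OF v]) blast
 note PL = Cinf_div_L2(1)[OF ph(1)] and vL = L2_divD[OF v]
 have PD: "ph n \<in> L2_div" for n by (rule H1_div_subset_L2_div[OF has_H1_gradient_Cinf_div[OF ph(1)]])
 have cc: "cts (correlation (ph n))" for n
 proof -
  have cp: "continuous_on S (ph n)" for S by (rule smooth_continuous[OF Cinf_divD(2)[OF ph(1)]])
  show ?thesis unfolding correlation_def L2_inner_def
   by (rule continuous_on_integral_torus) (auto simp: split_def intro!: continuous_intros cts_compose[OF cp[of UNIV]])
 qed
 have [measurable]: "correlation (ph n) \<in> borel_measurable borel" for n
  by (rule cts_measurable[OF cc])
 have [measurable]: "correlation v \<in> borel_measurable borel"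
  by (rule borel_measurable_LIMSEQ_metric[of "%n. correlation (ph n)"]) (auto intro: correlation_tendsto[OF PL vL ph(2)])
 have "(%n. (L2_norm (ph n))^2) \<longlonglongrightarrow> (L2_norm v)^2"
  by (intro tendsto_intros L2_norm_tendsto[OF PL vL ph(2)])
 then obtain K where K: "!!n. norm ((L2_norm (ph n))^2) <= K"
  using BseqE[OF convergent_imp_Bseq[OF convergentI]] by blast
 have "(%n. AV h. cos (phase k h) * correlation (ph n) h) \<longlonglongrightarrow> (AV h. cos (phase k h) * correlation v h)"
 proof (rule integral_dominated_convergence[where w="%_. K"])
  show "AE h in torus. (%n. cos (phase k h) * correlation (ph n) h) \<longlonglongrightarrow> cos (phase k h) * correlation v h"
   by (intro AE_I2 tendsto_intros correlation_tendsto[OF PL vL ph(2)])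
  fix n
  have "\<bar>cos (phase k h) * correlation (ph n) h\<bar> <= 1 * K" for h
   unfolding abs_mult using correlation_le[OF PL, of n h] K[of n] by (intro mult_mono) auto
  then show "AE h in torus. norm (cos (phase k h) * correlation (ph n) h) <= K" by simp
 qed (auto intro!: measurable_torusI)
 then have lim: "(%n. 2 * (norm k)^2 * (AV h. cos (phase k h) * correlation (ph n) h)) \<longlonglongrightarrow>
   2 * (norm k)^2 * (AV h. cos (phase k h) * correlation v h)" by (intro tendsto_intros)
 have "mode_sum k (%ph'. (L2_inner (ph n) ph')^2) = 2 * (norm k)^2 * (AV h. cos (phase k h) * correlation (ph n) h)" for n
  using Cinf_divD(1,2)[OF ph(1)] unfolding mode_sum_sq[OF PD k]
  by (subst smooth_correlation_mode) (auto intro: smooth_continuous k)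
 moreover have "(%n. mode_sum k (%ph'. (L2_inner (ph n) ph')^2)) \<longlonglongrightarrow> mode_sum k (%ph'. (L2_inner v ph')^2)"
  unfolding mode_sum_def
  by (intro tendsto_intros L2_inner_tendsto[OF PL vL _ ph(2)] L2_continuous smooth_continuous smooth_trig periodic_trig k)
 ultimately show "mode_sum k (%ph. (L2_inner v ph)^2) = 2 * (norm k)^2 * (AV h. cos (phase k h) * correlation v h)"
  using LIMSEQ_unique[OF _ lim] by simp
qed

text \<open>The left side is continuous in L^2, the right side needs convergence in L^3; the
  approximants of an H^1 field provide both. The factor pi is 4 pi from
  \<open>mode_sum_transport\<close> divided by the 4 of \<open>smooth_flux_mode\<close>.\<close>

lemma flux_mode:
 assumes G: "has_H1_gradient v G" and k: "k \<in> lattice" "k \<noteq> 0"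
 shows "mode_sum k (%ph. L2_inner v ph * transport ph v) = pi * (norm k)^2 * (AV h. sin (phase k h) * (k \<bullet> third_moment v h))"
proof -
 obtain ph where ph: "!!n. ph n \<in> Cinf_div" "L2_tendsto ph v"
  "!!n. integrable torus (%x. norm (ph n x - v x) ^ 3)" "(%n. AV x. norm (ph n x - v x) ^ 3) \<longlonglongrightarrow> 0"
  by (rule H1_L3_approx[OF G]) blast
 have vD: "v \<in> L2_div" by (rule H1_div_subset_L2_div[OF G])
 note PL = Cinf_div_L2(1)[OF ph(1)] and vL = L2_divD[OF vD] and v3 = H1_L3(1)[OF G]
 have PD: "ph n \<in> L2_div" for n by (rule H1_div_subset_L2_div[OF has_H1_gradient_Cinf_div[OF ph(1)]])
 note P3 = L3_triangle[OF vL v3 PL ph(3)]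
 have u: "uniform_limit UNIV (%n. structure_tensor (ph n) i j l) (structure_tensor v i j l) sequentially" for i j l
  by (rule structure_tensor_uniform_limit[OF vL v3 PL ph(3,4)])
 have pt: "(%n. third_moment (ph n) h) \<longlonglongrightarrow> third_moment v h" for h
  unfolding third_moment_def by (intro tendsto_vec_lambda tendsto_sum tendsto_uniform_limitI[OF u]) simp
 obtain K where K: "!!n. norm (AV x. norm (ph n x - v x) ^ 3) <= K"
  using BseqE[OF convergent_imp_Bseq[OF convergentI[OF ph(4)]]] by blast
 define B where "B = norm k * (72 * (4 * (K + (AV x. norm (v x) ^ 3))))"
 have bd: "\<bar>k \<bullet> third_moment (ph n) h\<bar> <= B" for n h
 proof -
  have "\<bar>k \<bullet> third_moment (ph n) h\<bar> <= norm k * norm (third_moment (ph n) h)" by (rule Cauchy_Schwarz_ineq2)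
  also have "... <= norm k * (72 * (AV x. norm (ph n x) ^ 3))"
   by (intro mult_left_mono norm_third_moment_le PL P3) auto
  also have "... <= B" unfolding B_def using P3(2)[of n] K[of n] by (intro mult_left_mono) auto
  finally show ?thesis .
 qed
 have [measurable]: "third_moment (ph n) \<in> borel_measurable borel" "third_moment v \<in> borel_measurable borel" for n
  using continuous_third_moment[OF G] continuous_third_moment[OF has_H1_gradient_Cinf_div[OF ph(1)]]
  by (auto intro: cts_measurable)
 have "(%n. AV h. sin (phase k h) * (k \<bullet> third_moment (ph n) h)) \<longlonglongrightarrow> (AV h. sin (phase k h) * (k \<bullet> third_moment v h))"
 proof (rule integral_dominated_convergence[where w="%_. B"])
  show "AE h in torus. (%n. sin (phase k h) * (k \<bullet> third_moment (ph n) h)) \<longlonglongrightarrow> sin (phase k h) * (k \<bullet> third_moment v h)"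
   by (intro AE_I2 tendsto_intros pt)
  fix n
  have "\<bar>sin (phase k h) * (k \<bullet> third_moment (ph n) h)\<bar> <= 1 * B" for h
   unfolding abs_mult by (intro mult_mono bd) auto
  then show "AE h in torus. norm (sin (phase k h) * (k \<bullet> third_moment (ph n) h)) <= B" by simp
 qed (auto intro!: measurable_torusI)
 then have lim: "(%n. pi * (norm k)^2 * (AV h. sin (phase k h) * (k \<bullet> third_moment (ph n) h))) \<longlonglongrightarrow>
   pi * (norm k)^2 * (AV h. sin (phase k h) * (k \<bullet> third_moment v h))" by (intro tendsto_intros)
 have "mode_sum k (%ph'. L2_inner (ph n) ph' * transport ph' (ph n)) = pi * (norm k)^2 * (AV h. sin (phase k h) * (k \<bullet> third_moment (ph n) h))" for n
  unfolding mode_sum_transport[OF PD k(1)] smooth_flux_mode[OF ph(1) k] by simp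
 moreover have "(%n. mode_sum k (%ph'. L2_inner (ph n) ph' * transport ph' (ph n))) \<longlonglongrightarrow> mode_sum k (%ph'. L2_inner v ph' * transport ph' v)"
  unfolding mode_sum_def
  by (intro tendsto_intros L2_inner_tendsto[OF PL vL _ ph(2)] transport_tendsto[OF _ _ PL vL ph(2)]
   L2_continuous smooth_continuous smooth_trig periodic_trig k)
 ultimately show ?thesis using LIMSEQ_unique[OF _ lim] by simp
qed

section \<open>The balance of a stationary process with Brownian forcing\<close>

lemma integral_sq_add_le:
 fixes f g :: "'a => real"
 assumes [measurable]: "f \<in> borel_measurable M" "g \<in> borel_measurable M"
  and f: "integrable M (%x. (f x)^2)" and g: "integrable M (%x. (g x)^2)"
 shows "integrable M (%x. (f x + g x)^2)" "(LINT x|M. (f x + g x)^2) <= 2 * (LINT x|M. (f x)^2) + 2 * (LINT x|M. (g x)^2)"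
proof -
 have eq: "(f x + g x)^2 = (f x)^2 + 2 * (f x * g x) + (g x)^2" for x by (simp add: power2_sum)
 show i: "integrable M (%x. (f x + g x)^2)"
  unfolding eq using f g integrable_mult_of_squares[OF assms] by simp
 have "(LINT x|M. (f x + g x)^2) <= (LINT x|M. 2 * (f x)^2 + 2 * (g x)^2)"
 proof (rule integral_mono[OF i])
  show "(f x + g x)^2 <= 2 * (f x)^2 + 2 * (g x)^2" for x
   using sum_squares_bound[of "f x" "g x"] by (simp add: power2_sum)
 qed (use f g in simp)
 then show "(LINT x|M. (f x + g x)^2) <= 2 * (LINT x|M. (f x)^2) + 2 * (LINT x|M. (g x)^2)" using f g by simp
qed

text \<open>Cauchy-Schwarz in time and Fubini. The second moment is quadratic in the length of the
  interval, whereas the variance of the noise is linear; this is what makes the drift squared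
  negligible in \<open>stationary_balance\<close>.\<close>

lemma (in prob_space) time_integral:
 fixes Y :: "'a => real" and N :: "real => 'a => real"
 assumes mN [measurable]: "(%(s, w). N s w) \<in> borel_measurable (borel \<Otimes>\<^sub>M M)"
  and mY [measurable]: "Y \<in> borel_measurable M" and Y: "integrable M (%w. (Y w)^2)"
  and N: "!!s. s \<in> {a..b} ==> integrable M (%w. (N s w)^2)" "!!s. s \<in> {a..b} ==> (LINT w|M. (N s w)^2) <= K"
  and ab: "a <= b"
 defines "A \<equiv> %w. LINT s:{a..b}|lborel. N s w"
 shows "A \<in> borel_measurable M" "integrable M (%w. (A w)^2)" "(LINT w|M. (A w)^2) <= K * (b - a)^2"
  and "(LINT w|M. Y w * A w) = (LINT s:{a..b}|lborel. LINT w|M. Y w * N s w)"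
  and "set_integrable lborel {a..b} (%s. LINT w|M. Y w * N s w)"
proof -
 define J where "J = restrict_space lborel {a..b}"
 have sJ: "space J = {a..b}" by (simp add: J_def space_restrict_space)
 interpret J: finite_measure J
  by standard (simp add: J_def space_restrict_space emeasure_restrict_space ab)
 have mJ: "measure J (space J) = b - a"
  using ab by (simp add: sJ J_def measure_restrict_space)
 interpret JM: pair_sigma_finite J M ..
 have [measurable]: "(%s. s) \<in> borel_measurable J"
  unfolding J_def by (rule measurable_restrict_space1) measurable
 have A: "A w = (LINT s|J. N s w)" for w
  unfolding A_def J_def set_lebesgue_integral_def by (subst integral_restrict_space) auto
 have mNJ [measurable]: "(%(s, w). N s w) \<in> borel_measurable (J \<Otimes>\<^sub>M M)"
  using measurable_compose[OF _ mN, of "%p. (fst p, snd p)" "J \<Otimes>\<^sub>M M"] by (simp add: split_def)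
 have mNs [measurable]: "(%w. N s w) \<in> borel_measurable M" for s
  using measurable_compose[OF _ mN, of "%w. (s, w)" M] by simp
 have mNw: "(%s. N s w) \<in> borel_measurable J" if "w \<in> space M" for w
  using measurable_compose[OF measurable_Pair2'[OF that, of J] mNJ] by simp
 show mA [measurable]: "A \<in> borel_measurable M"
  unfolding A by measurable
 have le2: "ennreal ((A w)^2) <= ennreal (b - a) * (\<integral>\<^sup>+s. ennreal ((N s w)^2) \<partial>J)" if w: "w \<in> space M" for w
 proof (cases "integrable J (%s. (N s w)^2)")
  case True
  have "(LINT s|J. N s w * 1)^2 <= (LINT s|J. (N s w)^2) * (LINT s|J. 1^2)"
   by (rule integral_Cauchy_Schwarz_sq[OF mNw[OF w] _ True]) auto
  then have "(A w)^2 <= (b - a) * (LINT s|J. (N s w)^2)" using mJ by (simp add: A mult.commute)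
  then have "ennreal ((A w)^2) <= ennreal ((b - a) * (LINT s|J. (N s w)^2))" by (rule ennreal_leI)
  also have "... = ennreal (b - a) * (\<integral>\<^sup>+s. ennreal ((N s w)^2) \<partial>J)"
   using ab True by (subst nn_integral_eq_integral) (auto simp: ennreal_mult)
  finally show ?thesis .
 next
  case False
  then have "\<not> (\<integral>\<^sup>+s. ennreal ((N s w)^2) \<partial>J) < \<infinity>"
   using mNw[OF w] by (auto simp: integrable_iff_bounded)
  then have inf: "(\<integral>\<^sup>+s. ennreal ((N s w)^2) \<partial>J) = \<infinity>" by (simp add: less_top[symmetric])
  \<comment> \<open>The right side is infinite unless the interval is a point; then its factor is 0,
    but so is the integral.\<close>
  show ?thesis
  proof (cases "a = b")
   case True
   have "AE s in lborel. indicator {a..b} s *\<^sub>R N s w = 0"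
    using AE_lborel_singleton[of b] by eventually_elim (simp add: True indicator_def)
   then have "A w = 0" unfolding A_def set_lebesgue_integral_def by (rule integral_eq_zero_AE)
   then show ?thesis by simp
  next
   case False
   then show ?thesis using ab by (simp add: inf ennreal_mult_top)
  qed
 qed
 have NN: "(\<integral>\<^sup>+w. \<integral>\<^sup>+s. ennreal ((N s w)^2) \<partial>J \<partial>M) <= ennreal (K * (b - a))"
 proof -
  have "(\<integral>\<^sup>+w. \<integral>\<^sup>+s. ennreal ((N s w)^2) \<partial>J \<partial>M) = (\<integral>\<^sup>+s. \<integral>\<^sup>+w. ennreal ((N s w)^2) \<partial>M \<partial>J)"
   by (rule JM.Fubini') measurable
  also have "... <= (\<integral>\<^sup>+s. ennreal K \<partial>J)"
   using N by (intro nn_integral_mono) (auto simp: sJ nn_integral_eq_integral intro!: ennreal_leI)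
  also have "... = ennreal K * emeasure J (space J)" by simp
  also have "... = ennreal (K * (b - a))"
   unfolding J.emeasure_eq_measure mJ using ab
   by (cases "K \<ge> 0") (auto simp: ennreal_mult' ennreal_neg mult_nonpos_nonneg)
  finally show ?thesis .
 qed
 have "(\<integral>\<^sup>+w. ennreal ((A w)^2) \<partial>M) <= (\<integral>\<^sup>+w. ennreal (b - a) * (\<integral>\<^sup>+s. ennreal ((N s w)^2) \<partial>J) \<partial>M)"
  by (rule nn_integral_mono) (rule le2)
 also have "... = ennreal (b - a) * (\<integral>\<^sup>+w. \<integral>\<^sup>+s. ennreal ((N s w)^2) \<partial>J \<partial>M)"
  by (rule nn_integral_cmult) measurable
 also have "... <= ennreal (b - a) * ennreal (K * (b - a))" by (rule mult_left_mono[OF NN]) simp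
 also have "... = ennreal (K * (b - a)^2)"
  using ab by (simp add: ennreal_mult'[symmetric] power2_eq_square mult_ac)
 finally have le: "(\<integral>\<^sup>+w. ennreal ((A w)^2) \<partial>M) <= ennreal (K * (b - a)^2)" .
 then show iA: "integrable M (%w. (A w)^2)"
  by (intro integrableI_bounded) (auto intro: le_less_trans)
 have K0: "0 <= K" by (rule order_trans[OF _ N(2)[of a]]) (use ab in auto)
 show "(LINT w|M. (A w)^2) <= K * (b - a)^2"
  using le iA K0 by (subst (asm) nn_integral_eq_integral) auto
 have iYN: "integrable (J \<Otimes>\<^sub>M M) (%(s, w). Y w * N s w)"
 proof (rule lint_bound)
  have "(\<integral>\<^sup>+p. ennreal ((Y (snd p))^2 + (N (fst p) (snd p))^2) \<partial>(J \<Otimes>\<^sub>M M))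
    = (\<integral>\<^sup>+s. \<integral>\<^sup>+w. ennreal ((Y w)^2 + (N s w)^2) \<partial>M \<partial>J)"
   by (subst nn_integral_fst[symmetric]) (auto simp: split_def)
  also have "... <= (\<integral>\<^sup>+s. ennreal ((LINT w|M. (Y w)^2) + K) \<partial>J)"
  proof (rule nn_integral_mono)
   fix s assume "s \<in> space J"
   then have s: "s \<in> {a..b}" by (simp add: sJ)
   show "(\<integral>\<^sup>+w. ennreal ((Y w)^2 + (N s w)^2) \<partial>M) <= ennreal ((LINT w|M. (Y w)^2) + K)"
   proof -
    have i: "integrable M (%w. (Y w)^2 + (N s w)^2)" using N(1)[OF s] Y by simp
    have "(\<integral>\<^sup>+w. ennreal ((Y w)^2 + (N s w)^2) \<partial>M) = ennreal (LINT w|M. (Y w)^2 + (N s w)^2)"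
     by (rule nn_integral_eq_integral[OF i]) simp
    also have "... <= ennreal ((LINT w|M. (Y w)^2) + K)"
     using N[OF s] Y by (intro ennreal_leI) simp
    finally show ?thesis .
   qed
  qed
  also have "... < \<infinity>"
   by (simp add: J.emeasure_eq_measure ennreal_mult_less_top)
  finally show "integrable (J \<Otimes>\<^sub>M M) (%p. (Y (snd p))^2 + (N (fst p) (snd p))^2)"
   by (intro integrableI_nonneg) (auto simp: split_def)
  have "\<bar>x * y\<bar> <= x^2 + y^2" for x y :: real
   using sum_squares_bound[of "\<bar>x\<bar>" "\<bar>y\<bar>"] mult_nonneg_nonneg[of "\<bar>x\<bar>" "\<bar>y\<bar>"]
   by (simp add: abs_mult del: mult_nonneg_nonneg)
  then show "AE p in J \<Otimes>\<^sub>M M. norm (case p of (s, w) => Y w * N s w) <= norm ((Y (snd p))^2 + (N (fst p) (snd p))^2)"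
   by (auto simp: split_def)
 qed measurable
 have "(LINT w|M. Y w * A w) = (LINT w|M. LINT s|J. Y w * N s w)" by (simp add: A)
 also have "... = (LINT s|J. LINT w|M. Y w * N s w)"
  by (rule JM.Fubini_integral[OF iYN])
 also have "... = (LINT s:{a..b}|lborel. LINT w|M. Y w * N s w)"
  unfolding J_def set_lebesgue_integral_def by (subst integral_restrict_space) auto
 finally show "(LINT w|M. Y w * A w) = (LINT s:{a..b}|lborel. LINT w|M. Y w * N s w)" .
 have "integrable J (%s. LINT w|M. Y w * N s w)"
  using JM.integrable_fst[OF iYN] .
 then show "set_integrable lborel {a..b} (%s. LINT w|M. Y w * N s w)"
  by (simp add: J_def set_integrable_def integrable_restrict_space)
qed

text \<open>Ito's formula for the square, at stationarity: expand \<open>X\<^sup>2\<close> over a short time interval.  Its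
 length is the variance of the noise, so that all remainders are of higher order.\<close>

lemma (in prob_space) stationary_balance:
 fixes X N Z :: "real => 'a => real"
 assumes mN [measurable]: "(%(s, w). N s w) \<in> borel_measurable (borel \<Otimes>\<^sub>M M)"
  and mX [measurable]: "!!s. t <= s ==> X s \<in> borel_measurable M"
  and X: "!!s. t <= s ==> integrable M (%w. (X s w)^2)" "!!s. t <= s ==> (LINT w|M. (X s w)^2) = (LINT w|M. (X t w)^2)"
  and N: "!!s. s \<in> {t..t+1} ==> integrable M (%w. (N s w)^2)" "!!s. s \<in> {t..t+1} ==> (LINT w|M. (N s w)^2) <= K"
  and XN: "!!s. s \<in> {t..t+1} ==> (LINT w|M. X s w * N s w) = c"
  and mZ [measurable]: "!!r. r \<in> {0<..1} ==> Z r \<in> borel_measurable M"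
  and Z: "!!r. r \<in> {0<..1} ==> integrable M (%w. (Z r w)^2)" "!!r. r \<in> {0<..1} ==> (LINT w|M. (Z r w)^2) = q * r"
    "!!r. r \<in> {0<..1} ==> (LINT w|M. X t w * Z r w) = 0"
  and eqn: "!!r. r \<in> {0<..1} ==> AE w in M. X (t + r) w - X t w = (LINT s:{t..t+r}|lborel. N s w) + Z r w"
 shows "2 * c + q = 0"
proof -
 define A where "A r w = (LINT s:{t..t+r}|lborel. N s w)" for r w
 \<comment> \<open>Bounds the second moment of an increment by \<open>C\<close> times its length:
   twice the drift part, at most K x^2, plus twice the noise part q x, with x^2 <= x on the unit
   interval.\<close>
 define C where "C = 2 * K + 2 * q"
 have K0: "0 <= K" by (rule order_trans[OF _ N(2)[of t]]) auto
 have q0: "0 <= q" using Z(2)[of 1] Bochner_Integration.integral_nonneg[of M "%w. (Z 1 w)^2"] by simp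
 have bound: "\<bar>2 * c + q\<bar> <= (2 * sqrt C * sqrt K + K + 2 * sqrt K * sqrt q) * sqrt r" if r: "r \<in> {0<..1}" for r
 proof -
  have N': "s \<in> {t..t+r} ==> integrable M (%w. (N s w)^2)" "s \<in> {t..t+r} ==> (LINT w|M. (N s w)^2) <= K" for s
   using N[of s] r by auto
  have r0: "0 <= r" "r <= 1" "t <= t + r" using r by auto
  have Ab [measurable]: "A x \<in> borel_measurable M" "integrable M (%w. (A x w)^2)" "(LINT w|M. (A x w)^2) <= K * x^2"
   if x: "x \<in> {0<..1}" for x
  proof -
   have N'': "s \<in> {t..t+x} ==> integrable M (%w. (N s w)^2)" "s \<in> {t..t+x} ==> (LINT w|M. (N s w)^2) <= K" for s
    using N[of s] x by auto
   have "t <= t + x" using x by simp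
   from time_integral(1-3)[OF mN _ _ N'' this, of "%_. 0", folded A_def]
   show "A x \<in> borel_measurable M" "integrable M (%w. (A x w)^2)" "(LINT w|M. (A x w)^2) <= K * x^2" by auto
  qed
  note Xt = mX[OF order_refl] X(1)[OF order_refl]
  have inc: "integrable M (%w. (A x w + Z x w)^2)" "(LINT w|M. (A x w + Z x w)^2) <= C * x" if x: "x \<in> {0<..1}" for x
  proof -
   show "integrable M (%w. (A x w + Z x w)^2)" by (rule integral_sq_add_le(1)[OF Ab(1)[OF x] mZ[OF x] Ab(2)[OF x] Z(1)[OF x]])
   have "(LINT w|M. (A x w + Z x w)^2) <= 2 * (K * x^2) + 2 * (q * x)"
    using integral_sq_add_le(2)[OF Ab(1)[OF x] mZ[OF x] Ab(2)[OF x] Z(1)[OF x]] Ab(3)[OF x] Z(2)[OF x] by simp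
   also have "x^2 <= x" using x by (simp add: power2_eq_square mult_left_le_one_le)
   then have "2 * (K * x^2) + 2 * (q * x) <= 2 * (K * x) + 2 * (q * x)" using K0 q0 by (intro add_mono mult_left_mono) auto
   finally show "(LINT w|M. (A x w + Z x w)^2) <= C * x" by (simp add: C_def algebra_simps)
  qed
  \<comment> \<open>The second moments of \<open>X\<close> at both ends cancel by stationarity, and
    the noise is uncorrelated with \<open>X t\<close>. Of the five remaining contributions only 2 c
    r and q r will be of first order in r.\<close>
  have expand: "2 * (LINT w|M. X t w * A r w) + (LINT w|M. (A r w)^2) + 2 * (LINT w|M. A r w * Z r w) + q * r = 0"
  proof -
   have "(LINT w|M. (X t w)^2) = (LINT w|M. (X (t + r) w)^2)" using X(2)[OF r0(3)] by simp
   also have "... = (LINT w|M. (X t w + (A r w + Z r w))^2)"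
   proof (rule integral_cong_AE)
    show "AE w in M. (X (t + r) w)^2 = (X t w + (A r w + Z r w))^2"
     using eqn[OF r] unfolding A_def[symmetric]
    proof eventually_elim
     case (elim w)
     then have "X (t + r) w = X t w + (A r w + Z r w)" by linarith
     then show ?case by simp
    qed
   qed (intro borel_measurable_power borel_measurable_add Ab(1)[OF r] mZ[OF r] mX[OF r0(3)] mX[OF order_refl])+
   also have "... = (LINT w|M. (X t w)^2 + 2 * (X t w * A r w) + 2 * (X t w * Z r w) + (A r w)^2 + 2 * (A r w * Z r w) + (Z r w)^2)"
    by (intro lint_cong) (auto simp: power2_eq_square algebra_simps)
   also have "... = (LINT w|M. (X t w)^2) + 2 * (LINT w|M. X t w * A r w) + 2 * (LINT w|M. X t w * Z r w) + (LINT w|M. (A r w)^2)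
     + 2 * (LINT w|M. A r w * Z r w) + (LINT w|M. (Z r w)^2)"
    by (intro has_bochner_integral_integral_eq has_bochner_integral_add has_bochner_integral_mult_right has_bochner_integral_integrable
     integrable_mult_of_squares Xt Ab[OF r] Z(1)[OF r] mZ[OF r])
   finally show ?thesis using Z[OF r] by simp
  qed
  have XA2: "set_integrable lborel {t..t+r} (%s. LINT w|M. X t w * N s w)"
   by (rule time_integral(5)[OF mN Xt N' r0(3)]) simp_all
  have XA1: "(LINT w|M. X t w * A r w) = (LINT s:{t..t+r}|lborel. LINT w|M. X t w * N s w)"
   unfolding A_def by (rule time_integral(4)[OF mN Xt N' r0(3)]) simp_all
  note XA = XA1 XA2
  \<comment> \<open>The drift at time s is compared with \<open>X t\<close> instead of
    \<open>X s\<close>. The error is an increment over a time at most r, of size the square root of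
    r, hence of higher order after integration.\<close>
  have close: "\<bar>(LINT w|M. X t w * N s w) - c\<bar> <= sqrt (C * r) * sqrt K" if s: "s \<in> {t..t+r}" for s
  proof (cases "s = t")
   case True
   then show ?thesis using XN[of t] r0 K0 q0 by (simp add: C_def)
  next
   case False
   define x where "x = s - t"
   have x: "x \<in> {0<..1}" "x <= r" "s \<in> {t..t+1}" "t <= s" using s r False by (auto simp: x_def)
   have mNs: "N s \<in> borel_measurable M"
    using measurable_compose[OF _ mN, of "%w. (s, w)" M] by simp
   have "c - (LINT w|M. X t w * N s w) = (LINT w|M. X s w * N s w) - (LINT w|M. X t w * N s w)" using XN[OF x(3)] by simp
   also have "... = (LINT w|M. X s w * N s w - X t w * N s w)"
    by (intro Bochner_Integration.integral_diff[symmetric] integrable_mult_of_squares mX X N mNs x) simp_all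
   also have "... = (LINT w|M. (A x w + Z x w) * N s w)"
   proof (rule integral_cong_AE)
    show "AE w in M. X s w * N s w - X t w * N s w = (A x w + Z x w) * N s w"
     using eqn[OF x(1)] unfolding A_def[symmetric]
    proof eventually_elim
     case (elim w)
     then have "X s w - X t w = A x w + Z x w" by (simp add: x_def)
     then show ?case by (simp add: left_diff_distrib[symmetric])
    qed
   qed (intro borel_measurable_diff borel_measurable_times borel_measurable_add Ab(1)[OF x(1)] mZ[OF x(1)] mX[OF x(4)] mX[OF order_refl] mNs)+
   finally have "\<bar>(LINT w|M. X t w * N s w) - c\<bar> = \<bar>LINT w|M. (A x w + Z x w) * N s w\<bar>" by simp
   also have "... <= sqrt (LINT w|M. (A x w + Z x w)^2) * sqrt (LINT w|M. (N s w)^2)"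
    by (rule integral_Cauchy_Schwarz) (use inc[OF x(1)] N(1)[OF x(3)] mNs Ab(1)[OF x(1)] mZ[OF x(1)] in auto)
   also have "... <= sqrt (C * r) * sqrt K"
   proof (intro mult_mono real_sqrt_le_mono)
    have "C * x <= C * r" using x K0 q0 by (intro mult_left_mono) (auto simp: C_def)
    then show "(LINT w|M. (A x w + Z x w)^2) <= C * r" using inc(2)[OF x(1)] by simp
   qed (use N(2)[OF x(3)] K0 q0 r0 in \<open>auto simp: C_def\<close>)
   finally show ?thesis .
  qed
  have "\<bar>(LINT w|M. X t w * A r w) - c * r\<bar> <= sqrt (C * r) * sqrt K * r"
  proof -
   have m: "measure lborel {t..t+r} = r" using r0 by simp
   have ci: "set_integrable lborel {t..t+r} (%_. d)" for d :: real
    unfolding set_integrable_def by (rule borel_integrable_compact) auto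
   have ct: "(LINT s:{t..t+r}|lborel. d) = d * r" for d :: real
    using m by (simp add: set_lebesgue_integral_def)
   have "(LINT w|M. X t w * A r w) - c * r = (LINT s:{t..t+r}|lborel. (LINT w|M. X t w * N s w) - c)"
    unfolding XA(1) using set_integral_diff(2)[OF XA(2) ci[of c]] ct[of c] by argo
   also have "\<bar>\<dots>\<bar> <= (LINT s:{t..t+r}|lborel. sqrt (C * r) * sqrt K)"
   proof -
    have "\<bar>LINT s:{t..t+r}|lborel. (LINT w|M. X t w * N s w) - c\<bar> <= (LINT s:{t..t+r}|lborel. \<bar>(LINT w|M. X t w * N s w) - c\<bar>)"
     using set_integral_norm_bound[OF set_integral_diff(1)[OF XA(2) ci]] by simp
    also have "... <= (LINT s:{t..t+r}|lborel. sqrt (C * r) * sqrt K)"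
     by (rule set_integral_mono[OF set_integrable_abs[OF set_integral_diff(1)[OF XA(2) ci]] ci close])
    finally show ?thesis .
   qed
   finally show ?thesis by (simp add: ct mult_ac)
  qed
  moreover have "\<bar>LINT w|M. A r w * Z r w\<bar> <= sqrt K * sqrt q * sqrt r * r"
  proof -
   have "\<bar>LINT w|M. A r w * Z r w\<bar> <= sqrt (LINT w|M. (A r w)^2) * sqrt (LINT w|M. (Z r w)^2)"
    by (intro integral_Cauchy_Schwarz Ab[OF r] Z(1)[OF r] mZ[OF r])
   also have "... <= sqrt (K * r^2) * sqrt (q * r)"
    using Ab(3)[OF r] Z(2)[OF r] by (intro mult_mono real_sqrt_le_mono) (auto simp: q0 r0 K0)
   also have "... = sqrt K * sqrt q * sqrt r * r" using r0 by (simp add: real_sqrt_mult)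
   finally show ?thesis .
  qed
  moreover have "0 <= (LINT w|M. (A r w)^2)" "(LINT w|M. (A r w)^2) <= K * r^2" using Ab(3)[OF r] by auto
  ultimately have "\<bar>(2 * c + q) * r\<bar> <= 2 * (sqrt (C * r) * sqrt K * r) + K * r^2 + 2 * (sqrt K * sqrt q * sqrt r * r)"
  proof -
   have arith: "\<bar>2 * cr + qr\<bar> <= 2 * e1 + e3 + 2 * e2"
    if "\<bar>xa - cr\<bar> <= e1" "\<bar>az\<bar> <= e2" "0 <= a2" "a2 <= e3" "2 * xa + a2 + 2 * az + qr = 0" for xa cr az a2 qr e1 e2 e3 :: real
    using that by linarith
   assume "\<bar>(LINT w|M. X t w * A r w) - c * r\<bar> <= sqrt (C * r) * sqrt K * r" "\<bar>LINT w|M. A r w * Z r w\<bar> <= sqrt K * sqrt q * sqrt r * r"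
    "0 <= (LINT w|M. (A r w)^2)" "(LINT w|M. (A r w)^2) <= K * r^2"
   from arith[OF this expand] show ?thesis by (simp add: distrib_right mult.assoc)
  qed
  also have "... = (2 * sqrt C * sqrt K * sqrt r + K * r + 2 * sqrt K * sqrt q * sqrt r) * r"
   by (simp add: real_sqrt_mult power2_eq_square algebra_simps)
  also have "... <= ((2 * sqrt C * sqrt K + K + 2 * sqrt K * sqrt q) * sqrt r) * r"
  proof (rule mult_right_mono)
   have "r <= sqrt r" using r0 by (intro real_le_rsqrt) (simp add: power2_eq_square mult_left_le_one_le)
   then have "K * r <= K * sqrt r" using K0 by (rule mult_left_mono)
   then show "2 * sqrt C * sqrt K * sqrt r + K * r + 2 * sqrt K * sqrt q * sqrt r <= (2 * sqrt C * sqrt K + K + 2 * sqrt K * sqrt q) * sqrt r"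
    by (simp add: distrib_right)
  qed (use r0 in simp)
  finally have "\<bar>2 * c + q\<bar> * r <= ((2 * sqrt C * sqrt K + K + 2 * sqrt K * sqrt q) * sqrt r) * r"
   using r0 by (simp add: abs_mult)
  then show ?thesis using r by (simp add: mult_le_cancel_right)
 qed
 \<comment> \<open>After division by r all errors are at most this constant times the square root of
   r, and r tends to zero.\<close>
 define B where "B = 2 * sqrt C * sqrt K + K + 2 * sqrt K * sqrt q"
 have lim: "((%r. B * sqrt r) \<longlongrightarrow> B * sqrt 0) (at_right 0)"
  by (intro tendsto_intros)
 have "\<bar>2 * c + q\<bar> <= B * sqrt 0"
 proof (rule tendsto_lowerbound[OF lim])
  show "\<forall>\<^sub>F r in at_right 0. \<bar>2 * c + q\<bar> <= B * sqrt r"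
   unfolding eventually_at_right_field B_def using bound by (intro exI[of _ 1]) auto
 qed simp
 then show ?thesis by simp
qed

section \<open>Brownian increments and their square-summable combinations\<close>

lemma usual_filtrationD:
 assumes "usual_filtration M F"
 shows "0 <= t ==> space (F t) = space M" "0 <= t ==> sets (F t) \<subseteq> sets M"
  "0 <= s ==> s <= t ==> sets (F s) \<subseteq> sets (F t)"
proof -
 note F = assms[unfolded usual_filtration_def]
 from F have "\<forall>t\<ge>0. subalgebra M (F t)" by (rule conjunct1)
 then show "0 <= t ==> space (F t) = space M" "0 <= t ==> sets (F t) \<subseteq> sets M"
  by (simp_all add: subalgebra_def)
 from F[THEN conjunct2, THEN conjunct1] show "0 <= s ==> s <= t ==> sets (F s) \<subseteq> sets (F t)" by simp
qed

lemma measurable_filtration: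
 assumes F: "usual_filtration M F" and t: "0 <= t" and f: "f \<in> F t \<rightarrow>\<^sub>M N"
 shows "f \<in> M \<rightarrow>\<^sub>M N"
 by (rule measurable_from_subalg[OF _ f]) (use F[unfolded usual_filtration_def, THEN conjunct1] t in simp)

lemma (in prob_space)
 assumes F: "usual_filtration M F" and \<beta>: "brownian_family M F \<beta>" and st: "0 <= s" "s < t"
 shows brownian_increment_measurable: "(%w. \<beta> k t w - \<beta> k s w) \<in> borel_measurable M"
  and brownian_increment_sq_integrable: "integrable M (%w. (\<beta> k t w - \<beta> k s w)^2)"
  and brownian_increment_sq: "expectation (%w. (\<beta> k t w - \<beta> k s w)^2) = t - s"
  and brownian_increment_cross: "j \<noteq> k ==> expectation (%w. (\<beta> j t w - \<beta> j s w) * (\<beta> k t w - \<beta> k s w)) = 0"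
  and brownian_increment_past: "X \<in> borel_measurable (F s) ==> integrable M X ==> expectation (%w. X w * (\<beta> k t w - \<beta> k s w)) = 0"
proof -
 let ?B = "%k w. \<beta> k t w - \<beta> k s w"
 have "\<beta> k r \<in> borel_measurable M" if "0 <= r" for k r
  by (rule measurable_filtration[OF F that]) (use \<beta> that in \<open>simp add: brownian_family_def\<close>)
 then show m [measurable]: "?B k \<in> borel_measurable M" for k
  using st by (intro borel_measurable_diff) auto
 have sd: "0 < sqrt (t - s)" using st by simp
 have D: "distributed M lborel (?B k) (normal_density 0 (sqrt (t - s)))" for k
  using \<beta> st unfolding brownian_family_def by blast
 have mean: "expectation (?B k) = 0" for k by (rule normal_distributed_expectation[OF sd D])
 have int: "integrable M (?B k)" for k
  by (rule distributed_integrable_var[OF D]) (use integrable_normal_moment_nz_1[OF sd] in auto)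
 have "integrable lborel (%x. normal_density 0 (sqrt (t - s)) x * (x - 0) ^ 2)" by (rule integrable_normal_moment[OF sd])
 then show "integrable M (%w. (?B k w)^2)"
  using distributed_integrable[OF D, of "%x. x^2"] by simp
 show "expectation (%w. (?B k w)^2) = t - s"
  using normal_distributed_variance[OF sd D, unfolded mean] st by simp
 show "expectation (%w. ?B j w * ?B k w) = 0" if jk: "j \<noteq> k"
 proof -
  have "indep_vars (%_. \<Pi>\<^sub>M t\<in>{0..}. borel) (%k w. \<lambda>t\<in>{0..}. \<beta> k t w) UNIV"
   using \<beta> unfolding brownian_family_def by blast
  then have "indep_vars (%_. \<Pi>\<^sub>M t\<in>{0..}. borel) (%k w. \<lambda>t\<in>{0..}. \<beta> k t w) {j, k}"
   by (rule indep_vars_subset) simp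
  then have "indep_vars (%_. borel) (%k w. (%f. f t - f s) (\<lambda>t\<in>{0..}. \<beta> k t w)) {j, k}"
  proof (rule indep_vars_compose2)
   show "(%f :: real => real. f t - f s) \<in> borel_measurable (\<Pi>\<^sub>M t\<in>{0..}. borel)" if "i \<in> {j, k}" for i
    using st by (intro borel_measurable_diff measurable_component_singleton) auto
  qed
  then have "indep_vars (%_. borel) ?B {j, k}" using st by simp
  from indep_vars_lebesgue_integral[OF _ this] int jk mean show ?thesis by simp
 qed
 assume X: "X \<in> borel_measurable (F s)" "integrable M X"
 have XM [measurable]: "X \<in> borel_measurable M" by (rule measurable_filtration[OF F st(1) X(1)])
 have ind: "indep_set (sets (F s)) (sets (vimage_algebra (space M) (%w k. \<beta> k t w - \<beta> k s w) (\<Pi>\<^sub>M k\<in>UNIV. borel)))"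
  using \<beta> st unfolding brownian_family_def by blast
 \<comment> \<open>Independence is assumed for the increments of the whole family jointly; the
   single increment generates a smaller sigma-algebra through the coordinate projection.\<close>
 have "indep_var borel X borel (?B k)"
  unfolding indep_var_eq
 proof (intro conjI)
  show "indep_set (sigma_sets (space M) {X -` A \<inter> space M |A. A \<in> sets borel}) (sigma_sets (space M) {?B k -` A \<inter> space M |A. A \<in> sets borel})"
   unfolding indep_set_def
  proof (rule indep_sets_mono_sets[OF ind[unfolded indep_set_def]])
   fix i :: bool
   have 1: "sigma_sets (space M) {X -` A \<inter> space M |A. A \<in> sets borel} \<subseteq> sets (F s)"
   proof -
    have "{X -` A \<inter> space M |A. A \<in> sets borel} \<subseteq> sets (F s)"
     using measurable_sets[OF X(1)] usual_filtrationD(1)[OF F st(1)] by auto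
    from sets.sigma_sets_subset[OF this] show ?thesis by (simp add: usual_filtrationD(1)[OF F st(1)])
   qed
   let ?V = "vimage_algebra (space M) (%w k. \<beta> k t w - \<beta> k s w) (\<Pi>\<^sub>M k\<in>(UNIV::nat set). borel :: real measure)"
   have "(%w k. \<beta> k t w - \<beta> k s w) \<in> ?V \<rightarrow>\<^sub>M (\<Pi>\<^sub>M k\<in>UNIV. borel)"
    by (rule measurable_vimage_algebra1) (auto simp: space_PiM)
   then have "(%w. (%k. \<beta> k t w - \<beta> k s w) k) \<in> borel_measurable ?V"
    by (rule measurable_compose[OF _ measurable_component_singleton]) simp
   then have "?B k -` A \<inter> space M \<in> sets ?V" if "A \<in> sets borel" for A
    using measurable_sets[OF _ that, of "?B k" ?V] by simp
   then have 2: "sigma_sets (space M) {?B k -` A \<inter> space M |A. A \<in> sets borel} \<subseteq> sets ?V"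
    using sets.sigma_sets_subset[of "{?B k -` A \<inter> space M |A. A \<in> sets borel}" ?V] by auto
   show "(case i of True => sigma_sets (space M) {X -` A \<inter> space M |A. A \<in> sets borel} | False => sigma_sets (space M) {?B k -` A \<inter> space M |A. A \<in> sets borel})
    \<subseteq> (case i of True => sets (F s) | False => sets ?V)"
    using 1 2 by (cases i) auto
  qed
 qed measurable
 from indep_var_lebesgue_integral[OF this X(2) int] mean show "expectation (%w. X w * ?B k w) = 0" by simp
qed

text \<open>The isometry for a deterministic integrand. The weak formulation provides only almost
  sure convergence of the series; Fatou's lemma applied to blocks of it yields a mean-square rate,
  with which the second moments of the partial sums pass to the limit.\<close>

lemma (in prob_space)
 fixes a :: "nat => real"
 assumes F: "usual_filtration M F" and \<beta>: "brownian_family M F \<beta>" and st: "0 <= s" "s < t"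
  and a: "summable (%k. (a k)^2)" and mZ [measurable]: "Z \<in> borel_measurable M"
  and Z: "AE w in M. (%k. a k * (\<beta> k t w - \<beta> k s w)) sums Z w"
 shows brownian_sum_sq_integrable: "integrable M (%w. (Z w)^2)"
  and brownian_sum_sq: "expectation (%w. (Z w)^2) = (\<Sum>k. (a k)^2) * (t - s)"
  and brownian_sum_past: "X \<in> borel_measurable (F s) ==> integrable M (%w. (X w)^2) ==> expectation (%w. X w * Z w) = 0"
proof -
 let ?B = "%k w. \<beta> k t w - \<beta> k s w"
 note mB [measurable] = brownian_increment_measurable[OF F \<beta> st]
 note B2 = brownian_increment_sq_integrable[OF F \<beta> st]
 define S where "S I w = (\<Sum>k\<in>I. a k * ?B k w)" for I w
 have mS [measurable]: "S I \<in> borel_measurable M" for I unfolding S_def by measurable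
 have iB: "integrable M (%w. ?B j w * ?B k w)" for j k
  by (rule integrable_mult_of_squares[OF mB mB B2 B2])
 have S2: "integrable M (%w. (S I w)^2)" "expectation (%w. (S I w)^2) = (\<Sum>k\<in>I. (a k)^2) * (t - s)" if I: "finite I" for I
 proof -
  have eq: "(S I w)^2 = (\<Sum>j\<in>I. \<Sum>k\<in>I. (a j * a k) * (?B j w * ?B k w))" for w
   unfolding S_def power2_eq_square sum_product by (simp add: mult_ac)
  show "integrable M (%w. (S I w)^2)" unfolding eq using iB by simp
  have "expectation (%w. (S I w)^2) = (\<Sum>j\<in>I. \<Sum>k\<in>I. (a j * a k) * expectation (%w. ?B j w * ?B k w))"
   unfolding eq using iB by simp
  also have "... = (\<Sum>j\<in>I. \<Sum>k\<in>I. if k = j then (a j)^2 * (t - s) else 0)"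
  proof (intro sum.cong refl)
   fix j k
   show "(a j * a k) * expectation (%w. ?B j w * ?B k w) = (if k = j then (a j)^2 * (t - s) else 0)"
    using brownian_increment_cross[OF F \<beta> st, of j k] brownian_increment_sq[OF F \<beta> st, of j] by (auto simp: power2_eq_square)
  qed
  also have "... = (\<Sum>k\<in>I. (a k)^2) * (t - s)" using I by (simp add: sum_distrib_right)
  finally show "expectation (%w. (S I w)^2) = (\<Sum>k\<in>I. (a k)^2) * (t - s)" .
 qed
 \<comment> \<open>The tail variance, which bounds the mean square distance of \<open>Z\<close> to
   its n-th partial sum.\<close>
 define R where "R n = (\<Sum>k. (a (k + n))^2) * (t - s)" for n
 have as: "summable (%k. (a (k + n))^2)" for n using a summable_iff_shift[of "%k. (a k)^2" n] by simp
 have R0: "0 <= R n" for n unfolding R_def using st as by (intro mult_nonneg_nonneg suminf_nonneg) auto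
 have tail: "integrable M (%w. (Z w - S {..<n} w)^2)" "expectation (%w. (Z w - S {..<n} w)^2) <= R n" for n
 proof -
  have "(\<integral>\<^sup>+w. ennreal ((Z w - S {..<n} w)^2) \<partial>M) = (\<integral>\<^sup>+w. liminf (%m. ennreal ((S {n..<m + n} w)^2)) \<partial>M)"
  proof (rule nn_integral_cong_AE)
   show "AE w in M. ennreal ((Z w - S {..<n} w)^2) = liminf (%m. ennreal ((S {n..<m + n} w)^2))"
    using Z
   proof eventually_elim
    case (elim w)
    have "(%m. S {..<m + n} w - S {..<n} w) \<longlonglongrightarrow> Z w - S {..<n} w"
     using LIMSEQ_ignore_initial_segment[OF elim[unfolded sums_def], of n] unfolding S_def by (intro tendsto_intros)
    moreover have "S {..<m + n} w - S {..<n} w = S {n..<m + n} w" for m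
     unfolding S_def by (subst sum_diff[symmetric]) (auto intro!: sum.cong)
    ultimately have "(%m. ennreal ((S {n..<m + n} w)^2)) \<longlonglongrightarrow> ennreal ((Z w - S {..<n} w)^2)"
     by (auto intro!: tendsto_intros)
    then show ?case by (intro lim_imp_Liminf[symmetric]) auto
   qed
  qed
  also have "... <= liminf (%m. \<integral>\<^sup>+w. ennreal ((S {n..<m + n} w)^2) \<partial>M)"
   by (rule nn_integral_liminf) measurable
  also have "... <= ennreal (R n)"
  proof (rule Liminf_le)
   show "\<forall>\<^sub>F m in sequentially. (\<integral>\<^sup>+w. ennreal ((S {n..<m + n} w)^2) \<partial>M) <= ennreal (R n)"
   proof (intro always_eventually allI)
    fix m
    have "(\<integral>\<^sup>+w. ennreal ((S {n..<m + n} w)^2) \<partial>M) = ennreal ((\<Sum>k\<in>{n..<m + n}. (a k)^2) * (t - s))"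
     using S2[of "{n..<m + n}"] by (subst nn_integral_eq_integral) auto
    also have "(\<Sum>k\<in>{n..<m + n}. (a k)^2) = (\<Sum>k<m. (a (k + n))^2)"
     using sum.shift_bounds_nat_ivl[of "%k. (a k)^2" 0 n m] by (simp add: atLeast0LessThan)
    also have "ennreal ((\<Sum>k<m. (a (k + n))^2) * (t - s)) <= ennreal (R n)"
     unfolding R_def using st by (intro ennreal_leI mult_right_mono sum_le_suminf[OF as]) auto
    finally show "(\<integral>\<^sup>+w. ennreal ((S {n..<m + n} w)^2) \<partial>M) <= ennreal (R n)" .
   qed
  qed simp
  finally have le: "(\<integral>\<^sup>+w. ennreal ((Z w - S {..<n} w)^2) \<partial>M) <= ennreal (R n)" .
  then show i: "integrable M (%w. (Z w - S {..<n} w)^2)"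
   by (intro integrableI_bounded) (auto intro: le_less_trans)
  show "expectation (%w. (Z w - S {..<n} w)^2) <= R n"
   using le i R0[of n] by (subst (asm) nn_integral_eq_integral) auto
 qed
 have Rlim: "R \<longlonglongrightarrow> 0"
 proof -
  have "(%n. (\<Sum>k. (a (k + n))^2) * (t - s)) \<longlonglongrightarrow> 0 * (t - s)"
   by (intro tendsto_intros suminf_exist_split2[OF a])
  then show ?thesis by (simp add: R_def[abs_def])
 qed
 have mD: "(%w. Z w - S {..<n} w) \<in> borel_measurable M" for n by measurable
 show iZ: "integrable M (%w. (Z w)^2)"
  using tail(1)[of 0] by (simp add: S_def)
 have Rb: "sqrt (R n) <= sqrt (R 0)" for n
 proof (rule real_sqrt_le_mono)
  have "(\<Sum>k. (a (k + n))^2) <= (\<Sum>k. (a k)^2)"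
   using suminf_split_initial_segment[OF a, of n] by (simp add: sum_nonneg)
  then show "R n <= R 0" unfolding R_def using st by (intro mult_right_mono) auto
 qed
 have "(%n. expectation (%w. (S {..<n} w)^2)) \<longlonglongrightarrow> expectation (%w. (Z w)^2)"
 proof -
  have le: "\<bar>expectation (%w. (S {..<n} w)^2) - expectation (%w. (Z w)^2)\<bar> <= 2 * sqrt (expectation (%w. (Z w)^2)) * sqrt (R n) + R n" for n
  proof -
   let ?D = "%w. Z w - S {..<n} w"
   have iZD: "integrable M (%w. Z w * ?D w)" by (rule integrable_mult_of_squares[OF mZ mD iZ tail(1)])
   have "expectation (%w. (S {..<n} w)^2) = expectation (%w. (Z w)^2 - 2 * (Z w * ?D w) + (?D w)^2)"
    by (intro lint_cong) (auto simp: power2_eq_square algebra_simps)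
   also have "... = expectation (%w. (Z w)^2) - 2 * expectation (%w. Z w * ?D w) + expectation (%w. (?D w)^2)"
    using iZ iZD tail(1)[of n] by simp
   finally have e: "expectation (%w. (S {..<n} w)^2) - expectation (%w. (Z w)^2) = expectation (%w. (?D w)^2) - 2 * expectation (%w. Z w * ?D w)" by simp
   have "\<bar>expectation (%w. Z w * ?D w)\<bar> <= sqrt (expectation (%w. (Z w)^2)) * sqrt (expectation (%w. (?D w)^2))"
    by (rule integral_Cauchy_Schwarz[OF mZ mD iZ tail(1)])
   also have "... <= sqrt (expectation (%w. (Z w)^2)) * sqrt (R n)"
    using tail(2)[of n] by (intro mult_left_mono real_sqrt_le_mono) auto
   finally have 1: "\<bar>expectation (%w. Z w * ?D w)\<bar> <= sqrt (expectation (%w. (Z w)^2)) * sqrt (R n)" .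
   have "0 <= expectation (%w. (?D w)^2)" by (intro integral_nonneg_AE) auto
   then show ?thesis unfolding e using 1 tail(2)[of n] by linarith
  qed
  have "(%n. 2 * sqrt (expectation (%w. (Z w)^2)) * sqrt (R n) + R n) \<longlonglongrightarrow> 2 * sqrt (expectation (%w. (Z w)^2)) * sqrt 0 + 0"
   by (intro tendsto_intros Rlim)
  then have up: "(%n. 2 * sqrt (expectation (%w. (Z w)^2)) * sqrt (R n) + R n) \<longlonglongrightarrow> 0" by simp
  have "(%n. expectation (%w. (S {..<n} w)^2) - expectation (%w. (Z w)^2)) \<longlonglongrightarrow> 0"
   by (rule tendsto_rabs_zero_cancel, rule tendsto_sandwich[OF _ _ tendsto_const up])
     (simp, rule always_eventually, rule allI, rule le)
  then show ?thesis by (simp add: LIM_zero_iff)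
 qed
 moreover have "(%n. expectation (%w. (S {..<n} w)^2)) \<longlonglongrightarrow> (\<Sum>k. (a k)^2) * (t - s)"
  unfolding S2(2)[OF finite_lessThan] by (intro tendsto_intros summable_LIMSEQ a)
 ultimately show "expectation (%w. (Z w)^2) = (\<Sum>k. (a k)^2) * (t - s)" by (rule LIMSEQ_unique)
 assume X: "X \<in> borel_measurable (F s)" "integrable M (%w. (X w)^2)"
 have XM [measurable]: "X \<in> borel_measurable M" by (rule measurable_filtration[OF F st(1) X(1)])
 have X1: "integrable M X" using integrable_mult_of_squares[OF XM _ X(2), of "%_. 1"] by simp
 have XS: "expectation (%w. X w * S {..<n} w) = 0" for n
 proof -
  have "expectation (%w. X w * S {..<n} w) = expectation (%w. \<Sum>k<n. a k * (X w * ?B k w))"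
   unfolding S_def sum_distrib_left by (simp add: mult_ac)
  also have "... = (\<Sum>k<n. a k * expectation (%w. X w * ?B k w))"
   using integrable_mult_of_squares[OF XM mB X(2) B2] by simp
  finally show ?thesis using brownian_increment_past[OF F \<beta> st X(1) X1] by simp
 qed
 have le: "\<bar>expectation (%w. X w * Z w)\<bar> <= sqrt (expectation (%w. (X w)^2)) * sqrt (R n)" for n
 proof -
  have "expectation (%w. X w * Z w) = expectation (%w. X w * (Z w - S {..<n} w) + X w * S {..<n} w)"
   by (intro lint_cong) (auto simp: algebra_simps)
  also have "... = expectation (%w. X w * (Z w - S {..<n} w))"
   using integrable_mult_of_squares[OF XM mD X(2) tail(1)] integrable_mult_of_squares[OF XM mS X(2) S2(1)[OF finite_lessThan]] XS by simp
  also have "\<bar>\<dots>\<bar> <= sqrt (expectation (%w. (X w)^2)) * sqrt (expectation (%w. (Z w - S {..<n} w)^2))"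
   by (rule integral_Cauchy_Schwarz[OF XM mD X(2) tail(1)])
  also have "... <= sqrt (expectation (%w. (X w)^2)) * sqrt (R n)"
   using tail(2)[of n] by (intro mult_left_mono real_sqrt_le_mono) auto
  finally show ?thesis .
 qed
 have "(%n. sqrt (expectation (%w. (X w)^2)) * sqrt (R n)) \<longlonglongrightarrow> sqrt (expectation (%w. (X w)^2)) * sqrt 0"
  by (intro tendsto_intros Rlim)
 then have "\<bar>expectation (%w. X w * Z w)\<bar> <= sqrt (expectation (%w. (X w)^2)) * sqrt 0"
  by (rule LIMSEQ_le_const) (use le in auto)
 then show "expectation (%w. X w * Z w) = 0" by simp
qed

section \<open>Stationary solutions\<close>

text \<open>The time derivative of the projection onto \<open>ph\<close> apart from the noise, with
  all space derivatives on \<open>ph\<close>. It therefore makes sense for every state in L^2 and is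
  a Borel function of it.\<close>

definition drift :: "real => vfield => vfield => real" where
 "drift \<nu> ph v = \<nu> * L2_inner v (laplacian ph) + transport ph v"

lemma
 assumes "ph \<in> Cinf_div"
 shows L2_inner_measurable_borel: "(%v. L2_inner v ph) \<in> borel_measurable L2_div_borel"
  and drift_measurable: "drift \<nu> ph \<in> borel_measurable L2_div_borel"
proof -
 note p = Cinf_divD(1,2)[OF assms]
 have lap: "laplacian ph \<in> L2" by (intro smooth_L2 smooth_laplacian periodic_laplacian p)
 show "(%v. L2_inner v ph) \<in> borel_measurable L2_div_borel"
  by (rule L2_continuous_measurable) (rule L2_inner_tendsto; auto intro: L2_divD smooth_L2 p)
 show "drift \<nu> ph \<in> borel_measurable L2_div_borel"
  unfolding drift_def
  by (rule L2_continuous_measurable, intro tendsto_intros L2_inner_tendsto[OF _ _ lap] transport_tendsto[OF p]) (auto intro: L2_divD)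
qed

lemma drift_bound:
 assumes "ph \<in> Cinf_div"
 obtains B where "B \<ge> 0" "!!v. v \<in> L2 ==> \<bar>L2_inner v (laplacian ph)\<bar> <= B * (1 + (L2_norm v)^2)"
  "!!v. v \<in> L2 ==> \<bar>transport ph v\<bar> <= B * (1 + (L2_norm v)^2)"
proof -
 note p = Cinf_divD(1,2)[OF assms]
 have lap: "laplacian ph \<in> L2" by (intro smooth_L2 smooth_laplacian periodic_laplacian p)
 obtain B1 where B1: "B1 \<ge> 0" "!!v. v \<in> L2 ==> \<bar>transport ph v\<bar> <= B1 * (L2_norm v)^2"
  by (rule transport_bound[OF p]) blast
 define B where "B = B1 + L2_norm (laplacian ph)"
 show thesis
 proof (rule that[of B])
  show "B \<ge> 0" using B1(1) by (simp add: B_def)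
  fix v :: vfield assume v: "v \<in> L2"
  have n: "L2_norm v <= 1 + (L2_norm v)^2"
  proof -
   have "0 <= (L2_norm v - 1/2)^2" by simp
   then have "0 <= (L2_norm v)^2 - L2_norm v + 1/4" by (simp add: power2_diff power_divide)
   then show ?thesis by linarith
  qed
  have "\<bar>L2_inner v (laplacian ph)\<bar> <= L2_norm v * L2_norm (laplacian ph)" by (rule L2_inner_le[OF v lap])
  also have "... <= (1 + (L2_norm v)^2) * B" using n B1(1) by (intro mult_mono) (auto simp: B_def)
  finally show "\<bar>L2_inner v (laplacian ph)\<bar> <= B * (1 + (L2_norm v)^2)" by (simp add: mult.commute)
  have "\<bar>transport ph v\<bar> <= B1 * (L2_norm v)^2" by (rule B1(2)[OF v])
  also have "... <= B * (1 + (L2_norm v)^2)" using B1(1) by (intro mult_mono) (auto simp: B_def)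
  finally show "\<bar>transport ph v\<bar> <= B * (1 + (L2_norm v)^2)" .
 qed
qed

lemma L2_norm_measurable: "L2_norm \<in> borel_measurable L2_div_borel"
 by (rule L2_continuous_measurable) (rule L2_norm_tendsto; auto intro: L2_divD)

text \<open>Progressive measurability is joint measurability on [0, T] only; freezing time at the
  end points extends the process to all real times while keeping it jointly measurable.\<close>

definition clamp_time :: "real => real => real" where
 "clamp_time T s = max 0 (min T s)"

lemma clamp_time_eq: "s \<in> {0..T} ==> clamp_time T s = s"
 by (auto simp: clamp_time_def)

locale stationary_solution =
 fixes \<sigma> :: "nat => real" and e :: "nat => vfield" and \<nu> :: real
  and M :: "'w measure" and F :: "real => 'w measure" and \<beta> :: "nat => real => 'w => real" and u :: "real => 'w => vfield"
 assumes noise: "noise_coefficients \<sigma> e"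
  and solution: "stationary_martingale_solution \<sigma> e \<nu> M F \<beta> u"
  and energy: "energy_bounds \<sigma> \<nu> M u"
  and \<nu>: "\<nu> > 0"
begin

section \<open>Measurability, stationarity and moments of a solution\<close>

lemma sol:
 shows prob_space_M: "prob_space M" and filtration: "usual_filtration M F" and brownian: "brownian_family M F \<beta>"
  and progressive: "progressive_process F u" and stationary: "stationary_process M u" and weak: "weak_navier_stokes \<sigma> e \<nu> M \<beta> u"
  and path: "0 <= T ==> \<exists>\<alpha><0. AE w in M. solution_path \<alpha> T (%t. u t w)"
 using solution unfolding stationary_martingale_solution_def stochastic_basis_def by blast+

sublocale prob_space M by (rule prob_space_M)

lemma space_F: "0 <= t ==> space (F t) = space M"
 by (rule usual_filtrationD(1)[OF filtration])

lemma u_measurable_F: assumes t: "0 <= t" shows "u t \<in> F t \<rightarrow>\<^sub>M L2_div_borel"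
proof -
 have "(%(t, w). u t w) \<in> restrict_space borel {0..t} \<Otimes>\<^sub>M F t \<rightarrow>\<^sub>M L2_div_borel"
  using progressive t unfolding progressive_process_def by blast
 from measurable_compose[OF measurable_Pair1' this, of t] show ?thesis using t by (simp add: space_restrict_space)
qed

lemma u_measurable: "0 <= t ==> u t \<in> M \<rightarrow>\<^sub>M L2_div_borel"
 by (rule measurable_filtration[OF filtration _ u_measurable_F])

lemma u_L2_div: "0 <= t ==> w \<in> space M ==> u t w \<in> L2_div"
 using measurable_space[OF u_measurable] by (simp add: space_L2_div_borel)

lemma u_measurable_space: assumes t: "0 <= t" shows "(%(w, x). u t w x) \<in> borel_measurable (M \<Otimes>\<^sub>M borel)"
proof -
 have 1: "(%((t, w), x). u t w x) \<in> (restrict_space borel {0..t} \<Otimes>\<^sub>M F t) \<Otimes>\<^sub>M borel \<rightarrow>\<^sub>M borel"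
  using progressive t unfolding progressive_process_def by blast
 have id: "(%w. w) \<in> M \<rightarrow>\<^sub>M F t" by (rule measurable_filtration[OF filtration t]) simp
 have "(%p. ((t, fst p), snd p)) \<in> M \<Otimes>\<^sub>M borel \<rightarrow>\<^sub>M (restrict_space borel {0..t} \<Otimes>\<^sub>M F t) \<Otimes>\<^sub>M borel"
  using t by (intro measurable_Pair measurable_const measurable_compose[OF measurable_fst id] measurable_snd) (simp add: space_restrict_space)
 from measurable_compose[OF this 1] show ?thesis by (simp add: split_def)
qed

lemma u_measurable_time:
 assumes T: "0 <= T"
 shows "(%(s, w). u (clamp_time T s) w) \<in> borel \<Otimes>\<^sub>M M \<rightarrow>\<^sub>M L2_div_borel"
proof -
 have 1: "(%(t, w). u t w) \<in> restrict_space borel {0..T} \<Otimes>\<^sub>M F T \<rightarrow>\<^sub>M L2_div_borel"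
  using progressive T unfolding progressive_process_def by blast
 have id: "(%w. w) \<in> M \<rightarrow>\<^sub>M F T" by (rule measurable_filtration[OF filtration T]) simp
 have cl: "clamp_time T \<in> borel \<rightarrow>\<^sub>M restrict_space borel {0..T}"
  using T by (intro measurable_restrict_space2) (auto simp: clamp_time_def[abs_def])
 have "(%p. (clamp_time T (fst p), snd p)) \<in> borel \<Otimes>\<^sub>M M \<rightarrow>\<^sub>M restrict_space borel {0..T} \<Otimes>\<^sub>M F T"
  by (intro measurable_Pair measurable_compose[OF measurable_fst cl] measurable_compose[OF measurable_snd id])
 from measurable_compose[OF this 1] show ?thesis by (simp add: split_def)
qed

text \<open>The law at time t is the marginal at time 0 of the path shifted by t.\<close>

lemma distr_u: assumes t: "0 <= t" shows "distr M L2_div_borel (u t) = distr M L2_div_borel (u 0)"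
proof -
 let ?P = "\<Pi>\<^sub>M t\<in>{0::real..}. L2_div_borel" and ?p = "%\<tau> w. \<lambda>t\<in>{0..}. u (t + \<tau>) w"
 have eq: "distr M ?P (?p t) = distr M ?P (?p 0)"
  using stationary t unfolding stationary_process_def by simp
 have m: "?p \<tau> \<in> M \<rightarrow>\<^sub>M ?P" if "0 <= \<tau>" for \<tau>
  using that by (intro measurable_restrict u_measurable) auto
 have c: "(%f. f 0) \<in> ?P \<rightarrow>\<^sub>M L2_div_borel" by (rule measurable_component_singleton) simp
 have d: "distr (distr M ?P (?p \<tau>)) L2_div_borel (%f. f 0) = distr M L2_div_borel (u \<tau>)" if "0 <= \<tau>" for \<tau>
  by (subst distr_distr[OF c m[OF that]]) (simp add: o_def)
 show ?thesis using d[OF t] d[OF order_refl] unfolding eq by simp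
qed

lemma stationary_expectation:
 fixes f :: "vfield => real"
 assumes t: "0 <= t" and f: "f \<in> borel_measurable L2_div_borel"
 shows "expectation (%w. f (u t w)) = expectation (%w. f (u 0 w))"
 using integral_distr[OF u_measurable[OF t] f] integral_distr[OF u_measurable[OF order_refl] f] distr_u[OF t] by auto

lemma stationary_nn_integral:
 assumes t: "0 <= t" and f: "f \<in> borel_measurable L2_div_borel"
 shows "(\<integral>\<^sup>+w. f (u t w) \<partial>M) = (\<integral>\<^sup>+w. f (u 0 w) \<partial>M)"
 using nn_integral_distr[OF u_measurable[OF t], of f] nn_integral_distr[OF u_measurable[OF order_refl], of f] distr_u[OF t] f by simp

text \<open>The assumed moments are those of an essential supremum over times, which says nothing
  about one given time. By stationarity the moment at any time equals its average over [0, 1], and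
  that average is below the essential supremum.\<close>

lemma L2_norm_moment:
 assumes t: "0 <= t"
 shows "integrable M (%w. L2_norm (u t w) ^ r)"
proof (cases "r = 0")
 case False
 note [measurable] = L2_norm_measurable
 let ?f = "%v. ennreal (L2_norm v ^ r)"
 have f [measurable]: "?f \<in> borel_measurable L2_div_borel" by measurable
 have one: "emeasure unit_interval {0..1} = 1"
  using unit_interval.emeasure_space_1 by (simp add: space_restrict_space)
 define L where "L w = Linf_L2_norm 1 (%t. u t w)" for w
 have le: "(\<integral>\<^sup>+s. ?f (u (clamp_time 1 s) w) \<partial>unit_interval) <= ennreal_power (L w) (real r)" for w
 proof (cases "L w = \<infinity>")
  case fin: False
  define l where "l = enn2real (L w)"
  have l: "L w = ennreal l" "0 <= l" using fin by (auto simp: l_def less_top)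
  have "AE s in unit_interval. ennreal (L2_norm (u s w)) <= L w"
   unfolding L_def Linf_L2_norm_def by (rule esssup_AE)
  moreover have "AE s in unit_interval. s \<in> {0..1}"
   by (rule AE_I2) (simp add: space_restrict_space)
  ultimately have "AE s in unit_interval. ?f (u (clamp_time 1 s) w) <= ennreal (l ^ r)"
  proof eventually_elim
   case (elim s)
   then show ?case using l by (auto simp: clamp_time_eq intro!: ennreal_leI power_mono)
  qed
  then have "(\<integral>\<^sup>+s. ?f (u (clamp_time 1 s) w) \<partial>unit_interval) <= (\<integral>\<^sup>+s. ennreal (l ^ r) \<partial>unit_interval)"
   by (rule nn_integral_mono_AE)
  also have "... = ennreal (l ^ r)" by (simp add: one)
  also have "... = ennreal_power (L w) (real r)"
   using fin False l by (cases "l = 0") (auto simp: ennreal_power_def powr_realpow)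
  finally show ?thesis .
 qed (simp add: ennreal_power_def)
 have fub: "pair_sigma_finite unit_interval M" ..
 have mj: "(%(s, w). ?f (u (clamp_time 1 s) w)) \<in> borel_measurable (unit_interval \<Otimes>\<^sub>M M)"
 proof -
  have "(%p. (fst p, snd p)) \<in> unit_interval \<Otimes>\<^sub>M M \<rightarrow>\<^sub>M borel \<Otimes>\<^sub>M M"
   by (intro measurable_Pair measurable_compose[OF measurable_fst measurable_unit_interval_ident] measurable_snd)
  from measurable_compose[OF measurable_compose[OF this u_measurable_time[of 1]] f] show ?thesis by (simp add: split_def)
 qed
 have "(\<integral>\<^sup>+s. \<integral>\<^sup>+w. ?f (u (clamp_time 1 s) w) \<partial>M \<partial>unit_interval) = (\<integral>\<^sup>+s. \<integral>\<^sup>+w. ?f (u 0 w) \<partial>M \<partial>unit_interval)"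
  by (rule nn_integral_cong, rule stationary_nn_integral[OF _ f]) (simp add: clamp_time_def)
 also have "... = (\<integral>\<^sup>+w. ?f (u 0 w) \<partial>M)" by (simp add: one)
 finally have "(\<integral>\<^sup>+w. ?f (u 0 w) \<partial>M) = (\<integral>\<^sup>+w. \<integral>\<^sup>+s. ?f (u (clamp_time 1 s) w) \<partial>unit_interval \<partial>M)"
  using pair_sigma_finite.Fubini'[OF fub mj] by simp
 also have "... <= (\<integral>\<^sup>+w. ennreal_power (L w) (real r) \<partial>M)" by (rule nn_integral_mono) (rule le)
 also have "... < \<infinity>"
 proof -
  have "\<forall>r\<ge>1. \<forall>T\<ge>0. (\<integral>\<^sup>+ w. ennreal_power (Linf_L2_norm T (%t. u t w)) r \<partial>M) < \<infinity>"
   using energy unfolding energy_bounds_def by (rule conjunct2)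
  then show ?thesis using False unfolding L_def by simp
 qed
 finally have "(\<integral>\<^sup>+w. ?f (u t w) \<partial>M) < \<infinity>" using stationary_nn_integral[OF t f] by simp
 then show ?thesis
  using u_measurable[OF t] by (intro integrableI_nonneg) (auto intro: measurable_compose[OF u_measurable[OF t]])
qed simp

lemma energy_le: "0 <= t ==> ennreal \<nu> * (\<integral>\<^sup>+ w. grad_normsq (u t w) \<partial>M) <= ennreal (energy_input \<sigma>)"
 using energy unfolding energy_bounds_def by blast

lemma grad_normsq_u_measurable: "0 <= t ==> (%w. grad_normsq (u t w)) \<in> borel_measurable M"
 by (rule measurable_compose[OF u_measurable grad_normsq_measurable])

text \<open>The path regularity gives H^1 only at almost every time; the energy inequality, imposed
  at each time, gives it at a fixed time almost surely.\<close>

lemma AE_H1: assumes t: "0 <= t" shows "AE w in M. u t w \<in> H1_div"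
proof -
 have "(\<integral>\<^sup>+ w. grad_normsq (u t w) \<partial>M) \<noteq> \<infinity>"
 proof
  assume "(\<integral>\<^sup>+ w. grad_normsq (u t w) \<partial>M) = \<infinity>"
  then show False using energy_le[OF t] \<nu> by (simp add: ennreal_mult_top top_unique)
 qed
 then have "AE w in M. grad_normsq (u t w) \<noteq> \<infinity>"
  by (rule nn_integral_PInf_AE[OF grad_normsq_u_measurable[OF t]])
 then show ?thesis by eventually_elim (auto simp: grad_normsq_def split: if_splits)
qed

lemma H1_div_sets: "{v \<in> space L2_div_borel. v \<in> H1_div} \<in> sets L2_div_borel"
proof -
 have "{v \<in> space L2_div_borel. v \<in> H1_div} = {v \<in> space L2_div_borel. grad_normsq v < \<infinity>}"
  by (auto simp: grad_normsq_def)
 also have "... \<in> sets L2_div_borel" using grad_normsq_measurable by measurable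
 finally show ?thesis .
qed

text \<open>Brings the weak formulation into the form of a scalar equation with drift. For almost
  every path the state is in H^1 at almost every time, where the derivatives can be moved to the
  test field.\<close>

lemma weak_drift:
 assumes t: "0 <= t" and ph: "ph \<in> Cinf_div"
 shows "AE w in M. set_integrable lborel {0..t} (%s. drift \<nu> ph (u s w)) \<and>
  (%k. \<sigma> k * L2_inner (e k) ph * (\<beta> k t w - \<beta> k 0 w)) sums
   (L2_inner (u t w) ph - L2_inner (u 0 w) ph - (LINT s:{0..t}|lborel. drift \<nu> ph (u s w)))"
proof -
 note p = Cinf_divD(1,2)[OF ph]
 have lap: "laplacian ph \<in> L2" by (intro smooth_L2 smooth_laplacian periodic_laplacian p)
 obtain \<alpha> where path: "AE w in M. solution_path \<alpha> t (%t. u t w)" using path[OF t] by blast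
 have weak': "AE w in M. (%k. \<sigma> k * L2_inner (e k) ph * (\<beta> k t w - \<beta> k 0 w)) sums
     (L2_inner (u t w) ph + \<nu> * (LINT s:{0..t}|lborel. L2_inner (grad (u s w)) (jac ph))
      + (LINT s:{0..t}|lborel. L2_inner (%x. grad (u s w) x *v u s w x) ph) - L2_inner (u 0 w) ph)"
  using weak t ph unfolding weak_navier_stokes_def by blast
 define J where "J = restrict_space lborel {0..t}"
 have setJ: "(LINT s:{0..t}|lborel. f s) = (LINT s|J. f s)" "set_integrable lborel {0..t} f \<longleftrightarrow> integrable J f" for f :: "real => real"
  by (simp_all add: J_def set_lebesgue_integral_def set_integrable_def integral_restrict_space integrable_restrict_space)
 obtain B where B: "B \<ge> 0" "!!v. v \<in> L2 ==> \<bar>L2_inner v (laplacian ph)\<bar> <= B * (1 + (L2_norm v)^2)"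
  "!!v. v \<in> L2 ==> \<bar>transport ph v\<bar> <= B * (1 + (L2_norm v)^2)"
  by (rule drift_bound[OF ph]) blast
 have mlap: "(%v. L2_inner v (laplacian ph)) \<in> borel_measurable L2_div_borel"
  by (rule L2_continuous_measurable) (rule L2_inner_tendsto[OF _ _ lap]; auto intro: L2_divD)
 have mtr: "transport ph \<in> borel_measurable L2_div_borel"
  by (rule L2_continuous_measurable) (rule transport_tendsto[OF p]; auto intro: L2_divD)
 show ?thesis
  using weak' path AE_space
 proof eventually_elim
  case (elim w)
  have uJ: "(%s. u s w) \<in> J \<rightarrow>\<^sub>M L2_div_borel"
  proof -
   have 1: "(%(t, w). u t w) \<in> restrict_space borel {0..t} \<Otimes>\<^sub>M F t \<rightarrow>\<^sub>M L2_div_borel"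
    using progressive t unfolding progressive_process_def by blast
   have "w \<in> space (F t)" using elim(3) t by (simp add: space_F)
   from measurable_compose[OF measurable_Pair2'[OF this] 1]
   have "(%s. u s w) \<in> restrict_space borel {0..t} \<rightarrow>\<^sub>M L2_div_borel" by simp
   also have "restrict_space borel {0..t} \<rightarrow>\<^sub>M L2_div_borel = J \<rightarrow>\<^sub>M L2_div_borel"
    unfolding J_def by (rule measurable_cong_sets) (simp_all add: sets_restrict_space)
   finally show ?thesis .
  qed
  have uL: "u s w \<in> L2" if "s \<in> space J" for s
   using measurable_space[OF uJ that] by (simp add: space_L2_div_borel L2_divD)
  have mg: "(%s. grad_normsq (u s w)) \<in> borel_measurable J" by (rule measurable_compose[OF uJ grad_normsq_measurable])
  have mn: "(%s. L2_norm (u s w)) \<in> borel_measurable J" by (rule measurable_compose[OF uJ L2_norm_measurable])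
  have fin: "(\<integral>\<^sup>+s. ennreal ((L2_norm (u s w))^2) + grad_normsq (u s w) \<partial>J) < \<infinity>"
   using elim(2) by (simp add: solution_path_def J_def nn_integral_restrict_space)
  have H1: "AE s in J. u s w \<in> H1_div"
  proof -
   have "AE s in J. ennreal ((L2_norm (u s w))^2) + grad_normsq (u s w) \<noteq> \<infinity>"
    by (rule nn_integral_PInf_AE) (use mg mn fin in auto)
   then show ?thesis by eventually_elim (auto simp: grad_normsq_def split: if_splits)
  qed
  have i2: "integrable J (%s. B * (1 + (L2_norm (u s w))^2))"
  proof -
   have "(\<integral>\<^sup>+s. ennreal ((L2_norm (u s w))^2) \<partial>J) <= (\<integral>\<^sup>+s. ennreal ((L2_norm (u s w))^2) + grad_normsq (u s w) \<partial>J)"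
    by (rule nn_integral_mono) simp
   then have "integrable J (%s. (L2_norm (u s w))^2)"
    using fin mn by (intro integrableI_nonneg) (auto intro: le_less_trans)
   moreover have "integrable J (%s. 1::real)"
    unfolding setJ(2)[symmetric] set_integrable_def by (rule borel_integrable_compact) auto
   ultimately show ?thesis by simp
  qed
  have ilap: "integrable J (%s. L2_inner (u s w) (laplacian ph))"
   by (rule lint_bound[OF i2 measurable_compose[OF uJ mlap]]) (rule AE_I2, use B uL in simp)
  have itr: "integrable J (%s. transport ph (u s w))"
   by (rule lint_bound[OF i2 measurable_compose[OF uJ mtr]]) (rule AE_I2, use B uL in simp)
  have mH: "{s \<in> space J. u s w \<in> H1_div} \<in> sets J"
  proof -
   have "{s \<in> space J. u s w \<in> H1_div} = (%s. u s w) -` {v \<in> space L2_div_borel. v \<in> H1_div} \<inter> space J"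
    using measurable_space[OF uJ] by auto
   then show ?thesis using measurable_sets[OF uJ H1_div_sets] by simp
  qed
  \<comment> \<open>Since \<open>grad\<close> is zero off \<open>H1_div\<close>, the identity can be
    stated for every \<open>v\<close>; along the path the exceptional times form a null set.\<close>
  have eqA: "L2_inner (grad v) (jac ph) = (if v \<in> H1_div then - L2_inner v (laplacian ph) else 0)" for v
   using H1_gradient_inner_jacobian[OF has_H1_gradient_grad p, of v] by (auto simp: grad_def L2_inner_def)
  have eqB: "L2_inner (%x. grad v x *v v x) ph = (if v \<in> H1_div then - transport ph v else 0)" for v
   using H1_transport[OF has_H1_gradient_grad p, of v] by (auto simp: grad_def L2_inner_def)
  have A: "(LINT s|J. L2_inner (grad (u s w)) (jac ph)) = - (LINT s|J. L2_inner (u s w) (laplacian ph))"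
  proof -
   have "(LINT s|J. L2_inner (grad (u s w)) (jac ph)) = (LINT s|J. - L2_inner (u s w) (laplacian ph))"
    unfolding eqA
   proof (rule integral_cong_AE)
    show "(%s. if u s w \<in> H1_div then - L2_inner (u s w) (laplacian ph) else 0) \<in> borel_measurable J"
     by (rule measurable_If) (use ilap mH in auto)
    show "AE s in J. (if u s w \<in> H1_div then - L2_inner (u s w) (laplacian ph) else 0) = - L2_inner (u s w) (laplacian ph)"
     using H1 by eventually_elim simp
   qed (use ilap in auto)
   then show ?thesis by simp
  qed
  have Bt: "(LINT s|J. L2_inner (%x. grad (u s w) x *v u s w x) ph) = - (LINT s|J. transport ph (u s w))"
  proof -
   have "(LINT s|J. L2_inner (%x. grad (u s w) x *v u s w x) ph) = (LINT s|J. - transport ph (u s w))"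
    unfolding eqB
   proof (rule integral_cong_AE)
    show "(%s. if u s w \<in> H1_div then - transport ph (u s w) else 0) \<in> borel_measurable J"
     by (rule measurable_If) (use itr mH in auto)
    show "AE s in J. (if u s w \<in> H1_div then - transport ph (u s w) else 0) = - transport ph (u s w)"
     using H1 by eventually_elim simp
   qed (use itr in auto)
   then show ?thesis by simp
  qed
  have "(LINT s|J. drift \<nu> ph (u s w)) = \<nu> * (LINT s|J. L2_inner (u s w) (laplacian ph)) + (LINT s|J. transport ph (u s w))"
   unfolding drift_def using ilap itr by simp
  moreover have "integrable J (%s. drift \<nu> ph (u s w))" unfolding drift_def using ilap itr by simp
  ultimately show ?case using elim(1) unfolding setJ A Bt by (simp add: algebra_simps)
 qed
qed

lemma forcing:
 shows e_Cinf: "e m \<in> Cinf_div" and e_L2: "e m \<in> L2" and e_L2_div: "e m \<in> L2_div" and e_norm: "L2_norm (e m) = 1"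
  and \<sigma>_summable: "summable (%m. (\<sigma> m)^2)"
proof -
 show c: "e m \<in> Cinf_div" using noise unfolding noise_coefficients_def stokes_eigenfunction_def by blast
 then show L: "e m \<in> L2" by (rule Cinf_div_L2)
 have "(%_. L2_norm (%x. e m x - e m x)) \<longlonglongrightarrow> 0" by (simp add: L2_norm_def)
 then show "e m \<in> L2_div" unfolding L2_div_def using c L by (auto intro!: exI[of _ "%_. e m"])
 have "L2_inner (e m) (e m) = 1" using noise unfolding noise_coefficients_def by simp
 then show "L2_norm (e m) = 1" using L2_norm_nonneg[of "e m"] by (simp add: L2_inner_self power2_eq_1_iff)
 show "summable (%m. (\<sigma> m)^2)" using noise unfolding noise_coefficients_def by simp
qed

text \<open>\<open>stationary_balance\<close> for the projection onto \<open>ph\<close>. The drift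
  is quadratic in the state, so its mean square is controlled by fourth moments of the L^2
  norm.\<close>

lemma mode_balance:
 assumes t: "0 <= t" and ph: "ph \<in> Cinf_div"
 shows "2 * expectation (%w. L2_inner (u t w) ph * drift \<nu> ph (u t w)) + (\<Sum>k. (\<sigma> k * L2_inner (e k) ph)^2) = 0"
  and mode_integrable: "integrable M (%w. L2_inner (u t w) ph * drift \<nu> ph (u t w))"
proof -
 note p = Cinf_divD(1,2)[OF ph]
 have ph_L: "ph \<in> L2" by (rule smooth_L2[OF p])
 obtain B where B: "B \<ge> 0" "!!v. v \<in> L2 ==> \<bar>L2_inner v (laplacian ph)\<bar> <= B * (1 + (L2_norm v)^2)"
  "!!v. v \<in> L2 ==> \<bar>transport ph v\<bar> <= B * (1 + (L2_norm v)^2)"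
  by (rule drift_bound[OF ph]) blast
 note mX [measurable] = L2_inner_measurable_borel[OF ph] and mD [measurable] = drift_measurable[OF ph, of \<nu>]
 define X where "X s w = L2_inner (u s w) ph" for s w
 define N where "N s w = drift \<nu> ph (u (clamp_time (t + 1) s) w)" for s w
 have X_m: "X s \<in> borel_measurable M" if "0 <= s" for s unfolding X_def by (rule measurable_compose[OF u_measurable[OF that] mX])
 have X2: "integrable M (%w. (X s w)^2)" if s: "0 <= s" for s
 proof (rule lint_bound)
  show "integrable M (%w. (L2_norm ph)^2 * L2_norm (u s w) ^ 2)" using L2_norm_moment[OF s] by simp
  show "AE w in M. norm ((X s w)^2) <= norm ((L2_norm ph)^2 * L2_norm (u s w) ^ 2)"
  proof (rule AE_I2)
   fix w assume "w \<in> space M"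
   then have "\<bar>X s w\<bar> <= L2_norm (u s w) * L2_norm ph" unfolding X_def by (intro L2_inner_le L2_divD u_L2_div s ph_L)
   from power_mono[OF this, of 2] show "norm ((X s w)^2) <= norm ((L2_norm ph)^2 * L2_norm (u s w) ^ 2)"
    by (simp add: power_mult_distrib mult.commute)
  qed
 qed (use X_m[OF s] in measurable)
 \<comment> \<open>From the bound on the drift by a multiple of 1 + |u|^2 and (1 + y)^2 <= 2 (1 +
   y^2) with y = |u|^2.\<close>
 define C where "C = 2 * ((\<bar>\<nu>\<bar> + 1) * B)^2"
 have D_m: "(%w. drift \<nu> ph (u s w)) \<in> borel_measurable M" if "0 <= s" for s by (rule measurable_compose[OF u_measurable[OF that] mD])
 have D2: "integrable M (%w. (drift \<nu> ph (u s w))^2)" if s: "0 <= s" for s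
 proof (rule lint_bound)
  show "integrable M (%w. C * (1 + L2_norm (u s w) ^ 4))" using L2_norm_moment[OF s] by simp
  show "AE w in M. norm ((drift \<nu> ph (u s w))^2) <= norm (C * (1 + L2_norm (u s w) ^ 4))"
  proof (rule AE_I2)
   fix w assume "w \<in> space M"
   then have L: "u s w \<in> L2" by (intro L2_divD u_L2_div s)
   let ?b = "B * (1 + (L2_norm (u s w))^2)"
   have "\<bar>drift \<nu> ph (u s w)\<bar> <= \<bar>\<nu>\<bar> * ?b + ?b"
    unfolding drift_def using B(2,3)[OF L]
    by (intro order_trans[OF abs_triangle_ineq] add_mono) (auto simp: abs_mult intro!: mult_left_mono)
   also have "... = (\<bar>\<nu>\<bar> + 1) * B * (1 + (L2_norm (u s w))^2)" by (simp add: algebra_simps)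
   finally have "(drift \<nu> ph (u s w))^2 <= ((\<bar>\<nu>\<bar> + 1) * B)^2 * (1 + (L2_norm (u s w))^2)^2"
    using power_mono[of "\<bar>drift \<nu> ph (u s w)\<bar>" "(\<bar>\<nu>\<bar> + 1) * B * (1 + (L2_norm (u s w))^2)" 2] by (simp only: power_mult_distrib power2_abs abs_ge_zero)
   also have "... <= ((\<bar>\<nu>\<bar> + 1) * B)^2 * (2 * (1 + L2_norm (u s w) ^ 4))"
   proof (rule mult_left_mono)
    have "2 * 1 * (L2_norm (u s w))^2 <= 1^2 + ((L2_norm (u s w))^2)^2" by (rule sum_squares_bound)
    then show "(1 + (L2_norm (u s w))^2)^2 <= 2 * (1 + L2_norm (u s w) ^ 4)" by (simp add: power2_sum power_mult[symmetric])
   qed simp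
   finally show "norm ((drift \<nu> ph (u s w))^2) <= norm (C * (1 + L2_norm (u s w) ^ 4))" by (simp add: C_def algebra_simps)
  qed
 qed (use D_m[OF s] in measurable)
 show "integrable M (%w. L2_inner (u t w) ph * drift \<nu> ph (u t w))"
  by (rule integrable_mult_of_squares[OF X_m[OF t, unfolded X_def] D_m[OF t] X2[OF t, unfolded X_def] D2[OF t]])
 have N_eq: "N s = (%w. drift \<nu> ph (u s w))" if "s \<in> {0..t+1}" for s using clamp_time_eq[OF that] by (simp add: N_def fun_eq_iff)
 have mN: "(%(s, w). N s w) \<in> borel_measurable (borel \<Otimes>\<^sub>M M)"
  using measurable_compose[OF u_measurable_time[of "t + 1"] mD] t by (simp add: N_def split_def)
 define K where "K = expectation (%w. (drift \<nu> ph (u 0 w))^2)"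
 define c where "c = expectation (%w. L2_inner (u 0 w) ph * drift \<nu> ph (u 0 w))"
 have EX: "expectation (%w. (X s w)^2) = expectation (%w. (X t w)^2)" if "t <= s" for s
  using stationary_expectation[of s "%v. (L2_inner v ph)^2"] stationary_expectation[of t "%v. (L2_inner v ph)^2"] that t
  by (simp add: X_def)
 have EN: "integrable M (%w. (N s w)^2)" "expectation (%w. (N s w)^2) = K" if "s \<in> {0..t+1}" for s
  using that stationary_expectation[of s "%v. (drift \<nu> ph v)^2"] by (simp_all add: N_eq K_def D2)
 have EXN: "expectation (%w. X s w * drift \<nu> ph (u s w)) = c" if "0 <= s" for s
  using that stationary_expectation[of s "%v. L2_inner v ph * drift \<nu> ph v"] by (simp add: X_def c_def)
 define a where "a k = \<sigma> k * L2_inner (e k) ph" for k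
 have a: "summable (%k. (a k)^2)"
 proof (rule summable_comparison_test'[OF summable_mult2[OF \<sigma>_summable]])
  show "norm ((a k)^2) <= (\<sigma> k)^2 * (L2_norm ph)^2" for k
   unfolding a_def power_mult_distrib using power_mono[OF L2_inner_le[OF e_L2 ph_L] abs_ge_zero, of k 2] by (simp add: e_norm mult_left_mono)
 qed
 \<comment> \<open>Defined as the remainder, so that the equation of
   \<open>stationary_balance\<close> holds identically and \<open>Z\<close> is measurable;
   \<open>sumsZ\<close> then identifies it with the noise by subtracting the equations at the times
   t + r and t.\<close>
 define Z where "Z r w = X (t + r) w - X t w - (LINT s:{t..t+r}|lborel. N s w)" for r w
 have N01: "s \<in> {t..t+r} ==> integrable M (%w. (N s w)^2)" "s \<in> {t..t+r} ==> expectation (%w. (N s w)^2) <= K" if "r \<in> {0<..1}" for r s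
  using EN[of s] that t by auto
 have mZ: "Z r \<in> borel_measurable M" if r: "r \<in> {0<..1}" for r
 proof -
  have "t <= t + r" using r by simp
  from time_integral(1)[OF mN _ _ N01[OF r] this, of "%_. 0"]
  have "(%w. LINT s:{t..t+r}|lborel. N s w) \<in> borel_measurable M" by simp
  then show ?thesis unfolding Z_def using r t by (intro borel_measurable_diff X_m) auto
 qed
 have sumsZ: "AE w in M. (%k. a k * (\<beta> k (t + r) w - \<beta> k t w)) sums Z r w" if r: "r \<in> {0<..1}" for r
 proof -
  have tr: "0 <= t + r" using r t by simp
  show ?thesis
   using weak_drift[OF tr ph] weak_drift[OF t ph]
  proof eventually_elim
   case (elim w)
   have "(LINT s:{0..t+r}|lborel. drift \<nu> ph (u s w)) = (LINT s:{0..t} \<union> {t..t+r}|lborel. drift \<nu> ph (u s w))"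
    using r t by (intro arg_cong[where f="%A. LINT s:A|lborel. drift \<nu> ph (u s w)"]) auto
   also have "... = (LINT s:{0..t}|lborel. drift \<nu> ph (u s w)) + (LINT s:{t..t+r}|lborel. drift \<nu> ph (u s w))"
   proof (rule set_integral_Un_AE)
    show "AE s in lborel. \<not> (s \<in> {0..t} \<and> s \<in> {t..t+r})"
     using AE_lborel_singleton[of t] by eventually_elim auto
    show "set_integrable lborel {t..t+r} (%s. drift \<nu> ph (u s w))"
     by (rule set_integrable_subset[OF elim(1)[THEN conjunct1]]) (use t in auto)
   qed (use elim in auto)
   also have "(LINT s:{t..t+r}|lborel. drift \<nu> ph (u s w)) = (LINT s:{t..t+r}|lborel. N s w)"
    using r t by (intro set_lebesgue_integral_cong) (auto simp: N_eq)
   finally have I: "(LINT s:{0..t+r}|lborel. drift \<nu> ph (u s w)) = (LINT s:{0..t}|lborel. drift \<nu> ph (u s w)) + (LINT s:{t..t+r}|lborel. N s w)" .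
   from sums_diff[OF elim(1)[THEN conjunct2] elim(2)[THEN conjunct2]]
   show ?case unfolding I a_def Z_def X_def by (simp add: algebra_simps)
  qed
 qed
 have tr: "t < t + r" if "r \<in> {0<..1}" for r using that by simp
 have "2 * c + (\<Sum>k. (a k)^2) = 0"
 proof (rule stationary_balance[where X=X and N=N and Z=Z and t=t and K=K])
  show "(%(s, w). N s w) \<in> borel_measurable (borel \<Otimes>\<^sub>M M)" by (rule mN)
  show "X s \<in> borel_measurable M" "integrable M (%w. (X s w)^2)" "expectation (%w. (X s w)^2) = expectation (%w. (X t w)^2)"
   if "t <= s" for s using X_m[of s] X2[of s] EX[of s] that t by auto
  show "integrable M (%w. (N s w)^2)" "expectation (%w. (N s w)^2) <= K" "expectation (%w. X s w * N s w) = c" if "s \<in> {t..t+1}" for s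
   using EN[of s] EXN[of s] N_eq[of s] that t by auto
  fix r :: real assume r: "r \<in> {0<..1}"
  show "Z r \<in> borel_measurable M" by (rule mZ[OF r])
  note bs = brownian_sum_sq_integrable[OF filtration brownian t tr[OF r] a mZ[OF r] sumsZ[OF r]]
   brownian_sum_sq[OF filtration brownian t tr[OF r] a mZ[OF r] sumsZ[OF r]]
   brownian_sum_past[OF filtration brownian t tr[OF r] a mZ[OF r] sumsZ[OF r], of "X t"]
  show "integrable M (%w. (Z r w)^2)" "expectation (%w. (Z r w)^2) = (\<Sum>k. (a k)^2) * r" using bs(1,2) by auto
  have "X t \<in> borel_measurable (F t)" unfolding X_def by (rule measurable_compose[OF u_measurable_F[OF t] mX])
  then show "expectation (%w. X t w * Z r w) = 0" using bs(3) X2[OF t] by simp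
  show "AE w in M. X (t + r) w - X t w = (LINT s:{t..t+r}|lborel. N s w) + Z r w" by (simp add: Z_def)
 qed
 then show "2 * expectation (%w. L2_inner (u t w) ph * drift \<nu> ph (u t w)) + (\<Sum>k. (\<sigma> k * L2_inner (e k) ph)^2) = 0"
  using EXN[OF t] by (simp add: X_def a_def)
qed

end

section \<open>Uniqueness of Fourier coefficients\<close>

definition fourier_null :: "(real^3 => real) => bool" where
 "fourier_null f \<longleftrightarrow> cts f \<and> periodic f \<and> (\<forall>k\<in>lattice. fcos k f = 0 \<and> fsin k f = 0)"

lemma
 fixes f g :: "sfield"
 assumes "integrable torus f" "integrable torus g"
 shows fcos_add: "fcos k (%x. f x + g x) = fcos k f + fcos k g"
  and fsin_add: "fsin k (%x. f x + g x) = fsin k f + fsin k g"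
 using integrable_cos[OF assms(1)] integrable_cos[OF assms(2)] integrable_sin[OF assms(1)] integrable_sin[OF assms(2)]
 by (simp_all add: fcos_def fsin_def distrib_left)

lemma
 fixes f :: "sfield"
 shows fcos_scale: "fcos k (%x. c * f x) = c * fcos k f"
  and fsin_scale: "fsin k (%x. c * f x) = c * fsin k f"
 by (simp_all add: fcos_def fsin_def mult.left_commute)

lemma fourier_null_add: "fourier_null f ==> fourier_null g ==> fourier_null (%x. f x + g x)"
 by (auto simp: fourier_null_def fcos_add fsin_add torus_integrable periodic_def intro!: continuous_intros)

lemma fourier_null_scale: "fourier_null f ==> fourier_null (%x. c * f x)"
 by (auto simp: fourier_null_def fcos_scale fsin_scale periodic_def intro!: continuous_intros)

text \<open>The product formulas shift the frequency k to k - m and k + m, which are again lattice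
  points. Thus the class is stable under multiplication by the cosine polynomial that peaks at the
  origin.\<close>

lemma fourier_null_mult_cos:
 assumes f: "fourier_null f" and m: "m \<in> lattice"
 shows "fourier_null (%x. cos (2 * pi * (m \<bullet> x)) * f x)"
proof -
 have c: "cts f" and p: "periodic f" and z: "!!k. k \<in> lattice ==> fcos k f = 0 \<and> fsin k f = 0"
  using f by (auto simp: fourier_null_def)
 have i: "integrable torus f" by (rule torus_integrable[OF c])
 have eqc: "fcos k (%x. cos (2 * pi * (m \<bullet> x)) * f x) = (fcos (k - m) f + fcos (k + m) f) / 2" for k
 proof -
  have "(fcos (k - m) f + fcos (k + m) f) / 2
    = (AV x. (cos (2 * pi * ((k - m) \<bullet> x)) * f x + cos (2 * pi * ((k + m) \<bullet> x)) * f x) / 2)"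
   using integrable_cos[OF i] by (simp add: fcos_def)
  also have "... = fcos k (%x. cos (2 * pi * (m \<bullet> x)) * f x)"
   unfolding fcos_def
   by (rule lint_cong) (simp_all add: inner_diff_left inner_add_left cos_diff cos_add algebra_simps)
  finally show ?thesis by simp
 qed
 have eqs: "fsin k (%x. cos (2 * pi * (m \<bullet> x)) * f x) = (fsin (k - m) f + fsin (k + m) f) / 2" for k
 proof -
  have "(fsin (k - m) f + fsin (k + m) f) / 2
    = (AV x. (sin (2 * pi * ((k - m) \<bullet> x)) * f x + sin (2 * pi * ((k + m) \<bullet> x)) * f x) / 2)"
   using integrable_sin[OF i] by (simp add: fsin_def)
  also have "... = fsin k (%x. cos (2 * pi * (m \<bullet> x)) * f x)"
   unfolding fsin_def
   by (rule lint_cong) (simp_all add: inner_diff_left inner_add_left sin_diff sin_add algebra_simps)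
  finally show ?thesis by simp
 qed
 have "fcos k (%x. cos (2 * pi * (m \<bullet> x)) * f x) = 0" "fsin k (%x. cos (2 * pi * (m \<bullet> x)) * f x) = 0" if "k \<in> lattice" for k
  unfolding eqc eqs using z[OF lattice_diff[OF that m]] z[OF lattice_add[OF that m]] by simp_all
 then show ?thesis
  using c p cos_periodic_lattice[OF m]
  by (auto simp: fourier_null_def periodic_def intro!: continuous_intros)
qed

lemma axis_lattice: "axis i 1 \<in> lattice"
 by (auto simp: lattice_def axis_def)

text \<open>A cube at one corner of the fundamental cube carries the peak. It covers only one octant
  of a neighbourhood of 0, but positive volume is all that is required.\<close>

lemma torus_const_power_bound:
 fixes f :: "sfield"
 assumes c: "cts f" and V: "0 < \<rho>" "\<rho> <= 1" and b: "0 <= b"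
  and lo: "!!x. x \<in> cbox 0 1 ==> - B <= f x" and hi: "!!x. x \<in> cbox 0 (\<chi> i. \<rho>) ==> b <= f x" and B: "0 <= B"
 shows "b * \<rho> ^ 3 - B <= (AV x. f x)"
proof -
 let ?V = "cbox 0 (\<chi> i. \<rho>) :: (real^3) set"
 have sub: "?V \<subseteq> cbox 0 1" using V(2) unfolding subset_iff mem_box_cart by (auto intro: order_trans[OF _ V(2)])
 have "emeasure lborel ?V = (\<Prod>b\<in>Basis. ((\<chi> i. \<rho>) - 0) \<bullet> (b::real^3))"
  using V by (subst emeasure_lborel_cbox) (auto simp: Basis_vec_def inner_axis)
 also have "(\<Prod>b\<in>Basis. ((\<chi> i. \<rho>) - 0) \<bullet> (b::real^3)) = \<rho> ^ 3"
 proof -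
  have "(\<Prod>b\<in>Basis. ((\<chi> i. \<rho>) - 0) \<bullet> (b::real^3)) = (\<Prod>b\<in>(Basis :: (real^3) set). \<rho>)"
   by (rule prod.cong) (auto simp: Basis_vec_def inner_axis)
  then show ?thesis by simp
 qed
 finally have "measure lborel ?V = \<rho> ^ 3" using V by (simp add: measure_def)
 then have mV: "measure torus ?V = \<rho> ^ 3"
  unfolding torus_def using sub by (subst measure_restrict_space) auto
 have sV: "?V \<in> sets torus" unfolding torus_def using sub by (auto simp: sets_restrict_space_iff)
 have iV: "integrable torus (indicator ?V :: _ => real)"
  using sV by (intro integrable_real_indicator) (simp_all add: torus.emeasure_eq_measure)
 have "b * \<rho> ^ 3 - B = (AV x. b * indicator ?V x - B)"
  using iV sV mV torus.prob_space by (subst Bochner_Integration.integral_diff) (auto simp: Int_absorb2 sets.sets_into_space)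
 also have "... <= (AV x. f x)"
 proof (rule integral_mono)
  show "integrable torus (%x. b * indicator ?V x - B)" using iV by simp
  show "integrable torus f" by (rule torus_integrable[OF c])
  show "b * indicator ?V x - B <= f x" if "x \<in> space torus" for x
   using lo[of x] hi[of x] B that by (auto simp: space_torus split: split_indicator)
 qed
 finally show ?thesis .
qed

text \<open>If \<open>f 0\<close> were positive, powers of a cosine polynomial \<open>q\<close>
  exceeding 1 only near the lattice would make the mean of q^N f grow exponentially, while stability
  of the class keeps it zero. The other sign follows by applying this to \<open>- f\<close>.\<close>

lemma fourier_null_eq_0:
 assumes f: "fourier_null f"
 shows "f 0 = 0"
proof -
 have nonpos: "f 0 <= 0" if f: "fourier_null f" for f
 proof (rule ccontr)
  assume "\<not> f 0 <= 0"
  then have c0: "0 < f 0" by simp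
  have c: "cts f" and p: "periodic f" using f by (auto simp: fourier_null_def)
  obtain B where B: "B > 0" "!!x. norm (f x) <= B" by (rule periodic_continuous_bounded[OF p c]) blast
  have "\<exists>d>0. \<forall>x. dist x 0 < d \<longrightarrow> dist (f x) (f 0) < f 0 / 2"
   using c c0 unfolding continuous_on_iff by (metis UNIV_I half_gt_zero)
  then obtain d where d: "d > 0" "!!x. norm x < d ==> f 0 / 2 < f x"
   by (auto simp: dist_norm abs_less_iff) (smt (verit) field_sum_of_halves)
  \<comment> \<open>Coordinates closer than \<rho> to integers give, through the l1 norm, a point
    closer than d to the lattice; \<rho> <= 1/2 keeps the cosine monotone where it is
    compared.\<close>
  define \<rho> where "\<rho> = min (d / 4) (1/2)"
  have \<rho>: "0 < \<rho>" "\<rho> <= 1/2" "3 * \<rho> < d" using d(1) by (auto simp: \<rho>_def min_def)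
  have cos1: "cos (2 * pi * \<rho>) < 1"
   using cos_monotone_0_pi[of 0 "2 * pi * \<rho>"] \<rho> by (simp add: mult.commute)
  define \<eta> where "\<eta> = (1 - cos (2 * pi * \<rho>)) / 6"
  have "- 1 <= cos (2 * pi * \<rho>)" by simp
  then have "1 - cos (2 * pi * \<rho>) < 6" by linarith
  then have \<eta>: "0 < \<eta>" "\<eta> < 1" using cos1 unfolding \<eta>_def by simp_all
  \<comment> \<open>Normalized so that the bound is exactly 1 once some coordinate has distance at
    least \<rho> from the integers: one cosine is then at most cos (2 pi \<rho>), the others at most
    1, and the numerator at most 6 (1 - \<eta>). At the origin the value is 1 / (1 - \<eta>) >
    1.\<close>
  define q where "q x = (3 + (SU i. cos (2 * pi * (axis i 1 \<bullet> x)))) / (6 * (1 - \<eta>))" for x :: "real^3"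
  have q0: "0 <= q x" for x
  proof -
   have "(\<Sum>i\<in>(UNIV::3 set). - 1) <= (\<Sum>i\<in>(UNIV::3 set). cos (2 * pi * (axis i 1 \<bullet> x)))" by (intro sum_mono) simp
   then show ?thesis using \<eta> by (auto simp: q_def)
  qed
  have cq: "cts q" unfolding q_def using \<eta> by (intro continuous_intros) auto
  have null: "fourier_null (%x. q x ^ N * f x)" for N
  proof (induction N)
   case (Suc N)
   have "(%x. q x ^ Suc N * f x) = (%x. (1 / (6 * (1 - \<eta>))) * (3 * (q x ^ N * f x) + (cos (2 * pi * (axis 1 1 \<bullet> x)) * (q x ^ N * f x)
     + (cos (2 * pi * (axis 2 1 \<bullet> x)) * (q x ^ N * f x) + cos (2 * pi * (axis 3 1 \<bullet> x)) * (q x ^ N * f x)))))"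
    by (rule ext) (simp add: q_def sum_3 algebra_simps add_divide_distrib)
   then show ?case
    by (simp only:) (intro fourier_null_scale fourier_null_add fourier_null_mult_cos Suc axis_lattice)
  qed (use f in simp)
  \<comment> \<open>Either all coordinates are near integers and \<open>f\<close> is positive by
    periodicity, or \<open>q\<close> is at most 1 and the bound for \<open>f\<close> itself serves,
    uniformly in \<open>N\<close>.\<close>
  have low: "- B <= q x ^ N * f x" for x N
  proof (cases "\<forall>i. \<bar>x $ i - real_of_int (round (x $ i))\<bar> < \<rho>")
   case True
   define y where "y = x + (\<chi> i. - of_int (round (x $ i)))"
   have "norm y <= (SU i. \<bar>y $ i\<bar>)" by (rule norm_le_l1_cart)
   also have "... < (\<Sum>i\<in>(UNIV::3 set). \<rho>)" using True by (intro sum_strict_mono) (auto simp: y_def)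
   finally have "norm y < d" using \<rho> by simp
   then have "f 0 / 2 < f y" by (rule d(2))
   moreover have "f y = f x" unfolding y_def by (rule periodicD[OF p]) (auto simp: lattice_def)
   ultimately have "0 < f x" using c0 by simp
   then have "0 <= q x ^ N * f x" using q0 by simp
   then show ?thesis using B(1) by linarith
  next
   case False
   then obtain i where i: "\<rho> <= \<bar>x $ i - round (x $ i)\<bar>" by (auto simp: not_less)
   let ?s = "\<bar>x $ i - round (x $ i)\<bar>"
   have s: "?s <= 1/2" using of_int_round_abs_le[of "x $ i"] by (simp add: abs_minus_commute)
   have "cos (2 * pi * (axis i 1 \<bullet> x)) = cos (2 * pi * (x $ i - round (x $ i)))"
    using cos_int_2pin[of "round (x $ i)"] sin_int_2pin[of "round (x $ i)"]
    by (simp add: inner_axis' right_diff_distrib cos_diff mult.commute mult.left_commute)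
   also have "... = cos (2 * pi * ?s)" using cos_abs_real[of "2 * pi * (x $ i - round (x $ i))"] by (simp add: abs_mult)
   also have "... <= cos (2 * pi * \<rho>)"
    using i s \<rho> by (intro cos_monotone_0_pi_le) auto
   finally have ci: "cos (2 * pi * (axis i 1 \<bullet> x)) <= cos (2 * pi * \<rho>)" .
   have "(SU i. cos (2 * pi * (axis i 1 \<bullet> x))) = cos (2 * pi * (axis i 1 \<bullet> x)) + (\<Sum>j\<in>UNIV - {i}. cos (2 * pi * (axis j 1 \<bullet> x)))"
    by (subst sum.remove[of _ i]) auto
   also have "... <= cos (2 * pi * \<rho>) + (\<Sum>j\<in>UNIV - {i}. 1)" by (intro add_mono ci sum_mono) simp
   finally have "(SU i. cos (2 * pi * (axis i 1 \<bullet> x))) <= cos (2 * pi * \<rho>) + 2" by simp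
   moreover have "6 * (1 - \<eta>) = 5 + cos (2 * pi * \<rho>)" by (simp add: \<eta>_def field_simps)
   ultimately have "3 + (SU i. cos (2 * pi * (axis i 1 \<bullet> x))) <= 6 * (1 - \<eta>)" by linarith
   then have "q x <= 1" using \<eta> by (simp add: q_def)
   then have "q x ^ N <= 1" using q0 by (simp add: power_le_one)
   then have "\<bar>q x ^ N\<bar> * \<bar>f x\<bar> <= 1 * B" using q0[of x] B(2)[of x] by (intro mult_mono) auto
   then have "\<bar>q x ^ N * f x\<bar> <= B" by (simp add: abs_mult)
   then show ?thesis by linarith
  qed
  \<comment> \<open>Halfway between 1 and \<open>q 0\<close>; near the origin \<open>q\<close> still
    exceeds it, and its powers grow beyond every bound.\<close>
  define b where "b = (1 + 1 / (1 - \<eta>)) / 2"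
  have inv: "1 < 1 / (1 - \<eta>)" using \<eta> by simp
  have "q 0 = 1 / (1 - \<eta>)" using \<eta> by (simp add: q_def sum_3 field_simps)
  then have b1: "1 < b" "b < q 0" using inv by (auto simp: b_def)
  have "\<exists>e>0. \<forall>x. dist x 0 < e \<longrightarrow> dist (q x) (q 0) < q 0 - b"
   using cq b1(2) unfolding continuous_on_iff by (metis UNIV_I diff_gt_0_iff_gt)
  then obtain e where e: "e > 0" "!!x. norm x < e ==> b < q x"
   by (auto simp: dist_norm abs_less_iff)
  define r where "r = min (min (e / 4) (d / 4)) (1::real)"
  have r: "0 < r" "r <= 1" "3 * r < e" "3 * r < d" using e(1) d(1) by (auto simp: r_def min_def)
  have hi: "b ^ N * (f 0 / 2) <= q x ^ N * f x" if "x \<in> cbox 0 (\<chi> i. r)" for x N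
  proof -
   have "norm x <= (SU i. \<bar>x $ i\<bar>)" by (rule norm_le_l1_cart)
   also have "... <= (\<Sum>i\<in>(UNIV::3 set). r)" using that by (intro sum_mono) (auto simp: mem_box_cart)
   finally have n: "norm x < d" "norm x < e" using r by auto
   show ?thesis using d(2)[OF n(1)] e(2)[OF n(2)] b1 c0 by (intro mult_mono power_mono) auto
  qed
  have key: "b ^ N * (f 0 / 2) * r ^ 3 <= B" for N
  proof -
   have "b ^ N * (f 0 / 2) * r ^ 3 - B <= (AV x. q x ^ N * f x)"
    by (rule torus_const_power_bound[OF _ r(1,2)]) (use c cq c0 b1 B low hi in \<open>auto intro!: continuous_intros\<close>)
   also have "... = 0" using null[of N] by (auto simp: fourier_null_def fcos_def dest!: bspec[OF _ lattice_0])
   finally show ?thesis by simp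
  qed
  have C: "0 < f 0 / 2 * r ^ 3" using c0 r by simp
  obtain N where "B / (f 0 / 2 * r ^ 3) < b ^ N" using real_arch_pow[OF b1(1)] by blast
  then have "B < b ^ N * (f 0 / 2 * r ^ 3)" using C by (simp add: pos_divide_less_eq)
  then show False using key[of N] by (simp add: mult.assoc)
 qed
 from nonpos[OF f] nonpos[OF fourier_null_scale[OF f, of "- 1"]] show ?thesis by simp
qed

section \<open>Convolution with compactly supported kernels\<close>

lemma outside_cbox:
 fixes x :: "real^3"
 assumes "x \<notin> cbox (- (\<chi> i. R)) (\<chi> i. R)"
 shows "R <= norm x"
 using not_in_cbox_abs[OF assms] component_le_norm_cart[of x] by (meson le_cases order_trans)

lemma integrable_compact_support:
 fixes f :: "sfield"
 assumes "cts f" "!!x. R <= norm x ==> f x = 0"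
 shows "integrable lborel f"
 by (rule integral_compact_support_cbox(1)[OF assms(1)]) (rule assms(2)[OF outside_cbox])

lemma torus_lborel_swap:
 fixes W :: "real^3 => sfield"
 assumes c: "cts (%(x, h). W x h)" and z: "!!x h. R <= norm h ==> W x h = 0"
 shows "(AV x. LI h. W x h) = (LI h. AV x. W x h)"
  and "integrable lborel (%h. AV x. W x h)"
proof -
 let ?C = "cbox (- (\<chi> i. R)) (\<chi> i. R) :: (real^3) set"
 have c': "cts (%(h, x). W x h)"
  unfolding split_def by (intro continuous_on_pair_compose[OF c] continuous_intros)
 have c1: "cts (%h. W x h)" "cts (%x. W x h)" for x h
  by (intro continuous_on_pair_compose[OF c] continuous_intros)+
 have i: "(LI h. W x h) = integral ?C (%h. W x h)" for x
  by (rule integral_compact_support_cbox(2)[OF c1(1)]) (rule z[OF outside_cbox])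
 have ci: "cts (%h. AV x. W x h)" by (rule continuous_on_integral_torus[OF c'])
 have zi: "(AV x. W x h) = 0" if "R <= norm h" for h using z[OF that] by simp
 have "(AV x. LI h. W x h) = integral (cbox 0 1) (%x. integral ?C (%h. W x h))"
  unfolding i by (rule integral_torus_cbox, rule integral_continuous_on_param, rule continuous_on_subset[OF c], simp)
 also have "... = integral ?C (%h. integral (cbox 0 1) (%x. W x h))"
  by (rule integral_swap_continuous) (rule continuous_on_subset[OF c], simp)
 also have "... = integral ?C (%h. AV x. W x h)" by (simp add: integral_torus_cbox[OF c1(2)])
 also have "... = (LI h. AV x. W x h)"
  by (rule integral_compact_support_cbox(2)[OF ci, symmetric]) (rule zi[OF outside_cbox])
 finally show "(AV x. LI h. W x h) = (LI h. AV x. W x h)" .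
 show "integrable lborel (%h. AV x. W x h)" by (rule integrable_compact_support[OF ci zi])
qed

context
 fixes K f :: "sfield" and R :: real
 assumes K: "cts K" "!!h. R <= norm h ==> K h = 0"
  and f: "cts f"
begin

lemma convolution_cbox: "(LI h. K h * f (h + y)) = integral (cbox (- (\<chi> i. R)) (\<chi> i. R)) (%h. K h * f (h + y))"
 by (rule integral_compact_support_cbox(2))
   (auto intro!: continuous_intros cts_compose[OF K(1)] cts_compose[OF f] simp: K(2)[OF outside_cbox])

lemma continuous_convolution: "cts (%y. LI h. K h * f (h + y))"
 unfolding convolution_cbox
 by (rule integral_continuous_on_param)
   (auto simp: split_def intro!: continuous_intros cts_compose[OF K(1)] cts_compose[OF f])

lemma convolution_torus_swap:
 assumes g: "cts g"
 shows "(AV y. g y * (LI h. K h * f (h + y))) = (LI h. K h * (AV y. g y * f (y + h)))"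
proof -
 have "cts (%(y, h). g y * (K h * f (h + y)))"
  unfolding split_def by (intro continuous_intros cts_compose[OF g] cts_compose[OF f] cts_compose[OF K(1)]) auto
 then have "(AV y. LI h. g y * (K h * f (h + y))) = (LI h. AV y. g y * (K h * f (h + y)))"
  by (rule torus_lborel_swap(1)[where R=R]) (simp add: K(2))
 moreover have "(AV y. g y * (K h * f (h + y))) = K h * (AV y. g y * f (y + h))" for h
  by (simp add: mult.left_commute[of _ "K h"] add.commute)
 ultimately show ?thesis by simp
qed

text \<open>The kernel is paired with f(h + y) and not with f(y - h), which explains the signs. At y
  = 0 the convolution is the plain pairing of kernel and function.\<close>

lemma
 assumes p: "periodic f" and k: "k \<in> lattice"
 defines "Kc \<equiv> LI h. K h * cos (phase k h)" and "Ks \<equiv> LI h. K h * sin (phase k h)"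
 shows fcos_convolution: "fcos k (%y. LI h. K h * f (h + y)) = Kc * fcos k f + Ks * fsin k f"
  and fsin_convolution: "fsin k (%y. LI h. K h * f (h + y)) = Kc * fsin k f - Ks * fcos k f"
proof -
 note sh = integral_torus_shift
 have i: "integrable torus f" by (rule torus_integrable[OF f])
 note ic = integrable_cos[OF i, of k] and isn = integrable_sin[OF i, of k]
 have [measurable]: "f \<in> borel_measurable borel" by (rule cts_measurable[OF f])
 have c: "(AV y. cos (phase k y) * f (y + h)) = cos (phase k h) * fcos k f + sin (phase k h) * fsin k f" for h
 proof -
  have "(AV y. cos (phase k y) * f (y + h)) = (AV y. (%z. cos (phase k (z - h)) * f z) (y + h))" by simp
  also have "... = (AV z. cos (phase k (z - h)) * f z)"
   by (rule sh) (use cos_periodic_lattice[OF k, of _ "_ - h"] p in \<open>auto simp: periodic_def diff_add_eq[symmetric]\<close>)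
  also have "... = (AV z. cos (phase k h) * (cos (phase k z) * f z) + sin (phase k h) * (sin (phase k z) * f z))"
   by (rule lint_cong) (simp_all add: inner_diff_right right_diff_distrib cos_diff algebra_simps)
  also have "... = cos (phase k h) * fcos k f + sin (phase k h) * fsin k f"
   using ic isn by (simp add: fcos_def fsin_def)
  finally show ?thesis .
 qed
 have s: "(AV y. sin (phase k y) * f (y + h)) = cos (phase k h) * fsin k f - sin (phase k h) * fcos k f" for h
 proof -
  have "(AV y. sin (phase k y) * f (y + h)) = (AV y. (%z. sin (phase k (z - h)) * f z) (y + h))" by simp
  also have "... = (AV z. sin (phase k (z - h)) * f z)"
   by (rule sh) (use cos_periodic_lattice[OF k, of _ "_ - h"] p in \<open>auto simp: periodic_def diff_add_eq[symmetric]\<close>)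
  also have "... = (AV z. cos (phase k h) * (sin (phase k z) * f z) - sin (phase k h) * (cos (phase k z) * f z))"
   by (rule lint_cong) (simp_all add: inner_diff_right right_diff_distrib sin_diff algebra_simps)
  also have "... = cos (phase k h) * fsin k f - sin (phase k h) * fcos k f"
   using ic isn by (simp add: fcos_def fsin_def)
  finally show ?thesis .
 qed
 have iK: "integrable lborel (%h. K h * g h)" if "cts g" for g
  by (rule integrable_compact_support[where R=R]) (auto intro!: continuous_intros K that)
 have cc: "cts (%y::real^3. cos (phase k y))" "cts (%y::real^3. sin (phase k y))"
  by (intro continuous_intros)+
 note iK2 = iK[OF cc(1)] iK[OF cc(2)]
 have "fcos k (%y. LI h. K h * f (h + y)) = (LI h. (K h * cos (phase k h)) * fcos k f + (K h * sin (phase k h)) * fsin k f)"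
  using convolution_torus_swap[OF cc(1)] unfolding fcos_def[of k "%y. LI h. K h * f (h + y)"] c by (simp add: algebra_simps)
 also have "... = Kc * fcos k f + Ks * fsin k f" unfolding Kc_def Ks_def using iK2 by simp
 finally show "fcos k (%y. LI h. K h * f (h + y)) = Kc * fcos k f + Ks * fsin k f" .
 have "fsin k (%y. LI h. K h * f (h + y)) = (LI h. (K h * cos (phase k h)) * fsin k f - (K h * sin (phase k h)) * fcos k f)"
  using convolution_torus_swap[OF cc(2)] unfolding fsin_def[of k "%y. LI h. K h * f (h + y)"] s by (simp add: algebra_simps)
 also have "... = Kc * fsin k f - Ks * fcos k f" unfolding Kc_def Ks_def using iK2 by simp
 finally show "fsin k (%y. LI h. K h * f (h + y)) = Kc * fsin k f - Ks * fcos k f" .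
qed

end

lemma integral_lborel_reflect:
 fixes f :: "real^3 => 'b::{banach, second_countable_topology}"
 assumes [measurable]: "f \<in> borel_measurable borel"
 shows "(LI x. f (a - x)) = (LI x. f x)"
proof -
 have "lborel = distr lborel borel (%x. a + (- 1) *\<^sub>R x :: real^3)"
  using lborel_affine[of "- 1" a] by (simp add: density_1)
 then have "(LI x. f x) = (LINT x|distr lborel borel (%x. a + (- 1) *\<^sub>R x). f x)" by simp
 also have "... = (LI x. f (a + (- 1) *\<^sub>R x))" by (rule integral_distr) auto
 finally show ?thesis by simp
qed

lemma integral_torus_reflect:
 fixes f :: "sfield"
 assumes f: "f \<in> borel_measurable borel" "periodic f"
 shows "(AV x. f (- x)) = (AV x. f x)"
proof -
 note [measurable] = f(1)
 have one: "1 \<in> lattice" by (simp add: lattice_def)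
 \<comment> \<open>By periodicity the reflection may be taken about the centre of the cube, which it
   maps onto itself.\<close>
 have "(AV x. f (- x)) = (AV x. f (1 - x))"
  using periodicD[OF f(2) one, of "- x" for x] by simp
 also have "... = (LI x. indicator (cbox 0 1) x *\<^sub>R f (1 - x))"
  unfolding torus_def by (rule integral_restrict_space) auto
 also have "... = (LI x. (%x. indicator (cbox 0 1) x *\<^sub>R f x) (1 - x))"
  by (intro lint_cong) (auto simp: mem_box_cart split: split_indicator)
 also have "... = (LI x. indicator (cbox 0 1) x *\<^sub>R f x)" by (rule integral_lborel_reflect) measurable
 also have "... = (AV x. f x)" unfolding torus_def by (rule integral_restrict_space[symmetric]) auto
 finally show ?thesis .
qed

lemma
 fixes f :: "sfield"
 assumes c: "cts f" and p: "periodic f" and k: "k \<in> lattice"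
 shows fcos_odd: "(!!x. f (- x) = - f x) ==> fcos k f = 0"
  and fsin_even: "(!!x. f (- x) = f x) ==> fsin k f = 0"
proof -
 have [measurable]: "f \<in> borel_measurable borel" by (rule cts_measurable[OF c])
 have "(AV x. (%x. cos (phase k x) * f x) (- x)) = fcos k f"
  unfolding fcos_def by (subst integral_torus_reflect) (use p cos_periodic_lattice[OF k] in \<open>auto simp: periodic_def\<close>)
 then show "fcos k f = 0" if "!!x. f (- x) = - f x" using that by (simp add: fcos_def)
 have "(AV x. (%x. sin (phase k x) * f x) (- x)) = fsin k f"
  unfolding fsin_def by (subst integral_torus_reflect) (use p cos_periodic_lattice[OF k] in \<open>auto simp: periodic_def\<close>)
 then show "fsin k f = 0" if "!!x. f (- x) = f x" using that by (simp add: fsin_def)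
qed

lemma
 assumes G: "!!x. G differentiable (at x)" "cts (pderiv_at j G)" "!!h. R <= norm h ==> G h = 0"
 shows kernel_cos_pderiv: "(LI h. pderiv_at j G h * cos (phase k h)) = 2 * pi * k $ j * (LI h. G h * sin (phase k h))"
  and kernel_sin_pderiv: "(LI h. pderiv_at j G h * sin (phase k h)) = - (2 * pi * k $ j * (LI h. G h * cos (phase k h)))"
proof -
 have t: "trig k a b differentiable (at x)" "cts (pderiv_at j (trig k a b))" for a b :: real and x
  using smooth_trig[of k a b] by (auto simp: smooth_def dest: spec[of _ "Suc 0"])
 have pull: "(LI h. G h * (g h * (2 * pi * k $ j))) = 2 * pi * k $ j * (LI h. G h * g h)" for g
  by (subst Bochner_Integration.integral_mult_right_zero[symmetric]) (simp add: mult_ac)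
 show "(LI h. pderiv_at j G h * cos (phase k h)) = 2 * pi * k $ j * (LI h. G h * sin (phase k h))"
  using lborel_integration_by_parts[OF G(1,2) _ t(1)[of 1 0] t(2)[of 1 0], of R] G(3) unfolding pderiv_at_trig by (simp add: trig_def pull)
 show "(LI h. pderiv_at j G h * sin (phase k h)) = - (2 * pi * k $ j * (LI h. G h * cos (phase k h)))"
  using lborel_integration_by_parts[OF G(1,2) _ t(1)[of 0 1] t(2)[of 0 1], of R] G(3) unfolding pderiv_at_trig by (simp add: trig_def pull)
qed

lemma
 fixes f :: "3 => sfield"
 assumes "!!j. cts (f j)"
 shows fcos_sum: "fcos k (%x. SU j. f j x) = (SU j. fcos k (f j))"
  and fsin_sum: "fsin k (%x. SU j. f j x) = (SU j. fsin k (f j))"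
 using integrable_cos[OF torus_integrable[OF assms]] integrable_sin[OF torus_integrable[OF assms]]
 by (simp_all add: fcos_def fsin_def sum_distrib_left)

text \<open>The convolution of the three terms with \<open>G\<close> and its derivatives has vanishing Fourier
 coefficients, hence vanishes at the origin.\<close>

lemma distributional_identity:
 fixes D :: "real^3 => real^3" and \<Gamma> w G :: "sfield"
 assumes D: "cts D" "periodic D" "!!h. D (- h) = - D h"
  and \<Gamma>: "cts \<Gamma>" "periodic \<Gamma>" "!!h. \<Gamma> (- h) = \<Gamma> h"
  and w: "cts w" "periodic w" "!!h. w (- h) = w h"
  and modes: "!!k. k \<in> lattice ==>
   - (8 * pi^2 * (norm k)^2 * \<nu> * fcos k \<Gamma>) + pi * fsin k (%h. k \<bullet> D h) + fcos k w = 0"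
  and G: "!!x. G differentiable (at x)" "!!j x. pderiv_at j G differentiable (at x)"
   "!!j. cts (pderiv_at j (pderiv_at j G))" "!!h. R <= norm h ==> G h = 0"
 shows "(LI h. G h * w h) + 2 * \<nu> * (SU j. LI h. pderiv_at j (pderiv_at j G) h * \<Gamma> h)
  = 1/2 * (SU j. LI h. pderiv_at j G h * D h $ j)"
proof -
 have cG: "cts G" and cG1: "cts (pderiv_at j G)" for j
  using G(1,2) by (meson continuous_at_imp_continuous_on differentiable_imp_continuous_within)+
 \<comment> \<open>A derivative is known to vanish only where the norm strictly exceeds the radius;
   enlarging the radius by 1 for each derivative restores a non-strict condition.\<close>
 have z1: "pderiv_at j G h = 0" if "R + 1 <= norm h" for j h
  by (rule pderiv_at_eq_0_outside[OF G(4)]) (use that in auto)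
 have z2: "pderiv_at j (pderiv_at j G) h = 0" if "R + 2 <= norm h" for j h
  by (rule pderiv_at_eq_0_outside[OF z1]) (use that in auto)
 have cD: "cts (%h. D h $ j)" and pD: "periodic (%h. D h $ j)" for j
  using D by (auto simp: periodic_def intro!: continuous_intros)
 define A where "A y = (LI h. G h * w (h + y))" for y
 define B where "B j y = (LI h. pderiv_at j (pderiv_at j G) h * \<Gamma> (h + y))" for j y
 define C where "C j y = (LI h. pderiv_at j G h * D (h + y) $ j)" for j y
 have c: "cts A" "cts (B j)" "cts (C j)" for j
  unfolding A_def B_def C_def
  by (rule continuous_convolution[OF cG G(4) w(1)] continuous_convolution[OF G(3) z2 \<Gamma>(1)] continuous_convolution[OF cG1 z1 cD]; assumption)+
 have p: "periodic A" "periodic (B j)" "periodic (C j)" for j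
  using w(2) \<Gamma>(2) D(2) unfolding A_def B_def C_def by (auto simp: periodic_def add.assoc[symmetric])
 define \<Phi> where "\<Phi> y = A y + (2 * \<nu> * (SU j. B j y) + (- 1/2) * (SU j. C j y))" for y
 have coeff: "fcos k \<Phi> = 0 \<and> fsin k \<Phi> = 0" if k: "k \<in> lattice" for k
 proof -
  define Gc Gs where "Gc = (LI h. G h * cos (phase k h))" and "Gs = (LI h. G h * sin (phase k h))"
  have K1: "(LI h. pderiv_at j G h * cos (phase k h)) = 2 * pi * k $ j * Gs"
   "(LI h. pderiv_at j G h * sin (phase k h)) = - (2 * pi * k $ j * Gc)" for j
   unfolding Gc_def Gs_def by (rule kernel_cos_pderiv[OF G(1) cG1] kernel_sin_pderiv[OF G(1) cG1]; rule G(4); assumption)+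
  have K2: "(LI h. pderiv_at j (pderiv_at j G) h * cos (phase k h)) = 2 * pi * k $ j * (LI h. pderiv_at j G h * sin (phase k h))"
   "(LI h. pderiv_at j (pderiv_at j G) h * sin (phase k h)) = - (2 * pi * k $ j * (LI h. pderiv_at j G h * cos (phase k h)))" for j
   by (rule kernel_cos_pderiv[OF G(2,3)] kernel_sin_pderiv[OF G(2,3)]; rule z1; assumption)+
  define a b where "a = fcos k \<Gamma>" and "b = fcos k w"
  define s where "s j = fsin k (%h. D h $ j)" for j
  have zero: "fsin k \<Gamma> = 0" "fsin k w = 0" "fcos k (%h. D h $ j) = 0" for j
   by (rule fsin_even[OF \<Gamma>(1,2) k \<Gamma>(3)], rule fsin_even[OF w(1,2) k w(3)], rule fcos_odd[OF cD pD k]) (simp add: D(3))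
  have fA: "fcos k A = Gc * b" "fsin k A = - (Gs * b)"
   using fcos_convolution[OF cG G(4) w(1,2) k, where R=R] fsin_convolution[OF cG G(4) w(1,2) k, where R=R]
   by (simp_all add: A_def[abs_def] zero Gc_def Gs_def b_def)
  have fB: "fcos k (B j) = - (4 * pi^2 * (k $ j)^2 * Gc * a)" "fsin k (B j) = 4 * pi^2 * (k $ j)^2 * Gs * a" for j
   using fcos_convolution[OF G(3)[of j] z2[where j=j] \<Gamma>(1,2) k, where R="R+2"] fsin_convolution[OF G(3)[of j] z2[where j=j] \<Gamma>(1,2) k, where R="R+2"]
   unfolding B_def[abs_def] zero K2 K1 a_def[symmetric] Gc_def[symmetric] Gs_def[symmetric] by (simp_all add: power2_eq_square mult_ac)
  have fC: "fcos k (C j) = - (2 * pi * k $ j * Gc * s j)" "fsin k (C j) = 2 * pi * k $ j * Gs * s j" for j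
   using fcos_convolution[OF cG1[of j] z1[where j=j] cD[of j] pD[of j] k, where R="R+1"] fsin_convolution[OF cG1[of j] z1[where j=j] cD[of j] pD[of j] k, where R="R+1"]
   unfolding C_def[abs_def] zero K1 s_def[symmetric] Gc_def[symmetric] Gs_def[symmetric] by (simp_all add: mult_ac)
  have "fsin k (%h. k \<bullet> D h) = (SU j. fsin k (%h. k $ j * D h $ j))"
   unfolding inner_vec_def inner_real_def by (rule fsin_sum) (intro continuous_intros cD)
  then have m: "- (8 * pi^2 * (norm k)^2 * \<nu> * a) + pi * (SU j. k $ j * s j) + b = 0"
   using modes[OF k] by (simp add: fsin_scale s_def a_def b_def)
  have n: "(norm k)^2 = (SU j. (k $ j)^2)" by (rule norm_sq_eq_sum)
  note ic = torus_integrable[OF c(1)]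
  have ir: "integrable torus (%y. 2 * \<nu> * (SU j. B j y))" "integrable torus (%y. (- 1/2) * (SU j. C j y))"
   by (intro torus_integrable continuous_intros c)+
  \<comment> \<open>Parity leaves a single coefficient of each of the three functions, so both
    coefficients of \<Phi> are the mode identity multiplied by \<open>Gc\<close> or by
    \<open>- Gs\<close>.\<close>
  have "fcos k \<Phi> = Gc * b + (2 * \<nu> * (SU j. - (4 * pi^2 * (k $ j)^2 * Gc * a)) + (- 1/2) * (SU j. - (2 * pi * k $ j * Gc * s j)))"
   unfolding \<Phi>_def fcos_add[OF ic Bochner_Integration.integrable_add[OF ir]] fcos_add[OF ir] fcos_scale fcos_sum[OF c(2)] fcos_sum[OF c(3)] fA fB fC ..
  also have "... = Gc * (- (8 * pi^2 * (norm k)^2 * \<nu> * a) + pi * (SU j. k $ j * s j) + b)"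
   unfolding n sum_3 by (simp add: algebra_simps)
  finally have 1: "fcos k \<Phi> = 0" using m by simp
  have "fsin k \<Phi> = - (Gs * b) + (2 * \<nu> * (SU j. 4 * pi^2 * (k $ j)^2 * Gs * a) + (- 1/2) * (SU j. 2 * pi * k $ j * Gs * s j))"
   unfolding \<Phi>_def fsin_add[OF ic Bochner_Integration.integrable_add[OF ir]] fsin_add[OF ir] fsin_scale fsin_sum[OF c(2)] fsin_sum[OF c(3)] fA fB fC ..
  also have "... = - Gs * (- (8 * pi^2 * (norm k)^2 * \<nu> * a) + pi * (SU j. k $ j * s j) + b)"
   unfolding n sum_3 by (simp add: algebra_simps)
  finally have 2: "fsin k \<Phi> = 0" using m by simp
  from 1 2 show ?thesis by simp
 qed
 have "fourier_null \<Phi>"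
  unfolding fourier_null_def using coeff p
  by (auto simp: \<Phi>_def[abs_def] periodic_def intro!: continuous_intros c)
 then have "\<Phi> 0 = 0" by (rule fourier_null_eq_0)
 then show ?thesis by (simp add: \<Phi>_def A_def B_def C_def)
qed

section \<open>Pairing a derivative with a Lipschitz function\<close>

lemma continuous_on_differentiable:
 fixes f :: "real^3 => 'b::real_normed_vector"
 assumes "!!x. f differentiable (at x)"
 shows "cts f"
 using assms by (meson continuous_at_imp_continuous_on differentiable_imp_continuous_within)

lemma bounded_on_cball:
 fixes f :: "sfield"
 assumes "cts f"
 obtains C where "C \<ge> 0" "!!x. norm x <= R ==> \<bar>f x\<bar> <= C"
proof -
 have "compact (f ` cball 0 R)" by (intro compact_continuous_image continuous_on_subset[OF assms]) auto
 from compact_imp_bounded[OF this] obtain C where "\<forall>y\<in>f ` cball 0 R. norm y <= C" unfolding bounded_iff by blast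
 then have "\<bar>f x\<bar> <= \<bar>C\<bar>" if "norm x <= R" for x using that by (auto intro: order_trans[OF _ abs_ge_self])
 then show thesis using that[of "\<bar>C\<bar>"] by simp
qed

lemma compact_support_bounded:
 fixes f :: "sfield"
 assumes "cts f" "!!x. R <= norm x ==> f x = 0"
 obtains C where "C \<ge> 0" "!!x. \<bar>f x\<bar> <= C"
proof -
 obtain C where C: "C \<ge> 0" "!!x. norm x <= R ==> \<bar>f x\<bar> <= C" by (rule bounded_on_cball[OF assms(1)]) blast
 have "\<bar>f x\<bar> <= C" for x using C(1) C(2)[of x] assms(2)[of x] by (cases "norm x <= R") auto
 with C(1) show thesis by (rule that)
qed

text \<open>As \<Gamma> is only Lipschitz, the derivative of \<open>f\<close> is replaced by a
  difference quotient, which a change of variables moves to \<Gamma>, where it is at most \<Lambda>.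
  The mean value theorem supplies the bound for dominated convergence.\<close>

lemma lipschitz_pairing:
 fixes f \<Gamma> :: "sfield"
 assumes f: "!!x. f differentiable (at x)" "cts (pderiv_at j f)" "!!x. R <= norm x ==> f x = 0"
  and \<Gamma>: "cts \<Gamma>" "!!h h'. \<bar>\<Gamma> h - \<Gamma> h'\<bar> <= \<Lambda> * norm (h - h')"
 shows "\<bar>LI h. pderiv_at j f h * \<Gamma> h\<bar> <= \<Lambda> * (LI h. \<bar>f h\<bar>)"
proof -
 let ?e = "axis j 1 :: real^3"
 define s where "s n = 1 / real (Suc n)" for n
 have s: "0 < s n" "s n <= 1" for n by (auto simp: s_def)
 have s0: "s \<longlonglongrightarrow> 0" unfolding s_def using LIMSEQ_inverse_real_of_nat by (simp add: inverse_eq_divide)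
 have cf: "cts f" by (rule continuous_on_differentiable[OF f(1)])
 note [measurable] = cts_measurable[OF cf] cts_measurable[OF \<Gamma>(1)] cts_measurable[OF f(2)]
 obtain C where C: "C \<ge> 0" "!!x. \<bar>pderiv_at j f x\<bar> <= C"
  by (rule compact_support_bounded[OF f(2), of "R + 1"]) (rule pderiv_at_eq_0_outside[OF f(3)], auto)
 define q where "q n h = (f (h + s n *\<^sub>R ?e) - f h) / s n" for n h
 have quot: "\<bar>q n h\<bar> <= C" for n h
 proof -
  have "\<exists>z. 0 < z \<and> z < s n \<and> f (h + s n *\<^sub>R ?e) - f (h + 0 *\<^sub>R ?e) = (s n - 0) * pderiv_at j f (h + z *\<^sub>R ?e)"
   by (rule MVT2[OF s(1)]) (rule line_derivative[OF f(1)])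
  then obtain z where "f (h + s n *\<^sub>R ?e) - f h = s n * pderiv_at j f (h + z *\<^sub>R ?e)" by auto
  then have "q n h = pderiv_at j f (h + z *\<^sub>R ?e)" using s(1)[of n] by (simp add: q_def)
  then show ?thesis using C(2) by simp
 qed
 have far: "q n h = 0" if "R + 1 <= norm h" for n h
 proof -
  have "norm h - norm (s n *\<^sub>R ?e) <= norm (h + s n *\<^sub>R ?e)" by (rule norm_diff_ineq)
  then have "R <= norm (h + s n *\<^sub>R ?e)" using that s[of n] by simp
  then show ?thesis using that by (simp add: q_def f(3))
 qed
 have lim: "(%n. LI h. q n h * \<Gamma> h) \<longlonglongrightarrow> (LI h. pderiv_at j f h * \<Gamma> h)"
 proof (rule integral_dominated_convergence)
  show "integrable lborel (%h. indicator (cball 0 (R + 1)) h *\<^sub>R (C * \<bar>\<Gamma> h\<bar>))"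
   by (intro borel_integrable_compact continuous_intros continuous_on_subset[OF \<Gamma>(1)]) auto
  show "AE h in lborel. norm (q n h * \<Gamma> h) <= indicator (cball 0 (R + 1)) h *\<^sub>R (C * \<bar>\<Gamma> h\<bar>)" for n
   using quot[of n] far[of _ n] by (intro AE_I2) (auto simp: abs_mult split: split_indicator intro!: mult_right_mono)
  show "AE h in lborel. (%n. q n h * \<Gamma> h) \<longlonglongrightarrow> pderiv_at j f h * \<Gamma> h"
  proof (rule AE_I2)
   fix h :: "real^3"
   have "((%t. f (h + t *\<^sub>R ?e)) has_real_derivative pderiv_at j f h) (at 0)"
    using line_derivative[OF f(1), of h j 0] by simp
   then have "((%t. (f (h + t *\<^sub>R ?e) - f h) / t) \<longlongrightarrow> pderiv_at j f h) (at 0)" by (simp add: DERIV_def)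
   moreover have "filterlim s (at 0) sequentially"
    using s0 s(1) by (auto simp: filterlim_at intro!: always_eventually) (metis less_irrefl)
   ultimately have "(%n. q n h) \<longlonglongrightarrow> pderiv_at j f h" unfolding q_def by (rule filterlim_compose)
   then show "(%n. q n h * \<Gamma> h) \<longlonglongrightarrow> pderiv_at j f h * \<Gamma> h" by (intro tendsto_intros)
  qed
 qed (simp_all add: q_def)
 have bound: "\<bar>LI h. q n h * \<Gamma> h\<bar> <= \<Lambda> * (LI h. \<bar>f h\<bar>)" for n
 proof -
  have i1: "integrable lborel (%h. f h * \<Gamma> (h - a))" for a
   by (rule integrable_compact_support[where R=R])
     (auto intro!: continuous_intros cts_compose[OF \<Gamma>(1)] cf simp: f(3))
  have c2: "cts (%h. f (h + a) * \<Gamma> h)" for a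
   by (intro continuous_intros \<Gamma>(1) cts_compose[OF cf]) auto
  have i2: "integrable lborel (%h. f (h + a) * \<Gamma> h)" for a
  proof (rule integrable_compact_support[OF c2, where R="R + norm a"])
   fix h :: "real^3" assume "R + norm a <= norm h"
   then have "R <= norm (h + a)" using norm_diff_ineq[of h a] by linarith
   then show "f (h + a) * \<Gamma> h = 0" by (simp add: f(3))
  qed
  have if': "integrable lborel (%h. \<bar>f h\<bar>)" using integrable_compact_support[OF cf f(3)] by simp
  have "(LI h. q n h * \<Gamma> h) = (LI h. (f (h + s n *\<^sub>R ?e) * \<Gamma> h - f (h + 0) * \<Gamma> h) / s n)"
   by (simp add: q_def algebra_simps)
  also have "... = ((LI h. f (h + s n *\<^sub>R ?e) * \<Gamma> h) - (LI h. f h * \<Gamma> h)) / s n"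
   using i2[of "s n *\<^sub>R ?e"] i2[of 0] by simp
  also have "(LI h. f (h + s n *\<^sub>R ?e) * \<Gamma> h) = (LI h. (%h. f h * \<Gamma> (h - s n *\<^sub>R ?e)) (h + s n *\<^sub>R ?e))" by simp
  also have "... = (LI h. f h * \<Gamma> (h - s n *\<^sub>R ?e))" by (rule integral_lborel_shift) measurable
  also have "(\<dots> - (LI h. f h * \<Gamma> h)) / s n = (LI h. f h * ((\<Gamma> (h - s n *\<^sub>R ?e) - \<Gamma> h) / s n))"
   using i1[of "s n *\<^sub>R ?e"] i1[of 0] by (simp add: right_diff_distrib diff_divide_distrib)
  finally have eq: "(LI h. q n h * \<Gamma> h) = (LI h. f h * ((\<Gamma> (h - s n *\<^sub>R ?e) - \<Gamma> h) / s n))" .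
  have "\<bar>LI h. f h * ((\<Gamma> (h - s n *\<^sub>R ?e) - \<Gamma> h) / s n)\<bar> <= (LI h. \<bar>f h\<bar> * \<Lambda>)"
  proof (rule order_trans[OF integral_abs_bound], rule integral_mono_AE')
   show "AE h in lborel. \<bar>f h * ((\<Gamma> (h - s n *\<^sub>R ?e) - \<Gamma> h) / s n)\<bar> <= \<bar>f h\<bar> * \<Lambda>"
   proof (rule AE_I2)
    fix h
    have "\<bar>\<Gamma> (h - s n *\<^sub>R ?e) - \<Gamma> h\<bar> <= \<Lambda> * s n" using \<Gamma>(2)[of "h - s n *\<^sub>R ?e" h] s(1)[of n] by simp
    then have "\<bar>(\<Gamma> (h - s n *\<^sub>R ?e) - \<Gamma> h) / s n\<bar> <= \<Lambda>" using s(1)[of n] by (simp add: pos_divide_le_eq)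
    then show "\<bar>f h * ((\<Gamma> (h - s n *\<^sub>R ?e) - \<Gamma> h) / s n)\<bar> <= \<bar>f h\<bar> * \<Lambda>" by (simp only: abs_mult mult_left_mono abs_ge_zero)
   qed
  qed (use if' order_trans[OF abs_ge_zero \<Gamma>(2)[of "axis 1 1" 0]] in auto)
  then show ?thesis unfolding eq using if' by (simp add: mult.commute)
 qed
 show ?thesis by (rule LIMSEQ_le_const2[OF tendsto_rabs[OF lim]]) (use bound in auto)
qed

section \<open>Radial test functions\<close>

text \<open>A profile in the variable |h|^2, which makes the radial kernel as smooth at the origin
  as the profile itself. Nonnegativity lets error bounds be kept under the integral until the radius
  is localized.\<close>

definition bump :: "real => (real => real) => bool" where
 "bump R ka \<longleftrightarrow> (\<exists>ka'. (\<forall>z. (ka has_real_derivative ka' z) (at z)) \<and> cts ka') \<and>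
   (\<forall>z. 0 <= ka z) \<and> (\<forall>z\<ge>R\<^sup>2. ka z = 0)"

lemma bump_continuous: assumes "bump R ka" shows "cts ka"
proof -
 obtain ka' where "!!z. (ka has_real_derivative ka' z) (at z)" using assms by (auto simp: bump_def)
 then show ?thesis by (rule DERIV_continuous_on)
qed

text \<open>\<open>th\<close> is the integral of \<open>ka\<close> from z to R^2. Its radial kernel
  is twice continuously differentiable and has gradient -2 ka(|h|^2) h, so testing with
  \<open>th\<close> produces \<open>D\<close> weighted by \<open>ka\<close> in the radial
  direction.\<close>

lemma bump_tail:
 assumes ka: "bump R ka"
 obtains th where "bump R th" "!!z. (th has_real_derivative - ka z) (at z)"
proof -
 have c: "cts ka" by (rule bump_continuous[OF ka])
 have "\<exists>F. \<forall>x::real. -\<infinity> < ereal x \<longrightarrow> ereal x < \<infinity> \<longrightarrow> (F has_vector_derivative ka x) (at x)"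
  by (rule einterval_antiderivative) (use c in \<open>auto simp: continuous_on_eq_continuous_at\<close>)
 then obtain F where F: "!!x. (F has_real_derivative ka x) (at x)" by (auto simp: has_real_derivative_iff_has_vector_derivative)
 define th where "th z = F (R^2) - F z" for z
 have d: "(th has_real_derivative - ka z) (at z)" for z
  unfolding th_def by (auto intro!: derivative_eq_intros F)
 have nn: "!!z. 0 <= ka z" and z: "!!z. R^2 <= z ==> ka z = 0" using ka by (auto simp: bump_def)
 have mono: "th y <= th x" if "x <= y" for x y
  by (rule DERIV_nonpos_imp_nonincreasing[OF that]) (use d nn in \<open>auto intro!: exI[of _ "- ka _"]\<close>)
 have zero: "th y = 0" if y: "R^2 <= y" for y
 proof -
  have "th (R^2) <= th y"
   by (rule DERIV_nonneg_imp_nondecreasing[OF y]) (use d z in \<open>metis order_refl minus_zero\<close>)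
  then show ?thesis using mono[OF y] by (simp add: th_def)
 qed
 have "0 <= th x" for x using mono[of x "max x (R^2)"] zero[of "max x (R^2)"] by simp
 then have "bump R th" unfolding bump_def using d c zero by (auto intro!: exI[of _ "%z. - ka z"] continuous_intros)
 then show thesis using that d by blast
qed

lemma radial_pderiv:
 fixes th :: "real => real"
 assumes "!!z. (th has_real_derivative th' z) (at z)"
 shows "(%h. th (sq h)) differentiable (at (h::real^3))"
  and "pderiv_at j (%h. th (sq h)) = (%h. 2 * h $ j * th' (sq h))"
proof -
 have d: "((%h. th (sq h)) has_derivative (%v. th' (sq h) * (h \<bullet> v + v \<bullet> h))) (at h)" for h :: "real^3"
  by (rule has_derivative_compose[where g=th and f="%h. h \<bullet> h" and g'="%t. th' (sq h) * t"])
    (use assms in \<open>auto simp: has_field_derivative_def intro!: derivative_eq_intros\<close>)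
 show "(%h. th (sq h)) differentiable (at (h::real^3))" using d by (auto simp: differentiable_def)
 show "pderiv_at j (%h. th (sq h)) = (%h. 2 * h $ j * th' (sq h))"
  by (rule ext, subst pderiv_at_eqI[OF d]) (simp add: inner_axis inner_commute)
qed

lemma norm_le_inner: "0 <= R ==> R <= norm h ==> R^2 <= h \<bullet> (h::'a::real_inner)"
 by (simp flip: power2_norm_eq_inner add: power_mono)

lemma continuous_radial: "cts ka ==> cts (%h::'a::real_inner. ka (sq h))" for ka :: "real => real"
 by (auto intro!: cts_compose[of UNIV ka] continuous_intros)

lemma bump_integrable:
 assumes ka: "bump R ka" and R: "0 <= R" and f: "cts f"
 shows "integrable lborel (%h::real^3. ka (sq h) * f h)"
 using ka norm_le_inner[OF R]
 by (intro integrable_compact_support[where R=R] continuous_intros continuous_radial bump_continuous[OF ka] f) (auto simp: bump_def)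

lemma bump_integral_add:
 assumes "bump R ka" "0 <= R" "cts f" "cts g"
 shows "(LI h. ka (sq h) * (f h + g h)) = (LI h. ka (sq h) * f h) + (LI h. ka (sq h) * g h)"
 using bump_integrable[OF assms(1-3)] bump_integrable[OF assms(1,2,4)] by (simp add: distrib_left)

lemma bump_integral_scale:
 "(LI h. ka (sq h) * (c * f h)) = c * (LI h. ka (sq h) * f h)" for c :: real
 by (simp add: mult.left_commute[of _ c])

text \<open>Integration by parts against the field |h|^(2m) h, of divergence (3 + 2m) |h|^(2m). The
  factors 2/3 for m = 0 and 2/5 for m = 1 are what turns into the constants of the two laws.\<close>

lemma bump_tail_moment:
 assumes ka: "bump R ka" and th: "bump R th" "!!z. (th has_real_derivative - ka z) (at z)" and R: "0 <= R"
 shows "(3 + 2 * real m) * (LI h. th (sq h) * (sq h) ^ m) = 2 * (LI h. ka (sq h) * (sq h) ^ Suc m)"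
proof -
 let ?g = "%j (h::real^3). h $ j * (sq h) ^ m"
 note G = radial_pderiv[OF th(2)]
 have dg: "(?g j has_derivative (%v. h $ j * (real m * (sq h) ^ (m - 1) * (h \<bullet> v + v \<bullet> h)) + v $ j * (sq h) ^ m)) (at h)" for j h
  by (auto intro!: derivative_eq_intros bounded_linear.has_derivative[OF bounded_linear_vec_nth] simp: algebra_simps)
 have pg: "pderiv_at j (?g j) = (%h. 2 * real m * (sq h) ^ (m - 1) * (h $ j)^2 + (sq h) ^ m)" for j
  by (rule ext, subst pderiv_at_eqI[OF dg]) (simp add: inner_axis inner_commute power2_eq_square algebra_simps)
 have z: "th (sq h) = 0" if "R <= norm h" for h :: "real^3"
  using th(1) norm_le_inner[OF R that] by (auto simp: bump_def)
 have ibp: "(LI h. 2 * h $ j * - ka (sq h) * ?g j h) = - (LI h. th (sq h) * (2 * real m * (sq h) ^ (m - 1) * (h $ j)^2 + (sq h) ^ m))" for j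
 proof -
  have "(LI h. pderiv_at j (%h. th (sq h)) h * ?g j h) = - (LI h. th (sq h) * pderiv_at j (?g j) h)"
   by (rule lborel_integration_by_parts[OF G(1) _ z])
     (use dg in \<open>auto simp: G(2) pg differentiable_def intro!: continuous_intros continuous_radial bump_continuous[OF ka]\<close>)
  then show ?thesis unfolding G(2) pg .
 qed
 have cp: "cts (%h::real^3. (sq h) ^ m)" "cts (%h::real^3. h $ j)" for j m
  by (intro continuous_intros)+
 have sq: "h \<bullet> h = (SU j. (h $ j)^2)" for h :: "real^3" by (simp add: inner_vec_def power2_eq_square)
 have "2 * (LI h. ka (sq h) * (sq h) ^ Suc m) = (LI h. (SU j. 2 * (ka (sq h) * ((h $ j)^2 * (sq h) ^ m))))"
  by (simp add: sum_distrib_left[symmetric] sum_distrib_right[symmetric] sq[symmetric])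
 also have "... = (SU j. 2 * (LI h. ka (sq h) * ((h $ j)^2 * (sq h) ^ m)))"
  by (subst lint_sum) (auto intro!: bump_integrable[OF ka R] continuous_intros)
 also have "... = (SU j. - (LI h. 2 * h $ j * - ka (sq h) * ?g j h))"
 proof (rule sum.cong[OF refl])
  show "2 * (LI h. ka (sq h) * ((h $ j)^2 * (sq h) ^ m)) = - (LI h. 2 * h $ j * - ka (sq h) * ?g j h)" for j
   by (subst Bochner_Integration.integral_mult_right_zero[symmetric], subst Bochner_Integration.integral_minus[symmetric])
     (simp add: power2_eq_square mult_ac)
 qed
 also have "... = (SU j. (LI h. th (sq h) * (2 * real m * (sq h) ^ (m - 1) * (h $ j)^2 + (sq h) ^ m)))"
  unfolding ibp by simp
 also have "... = (LI h. (SU j. th (sq h) * (2 * real m * (sq h) ^ (m - 1) * (h $ j)^2 + (sq h) ^ m)))"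
  by (subst lint_sum) (auto intro!: bump_integrable[OF th(1) R] continuous_intros)
 also have "... = (LI h. (3 + 2 * real m) * (th (sq h) * (sq h) ^ m))"
 proof (rule lint_cong[OF refl])
  fix h :: "real^3"
  have "(SU j. th (sq h) * (2 * real m * (sq h) ^ (m - 1) * (h $ j)^2 + (sq h) ^ m))
    = th (sq h) * (2 * real m * (sq h) ^ (m - 1) * (sq h) + 3 * (sq h) ^ m)"
   by (simp add: sum.distrib sum_distrib_left[symmetric] sq[symmetric])
  \<comment> \<open>For m = 0 the truncated exponent m - 1 would be wrong, but the factor
    \<open>real m\<close> is then zero.\<close>
  also have "2 * real m * (sq h) ^ (m - 1) * (sq h) = 2 * real m * (sq h) ^ m" by (cases m) auto
  finally show "(SU j. th (sq h) * (2 * real m * (sq h) ^ (m - 1) * (h $ j)^2 + (sq h) ^ m)) = (3 + 2 * real m) * (th (sq h) * (sq h) ^ m)"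
   by (simp add: algebra_simps)
 qed
 finally show ?thesis by simp
qed

text \<open>\<open>distributional_identity\<close> with the kernel \<open>th\<close>. Replacing
  \<open>w\<close> by its value 2 \<epsilon> at the origin costs \<eta> times the mass of
  \<open>th\<close>, that is 2/3 of the moment of \<open>ka\<close>; one derivative in the viscous
  term is absorbed by the Lipschitz bound.\<close>

lemma radial_balance:
 fixes D :: "real^3 => real^3" and \<Gamma> w :: "sfield"
 assumes D: "cts D" "periodic D" "!!h. D (- h) = - D h"
  and \<Gamma>: "cts \<Gamma>" "periodic \<Gamma>" "!!h. \<Gamma> (- h) = \<Gamma> h"
  and w: "cts w" "periodic w" "!!h. w (- h) = w h"
  and modes: "!!k. k \<in> lattice ==>
   - (8 * pi^2 * (norm k)^2 * \<nu> * fcos k \<Gamma>) + pi * fsin k (%h. k \<bullet> D h) + fcos k w = 0"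
  and lip: "!!h h'. \<bar>\<Gamma> h - \<Gamma> h'\<bar> <= \<Lambda> * norm (h - h')" and \<nu>: "0 <= \<nu>"
  and near: "!!h. norm h < R ==> \<bar>w h - 2 * \<epsilon>\<bar> <= \<eta>" and R: "0 <= R" and r: "0 < r"
  and ka: "bump R ka"
 shows "\<bar>LI h. ka (sq h) * (h \<bullet> D h + 4/3 * \<epsilon> * (sq h))\<bar>
  <= (LI h. ka (sq h) * (2/3 * \<eta> * (sq h) + 6 * \<nu> * \<Lambda> * (r + (sq h) / r)))"
proof -
 obtain th where th: "bump R th" "!!z. (th has_real_derivative - ka z) (at z)" by (rule bump_tail[OF ka]) blast
 obtain ka' where ka': "!!z. (ka has_real_derivative ka' z) (at z)" "cts ka'" using ka by (auto simp: bump_def)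
 have nn: "0 <= ka z" "0 <= th z" for z using ka th(1) by (auto simp: bump_def)
 note G = radial_pderiv[OF th(2)] and X = radial_pderiv[OF DERIV_minus[OF ka'(1)]]
 have z: "th (sq h) = 0" "ka (sq h) = 0" if "R <= norm h" for h :: "real^3"
  using th(1) ka norm_le_inner[OF R that] by (auto simp: bump_def)
 let ?G = "%h::real^3. th (sq h)" and ?g = "%j (h::real^3). 2 * h $ j * - ka (sq h)"
 have lin: "((%h::real^3. 2 * h $ j) has_derivative (%v. 2 * v $ j)) (at h)" for j h
  by (intro has_derivative_mult_right bounded_linear.has_derivative[OF bounded_linear_vec_nth] has_derivative_ident)
 have d2: "?g j differentiable (at h)" for j h
  by (rule differentiable_mult[OF differentiableI[OF lin] X(1)])
 have p2: "pderiv_at j (?g j) = (%h. 2 * h $ j * (2 * h $ j * - ka' (sq h)) + 2 * - ka (sq h))" for j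
  by (rule ext, subst pderiv_at_mult[OF differentiableI[OF lin] X(1)]) (simp add: pderiv_at_eqI[OF lin] X(2))
 have c2: "cts (pderiv_at j (?g j))" for j
  unfolding p2 by (intro continuous_intros continuous_radial bump_continuous[OF ka] ka'(2))
 note i_ka = bump_integrable[OF ka R] and iG = bump_integrable[OF th(1) R] and add = bump_integral_add[OF ka R]
 let ?m = "LI h. ka (sq h) * (sq h)"
 have id: "(LI h. ?G h * w h) + 2 * \<nu> * (SU j. LI h. pderiv_at j (?g j) h * \<Gamma> h)
  = 1/2 * (SU j. LI h. ?g j h * D h $ j)"
  using distributional_identity[OF D \<Gamma> w modes G(1), of R] d2 c2 z(1) by (simp add: G(2))
 have "(SU j. LI h. ?g j h * D h $ j) = (LI h. (SU j. ?g j h * D h $ j))"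
  by (rule lint_sum[symmetric], rule integrable_compact_support[where R=R])
    (auto intro!: continuous_intros D continuous_radial bump_continuous[OF ka] simp: z)
 also have "... = (LI h. ka (sq h) * (- 2 * (h \<bullet> D h)))"
  by (simp add: inner_vec_def[of _ "D _"] sum_distrib_left sum_negf mult_ac)
 also have "... = - 2 * (LI h. ka (sq h) * (h \<bullet> D h))" by (rule bump_integral_scale)
 finally have flux: "1/2 * (SU j. LI h. ?g j h * D h $ j) = - (LI h. ka (sq h) * (h \<bullet> D h))"
  by simp
 have mom: "3 * (LI h. ?G h) = 2 * ?m" using bump_tail_moment[OF ka th R, of 0] by simp
 have "(LI h. ?G h * w h) = (LI h. ?G h * (w h - 2 * \<epsilon>)) + 2 * \<epsilon> * (LI h. ?G h)"
  using iG[of "%h. w h"] iG[of "%_. 1"] w(1) by (simp add: right_diff_distrib)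
 then have split: "(LI h. ?G h * w h) = (LI h. ?G h * (w h - 2 * \<epsilon>)) + 4/3 * \<epsilon> * ?m"
  using mom by simp
 have tot: "(LI h. ka (sq h) * (h \<bullet> D h + 4/3 * \<epsilon> * (sq h))) = (LI h. ka (sq h) * (h \<bullet> D h)) + 4/3 * \<epsilon> * ?m"
  unfolding bump_integral_scale[of ka, symmetric] by (intro add continuous_intros D)
 have E1: "\<bar>LI h. ?G h * (w h - 2 * \<epsilon>)\<bar> <= 2/3 * \<eta> * ?m"
 proof -
  have "\<bar>LI h. ?G h * (w h - 2 * \<epsilon>)\<bar> <= (LI h. ?G h * \<eta>)"
  proof (rule order_trans[OF integral_abs_bound], rule integral_mono)
   show "integrable lborel (%h. \<bar>?G h * (w h - 2 * \<epsilon>)\<bar>)" by (intro integrable_abs iG continuous_intros w)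
   show "integrable lborel (%h. ?G h * \<eta>)" by (intro iG continuous_intros)
   show "\<bar>?G h * (w h - 2 * \<epsilon>)\<bar> <= ?G h * \<eta>" for h
    using near[of h] z(1)[of h] nn(2) by (cases "norm h < R") (auto simp: abs_mult intro!: mult_left_mono)
  qed
  also have "... = (LI h. ?G h) * \<eta>" by (rule integral_mult_left_zero)
  also have "(LI h. ?G h) = 2/3 * ?m" using mom by simp
  finally show ?thesis by (simp add: mult_ac)
 qed
 \<comment> \<open>Bounds 2 |h_j| by the inequality of means. It is a polynomial in |h|^2 and equals
   2r on the sphere of radius r, where the estimate will finally be read off.\<close>
 let ?k = "%h::real^3. r + (sq h) / r"
 have ck: "cts ?k" using r by (intro continuous_intros) auto
 have \<Lambda>: "0 <= \<Lambda>" using order_trans[OF abs_ge_zero lip[of "axis 1 1" 0]] by simp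
 have "\<bar>LI h. pderiv_at j (?g j) h * \<Gamma> h\<bar> <= \<Lambda> * (LI h. ka (sq h) * ?k h)" for j
 proof -
  have "\<bar>LI h. pderiv_at j (?g j) h * \<Gamma> h\<bar> <= \<Lambda> * (LI h. \<bar>?g j h\<bar>)"
   by (rule lipschitz_pairing[OF d2 c2 _ \<Gamma>(1) lip, of R]) (simp add: z)
  also have "... <= \<Lambda> * (LI h. ka (sq h) * ?k h)"
  proof (intro mult_left_mono \<Lambda> integral_mono i_ka ck)
   show "integrable lborel (%h. \<bar>?g j h\<bar>)"
    using i_ka[of "%h. \<bar>2 * h $ j\<bar>"] nn(1) by (simp add: abs_mult mult_ac continuous_intros)
   fix h :: "real^3"
   have "0 <= (\<bar>h $ j\<bar> - r)^2" by simp
   then have "\<bar>2 * h $ j\<bar> * r <= r^2 + (h $ j)^2" by (simp add: power2_diff abs_mult algebra_simps)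
   also have "(h $ j)^2 <= h \<bullet> h" using component_le_norm_cart[of h j] by (simp flip: power2_norm_eq_inner add: abs_le_square_iff[symmetric])
   finally have "\<bar>2 * h $ j\<bar> <= ?k h" using r by (simp add: field_simps power2_eq_square)
   from mult_left_mono[OF this nn(1), of "h \<bullet> h"] show "\<bar>?g j h\<bar> <= ka (sq h) * ?k h" using nn(1)[of "h \<bullet> h"] by (simp add: abs_mult mult_ac)
  qed
  finally show ?thesis .
 qed
 then have "\<bar>SU j. LI h. pderiv_at j (?g j) h * \<Gamma> h\<bar> <= (\<Sum>j\<in>(UNIV::3 set). \<Lambda> * (LI h. ka (sq h) * ?k h))"
  by (intro order_trans[OF sum_abs] sum_mono)
 then have S: "\<bar>SU j. LI h. pderiv_at j (?g j) h * \<Gamma> h\<bar> <= 3 * (\<Lambda> * (LI h. ka (sq h) * ?k h))" by simp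
 have "\<bar>2 * \<nu> * S\<bar> <= 6 * \<nu> * \<Lambda> * K" if "\<bar>S\<bar> <= 3 * (\<Lambda> * K)" for S K
  using mult_left_mono[OF that, of "2 * \<nu>"] \<nu> by (simp add: abs_mult)
 note E2 = this[OF S]
 have "(LI h. ka (sq h) * (2/3 * \<eta> * (sq h) + 6 * \<nu> * \<Lambda> * ?k h)) = 2/3 * \<eta> * ?m + 6 * \<nu> * \<Lambda> * (LI h. ka (sq h) * ?k h)"
  unfolding bump_integral_scale[of ka, symmetric] by (intro add continuous_intros ck)
 then show ?thesis using E1 E2 id flux split tot by linarith
qed

section \<open>Spherical averages\<close>

text \<open>As a constant density the factor 3 passes through Bochner integrals.\<close>

lemma sphere_measure_density:
 "sphere_measure = density (distr (restrict_space lborel (ball 0 1 - {0})) borel (%x. x /\<^sub>R norm x)) (%_. ennreal 3)"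
 unfolding sphere_measure_def by (rule measure_eqI) (simp_all add: emeasure_density nn_integral_cmult_indicator)

lemma radial_projection_measurable: "(%x. x /\<^sub>R norm x) \<in> restrict_space lborel (ball 0 1 - {0}) \<rightarrow>\<^sub>M (borel :: (real^3) measure)"
 by (rule measurable_restrict_space1) measurable

lemma sets_sphere_measure [simp, measurable_cong]: "sets sphere_measure = sets borel"
 by (simp add: sphere_measure_def)

lemma space_sphere_measure [simp]: "space sphere_measure = UNIV"
 by (simp add: sphere_measure_def space_scale_measure)

lemma integral_sphere_measure:
 fixes f :: "sfield"
 assumes [measurable]: "f \<in> borel_measurable borel"
 shows "(LINT n|sphere_measure. f n) = 3 * (LI x. indicator (ball 0 1 - {0}) x * f (x /\<^sub>R norm x))"
proof -
 have "(LINT n|sphere_measure. f n) = 3 * (LINT n|distr (restrict_space lborel (ball 0 1 - {0})) borel (%x. x /\<^sub>R norm x). f n)"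
  unfolding sphere_measure_density by (subst integral_density) auto
 also have "(LINT n|distr (restrict_space lborel (ball 0 1 - {0})) borel (%x. x /\<^sub>R norm x). f n)
   = (LINT x|restrict_space lborel (ball 0 1 - {0}). f (x /\<^sub>R norm x))"
  by (rule integral_distr[OF radial_projection_measurable]) measurable
 also have "... = (LI x. indicator (ball 0 1 - {0}) x * f (x /\<^sub>R norm x))"
  by (subst integral_restrict_space) auto
 finally show ?thesis .
qed

lemma measure_punctured_ball: "measure lborel (ball (0::real^3) 1 - {0}) = 4/3 * pi"
proof -
 have "measure lborel (ball (0::real^3) 1 - {0}) = measure lborel (ball (0::real^3) 1)"
  by (intro measure_Diff_null_set) (auto simp: null_sets_def)
 then show ?thesis using sphere_volume[of 1 "0::real^3"] by simp
qed

lemma emeasure_sphere_measure: "emeasure sphere_measure UNIV = ennreal (4 * pi)"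
proof -
 have "emeasure lborel (ball (0::real^3) 1 - {0}) = ennreal (4/3 * pi)"
 proof -
  have "emeasure lborel (ball (0::real^3) 1 - {0}) <= emeasure lborel (ball (0::real^3) 1)" by (rule emeasure_mono) auto
  also have "... < top" using emeasure_lborel_ball_finite[of "0::real^3" 1] by simp
  finally show ?thesis using measure_punctured_ball by (subst emeasure_eq_ennreal_measure) auto
 qed
 then have "emeasure sphere_measure UNIV = 3 * ennreal (4/3 * pi)"
  unfolding sphere_measure_def
  by (simp add: emeasure_distr radial_projection_measurable emeasure_restrict_space space_restrict_space)
 also have "... = ennreal (3 * (4/3 * pi))" by (subst ennreal_mult) auto
 finally show ?thesis by simp
qed

interpretation sphere: finite_measure sphere_measure
 by standard (simp add: emeasure_sphere_measure)

lemma measure_sphere_measure: "measure sphere_measure UNIV = 4 * pi"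
 by (simp add: measure_def emeasure_sphere_measure)

lemma AE_sphere_measure: "AE n in sphere_measure. norm n = 1"
proof -
 have e: "{y. inverse (norm y) * norm y \<noteq> 1} \<inter> (ball 0 1 - {0}) = ({} :: (real^3) set)"
  by auto (metis left_inverse norm_eq_zero)
 have "emeasure sphere_measure {n. norm n \<noteq> 1} = 0"
  unfolding sphere_measure_def
  by (simp add: emeasure_distr radial_projection_measurable emeasure_restrict_space space_restrict_space e)
 then show ?thesis by (intro AE_I[of _ _ "{n. norm n \<noteq> 1}"]) auto
qed

lemma sphere_integrable:
 fixes f :: "sfield"
 assumes f: "cts f"
 shows "integrable sphere_measure (%n. f (r *\<^sub>R n))"
proof -
 obtain C where C: "!!x. norm x <= \<bar>r\<bar> ==> \<bar>f x\<bar> <= C" by (rule bounded_on_cball[OF f]) blast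
 show ?thesis
 proof (rule sphere.integrable_const_bound[where B=C])
  show "AE n in sphere_measure. norm (f (r *\<^sub>R n)) <= C"
   using AE_sphere_measure by eventually_elim (use C in auto)
  have [measurable]: "f \<in> borel_measurable borel" by (rule cts_measurable[OF f])
  show "(%n. f (r *\<^sub>R n)) \<in> borel_measurable sphere_measure" by measurable
 qed
qed

lemma integral_lborel_scale:
 fixes f :: "sfield"
 assumes [measurable]: "f \<in> borel_measurable borel" and c: "0 < c"
 shows "(LI x. f x) = c ^ 3 * (LI x. f (c *\<^sub>R x))"
proof -
 have "lborel = density (distr lborel borel (%x. 0 + c *\<^sub>R x :: real^3)) (%_. ennreal (c ^ 3))"
  using lborel_affine[of c "0 :: real^3"] c by (simp add: ennreal_power)
 then have "(LI x. f x) = (LINT x|density (distr lborel borel (%x. 0 + c *\<^sub>R x)) (%_. ennreal (c ^ 3)). f x)" by simp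
 also have "... = c ^ 3 * (LINT x|distr lborel borel (%x. 0 + c *\<^sub>R x). f x)" using c by (subst integral_density) auto
 also have "(LINT x|distr lborel borel (%x. 0 + c *\<^sub>R x). f x) = (LI x. f (c *\<^sub>R x))" by (subst integral_distr) auto
 finally show ?thesis .
qed

text \<open>Polar coordinates for a function of the direction alone: \<open>g\<close> is homogeneous
  of degree 0, so its integral over a ball scales with the cube of the radius, and the unit ball
  gives one third of the spherical integral.\<close>

lemma integral_shell:
 fixes f :: "sfield" and r :: real
 assumes f: "cts f" and ab: "0 < a" "a < b"
 defines "g \<equiv> %h::real^3. f ((r / norm h) *\<^sub>R h)"
 shows "integrable lborel (%h. indicator {h. a <= norm h \<and> norm h < b} h * g h)"
  and "3 * (LI h. indicator {h. a <= norm h \<and> norm h < b} h * g h) = (b ^ 3 - a ^ 3) * (LINT n|sphere_measure. f (r *\<^sub>R n))"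
proof -
 have fm [measurable]: "f \<in> borel_measurable borel" by (rule cts_measurable[OF f])
 have gm [measurable]: "g \<in> borel_measurable borel" unfolding g_def by measurable
 obtain C where C: "!!x. norm x <= \<bar>r\<bar> ==> \<bar>f x\<bar> <= C" by (rule bounded_on_cball[OF f]) blast
 have gC: "\<bar>g h\<bar> <= C" for h unfolding g_def by (rule C) simp
 define I where "I c = (LI h. indicator (ball 0 c - {0}) h * g h)" for c
 have i: "integrable lborel (%h. indicator A h * g h)" if "A \<in> sets lborel" "A \<subseteq> ball 0 b" for A
 proof (rule lint_bound[where f="%h. C * indicator (ball 0 b) h"])
  show "integrable lborel (%h. C * indicator (ball (0::real^3) b) h)"
   using emeasure_lborel_ball_finite[of "0::real^3" b] by (intro integrable_mult_right integrable_real_indicator) auto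
  show "AE h in lborel. norm (indicator A h * g h) <= norm (C * indicator (ball 0 b) h)"
   using gC that(2) order_trans[OF abs_ge_zero gC[of 0]] by (intro AE_I2) (auto split: split_indicator)
  show "(%h. indicator A h * g h) \<in> borel_measurable lborel" using that(1) by measurable
 qed
 have sh: "{h. a <= norm h \<and> norm h < b} = ball 0 b - ball (0::real^3) a" by auto
 show "integrable lborel (%h. indicator {h. a <= norm h \<and> norm h < b} h * g h)"
  unfolding sh by (rule i) auto
 have scale: "I c = c ^ 3 * I 1" if c: "0 < c" for c
 proof -
  have "I c = c ^ 3 * (LI h. indicator (ball 0 c - {0}) (c *\<^sub>R h) * g (c *\<^sub>R h))"
   unfolding I_def by (rule integral_lborel_scale[OF _ c]) (intro borel_measurable_times gm borel_measurable_indicator, simp)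
  also have "(LI h. indicator (ball 0 c - {0}) (c *\<^sub>R h) * g (c *\<^sub>R h)) = I 1"
   unfolding I_def using c by (intro lint_cong) (auto simp: g_def split: split_indicator)
  finally show ?thesis .
 qed
 have sphere: "(LINT n|sphere_measure. f (r *\<^sub>R n)) = 3 * I 1"
  unfolding I_def by (subst integral_sphere_measure) (auto simp: g_def divide_inverse)
 have "(LI h. indicator {h. a <= norm h \<and> norm h < b} h * g h)
   = (LI h. indicator (ball 0 b - {0}) h * g h - indicator (ball 0 a - {0}) h * g h)"
  using ab by (intro lint_cong) (auto split: split_indicator)
 also have "... = I b - I a"
  unfolding I_def by (rule Bochner_Integration.integral_diff; rule i) (use ab in auto)
 also have "... = (b ^ 3 - a ^ 3) * I 1" using scale[of a] scale[of b] ab by (simp add: left_diff_distrib)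
 finally show "3 * (LI h. indicator {h. a <= norm h \<and> norm h < b} h * g h) = (b ^ 3 - a ^ 3) * (LINT n|sphere_measure. f (r *\<^sub>R n))"
  unfolding sphere by simp
qed

section \<open>Smooth approximation of shells and localization in the radius\<close>

lemma DERIV_pos_part_sq: "((%t. (max 0 t)^2) has_real_derivative 2 * max 0 t) (at (t::real))"
proof -
 consider "t < 0" | "t > 0" | "t = 0" by linarith
 then show ?thesis
 proof cases
  case 1
  have "((%t. 0) has_real_derivative 2 * max 0 t) (at t)" using 1 by simp
  then show ?thesis by (rule has_field_derivative_transform_within_open[of _ _ _ "{..<0}"]) (use 1 in auto)
 next
  case 2
  have "((%t. t^2) has_real_derivative 2 * max 0 t) (at t)" using 2 by (auto intro!: derivative_eq_intros)
  then show ?thesis by (rule has_field_derivative_transform_within_open[of _ _ _ "{0<..}"]) (use 2 in auto)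
 next
  case 3
  have "((%h. (max 0 h)^2 / h) \<longlongrightarrow> 0) (at (0::real))"
  proof (rule Lim_null_comparison)
   show "\<forall>\<^sub>F h in at 0. norm ((max 0 h)^2 / h) <= \<bar>h\<bar>"
    by (rule always_eventually) (auto simp: max_def power2_eq_square)
   show "((%h. \<bar>h\<bar>) \<longlongrightarrow> 0) (at (0::real))" by (rule tendsto_rabs_zero) (rule tendsto_ident_at)
  qed
  then show ?thesis using 3 by (simp add: DERIV_def)
 qed
qed

text \<open>For \<open>n \<rightarrow> \<infinity>\<close> this tends to the indicator of \<open>a <= z < b\<close>.\<close>

definition shell_bump :: "real => real => nat => real => real" where
 "shell_bump a b n z = 1 / (1 + real n * (max 0 (a - z))^2) * (1 - 1 / (1 + real n * (max 0 (b - z))^2))"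

lemma shell_bump: assumes "b <= R^2" shows "bump R (shell_bump a b n)"
proof -
 let ?p = "%a z. (max 0 (a - z))^2" and ?q = "%a z. - 2 * max 0 (a - z)"
 have d: "(?p a has_real_derivative ?q a z) (at z)" for a z
 proof -
  have "((%z. a - z) has_real_derivative - 1) (at z)" by (auto intro!: derivative_eq_intros)
  from DERIV_chain2[OF DERIV_pos_part_sq this] show ?thesis by simp
 qed
 have p: "1 + real n * (max 0 (a - z))^2 > 0" for a z :: real by (intro add_pos_nonneg) auto
 let ?r = "%a z. - (real n * ?q a z) / (1 + real n * ?p a z)^2"
 have r: "((%z. 1 / (1 + real n * ?p a z)) has_real_derivative ?r a z) (at z)" for a z
 proof -
  have "((%z. 1 + real n * ?p a z) has_real_derivative 0 + real n * ?q a z) (at z)"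
   by (rule DERIV_add[OF DERIV_const DERIV_cmult[OF d]])
  from DERIV_divide[OF DERIV_const[of 1] this] p[of a z] show ?thesis by (simp add: power2_eq_square)
 qed
 have "(shell_bump a b n has_real_derivative
   (?r a z * (1 - 1 / (1 + real n * ?p b z)) - ?r b z * (1 / (1 + real n * ?p a z)))) (at z)" for z
  unfolding shell_bump_def[abs_def]
  using DERIV_mult[OF r[of a z] DERIV_diff[OF DERIV_const[of 1] r[of b z]]] by (simp add: algebra_simps)
 moreover have "cts (%z. ?r a z * (1 - 1 / (1 + real n * ?p b z)) - ?r b z * (1 / (1 + real n * ?p a z)))"
  using p by (intro continuous_intros) (auto simp: less_imp_neq[symmetric])
 moreover have "0 <= shell_bump a b n z" for z
  unfolding shell_bump_def using p[of a z] p[of b z] by (intro mult_nonneg_nonneg) (auto simp: divide_le_eq)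
 moreover have "shell_bump a b n z = 0" if "R^2 <= z" for z using that assms by (simp add: shell_bump_def)
 ultimately show ?thesis
  unfolding bump_def
  by (intro conjI exI[of _ "%z. ?r a z * (1 - 1 / (1 + real n * ?p b z)) - ?r b z * (1 / (1 + real n * ?p a z))"] allI impI)
qed

lemma shell_bump_le: "shell_bump a b n z <= 1"
proof -
 have p: "1 <= 1 + real n * (max 0 (a - z))^2" for a z :: real by simp
 then have "0 <= 1 / (1 + real n * (max 0 (a - z))^2)" "1 / (1 + real n * (max 0 (a - z))^2) <= 1" for a z :: real
  by (auto simp: divide_le_eq intro: order_trans)
 then show ?thesis unfolding shell_bump_def by (intro mult_le_one) auto
qed

lemma tendsto_inverse_linear:
 "(%n. 1 / (1 + real n * c)) \<longlonglongrightarrow> (if c = 0 then 1 else 0)" if "0 <= c"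
proof (cases "c = 0")
 case False
 then have "filterlim (%n. 1 + real n * c) at_top sequentially"
  using that by (intro filterlim_tendsto_add_at_top[OF tendsto_const] filterlim_at_top_mult_tendsto_pos[OF tendsto_const _ filterlim_real_sequentially]) auto
 from tendsto_divide_0[OF tendsto_const filterlim_at_top_imp_at_infinity[OF this]] False show ?thesis by simp
qed simp

lemma shell_bump_tendsto: "(%n. shell_bump a b n z) \<longlonglongrightarrow> indicator {a..<b} z"
proof -
 have "(%n. shell_bump a b n z) \<longlonglongrightarrow> (if (max 0 (a - z))^2 = 0 then 1 else 0) * (1 - (if (max 0 (b - z))^2 = 0 then 1 else 0))"
  unfolding shell_bump_def by (intro tendsto_intros tendsto_inverse_linear) auto
 then show ?thesis by (auto split: split_indicator simp: max_def split: if_splits)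
qed

text \<open>A positive spherical integral would remain positive on a thin shell by uniform
  continuity, and the indicator of the shell is a dominated limit of admissible profiles.\<close>

lemma sphere_average_nonpos:
 fixes f :: "sfield"
 assumes f: "cts f" and r: "0 < r" "r < R"
  and le: "!!ka. bump R ka ==> (LI h. ka (sq h) * f h) <= 0"
 shows "(LINT n|sphere_measure. f (r *\<^sub>R n)) <= 0"
proof (rule ccontr)
 assume "\<not> (LINT n|sphere_measure. f (r *\<^sub>R n)) <= 0"
 define J where "J = (LINT n|sphere_measure. f (r *\<^sub>R n))"
 have J: "0 < J" using \<open>\<not> _\<close> by (simp add: J_def)
 \<comment> \<open>An error \<eta> on the whole sphere costs 4 pi \<eta>, which is half of
   \<open>J\<close>.\<close>
 define \<eta> where "\<eta> = J / (8 * pi)"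
 have \<eta>: "0 < \<eta>" using J by (simp add: \<eta>_def)
 have "uniformly_continuous_on (cball 0 R) f"
  by (intro compact_uniformly_continuous continuous_on_subset[OF f]) auto
 then obtain d where d: "0 < d" "!!x y. x \<in> cball 0 R ==> y \<in> cball 0 R ==> dist y x < d ==> dist (f y) (f x) < \<eta>"
  unfolding uniformly_continuous_on_def using \<eta> by metis
 \<comment> \<open>Half-thickness of the shell: below the modulus of continuity, and small enough to
   stay away from the origin and inside radius \<open>R\<close>.\<close>
 define s where "s = min (d / 2) (min (r / 2) ((R - r) / 2))"
 have s: "0 < s" "s < d" "s < r" "r + s < R" using d(1) r by (auto simp: s_def min_def field_simps)
 define a b where "a = r - s" and "b = r + s"
 have ab: "0 < a" "a < b" "b < R" using s by (auto simp: a_def b_def)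
 let ?S = "{h::real^3. a <= norm h \<and> norm h < b}" and ?g = "%h. f ((r / norm h) *\<^sub>R h)"
 have close: "?g h - \<eta> <= f h" if "h \<in> ?S" for h
 proof -
  have h: "norm h > 0" "\<bar>norm h - r\<bar> <= s" using that ab by (auto simp: a_def b_def)
  have "h - (r / norm h) *\<^sub>R h = (1 - r / norm h) *\<^sub>R h" by (simp add: algebra_simps)
  then have "dist h ((r / norm h) *\<^sub>R h) = \<bar>1 - r / norm h\<bar> * norm h" by (simp add: dist_norm)
  also have "... = \<bar>(1 - r / norm h) * norm h\<bar>" by (simp add: abs_mult)
  also have "... = \<bar>norm h - r\<bar>" using h(1) by (simp add: left_diff_distrib)
  finally have "dist h ((r / norm h) *\<^sub>R h) < d" using h(2) s by linarith
  moreover have "norm ((r / norm h) *\<^sub>R h) = r" using h(1) r by simp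
  ultimately have "dist (f h) (?g h) < \<eta>" using that ab r by (intro d(2)) auto
  then show ?thesis by (simp add: dist_real_def)
 qed
 note sh = integral_shell[OF f ab(1,2), of r]
 have sh1: "integrable lborel (%h. indicator ?S h * \<eta>)" "3 * (LI h. indicator ?S h * \<eta>) = (b ^ 3 - a ^ 3) * (4 * pi * \<eta>)"
  using integral_shell[OF continuous_on_const[of _ \<eta>] ab(1,2)] by (simp_all add: measure_sphere_measure)
 have fm: "f \<in> borel_measurable borel" by (rule cts_measurable[OF f])
 have lim: "(%n. LI h. shell_bump (a^2) (b^2) n (sq h) * f h) \<longlonglongrightarrow> (LI h. indicator ?S h * f h)"
  and iS: "integrable lborel (%h. indicator ?S h * f h)"
 proof -
  have cm: "(%h. shell_bump (a^2) (b^2) n (sq h) * f h) \<in> borel_measurable lborel" for n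
  proof -
   have "cts (%h. shell_bump (a^2) (b^2) n (sq h) * f h)"
    by (intro continuous_intros f continuous_radial bump_continuous[OF shell_bump[OF order_refl]])
   then show ?thesis using cts_measurable by simp
  qed
  have lm: "(%h. indicator ?S h * f h) \<in> borel_measurable lborel"
   using fm by measurable
  have dom: "integrable lborel (%h. indicator (cball 0 R) h *\<^sub>R \<bar>f h\<bar>)"
   by (intro borel_integrable_compact continuous_intros continuous_on_subset[OF f]) auto
  have pt: "AE h in lborel. (%n. shell_bump (a^2) (b^2) n (sq h) * f h) \<longlonglongrightarrow> indicator ?S h * f h"
  proof (rule AE_I2)
   fix h :: "real^3"
   have "indicator {a^2..<b^2} (sq h) = (indicator ?S h :: real)"
    using ab by (auto simp: power2_norm_eq_inner[symmetric] abs_le_square_iff[symmetric] not_le[symmetric] split: split_indicator)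
   then show "(%n. shell_bump (a^2) (b^2) n (sq h) * f h) \<longlonglongrightarrow> indicator ?S h * f h"
    using tendsto_mult[OF shell_bump_tendsto[of "a^2" "b^2" "h \<bullet> h"] tendsto_const[of "f h"]] by simp
  qed
  have bd: "AE h in lborel. norm (shell_bump (a^2) (b^2) n (sq h) * f h) <= indicator (cball 0 R) h *\<^sub>R \<bar>f h\<bar>" for n
  proof (rule AE_I2)
   fix h :: "real^3"
   have bb: "bump R (shell_bump (a^2) (b^2) n)" using ab by (intro shell_bump power_mono) auto
   then have "0 <= shell_bump (a^2) (b^2) n (sq h)" "R <= norm h ==> shell_bump (a^2) (b^2) n (sq h) = 0"
    using norm_le_inner[of R h] r by (auto simp: bump_def)
   then show "norm (shell_bump (a^2) (b^2) n (sq h) * f h) <= indicator (cball 0 R) h *\<^sub>R \<bar>f h\<bar>"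
    using mult_right_mono[OF shell_bump_le[of "a^2" "b^2" n "h \<bullet> h"] abs_ge_zero[of "f h"]]
    by (auto simp: abs_mult split: split_indicator)
  qed
  show "(%n. LI h. shell_bump (a^2) (b^2) n (sq h) * f h) \<longlonglongrightarrow> (LI h. indicator ?S h * f h)"
   by (rule integral_dominated_convergence[OF lm cm dom pt bd])
  show "integrable lborel (%h. indicator ?S h * f h)"
   by (rule integrable_dominated_convergence[OF lm cm dom pt bd])
 qed
 have "(LI h. indicator ?S h * f h) <= 0"
  by (rule LIMSEQ_le_const2[OF lim]) (use ab in \<open>auto intro!: le shell_bump power_mono\<close>)
 moreover have "(LI h. indicator ?S h * ?g h - indicator ?S h * \<eta>) <= (LI h. indicator ?S h * f h)"
 proof (rule integral_mono[OF _ iS])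
  show "integrable lborel (%h. indicator ?S h * ?g h - indicator ?S h * \<eta>)" by (intro Bochner_Integration.integrable_diff sh(1) sh1(1))
  show "indicator ?S h * ?g h - indicator ?S h * \<eta> <= indicator ?S h * f h" for h
   using close[of h] by (auto split: split_indicator)
 qed
 moreover have "(LI h. indicator ?S h * ?g h - indicator ?S h * \<eta>) = (LI h. indicator ?S h * ?g h) - (LI h. indicator ?S h * \<eta>)"
  by (rule Bochner_Integration.integral_diff[OF sh(1) sh1(1)])
 ultimately have "(b ^ 3 - a ^ 3) * J <= (b ^ 3 - a ^ 3) * (4 * pi * \<eta>)" using sh(2) sh1(2) unfolding J_def by linarith
 moreover have "a ^ 3 < b ^ 3" using ab by (intro power_strict_mono) auto
 ultimately have "J <= 4 * pi * \<eta>" by (simp add: mult_le_cancel_left)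
 then show False using J by (simp add: \<eta>_def)
qed

text \<open>Linearity in the profile allows the absolute value to be taken after localization: both
  signs of \<open>f\<close> are compared with \<open>g\<close> separately.\<close>

lemma sphere_average_le:
 fixes f g :: "sfield"
 assumes f: "cts f" and g: "cts g" and r: "0 < r" "r < R"
  and le: "!!ka. bump R ka ==> \<bar>LI h. ka (sq h) * f h\<bar> <= (LI h. ka (sq h) * g h)"
 shows "\<bar>LINT n|sphere_measure. f (r *\<^sub>R n)\<bar> <= (LINT n|sphere_measure. g (r *\<^sub>R n))"
proof -
 have R: "0 <= R" using r by simp
 have one: "(LINT n|sphere_measure. c * f (r *\<^sub>R n)) <= (LINT n|sphere_measure. g (r *\<^sub>R n))" if c: "c = 1 \<or> c = - 1" for c
 proof -
  have "(LINT n|sphere_measure. c * f (r *\<^sub>R n) - g (r *\<^sub>R n)) <= 0"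
  proof (rule sphere_average_nonpos[OF _ r])
   show "cts (%h. c * f h - g h)" by (intro continuous_intros f g)
   fix ka assume ka: "bump R ka"
   note i = bump_integrable[OF ka R f] bump_integrable[OF ka R g]
   have "(LI h. ka (sq h) * (c * f h - g h)) = (LI h. c * (ka (sq h) * f h) - ka (sq h) * g h)"
    by (simp add: algebra_simps)
   also have "... = c * (LI h. ka (sq h) * f h) - (LI h. ka (sq h) * g h)"
    using i by simp
   also have "... <= 0" using le[OF ka] c by auto
   finally show "(LI h. ka (sq h) * (c * f h - g h)) <= 0" .
  qed
  also have "(LINT n|sphere_measure. c * f (r *\<^sub>R n) - g (r *\<^sub>R n)) = (LINT n|sphere_measure. c * f (r *\<^sub>R n)) - (LINT n|sphere_measure. g (r *\<^sub>R n))"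
   using sphere_integrable[OF f, of r] sphere_integrable[OF g, of r] by simp
  finally show ?thesis by simp
 qed
 show ?thesis using one[of 1] one[of "- 1"] by simp
qed

lemma sphere_integral_const:
 fixes c :: real
 assumes "f \<in> borel_measurable borel" "!!n. norm n = 1 ==> f n = c"
 shows "(LINT n|sphere_measure. f n) = 4 * pi * c"
 using integral_cong_AE[of f sphere_measure "%_. c"] AE_sphere_measure measure_sphere_measure assms by (simp add: eventually_mono)

lemma sphere_average_bound:
 fixes f :: "sfield" and p g :: "real => real"
 assumes f: "cts f" and p: "cts p" and g: "cts g" and r: "0 < r" "r < R"
  and le: "!!ka. bump R ka ==> \<bar>LI h. ka (sq h) * (f h + p (sq h))\<bar> <= (LI h. ka (sq h) * g (sq h))"
 shows "\<bar>(LINT n|sphere_measure. f (r *\<^sub>R n)) / (4 * pi) + p (r^2)\<bar> <= g (r^2)"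
proof -
 have const: "(LINT n::real^3|sphere_measure. q ((r *\<^sub>R n) \<bullet> (r *\<^sub>R n))) = 4 * pi * q (r^2)" if "cts q" for q :: "real => real"
  by (rule sphere_integral_const)
    (auto simp: norm_eq_1 power2_eq_square intro!: cts_measurable cts_compose[OF that] continuous_intros)
 have "\<bar>LINT n|sphere_measure. f (r *\<^sub>R n) + p ((r *\<^sub>R n) \<bullet> (r *\<^sub>R n))\<bar> <= (LINT n::real^3|sphere_measure. g ((r *\<^sub>R n) \<bullet> (r *\<^sub>R n)))"
  by (rule sphere_average_le[where f="%h. f h + p (sq h)" and g="%h. g (sq h)", OF _ _ r le])
    (intro continuous_intros f continuous_radial p g)+
 also have "(LINT n|sphere_measure. f (r *\<^sub>R n) + p ((r *\<^sub>R n) \<bullet> (r *\<^sub>R n))) = (LINT n|sphere_measure. f (r *\<^sub>R n)) + 4 * pi * p (r^2)"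
  unfolding const[OF p, symmetric]
  using sphere_integrable[OF f, of r] sphere_integrable[OF continuous_radial[OF p], of r] by (rule Bochner_Integration.integral_add)
 also have "(LINT n::real^3|sphere_measure. g ((r *\<^sub>R n) \<bullet> (r *\<^sub>R n))) = 4 * pi * g (r^2)" by (rule const[OF g])
 finally have B: "\<bar>(LINT n|sphere_measure. f (r *\<^sub>R n)) + 4 * pi * p (r^2)\<bar> <= 4 * pi * g (r^2)" .
 have "(LINT n|sphere_measure. f (r *\<^sub>R n)) / (4 * pi) + p (r^2) = ((LINT n|sphere_measure. f (r *\<^sub>R n)) + 4 * pi * p (r^2)) / (4 * pi)"
  by (simp add: add_divide_distrib)
 then show ?thesis using B by (simp only: abs_divide) (simp add: pos_divide_le_eq mult.commute)
qed

section \<open>The kinematic identity\<close>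

text \<open>By \<open>longitudinal_moment_eq\<close> the mean of (h \<bullet> \<delta>)^3 for an L^3
  field. The expansion in tensor components makes continuity and uniform limits available.\<close>

definition longitudinal_moment :: "vfield => sfield" where
 "longitudinal_moment v h = (SU i. SU j. SU l. h $ i * h $ j * h $ l * structure_tensor v i j l h)"

lemma inner_cube: "(h \<bullet> d) ^ 3 = (SU i. SU j. SU l. h $ i * h $ j * h $ l * (d $ i * d $ j * d $ l))"
 for h d :: "real^3"
 by (simp add: inner_vec_def sum_3 power3_eq_cube algebra_simps)

lemma smooth_shift:
 fixes f :: "real^3 => 'b::real_normed_vector"
 assumes "smooth f" shows "smooth (%x. f (x + h))"
proof -
 have "C_k n f ==> C_k n (%x. f (x + h))" for n and f :: "real^3 => 'b"
 proof (induction n arbitrary: f)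
  case 0
  then show ?case by (auto intro!: cts_compose[of UNIV f] continuous_intros)
 next
  case (Suc n)
  then have d: "f differentiable (at x)" for x by simp
  have "(%x. f (x + h)) differentiable (at x)" for x
   using differentiable_compose[of f "%x. x + h" x UNIV] d by (auto intro!: derivative_intros)
  moreover have "pderiv_at i (%x. f (x + h)) = (%x. pderiv_at i f (x + h))" for i
   using pderiv_at_shift[OF d] by blast
  ultimately show ?case using Suc by simp
 qed
 then show ?thesis using assms by (simp add: smooth_def)
qed

lemma longitudinal_moment_eq:
 assumes v: "v \<in> L2" "integrable torus (%x. norm (v x) ^ 3)"
 shows "longitudinal_moment v h = (AV x. (h \<bullet> increment h v x) ^ 3)"
  and "integrable torus (%x. (h \<bullet> increment h v x) ^ 3)"
proof -
 note i = structure_tensor_integrable[OF v]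
 show "longitudinal_moment v h = (AV x. (h \<bullet> increment h v x) ^ 3)"
  unfolding longitudinal_moment_def inner_cube structure_tensor_def
  by (intro has_bochner_integral_integral_eq[symmetric] has_bochner_integral_sum has_bochner_integral_mult_right has_bochner_integral_integrable i)
 show "integrable torus (%x. (h \<bullet> increment h v x) ^ 3)"
  unfolding inner_cube by (intro Bochner_Integration.integrable_sum integrable_mult_right i)
qed

text \<open>The kernel \<open>th(|h|\<^sup>2) |\<delta>|\<^sup>2 (h \<bullet> \<delta>)\<close> differs from a multiple of \<open>th'(|h|\<^sup>2) (h \<bullet> \<delta>)\<^sup>3\<close> by a gradient
 in \<open>h\<close>, tested against the divergence free field \<open>v(x + h)\<close>, and by terms which vanish after
 integration in \<open>x\<close> or under \<open>h \<mapsto> - h\<close>.\<close>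

lemma gradient_test:
 fixes a :: "real^3"
 assumes ka: "bump R ka" and th: "bump R th" "!!z. (th has_real_derivative - ka z) (at z)" and R: "0 <= R"
  and v: "smooth v" "!!x. divergence v x = 0"
 shows "(LI h. v (x + h) \<bullet> ((6 * th (sq h) * (h \<bullet> a)) *\<^sub>R a + (3 * th (sq h) * (a \<bullet> a) - 6 * ka (sq h) * (h \<bullet> a)^2) *\<^sub>R h)) = 0"
proof -
 obtain \<zeta> where \<zeta>: "bump R \<zeta>" "!!z. (\<zeta> has_real_derivative - th z) (at z)" by (rule bump_tail[OF th(1)]) blast
 \<comment> \<open>The potential: since \<zeta> is the tail of \<open>th\<close>, its radial kernel
   has gradient -2 th(|h|^2) h, and the gradient of \<open>q\<close> is exactly the field in the
   statement.\<close>
 define q where "q h = 3 * (h \<bullet> a)^2 * th (sq h) - 3/2 * (a \<bullet> a) * \<zeta> (sq h)" for h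
 have z: "th (sq h) = 0" "\<zeta> (sq h) = 0" if "R <= norm h" for h :: "real^3"
  using th(1) \<zeta>(1) norm_le_inner[OF R that] by (auto simp: bump_def)
 have dr: "((%h. f (sq h)) has_derivative (%w. f' (sq h) * (2 * (h \<bullet> w)))) (at h)"
  if "!!z. (f has_real_derivative f' z) (at z)" for f f' :: "real => real" and h :: "real^3"
  by (rule has_derivative_compose[where g=f and f="%h. h \<bullet> h" and g'="%t. f' (sq h) * t", THEN has_derivative_eq_rhs])
    (use that in \<open>auto simp: has_field_derivative_def inner_commute intro!: derivative_eq_intros\<close>)
 have dq: "(q has_derivative (%w. 3 * (h \<bullet> a)^2 * (- ka (sq h) * (2 * (h \<bullet> w))) + 6 * (h \<bullet> a) * (w \<bullet> a) * th (sq h)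
   - 3/2 * (a \<bullet> a) * (- th (sq h) * (2 * (h \<bullet> w))))) (at h)" for h
  unfolding q_def[abs_def]
  by (rule derivative_eq_intros dr[OF th(2)] dr[OF \<zeta>(2)] refl | simp add: algebra_simps)+
 define p where "p j h = 6 * th (sq h) * (h \<bullet> a) * a $ j + (3 * th (sq h) * (a \<bullet> a) - 6 * ka (sq h) * (h \<bullet> a)^2) * h $ j" for j h
 have pq: "pderiv_at j q = p j" for j
  by (rule ext, subst pderiv_at_eqI[OF dq]) (simp add: p_def inner_axis inner_axis' algebra_simps)
 have cp: "cts (p j)" for j
  unfolding p_def by (intro continuous_intros continuous_radial bump_continuous[OF ka] bump_continuous[OF th(1)])
 have cq: "cts q" unfolding q_def by (intro continuous_intros continuous_radial bump_continuous[OF \<zeta>(1)] bump_continuous[OF th(1)])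
 have zq: "q h = 0" if "R <= norm h" for h using z[OF that] by (simp add: q_def)
 have vs: "smooth (%h. v (x + h) $ j)" for j
 proof -
  have "smooth (%h. v (h + x))" by (rule smooth_shift[OF v(1)])
  then show ?thesis using smooth_nth[of "%h. v (h + x)" j] by (simp add: add.commute)
 qed
 have vd: "(%h. v (x + h) $ j) differentiable (at h)" "cts (pderiv_at j (%h. v (x + h) $ j))" for j h
  using vs[of j] by (auto simp: smooth_def dest: spec[of _ "Suc 0"])
 have vp: "pderiv_at j (%h. v (x + h) $ j) h = pderiv_at j v (x + h) $ j" for j h
 proof -
  have "(%h. v (h + x)) differentiable (at h)" by (rule smooth_differentiable[OF smooth_shift[OF v(1)]])
  from pderiv_at_nth(1)[OF this, of j j] show ?thesis
   using pderiv_at_shift[OF smooth_differentiable[OF v(1), of "h + x"], where i=j] by (simp add: add.commute)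
 qed
 have z1: "p j h = 0" if "R + 1 <= norm h" for j h
  unfolding pq[symmetric] by (rule pderiv_at_eq_0_outside[OF zq]) (use that in auto)
 have cv: "cts (%h. v (x + h) $ j)" for j by (rule continuous_on_differentiable[OF vd(1)])
 have ip: "integrable lborel (%h. p j h * v (x + h) $ j)" for j
  by (rule integrable_compact_support[where R="R + 1"]) (auto intro!: continuous_intros cp cv simp: z1)
 have iq: "integrable lborel (%h. q h * pderiv_at j v (x + h) $ j)" for j
  unfolding vp[symmetric] by (rule integrable_compact_support[where R=R]) (auto intro!: continuous_intros cq vd simp: zq)
 have "(LI h. v (x + h) \<bullet> ((6 * th (sq h) * (h \<bullet> a)) *\<^sub>R a + (3 * th (sq h) * (a \<bullet> a) - 6 * ka (sq h) * (h \<bullet> a)^2) *\<^sub>R h))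
   = (LI h. (SU j. p j h * v (x + h) $ j))"
  by (rule lint_cong) (simp_all add: p_def inner_vec_def[of "v _"] mult.commute)
 also have "... = (SU j. LI h. p j h * v (x + h) $ j)" by (rule lint_sum[OF ip])
 also have "... = (SU j. - (LI h. q h * pderiv_at j v (x + h) $ j))"
 proof (rule sum.cong[OF refl])
  fix j
  show "(LI h. p j h * v (x + h) $ j) = - (LI h. q h * pderiv_at j v (x + h) $ j)"
   unfolding pq[symmetric] vp[symmetric]
   by (rule lborel_integration_by_parts[OF _ _ zq vd]) (use dq cp in \<open>auto simp: differentiable_def pq\<close>)
 qed
 also have "... = - (LI h. (SU j. q h * pderiv_at j v (x + h) $ j))"
  by (subst lint_sum[OF iq]) (simp add: sum_negf)
 also have "... = - (LI h. q h * divergence v (x + h))" by (simp add: divergence_def sum_distrib_left)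
 finally show ?thesis by (simp add: v(2))
qed

text \<open>With a = v(x) and b = v(x + h) the integrand splits into \<open>Q a b h\<close>, linear
  in b, its mirror image \<open>Q b a (- h)\<close>, and terms seeing only one of the points. The
  first integrates to zero in \<open>h\<close> by \<open>gradient_test\<close>, the second becomes
  the first after a shift in x and a reflection in \<open>h\<close>, and the last cancel by
  translation invariance.\<close>

lemma smooth_kinematic:
 assumes ka: "bump R ka" and th: "bump R th" "!!z. (th has_real_derivative - ka z) (at z)" and R: "0 <= R"
  and v: "v \<in> Cinf_div"
 shows "(LI h. 3 * th (sq h) * (h \<bullet> third_moment v h) - 2 * ka (sq h) * longitudinal_moment v h) = 0"
proof -
 note vp = Cinf_divD(1,2)[OF v]
 have div: "!!x. divergence v x = 0" using v by (simp add: Cinf_div_def)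
 have cv: "cts v" by (rule continuous_on_differentiable[OF smooth_differentiable[OF vp(2)]])
 have L: "v \<in> L2" by (rule smooth_L2[OF vp])
 have L3: "integrable torus (%x. norm (v x) ^ 3)" by (intro torus_integrable continuous_intros cv)
 define Q where "Q a b h = b \<bullet> ((6 * th (sq h) * (h \<bullet> a)) *\<^sub>R a + (3 * th (sq h) * (a \<bullet> a) - 6 * ka (sq h) * (h \<bullet> a)^2) *\<^sub>R h)"
  for a b h :: "real^3"
 \<comment> \<open>The one-point terms of the expansion; they enter as \<open>c b h - c a h\<close>,
   whose mean in x is zero.\<close>
 define c where "c b h = 3 * th (sq h) * (b \<bullet> b) * (h \<bullet> b) - 2 * ka (sq h) * (h \<bullet> b) ^ 3" for b h :: "real^3"
 have alg: "3 * th (sq h) * ((norm (b - a))^2 * (h \<bullet> (b - a))) - 2 * ka (sq h) * (h \<bullet> (b - a)) ^ 3 = Q a b h + Q b a (- h) + (c b h - c a h)" for a b h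
 proof -
  have e1: "h \<bullet> (b - a) = h \<bullet> b - h \<bullet> a" by (rule inner_diff_right)
  have e2: "(norm (b - a))^2 = b \<bullet> b - 2 * (a \<bullet> b) + a \<bullet> a"
   unfolding power2_norm_eq_inner inner_diff_left inner_diff_right inner_commute[of b a] by simp
  have e3: "Q a b h = 6 * th (sq h) * (h \<bullet> a) * (a \<bullet> b) + (3 * th (sq h) * (a \<bullet> a) - 6 * ka (sq h) * (h \<bullet> a)^2) * (h \<bullet> b)"
   unfolding Q_def inner_add_right inner_scaleR_right inner_commute[of b a] inner_commute[of b h] ..
  have e4: "Q b a (- h) = - (6 * th (sq h) * (h \<bullet> b) * (a \<bullet> b)) - (3 * th (sq h) * (b \<bullet> b) - 6 * ka (sq h) * (h \<bullet> b)^2) * (h \<bullet> a)"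
   unfolding Q_def inner_add_right inner_scaleR_right inner_minus_left inner_minus_right inner_commute[of a h] by simp
  show ?thesis unfolding e1 e2 e3 e4 c_def by (simp add: power2_eq_square power3_eq_cube algebra_simps)
 qed
 define P where "P h = (AV x. Q (v x) (v (x + h)) h)" for h
 have c1: "cts (%x. Q (v x) (v (x + h)) h)" "cts (%x. Q (v (x + h)) (v x) (- h))" "cts (%x. c (v (x + y)) h)" for h y
  unfolding Q_def c_def by (intro continuous_intros cts_compose[OF cv], auto)+
 note ii = torus_integrable[OF c1(1)] torus_integrable[OF c1(2)] torus_integrable[OF c1(3)]
 have F: "3 * th (sq h) * (h \<bullet> third_moment v h) - 2 * ka (sq h) * longitudinal_moment v h = P h + P (- h)" for h
 proof -
  have i1: "integrable torus (%x. (norm (increment h v x))^2 * (h \<bullet> increment h v x))"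
   unfolding increment_def by (intro torus_integrable continuous_intros cts_compose[OF cv]) auto
  have "3 * th (sq h) * (h \<bullet> third_moment v h) - 2 * ka (sq h) * longitudinal_moment v h
   = (AV x. 3 * th (sq h) * ((norm (increment h v x))^2 * (h \<bullet> increment h v x)) - 2 * ka (sq h) * (h \<bullet> increment h v x) ^ 3)"
   unfolding inner_third_moment[OF L L3] longitudinal_moment_eq(1)[OF L L3]
   using i1 longitudinal_moment_eq(2)[OF L L3] by simp
  also have "... = (AV x. Q (v x) (v (x + h)) h + Q (v (x + h)) (v x) (- h) + (c (v (x + h)) h - c (v x) h))"
   unfolding increment_def alg ..
  also have "... = P h + (AV x. Q (v (x + h)) (v x) (- h)) + ((AV x. c (v (x + h)) h) - (AV x. c (v x) h))"
   using ii(1,2)[of h] ii(3)[of h h] ii(3)[of 0 h] by (simp add: P_def)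
  also have "(AV x. c (v (x + h)) h) = (AV x. c (v x) h)"
   by (rule integral_torus_shift[of "%x. c (v x) h"])
     (use c1(3)[of 0 h] vp(1) in \<open>auto simp: periodic_def intro!: cts_measurable\<close>)
  also have "(AV x. Q (v (x + h)) (v x) (- h)) = (AV x. (%x. Q (v x) (v (x + (- h))) (- h)) (x + h))" by simp
  also have "... = P (- h)"
   unfolding P_def
   by (rule integral_torus_shift)
     (use c1(1)[of "- h"] periodicD[OF vp(1)] in \<open>auto simp: periodic_def diff_add_eq[symmetric] intro!: cts_measurable\<close>)
  finally show ?thesis by simp
 qed
 have W: "cts (%(x, h). Q (v x) (v (x + h)) h)"
  unfolding Q_def split_def
  by (intro continuous_intros cts_compose[OF cv] cts_compose[OF bump_continuous[OF ka]] cts_compose[OF bump_continuous[OF th(1)]]) auto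
 have zW: "Q a b h = 0" if "R <= norm h" for a b h
  using th(1) ka norm_le_inner[OF R that] by (auto simp: Q_def bump_def)
 have sw: "(AV x. LI h. Q (v x) (v (x + h)) h) = (LI h. AV x. Q (v x) (v (x + h)) h)"
  "integrable lborel (%h. AV x. Q (v x) (v (x + h)) h)"
  by (rule torus_lborel_swap[OF W], erule zW)+
 have iP: "integrable lborel P" unfolding P_def[abs_def] by (rule sw(2))
 have P0: "(LI h. P h) = 0"
  unfolding P_def sw(1)[symmetric] unfolding Q_def gradient_test[OF ka th R vp(2) div] by simp
 have Pm: "P \<in> borel_measurable borel" using borel_measurable_integrable[OF iP] by simp
 have Pr: "(LI h. P (0 - h)) = (LI h. P h)" by (rule integral_lborel_reflect[OF Pm])
 have "integrable lborel (%h. P (- h))"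
 proof -
  have z: "P (- h) = 0" if "R <= norm h" for h using zW[of "- h"] that by (simp add: P_def)
  have "cts P" unfolding P_def[abs_def]
   by (rule continuous_on_integral_torus) (unfold split_def, intro continuous_on_pair_compose[OF W] continuous_intros)
  then show ?thesis by (intro integrable_compact_support[OF _ z]) (auto intro!: cts_compose[of UNIV P] continuous_intros)
 qed
 then show ?thesis unfolding F using iP P0 Pr by simp
qed

lemma uniform_limit_kernel:
 fixes K :: "sfield"
 assumes K: "cts K" "!!h. R <= norm h ==> K h = 0"
  and f: "!!n. cts (f n)" "cts g" and lim: "uniform_limit UNIV f g sequentially"
 shows "(%n. LI h. K h * f n h) \<longlonglongrightarrow> (LI h. K h * g h)"
proof (rule LIMSEQ_I)
 fix e :: real assume e: "0 < e"
 have iK: "integrable lborel (%h. \<bar>K h\<bar>)" using integrable_compact_support[OF K] by simp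
 define I where "I = (LI h. \<bar>K h\<bar>)"
 have I: "0 <= I" unfolding I_def by simp
 have i: "integrable lborel (%h. K h * f n h)" "integrable lborel (%h. K h * g h)" for n
  by (rule integrable_compact_support[where R=R]; auto intro!: continuous_intros K f simp: K(2))+
 define d where "d = e / (I + 1)"
 have d: "0 < d" "d * I < e" using e I by (auto simp: d_def field_simps)
 obtain N where N: "!!n h. n \<ge> N ==> dist (f n h) (g h) < d"
  using uniform_limitD[OF lim d(1)] by (auto simp: eventually_sequentially)
 have "norm ((LI h. K h * f n h) - (LI h. K h * g h)) < e" if n: "n \<ge> N" for n
 proof -
  have "(LI h. K h * f n h) - (LI h. K h * g h) = (LI h. K h * (f n h - g h))"
   using i by (simp add: right_diff_distrib)
  also have "\<bar>\<dots>\<bar> <= (LI h. \<bar>K h\<bar> * d)"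
  proof (rule order_trans[OF integral_abs_bound], rule integral_mono)
   show "integrable lborel (%h. \<bar>K h * (f n h - g h)\<bar>)" using i by (intro integrable_abs) (simp add: right_diff_distrib)
   show "integrable lborel (%h. \<bar>K h\<bar> * d)" using iK by simp
   show "\<bar>K h * (f n h - g h)\<bar> <= \<bar>K h\<bar> * d" for h
    using N[OF n, of h] by (auto simp: abs_mult dist_real_def intro!: mult_left_mono)
  qed
  also have "... = d * I" by (simp add: I_def)
  finally show ?thesis using d(2) by simp
 qed
 then show "\<exists>N. \<forall>n\<ge>N. norm ((LI h. K h * f n h) - (LI h. K h * g h)) < e" by blast
qed

text \<open>Both sides are finite sums of fixed compactly supported kernels against structure
  tensors, and these converge uniformly under approximation in L^3.\<close>

lemma kinematic_identity:
 assumes ka: "bump R ka" and th: "bump R th" "!!z. (th has_real_derivative - ka z) (at z)" and R: "0 <= R"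
  and G: "has_H1_gradient v G"
 shows "2 * (LI h. ka (sq h) * longitudinal_moment v h) = 3 * (LI h. th (sq h) * (h \<bullet> third_moment v h))"
proof -
 have L: "v \<in> L2" using G by (simp add: has_H1_gradient_def)
 have L3: "integrable torus (%x. norm (v x) ^ 3)" by (rule H1_L3(1)[OF G])
 obtain ph where ph: "!!n. ph n \<in> Cinf_div" "!!n. integrable torus (%x. norm (ph n x - v x) ^ 3)" "(%n. AV x. norm (ph n x - v x) ^ 3) \<longlonglongrightarrow> 0"
  by (rule H1_L3_approx[OF G]) blast
 have cs: "cts (structure_tensor (ph n) i j l)" for n i j l
  by (intro continuous_structure_tensor_smooth continuous_on_differentiable smooth_differentiable Cinf_divD(2)[OF ph(1)])
 note cv = continuous_structure_tensor[OF G]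
 note ul = structure_tensor_uniform_limit[OF L L3 Cinf_div_L2(1)[OF ph(1)] ph(2,3)]
 have z: "th (sq h) = 0" "ka (sq h) = 0" if "R <= norm h" for h :: "real^3"
  using th(1) ka norm_le_inner[OF R that] by (auto simp: bump_def)
 note cr = continuous_radial[OF bump_continuous[OF ka]] continuous_radial[OF bump_continuous[OF th(1)]]
 let ?A = "%w. SU i. SU j. SU l. LI h. (ka (sq h) * (h $ i * h $ j * h $ l)) * structure_tensor w i j l h"
 let ?B = "%w. SU j. SU i. LI h. (th (sq h) * h $ j) * structure_tensor w i i j h"
 have A: "(LI h. ka (sq h) * longitudinal_moment w h) = ?A w" "integrable lborel (%h. ka (sq h) * longitudinal_moment w h)"
  and B: "(LI h. th (sq h) * (h \<bullet> third_moment w h)) = ?B w" "integrable lborel (%h. th (sq h) * (h \<bullet> third_moment w h))"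
  if cw: "!!i j l. cts (structure_tensor w i j l)" for w
 proof -
  have i1: "integrable lborel (%h. (ka (sq h) * (h $ i * h $ j * h $ l)) * structure_tensor w i j l h)" for i j l
   by (rule integrable_compact_support[where R=R]) (auto intro!: continuous_intros cw cr simp: z)
  have i2: "integrable lborel (%h. (th (sq h) * h $ j) * structure_tensor w i i j h)" for i j
   by (rule integrable_compact_support[where R=R]) (auto intro!: continuous_intros cw cr simp: z)
  have e1: "(%h. ka (sq h) * longitudinal_moment w h) = (%h. SU i. SU j. SU l. (ka (sq h) * (h $ i * h $ j * h $ l)) * structure_tensor w i j l h)"
   by (simp add: longitudinal_moment_def sum_distrib_left mult_ac)
  have e2: "(%h. th (sq h) * (h \<bullet> third_moment w h)) = (%h. SU j. SU i. (th (sq h) * h $ j) * structure_tensor w i i j h)"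
   by (simp add: third_moment_def inner_vec_def sum_distrib_left mult_ac)
  show "(LI h. ka (sq h) * longitudinal_moment w h) = ?A w" "integrable lborel (%h. ka (sq h) * longitudinal_moment w h)"
   unfolding e1 by (intro has_bochner_integral_integral_eq has_bochner_integral_sum has_bochner_integral_integrable Bochner_Integration.integrable_sum i1)+
  show "(LI h. th (sq h) * (h \<bullet> third_moment w h)) = ?B w" "integrable lborel (%h. th (sq h) * (h \<bullet> third_moment w h))"
   unfolding e2 by (intro has_bochner_integral_integral_eq has_bochner_integral_sum has_bochner_integral_integrable Bochner_Integration.integrable_sum i2)+
 qed
 have zero: "3 * ?B (ph n) - 2 * ?A (ph n) = 0" for n
  using smooth_kinematic[OF ka th R ph(1)[of n]] A[OF cs[of n]] B[OF cs[of n]] by (simp add: mult.assoc)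
 have "(%n. 3 * ?B (ph n) - 2 * ?A (ph n)) \<longlonglongrightarrow> 3 * ?B v - 2 * ?A v"
  by (intro tendsto_intros uniform_limit_kernel[where R=R] cs cv ul cr continuous_intros) (simp_all add: z)
 then have "3 * ?B v - 2 * ?A v = 0" unfolding zero by (simp add: LIMSEQ_const_iff)
 then show ?thesis using A(1)[OF cv] B(1)[OF cv] by simp
qed

section \<open>Mean structure tensors\<close>

lemma (in prob_space) continuous_on_expectation:
 fixes f :: "'a => 'b::metric_space => real"
 assumes m: "!!h. (%w. f w h) \<in> borel_measurable M" and c: "AE w in M. cts (f w)"
  and g: "integrable M g" "AE w in M. \<forall>h. \<bar>f w h\<bar> <= g w"
 shows "cts (%h. expectation (%w. f w h))"
proof (rule continuous_on_sequentiallyI)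
 fix s :: "nat => 'b" and a assume s: "s \<longlonglongrightarrow> a"
 show "(%n. expectation (%w. f w (s n))) \<longlonglongrightarrow> expectation (%w. f w a)"
 proof (rule integral_dominated_convergence[OF m m g(1)])
  show "AE w in M. (%n. f w (s n)) \<longlonglongrightarrow> f w a"
   using c by eventually_elim (rule continuous_on_tendsto_compose[OF _ s], auto)
  show "AE w in M. norm (f w (s n)) <= g w" for n using g(2) by eventually_elim simp
 qed
qed

lemma (in prob_space)
 fixes f :: "'a => 'b => real"
 assumes N: "sigma_finite_measure N" and K: "integrable N K"
  and f: "(%(w, h). f w h) \<in> borel_measurable (M \<Otimes>\<^sub>M N)"
  and g: "integrable M g" "AE w in M. \<forall>h. \<bar>f w h\<bar> <= g w"
 shows expectation_kernel: "(LINT h|N. K h * expectation (%w. f w h)) = expectation (%w. LINT h|N. K h * f w h)"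
  and expectation_kernel_integrable: "integrable M (%w. LINT h|N. K h * f w h)"
proof -
 interpret N: sigma_finite_measure N by (rule N)
 interpret P: pair_sigma_finite M N ..
 note [measurable] = borel_measurable_integrable[OF K] f
 have m: "(%(w, h). K h * f w h) \<in> borel_measurable (M \<Otimes>\<^sub>M N)"
  using f unfolding split_def by (intro borel_measurable_times measurable_compose[OF measurable_snd borel_measurable_integrable[OF K]])
 have i: "integrable (M \<Otimes>\<^sub>M N) (%(w, h). K h * f w h)"
 proof (rule integrableI_bounded[OF m])
  have "(\<integral>\<^sup>+p. norm (case p of (w, h) => K h * f w h) \<partial>(M \<Otimes>\<^sub>M N)) = (\<integral>\<^sup>+w. \<integral>\<^sup>+h. norm (K h * f w h) \<partial>N \<partial>M)"
   using m by (subst N.nn_integral_fst[symmetric]) simp_all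
  also have "... <= (\<integral>\<^sup>+w. ennreal (norm (g w)) * (\<integral>\<^sup>+h. norm (K h) \<partial>N) \<partial>M)"
  proof (rule nn_integral_mono_AE)
   show "AE w in M. (\<integral>\<^sup>+h. norm (K h * f w h) \<partial>N) <= ennreal (norm (g w)) * (\<integral>\<^sup>+h. norm (K h) \<partial>N)"
    using g(2)
   proof eventually_elim
    case (elim w)
    have "norm (K h * f w h) <= norm (g w) * norm (K h)" for h
     using mult_right_mono[OF order_trans[OF elim[rule_format, of h] abs_ge_self] abs_ge_zero, of "K h"]
     by (simp add: abs_mult mult.commute)
    then have "(\<integral>\<^sup>+h. norm (K h * f w h) \<partial>N) <= (\<integral>\<^sup>+h. ennreal (norm (g w)) * norm (K h) \<partial>N)"
     by (intro nn_integral_mono) (simp flip: ennreal_mult)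
    then show ?case by (simp add: nn_integral_cmult)
   qed
  qed
  also have "... < \<infinity>"
   using g(1) borel_measurable_integrable[OF g(1)] K by (simp add: nn_integral_multc integrable_iff_bounded ennreal_mult_less_top)
  finally show "(\<integral>\<^sup>+p. norm (case p of (w, h) => K h * f w h) \<partial>(M \<Otimes>\<^sub>M N)) < \<infinity>" .
 qed
 show "integrable M (%w. LINT h|N. K h * f w h)" using P.integrable_fst'[OF i] by simp
 have "(LINT h|N. expectation (%w. K h * f w h)) = expectation (%w. LINT h|N. K h * f w h)"
  using P.Fubini_integral[OF i] by simp
 then show "(LINT h|N. K h * expectation (%w. f w h)) = expectation (%w. LINT h|N. K h * f w h)" by simp
qed

text \<open>Young's inequality with exponents 4 and 4/3. The gradient norm must enter with power at
  most 2, as only its second moment is known, while all moments of the L^2 norm are at hand.\<close>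

lemma cube_le:
 fixes m a c :: real
 assumes m: "m^2 <= (a^2 + 2 * a * c) ^ 3" and ac: "0 <= a" "0 <= c"
 shows "m <= a ^ 6 + 2 * a^2 + 6 * c^2"
proof -
 define x y where "x = a ^ 3" and "y = a + 2 * c"
 have "(a^2 + 2 * a * c) ^ 3 = x * y ^ 3" unfolding x_def y_def by (simp add: power2_eq_square power3_eq_cube algebra_simps)
 \<comment> \<open>This is the difference (x^2 + 3 y^2)^2 - 16 x y^3, factored so as to show its
   sign.\<close>
 moreover have "0 <= (x - y)^2 * ((x + y)^2 + 8 * y^2)" by simp
 then have "16 * (x * y ^ 3) <= (x^2 + 3 * y^2)^2"
  by (simp add: power2_eq_square power3_eq_cube algebra_simps)
 ultimately have "(4 * m)^2 <= (x^2 + 3 * y^2)^2" using m by (simp add: power_mult_distrib)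
 then have "4 * m <= x^2 + 3 * y^2" by (rule power2_le_imp_le) simp
 moreover have "y^2 <= 2 * a^2 + 8 * c^2"
 proof -
  have "0 <= (a - 2 * c)^2" by simp
  then show ?thesis by (simp add: y_def power2_eq_square algebra_simps)
 qed
 moreover have "x^2 = a ^ 6" by (simp add: x_def flip: power_mult)
 moreover have "0 <= a ^ 6" "0 <= a^2" by simp_all
 ultimately show ?thesis by linarith
qed

context stationary_solution
begin

lemma
 assumes t: "0 <= t"
 shows grad_moment: "integrable M (%w. (L2_norm (grad (u t w)))^2)"
  and grad_moment_le: "\<nu> * expectation (%w. (L2_norm (grad (u t w)))^2) <= energy_input \<sigma>"
  and grad_norm_measurable: "(%w. L2_norm (grad (u t w))) \<in> borel_measurable M"
proof -
 have zero: "grad v = (%_. 0)" if "v \<notin> H1_div" for v using that by (simp add: grad_def)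
 have eq: "(L2_norm (grad v))^2 = enn2real (grad_normsq v)" for v
  by (simp add: grad_normsq_def zero L2_norm_def)
 have m2: "(%w. (L2_norm (grad (u t w)))^2) \<in> borel_measurable M"
  unfolding eq using grad_normsq_u_measurable[OF t] by measurable
 have "(%w. sqrt ((L2_norm (grad (u t w)))^2)) \<in> borel_measurable M" using m2 by measurable
 then show "(%w. L2_norm (grad (u t w))) \<in> borel_measurable M" by simp
 have le: "(\<integral>\<^sup>+w. ennreal ((L2_norm (grad (u t w)))^2) \<partial>M) <= (\<integral>\<^sup>+w. grad_normsq (u t w) \<partial>M)"
  by (rule nn_integral_mono) (auto simp: grad_normsq_def)
 have e: "ennreal \<nu> * (\<integral>\<^sup>+w. ennreal ((L2_norm (grad (u t w)))^2) \<partial>M) <= ennreal (energy_input \<sigma>)"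
  by (rule order_trans[OF mult_left_mono[OF le] energy_le[OF t]]) simp
 have fin: "(\<integral>\<^sup>+w. ennreal ((L2_norm (grad (u t w)))^2) \<partial>M) < \<infinity>"
 proof (rule ccontr)
  assume "\<not> ?thesis"
  then have "(\<integral>\<^sup>+w. ennreal ((L2_norm (grad (u t w)))^2) \<partial>M) = \<infinity>" by (simp add: not_less top_unique)
  then show False using e \<nu> by (simp add: ennreal_mult_top top_unique)
 qed
 show i: "integrable M (%w. (L2_norm (grad (u t w)))^2)" by (rule integrableI_nonneg[OF m2 _ fin]) simp
 have "0 <= energy_input \<sigma>"
  unfolding energy_input_def using noise by (auto simp: noise_coefficients_def intro!: suminf_nonneg)
 moreover have "ennreal (\<nu> * expectation (%w. (L2_norm (grad (u t w)))^2)) <= ennreal (energy_input \<sigma>)"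
  using e \<nu> nn_integral_eq_integral[OF i] by (simp add: ennreal_mult)
 ultimately show "\<nu> * expectation (%w. (L2_norm (grad (u t w)))^2) <= energy_input \<sigma>" by simp
qed

lemma u_pair_measurable:
 assumes t: "0 <= t" and "f \<in> P \<rightarrow>\<^sub>M M" "g \<in> P \<rightarrow>\<^sub>M borel"
 shows "(%p. u t (f p) (g p)) \<in> borel_measurable P"
 using measurable_compose[OF measurable_Pair[OF assms(2,3)] u_measurable_space[OF t]] by simp

lemma torus_ident: "(%x. x) \<in> torus \<rightarrow>\<^sub>M borel"
 by (rule measurable_torusI) simp

lemma structure_tensor_measurable:
 assumes t: "0 <= t"
 shows "(%(w, h). structure_tensor (u t w) i j l h) \<in> borel_measurable (M \<Otimes>\<^sub>M borel)"
proof -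
 have x: "(%p. snd p) \<in> (M \<Otimes>\<^sub>M borel) \<Otimes>\<^sub>M torus \<rightarrow>\<^sub>M borel" by (rule measurable_compose[OF measurable_snd torus_ident])
 have h: "(%p. snd (fst p)) \<in> (M \<Otimes>\<^sub>M borel) \<Otimes>\<^sub>M torus \<rightarrow>\<^sub>M (borel :: (real^3) measure)" and w: "(%p. fst (fst p)) \<in> (M \<Otimes>\<^sub>M (borel :: (real^3) measure)) \<Otimes>\<^sub>M torus \<rightarrow>\<^sub>M M"
  by measurable
 have "(%p. increment (snd (fst p)) (u t (fst (fst p))) (snd p)) \<in> borel_measurable ((M \<Otimes>\<^sub>M borel) \<Otimes>\<^sub>M torus)"
  unfolding increment_def by (intro borel_measurable_diff u_pair_measurable[OF t w] borel_measurable_add x h)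
 then show ?thesis
  unfolding structure_tensor_def split_def
  by (intro torus.borel_measurable_lebesgue_integral) (simp add: split_def borel_measurable_times borel_measurable_vec_nth)
qed

lemma correlation_joint_measurable:
 assumes t: "0 <= t"
 shows "(%(w, h). correlation (u t w) h) \<in> borel_measurable (M \<Otimes>\<^sub>M borel)"
proof -
 have x: "(%p. snd p) \<in> (M \<Otimes>\<^sub>M borel) \<Otimes>\<^sub>M torus \<rightarrow>\<^sub>M borel" by (rule measurable_compose[OF measurable_snd torus_ident])
 have h: "(%p. snd (fst p)) \<in> (M \<Otimes>\<^sub>M borel) \<Otimes>\<^sub>M torus \<rightarrow>\<^sub>M (borel :: (real^3) measure)" and w: "(%p. fst (fst p)) \<in> (M \<Otimes>\<^sub>M (borel :: (real^3) measure)) \<Otimes>\<^sub>M torus \<rightarrow>\<^sub>M M"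
  by measurable
 have "(%p. u t (fst (fst p)) (snd p) \<bullet> u t (fst (fst p)) (snd p + snd (fst p))) \<in> borel_measurable ((M \<Otimes>\<^sub>M borel) \<Otimes>\<^sub>M torus)"
  by (intro borel_measurable_inner u_pair_measurable[OF t w] borel_measurable_add x h)
 then show ?thesis
  unfolding correlation_def L2_inner_def split_def
  by (intro torus.borel_measurable_lebesgue_integral) (simp add: split_def)
qed

text \<open>The random constant that dominates all third-order quantities, uniformly in the
  separation; it is integrable by \<open>cube_moment_integrable\<close>.\<close>

definition cube_moment :: "real => 'w => real" where
 "cube_moment t w = (AV x. norm (u t w x) ^ 3)"

lemma AE_L3: assumes t: "0 <= t" shows "AE w in M. u t w \<in> L2 \<and> integrable torus (%x. norm (u t w x) ^ 3)"
 using AE_H1[OF t]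
proof eventually_elim
 case (elim w)
 then have G: "has_H1_gradient (u t w) (grad (u t w))" by (rule has_H1_gradient_grad)
 then show ?case using H1_L3(1)[OF G] by (simp add: has_H1_gradient_def)
qed

lemma cube_moment_integrable: assumes t: "0 <= t" shows "integrable M (cube_moment t)"
proof (rule lint_bound)
 let ?a = "%w. L2_norm (u t w)" and ?c = "%w. L2_norm (grad (u t w))"
 show "integrable M (%w. ?a w ^ 6 + 2 * ?a w ^ 2 + 6 * (?c w)^2)"
  using L2_norm_moment[OF t] grad_moment[OF t] by simp
 have "(%p. norm (u t (fst p) (snd p)) ^ 3) \<in> borel_measurable (M \<Otimes>\<^sub>M torus)"
  by (intro borel_measurable_power borel_measurable_norm[THEN measurable_compose[rotated]] u_pair_measurable[OF t] measurable_fst measurable_compose[OF measurable_snd torus_ident])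
 then show "cube_moment t \<in> borel_measurable M"
  unfolding cube_moment_def[abs_def] by (intro torus.borel_measurable_lebesgue_integral) (simp add: split_def)
 show "AE w in M. norm (cube_moment t w) <= norm (?a w ^ 6 + 2 * ?a w ^ 2 + 6 * (?c w)^2)"
  using AE_H1[OF t]
 proof eventually_elim
  case (elim w)
  from H1_L3(2)[OF has_H1_gradient_grad[OF elim]]
  have "cube_moment t w <= ?a w ^ 6 + 2 * ?a w ^ 2 + 6 * (?c w)^2"
   unfolding cube_moment_def by (rule cube_le) (auto simp: L2_norm_nonneg)
  moreover have "0 <= cube_moment t w" unfolding cube_moment_def by simp
  ultimately show ?case by simp
 qed
qed

definition mean_tensor :: "real => 3 => 3 => 3 => sfield" where
 "mean_tensor t i j l h = expectation (%w. structure_tensor (u t w) i j l h)"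

lemma tensor_measurable: "0 <= t ==> (%w. structure_tensor (u t w) i j l h) \<in> borel_measurable M"
 using measurable_compose[OF measurable_Pair2' structure_tensor_measurable, of h] by simp

lemma tensor_bound:
 assumes t: "0 <= t" shows "AE w in M. \<forall>h. \<bar>structure_tensor (u t w) i j l h\<bar> <= 8 * cube_moment t w"
 using AE_L3[OF t] by eventually_elim (auto simp: cube_moment_def structure_tensor_bound)

lemma tensor_integrable:
 assumes t: "0 <= t" shows "integrable M (%w. structure_tensor (u t w) i j l h)"
 by (rule lint_bound[OF integrable_mult_right[OF cube_moment_integrable[OF t], of 8] tensor_measurable[OF t]])
   (use tensor_bound[OF t, of i j l] in \<open>eventually_elim, auto intro: order_trans[OF _ abs_ge_self]\<close>)

lemma continuous_mean_tensor: assumes t: "0 <= t" shows "cts (mean_tensor t i j l)"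
 unfolding mean_tensor_def[abs_def]
proof (rule continuous_on_expectation[OF tensor_measurable[OF t] _ integrable_mult_right[OF cube_moment_integrable[OF t]] tensor_bound[OF t]])
 show "AE w in M. cts (structure_tensor (u t w) i j l)"
  using AE_H1[OF t] by eventually_elim (rule continuous_structure_tensor[OF has_H1_gradient_grad])
qed

lemma u_periodic: "0 <= t ==> w \<in> space M ==> periodic (u t w)"
 using u_L2_div[of t w] L2_divD[of "u t w"] by (simp add: L2_def)

lemma periodic_mean_tensor: assumes t: "0 <= t" shows "periodic (mean_tensor t i j l)"
 unfolding periodic_def mean_tensor_def
 by (intro allI ballI lint_cong periodicD[OF periodic_structure_tensor] u_periodic[OF t]) auto

definition mean_flux :: "real => real^3 => real^3" where
 "mean_flux t h = (\<chi> j. SU i. mean_tensor t i i j h)"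

lemma inner_mean_flux: assumes t: "0 <= t" shows "k \<bullet> mean_flux t h = expectation (%w. k \<bullet> third_moment (u t w) h)"
 using tensor_integrable[OF t] by (simp add: mean_flux_def third_moment_def inner_vec_def mean_tensor_def)

lemma continuous_mean_flux: "0 <= t ==> cts (mean_flux t)"
 unfolding mean_flux_def[abs_def] by (intro continuous_intros continuous_mean_tensor)

lemma periodic_mean_flux: "0 <= t ==> periodic (mean_flux t)"
 using periodic_mean_tensor[of t] by (simp add: periodic_def mean_flux_def)

definition mean_longitudinal :: "real => sfield" where
 "mean_longitudinal t h = expectation (%w. longitudinal_moment (u t w) h)"

lemma mean_longitudinal_eq:
 assumes t: "0 <= t"
 shows "mean_longitudinal t h = (SU i. SU j. SU l. h $ i * h $ j * h $ l * mean_tensor t i j l h)"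
 using tensor_integrable[OF t] by (simp add: mean_longitudinal_def longitudinal_moment_def mean_tensor_def)

lemma continuous_mean_longitudinal: "0 <= t ==> cts (mean_longitudinal t)"
proof -
 assume t: "0 <= t"
 have "mean_longitudinal t = (%h. SU i. SU j. SU l. h $ i * h $ j * h $ l * mean_tensor t i j l h)"
  using mean_longitudinal_eq[OF t] by blast
 then show ?thesis using t by (auto intro!: continuous_intros continuous_mean_tensor)
qed

definition mean_correlation :: "real => sfield" where
 "mean_correlation t h = expectation (%w. correlation (u t w) h)"

text \<open>The constant \<Lambda> of the overview.\<close>

definition lipschitz_constant :: "real => real" where
 "lipschitz_constant t = expectation (%w. L2_norm (u t w) * L2_norm (grad (u t w)))"

lemma correlation_omega_measurable: "0 <= t ==> (%w. correlation (u t w) h) \<in> borel_measurable M"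
 using measurable_compose[OF measurable_Pair2' correlation_joint_measurable, of h] by simp

lemma correlation_bound: assumes t: "0 <= t" shows "AE w in M. \<forall>h. \<bar>correlation (u t w) h\<bar> <= (L2_norm (u t w))^2"
 by (rule AE_I2) (auto intro!: correlation_le L2_divD u_L2_div t)

lemma correlation_integrable: assumes t: "0 <= t" shows "integrable M (%w. correlation (u t w) h)"
 by (rule lint_bound[OF L2_norm_moment[OF t, of 2] correlation_omega_measurable[OF t]])
   (use correlation_bound[OF t] in \<open>eventually_elim, auto\<close>)

lemma norm_grad_integrable: assumes t: "0 <= t" shows "integrable M (%w. L2_norm (u t w) * L2_norm (grad (u t w)))"
 by (rule integrable_mult_of_squares[OF measurable_compose[OF u_measurable[OF t] L2_norm_measurable] grad_norm_measurable[OF t] L2_norm_moment[OF t] grad_moment[OF t]])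

lemma mean_correlation_lipschitz:
 assumes t: "0 <= t"
 shows "\<bar>mean_correlation t h - mean_correlation t h'\<bar> <= lipschitz_constant t * norm (h - h')"
proof -
 have "\<bar>mean_correlation t h - mean_correlation t h'\<bar> = \<bar>expectation (%w. correlation (u t w) h - correlation (u t w) h')\<bar>"
  using correlation_integrable[OF t] by (simp add: mean_correlation_def)
 also have "... <= expectation (%w. norm (h - h') * (L2_norm (u t w) * L2_norm (grad (u t w))))"
 proof (rule order_trans[OF integral_abs_bound], rule integral_mono_AE)
  show "integrable M (%w. \<bar>correlation (u t w) h - correlation (u t w) h'\<bar>)" using correlation_integrable[OF t] by simp
  show "integrable M (%w. norm (h - h') * (L2_norm (u t w) * L2_norm (grad (u t w))))" using norm_grad_integrable[OF t] by simp
  show "AE w in M. \<bar>correlation (u t w) h - correlation (u t w) h'\<bar> <= norm (h - h') * (L2_norm (u t w) * L2_norm (grad (u t w)))"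
   using AE_H1[OF t] by eventually_elim (rule correlation_lipschitz[OF has_H1_gradient_grad])
 qed
 finally show ?thesis by (simp add: lipschitz_constant_def mult.commute)
qed

lemma lipschitz_constant_nonneg: "0 <= lipschitz_constant t"
 unfolding lipschitz_constant_def by (rule Bochner_Integration.integral_nonneg) (simp add: L2_norm_nonneg)

lemma continuous_mean_correlation: assumes t: "0 <= t" shows "cts (mean_correlation t)"
proof (rule continuous_onI)
 fix h :: "real^3" and e :: real assume e: "0 < e"
 let ?d = "e / (lipschitz_constant t + 1)"
 have L: "0 < lipschitz_constant t + 1" using lipschitz_constant_nonneg[of t] by simp
 show "\<exists>d>0. \<forall>h'\<in>UNIV. dist h' h < d \<longrightarrow> dist (mean_correlation t h') (mean_correlation t h) <= e"
 proof (intro exI[of _ ?d] conjI ballI impI)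
  fix h' assume "dist h' h < ?d"
  then have "(lipschitz_constant t + 1) * norm (h' - h) < e" using L by (simp add: dist_norm pos_less_divide_eq mult.commute)
  then show "dist (mean_correlation t h') (mean_correlation t h) <= e"
   using mean_correlation_lipschitz[OF t, of h' h] norm_ge_zero[of "h' - h"]
   by (simp only: dist_real_def distrib_right mult_1_left)
 qed (use e L in simp)
qed

lemma periodic_mean_correlation: assumes t: "0 <= t" shows "periodic (mean_correlation t)"
 unfolding periodic_def mean_correlation_def
 by (intro allI ballI lint_cong periodicD[OF periodic_correlation] L2_divD u_L2_div[OF t]) auto

text \<open>Cauchy-Schwarz in the sample point splits the viscosity evenly: one half is absorbed
  with the gradient by the energy inequality, the other stays with the L^2 norm, where weak
  anomalous dissipation makes it vanish.\<close>

lemma dissipation_bound: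
 assumes t: "0 <= t"
 shows "\<nu> * lipschitz_constant t <= sqrt (\<nu> * expectation (%w. (L2_norm (u t w))^2)) * sqrt (energy_input \<sigma>)"
proof -
 let ?a = "expectation (%w. (L2_norm (u t w))^2)" and ?c = "expectation (%w. (L2_norm (grad (u t w)))^2)"
 have "lipschitz_constant t <= sqrt ?a * sqrt ?c"
  using integral_Cauchy_Schwarz[OF measurable_compose[OF u_measurable[OF t] L2_norm_measurable] grad_norm_measurable[OF t] L2_norm_moment[OF t] grad_moment[OF t]]
  unfolding lipschitz_constant_def by linarith
 then have "\<nu> * lipschitz_constant t <= \<nu> * (sqrt ?a * sqrt ?c)" using \<nu> by simp
 also have "... = sqrt (\<nu> * ?a) * sqrt (\<nu> * ?c)" using \<nu> by (simp add: real_sqrt_mult)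
 also have "... <= sqrt (\<nu> * ?a) * sqrt (energy_input \<sigma>)"
  using grad_moment_le[OF t] \<nu> by (intro mult_left_mono real_sqrt_le_mono real_sqrt_ge_zero mult_nonneg_nonneg Bochner_Integration.integral_nonneg) auto
 finally show ?thesis .
qed

end

section \<open>The balance of the Fourier modes\<close>

lemma correlation_even: assumes v: "v \<in> L2" shows "correlation v (- h) = correlation v h"
proof -
 have p: "periodic v" and m [measurable]: "v \<in> borel_measurable borel" using v by (auto simp: L2_def)
 have "correlation v (- h) = (AV x. (%x. v x \<bullet> v (x + - h)) (x + h))"
  unfolding correlation_def L2_inner_def
  by (rule integral_torus_shift[symmetric]) (use p in \<open>auto simp: periodic_def diff_add_eq[symmetric]\<close>)
 then show ?thesis by (simp add: correlation_def L2_inner_def inner_commute)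
qed

lemma structure_tensor_odd: assumes v: "v \<in> L2" shows "structure_tensor v i j l (- h) = - structure_tensor v i j l h"
proof -
 have p: "periodic v" and m [measurable]: "v \<in> borel_measurable borel" using v by (auto simp: L2_def)
 let ?f = "%x. increment (- h) v x $ i * increment (- h) v x $ j * increment (- h) v x $ l"
 have "structure_tensor v i j l (- h) = (AV x. ?f (x + h))"
  unfolding structure_tensor_def
  by (rule integral_torus_shift[symmetric]) (use p in \<open>auto simp: increment_def periodic_def diff_add_eq[symmetric]\<close>)
 also have "... = (AV x. - (increment h v x $ i * increment h v x $ j * increment h v x $ l))"
  by (rule lint_cong) (simp_all add: increment_def algebra_simps)
 finally show ?thesis by (simp add: structure_tensor_def)
qed

lemma mode_sum_add: "mode_sum k (%ph. F ph + G ph) = mode_sum k F + mode_sum k G"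
 by (simp add: mode_sum_def sum.distrib)

lemma mode_sum_scale: "mode_sum k (%ph. c * F ph) = c * mode_sum k F"
 by (simp add: mode_sum_def sum_distrib_left distrib_left)

lemma mode_sum_sums:
 assumes "!!a b. k \<bullet> a = 0 ==> k \<bullet> b = 0 ==> (%m. F m (trig k a b)) sums G (trig k a b)"
 shows "(%m. mode_sum k (F m)) sums mode_sum k G"
 unfolding mode_sum_def by (intro sums_sum sums_add assms) (simp_all add: transversal_orthogonal)

lemma drift_trig:
 "drift \<nu> (trig k a b) v = - (4 * pi^2 * (norm k)^2 * \<nu>) * L2_inner v (trig k a b) + transport (trig k a b) v"
 by (simp add: drift_def laplacian_trig L2_inner_def)

context stationary_solution
begin

text \<open>The trace of the spatial covariance of the forcing. It is built from \<sigma> and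
  \<open>e\<close> alone, so its modulus of continuity at the origin is common to all
  viscosities.\<close>

definition forcing_correlation :: "sfield" where
 "forcing_correlation h = (\<Sum>m. (\<sigma> m)^2 * correlation (e m) h)"

lemma forcing_term_le: "norm ((\<sigma> m)^2 * correlation (e m) h) <= (\<sigma> m)^2"
 using correlation_le[OF e_L2, of m h] by (simp add: abs_mult e_norm mult_left_le)

lemma e_correlation: "cts (correlation (e m))" "periodic (correlation (e m))"
proof -
 have ce: "cts (e m)"
  by (intro continuous_on_differentiable smooth_differentiable Cinf_divD(2)[OF e_Cinf])
 show "cts (correlation (e m))"
  unfolding correlation_def[abs_def] L2_inner_def
  by (rule continuous_on_integral_torus) (auto simp: split_def intro!: continuous_intros cts_compose[OF ce])
 show "periodic (correlation (e m))" by (rule periodic_correlation[OF e_L2])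
qed

lemma continuous_forcing_correlation: "cts forcing_correlation"
proof (rule uniform_limit_theorem)
 show "uniform_limit UNIV (%n h. \<Sum>m<n. (\<sigma> m)^2 * correlation (e m) h) forcing_correlation sequentially"
  unfolding forcing_correlation_def[abs_def] by (rule Weierstrass_m_test[OF forcing_term_le \<sigma>_summable])
 show "\<forall>\<^sub>F n in sequentially. cts (%h. \<Sum>m<n. (\<sigma> m)^2 * correlation (e m) h)"
  by (intro always_eventually allI continuous_intros e_correlation)
qed simp

lemma periodic_forcing_correlation: "periodic forcing_correlation"
 using e_correlation(2) by (simp add: periodic_def forcing_correlation_def)

lemma forcing_correlation_even: "forcing_correlation (- h) = forcing_correlation h"
 by (simp add: forcing_correlation_def correlation_even[OF e_L2])

lemma forcing_correlation_0: "forcing_correlation 0 = 2 * energy_input \<sigma>"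
 by (simp add: forcing_correlation_def correlation_0 e_norm energy_input_def)

lemma fcos_forcing: "(%m. (\<sigma> m)^2 * fcos k (correlation (e m))) sums fcos k forcing_correlation"
proof -
 let ?f = "%m h. cos (phase k h) * ((\<sigma> m)^2 * correlation (e m) h)"
 have i: "integrable torus (?f m)" for m
  by (intro torus_integrable continuous_intros e_correlation)
 have le: "norm (?f m h) <= (\<sigma> m)^2" for m h
  using mult_mono[OF abs_cos_le_one[of "2 * pi * (k \<bullet> h)"] forcing_term_le[of m h]] by (simp add: abs_mult)
 have s: "summable (%m. norm (?f m h))" for h
  by (rule summable_comparison_test'[OF \<sigma>_summable]) (use le in simp)
 have "(%m. AV h. ?f m h) sums (AV h. (\<Sum>m. ?f m h))"
 proof (rule sums_integral[OF i])
  show "AE h in torus. summable (%m. norm (?f m h))" using s by simp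
  show "summable (%m. AV h. norm (?f m h))"
  proof (rule summable_comparison_test'[OF \<sigma>_summable])
   fix m :: nat
   have "(AV h. norm (?f m h)) <= (AV h. (\<sigma> m)^2)"
    by (rule integral_mono) (use i[of m] le in auto)
   then show "norm (AV h. norm (?f m h)) <= (\<sigma> m)^2" using torus.prob_space by simp
  qed
 qed
 moreover have "(\<Sum>m. ?f m h) = cos (phase k h) * forcing_correlation h" for h
  unfolding forcing_correlation_def
  by (rule suminf_mult) (rule summable_comparison_test'[OF \<sigma>_summable forcing_term_le])
 moreover have "(AV h. ?f m h) = (\<sigma> m)^2 * fcos k (correlation (e m))" for m
  unfolding fcos_def by (subst Bochner_Integration.integral_mult_right_zero[symmetric]) (simp add: mult_ac)
 ultimately show ?thesis by (simp add: fcos_def)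
qed

lemma mean_correlation_even: assumes t: "0 <= t" shows "mean_correlation t (- h) = mean_correlation t h"
 unfolding mean_correlation_def
 by (rule lint_cong) (auto intro!: correlation_even L2_divD u_L2_div t)

lemma mean_flux_odd: assumes t: "0 <= t" shows "mean_flux t (- h) = - mean_flux t h"
proof -
 have "mean_tensor t i j l (- h) = - mean_tensor t i j l h" for i j l
 proof -
  have "mean_tensor t i j l (- h) = expectation (%w. - structure_tensor (u t w) i j l h)"
   unfolding mean_tensor_def
   by (rule lint_cong) (auto intro!: structure_tensor_odd L2_divD u_L2_div t)
  then show ?thesis by (simp add: mean_tensor_def)
 qed
 then show ?thesis by (simp add: mean_flux_def vec_eq_iff sum_negf)
qed

lemma measurable_torus_of_borel:
 assumes "(%(w, h). f w h) \<in> borel_measurable (M \<Otimes>\<^sub>M borel)"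
 shows "(%(w, h). f w h) \<in> borel_measurable (M \<Otimes>\<^sub>M torus)"
proof -
 have "(%p. (fst p, snd p)) \<in> M \<Otimes>\<^sub>M torus \<rightarrow>\<^sub>M M \<Otimes>\<^sub>M borel"
  by (intro measurable_Pair measurable_fst measurable_compose[OF measurable_snd torus_ident])
 from measurable_compose[OF this assms] show ?thesis by (simp add: split_def)
qed

lemma third_moment_measurable:
 assumes t: "0 <= t" shows "(%(w, h). k \<bullet> third_moment (u t w) h) \<in> borel_measurable (M \<Otimes>\<^sub>M borel)"
 using structure_tensor_measurable[OF t]
 by (simp add: third_moment_def inner_vec_def split_def borel_measurable_sum borel_measurable_times)

lemma third_moment_bound:
 assumes t: "0 <= t" shows "AE w in M. \<forall>h. \<bar>k \<bullet> third_moment (u t w) h\<bar> <= norm k * 72 * cube_moment t w"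
 using AE_L3[OF t]
proof eventually_elim
 case (elim w)
 show ?case
 proof
  fix h
  have "\<bar>k \<bullet> third_moment (u t w) h\<bar> <= norm k * norm (third_moment (u t w) h)" by (rule Cauchy_Schwarz_ineq2)
  also have "... <= norm k * (72 * cube_moment t w)"
   using norm_third_moment_le[of "u t w" h] elim by (intro mult_left_mono) (auto simp: cube_moment_def)
  finally show "\<bar>k \<bullet> third_moment (u t w) h\<bar> <= norm k * 72 * cube_moment t w" by (simp add: mult.assoc)
 qed
qed

text \<open>The balances of all solenoidal test fields of wave number \<open>k\<close> added up: the
  viscous drift yields the coefficient of the correlation, transport that of the flux, and the
  variance of the noise that of the forcing correlation.\<close>

lemma mean_modes:
 assumes t: "0 <= t" and k: "k \<in> lattice"
 shows "- (8 * pi^2 * (norm k)^2 * \<nu> * fcos k (mean_correlation t)) + pi * fsin k (%h. k \<bullet> mean_flux t h)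
  + fcos k forcing_correlation = 0"
proof (cases "k = 0")
 case True
 \<comment> \<open>At wave number 0 only the forcing term remains, and it vanishes because the
   \<open>e m\<close> have zero average.\<close>
 have "fcos 0 (correlation (e m)) = 0" for m
 proof -
  have ce: "cts (e m)"
   by (intro continuous_on_differentiable smooth_differentiable Cinf_divD(2)[OF e_Cinf])
  have "fcos 0 (e m) = 0" "fsin 0 (e m) = 0" using Cinf_divD(4)[OF e_Cinf[of m]] by (simp_all add: fcos_def fsin_def)
  then show ?thesis
   using smooth_correlation_mode[OF Cinf_divD(1)[OF e_Cinf] ce lattice_0] by (simp add: fcos_def[of 0 "correlation (e m)"])
 qed
 then have "fcos 0 forcing_correlation = 0" using fcos_forcing[of 0] by (simp add: sums_iff)
 then show ?thesis using True by (simp add: fsin_def)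
next
 case False
 let ?c = "%v. AV h. cos (phase k h) * correlation v h"
 let ?s = "%v. AV h. sin (phase k h) * (k \<bullet> third_moment v h)"
 define X where "X ph w = L2_inner (u t w) ph * drift \<nu> ph (u t w)" for ph w
 define N where "N ph = (\<Sum>m. (\<sigma> m * L2_inner (e m) ph)^2)" for ph
 have mode: "trig k a b \<in> Cinf_div" if "k \<bullet> a = 0" "k \<bullet> b = 0" for a b by (rule trig_Cinf_div[OF k False that])
 have bal: "2 * expectation (X (trig k a b)) + N (trig k a b) = 0" and iX: "integrable M (X (trig k a b))" if "k \<bullet> a = 0" "k \<bullet> b = 0" for a b
  using mode_balance[OF t mode[OF that]] mode_integrable[OF t mode[OF that]] by (simp_all add: X_def[abs_def] N_def)
 have 1: "2 * mode_sum k (%ph. expectation (X ph)) + mode_sum k N = 0"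
 proof -
  have "mode_sum k (%ph. 2 * expectation (X ph) + N ph) = 0"
   unfolding mode_sum_def by (intro sum.neutral ballI) (simp add: bal transversal_orthogonal)
  then show ?thesis by (simp add: mode_sum_add mode_sum_scale)
 qed
 have cm: "integrable torus (%h. cos (phase k h))" "integrable torus (%h. sin (phase k h))"
  by (intro torus_integrable continuous_intros)+
 note Kc = expectation_kernel[OF torus.sigma_finite_measure_axioms cm(1) measurable_torus_of_borel[OF correlation_joint_measurable[OF t]] L2_norm_moment[OF t] correlation_bound[OF t]]
  expectation_kernel_integrable[OF torus.sigma_finite_measure_axioms cm(1) measurable_torus_of_borel[OF correlation_joint_measurable[OF t]] L2_norm_moment[OF t] correlation_bound[OF t]]
 note Ks = expectation_kernel[OF torus.sigma_finite_measure_axioms cm(2) measurable_torus_of_borel[OF third_moment_measurable[OF t, of k]] integrable_mult_right[OF cube_moment_integrable[OF t]] third_moment_bound[OF t, of k]]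
  expectation_kernel_integrable[OF torus.sigma_finite_measure_axioms cm(2) measurable_torus_of_borel[OF third_moment_measurable[OF t, of k]] integrable_mult_right[OF cube_moment_integrable[OF t]] third_moment_bound[OF t, of k]]
 have "mode_sum k (%ph. expectation (X ph)) = expectation (%w. mode_sum k (%ph. X ph w))"
  unfolding mode_sum_def
  by (intro has_bochner_integral_integral_eq[symmetric] has_bochner_integral_sum has_bochner_integral_add has_bochner_integral_integrable iX)
    (simp_all add: transversal_orthogonal)
 also have "... = expectation (%w. - (8 * pi^2 * (norm k)^4 * \<nu>) * ?c (u t w) + pi * (norm k)^2 * ?s (u t w))"
 proof (rule integral_cong_AE)
  show "(%w. mode_sum k (%ph. X ph w)) \<in> borel_measurable M"
   unfolding mode_sum_def by (intro borel_measurable_sum borel_measurable_add borel_measurable_integrable iX) (simp_all add: transversal_orthogonal)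
  show "(%w. - (8 * pi^2 * (norm k)^4 * \<nu>) * ?c (u t w) + pi * (norm k)^2 * ?s (u t w)) \<in> borel_measurable M"
   by (intro borel_measurable_add borel_measurable_times borel_measurable_const borel_measurable_integrable Kc(2) Ks(2))
  show "AE w in M. mode_sum k (%ph. X ph w) = - (8 * pi^2 * (norm k)^4 * \<nu>) * ?c (u t w) + pi * (norm k)^2 * ?s (u t w)"
   using AE_H1[OF t]
  proof eventually_elim
   case (elim w)
   note G = has_H1_gradient_grad[OF elim]
   let ?v = "u t w"
   \<comment> \<open>Modes are eigenfunctions of the Laplacian, so the viscous part of the drift
     times the projection is a multiple of the squared projection.\<close>
   have "mode_sum k (%ph. X ph w) = mode_sum k (%ph. - (4 * pi^2 * (norm k)^2 * \<nu>) * (L2_inner ?v ph)^2 + L2_inner ?v ph * transport ph ?v)"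
    unfolding X_def mode_sum_def drift_trig by (simp add: power2_eq_square algebra_simps)
   also have "... = - (4 * pi^2 * (norm k)^2 * \<nu>) * (2 * (norm k)^2 * ?c ?v) + pi * (norm k)^2 * ?s ?v"
    unfolding mode_sum_add mode_sum_scale flux_mode[OF G k False] correlation_mode[OF H1_div_subset_L2_div[OF G] k] ..
   finally show ?case by (simp add: power4_eq_xxxx power2_eq_square)
  qed
 qed
 also have "... = - (8 * pi^2 * (norm k)^4 * \<nu>) * expectation (%w. ?c (u t w)) + pi * (norm k)^2 * expectation (%w. ?s (u t w))"
  using Kc(2) Ks(2) by simp
 also have "expectation (%w. ?c (u t w)) = fcos k (mean_correlation t)"
  using Kc(1) by (simp add: fcos_def mean_correlation_def)
 also have "expectation (%w. ?s (u t w)) = fsin k (%h. k \<bullet> mean_flux t h)"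
  using Ks(1) by (simp add: fsin_def inner_mean_flux[OF t])
 finally have 2: "mode_sum k (%ph. expectation (X ph))
   = - (8 * pi^2 * (norm k)^4 * \<nu>) * fcos k (mean_correlation t) + pi * (norm k)^2 * fsin k (%h. k \<bullet> mean_flux t h)" .
 have sN: "(%m. mode_sum k (%ph. (\<sigma> m * L2_inner (e m) ph)^2)) sums mode_sum k N"
 proof (rule mode_sum_sums)
  fix a b assume "k \<bullet> a = 0" "k \<bullet> b = 0"
  then have L: "trig k a b \<in> L2" by (intro Cinf_div_L2 mode)
  have "summable (%m. (\<sigma> m * L2_inner (e m) (trig k a b))^2)"
  proof (rule summable_comparison_test')
   show "summable (%m. (\<sigma> m)^2 * (L2_norm (trig k a b))^2)" by (intro summable_mult2 \<sigma>_summable)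
   show "norm ((\<sigma> m * L2_inner (e m) (trig k a b))^2) <= (\<sigma> m)^2 * (L2_norm (trig k a b))^2" for m
    using power_mono[OF L2_inner_le[OF e_L2[of m] L] abs_ge_zero, of 2] by (simp add: e_norm power_mult_distrib mult_left_mono)
  qed
  then show "(%m. (\<sigma> m * L2_inner (e m) (trig k a b))^2) sums N (trig k a b)" unfolding N_def by (rule summable_sums)
 qed
 have "mode_sum k (%ph. (\<sigma> m * L2_inner (e m) ph)^2) = 2 * (norm k)^2 * ((\<sigma> m)^2 * fcos k (correlation (e m)))" for m
  unfolding power_mult_distrib mode_sum_scale correlation_mode[OF e_L2_div k] by (simp add: fcos_def)
 then have 3: "mode_sum k N = 2 * (norm k)^2 * fcos k forcing_correlation"
  using sN sums_mult[OF fcos_forcing[of k], of "2 * (norm k)^2"] by (simp add: sums_iff)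
 \<comment> \<open>Every term carries the factor 2 |k|^2 of the redundant family of amplitudes,
   which is nonzero here.\<close>
 from 1 have "2 * (norm k)^2 * (- (8 * pi^2 * (norm k)^2 * \<nu> * fcos k (mean_correlation t)) + pi * fsin k (%h. k \<bullet> mean_flux t h)
  + fcos k forcing_correlation) = 0"
  unfolding 2 3 by (simp add: power4_eq_xxxx power2_eq_square algebra_simps)
 then show ?thesis using False by simp
qed

section \<open>Spherically averaged balances\<close>

lemma flux_balance:
 assumes t: "0 <= t" and near: "!!h. norm h < R ==> \<bar>forcing_correlation h - 2 * energy_input \<sigma>\<bar> <= \<eta>"
  and R: "0 <= R" and r: "0 < r" and ka: "bump R ka"
 shows "\<bar>LI h. ka (sq h) * (h \<bullet> mean_flux t h + 4/3 * energy_input \<sigma> * (sq h))\<bar>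
  <= (LI h. ka (sq h) * (2/3 * \<eta> * (sq h) + 6 * \<nu> * lipschitz_constant t * (r + (sq h) / r)))"
 by (rule radial_balance[OF continuous_mean_flux periodic_mean_flux mean_flux_odd continuous_mean_correlation periodic_mean_correlation mean_correlation_even
    continuous_forcing_correlation periodic_forcing_correlation forcing_correlation_even mean_modes mean_correlation_lipschitz])
   (use t \<nu> near R r ka in auto)

text \<open>\<open>flux_balance\<close> localized at radius r and divided by r^2. The parameter of
  its viscous weight is taken equal to the radius, so that r + |h|^2 / r becomes 2r and the constant
  12 results.\<close>

lemma averaged_43:
 assumes t: "0 <= t" and near: "!!h. norm h < R ==> \<bar>forcing_correlation h - 2 * energy_input \<sigma>\<bar> <= \<eta>"
  and r: "0 < r" "r < R"
 shows "\<bar>(LINT n|sphere_measure. n \<bullet> mean_flux t (r *\<^sub>R n)) / (4 * pi * r) + 4/3 * energy_input \<sigma>\<bar> <= 2/3 * \<eta> + 12 * (\<nu> * lipschitz_constant t) / r"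
proof -
 define \<epsilon> L I where "\<epsilon> = energy_input \<sigma>" and "L = \<nu> * lipschitz_constant t" and "I = (LINT n|sphere_measure. n \<bullet> mean_flux t (r *\<^sub>R n))"
 have "\<bar>(LINT n|sphere_measure. (r *\<^sub>R n) \<bullet> mean_flux t (r *\<^sub>R n)) / (4 * pi) + 4/3 * \<epsilon> * r^2\<bar> <= 2/3 * \<eta> * r^2 + 6 * \<nu> * lipschitz_constant t * (r + r^2 / r)"
  unfolding \<epsilon>_def
  by (rule sphere_average_bound[where f="%h. h \<bullet> mean_flux t h" and p="%z. 4/3 * energy_input \<sigma> * z" and g="%z. 2/3 * \<eta> * z + 6 * \<nu> * lipschitz_constant t * (r + z / r)", OF _ _ _ r flux_balance[OF t near _ r(1)]])
    (use r in \<open>auto intro!: continuous_intros continuous_mean_flux[OF t]\<close>)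
 then have "\<bar>r * I / (4 * pi) + 4/3 * \<epsilon> * r^2\<bar> <= 2/3 * \<eta> * r^2 + 6 * L * (r + r^2 / r)" by (simp add: I_def L_def)
 moreover have "r * I / (4 * pi) + 4/3 * \<epsilon> * r^2 = r^2 * (I / (4 * pi * r) + 4/3 * \<epsilon>)" using r by (simp add: field_simps power2_eq_square)
 moreover have "2/3 * \<eta> * r^2 + 6 * L * (r + r^2 / r) = r^2 * (2/3 * \<eta> + 12 * L / r)" using r by (simp add: field_simps power2_eq_square)
 ultimately show ?thesis using r unfolding \<epsilon>_def L_def I_def by (simp add: abs_mult mult_le_cancel_left)
qed

text \<open>The bounds contain powers of |h| and hold only inside the support of the kernel; cutting
  \<open>f\<close> off outside the ball of radius \<open>R\<close> changes nothing under the kernel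
  and makes the bound global.\<close>

lemma bump_expectation:
 assumes ka: "bump R ka" and R: "0 <= R" and f: "(%(w, h). f w h) \<in> borel_measurable (M \<Otimes>\<^sub>M borel)"
  and g: "integrable M g" "AE w in M. \<forall>h. norm h <= R \<longrightarrow> \<bar>f w h\<bar> <= g w"
 shows "(LI h. ka (sq h) * expectation (%w. f w h)) = expectation (%w. LI h. ka (sq h) * f w h)"
  and "integrable M (%w. LI h. ka (sq h) * f w h)"
proof -
 let ?f = "%w h. indicator (cball 0 R) h * f w h"
 have "(%(w, h). ?f w h) \<in> borel_measurable (M \<Otimes>\<^sub>M borel)"
  using f unfolding split_def
  by (intro borel_measurable_times measurable_compose[OF measurable_snd borel_measurable_indicator]) auto
 then have m: "(%(w, h). ?f w h) \<in> borel_measurable (M \<Otimes>\<^sub>M lborel)" by simp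
 have b: "AE w in M. \<forall>h. \<bar>?f w h\<bar> <= \<bar>g w\<bar>"
  using g(2) by eventually_elim (auto split: split_indicator intro: order_trans[OF _ abs_ge_self])
 have K: "integrable lborel (%h::real^3. ka (sq h))" using bump_integrable[OF ka R continuous_on_const[of _ 1]] by simp
 have z: "ka (sq h) * (indicator (cball 0 R) h * c) = ka (sq h) * c" for h :: "real^3" and c
  using ka norm_le_inner[OF R, of h] by (auto simp: bump_def split: split_indicator)
 have E: "expectation (%w. ?f w h) = indicator (cball 0 R) h * expectation (%w. f w h)" for h by simp
 note k = expectation_kernel[OF lborel.sigma_finite_measure_axioms K m integrable_abs[OF g(1)] b]
  expectation_kernel_integrable[OF lborel.sigma_finite_measure_axioms K m integrable_abs[OF g(1)] b]
 show "(LI h. ka (sq h) * expectation (%w. f w h)) = expectation (%w. LI h. ka (sq h) * f w h)"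
  using k(1) unfolding E z .
 show "integrable M (%w. LI h. ka (sq h) * f w h)" using k(2) unfolding z .
qed

lemma longitudinal_balance:
 assumes t: "0 <= t" and ka: "bump R ka" and th: "bump R th" "!!z. (th has_real_derivative - ka z) (at z)" and R: "0 <= R"
 shows "2 * (LI h. ka (sq h) * mean_longitudinal t h) = 3 * (LI h. th (sq h) * (h \<bullet> mean_flux t h))"
proof -
 have nth: "(%p. snd p $ j) \<in> borel_measurable (M \<Otimes>\<^sub>M (borel :: (real^3) measure))" for j by measurable
 have T: "(%p. structure_tensor (u t (fst p)) i j l (snd p)) \<in> borel_measurable (M \<Otimes>\<^sub>M borel)" for i j l
  using structure_tensor_measurable[OF t] by (simp add: split_def)
 have mA: "(%(w, h). longitudinal_moment (u t w) h) \<in> borel_measurable (M \<Otimes>\<^sub>M borel)"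
  unfolding longitudinal_moment_def split_def by (intro borel_measurable_sum borel_measurable_times nth T)
 have mB: "(%(w, h). h \<bullet> third_moment (u t w) h) \<in> borel_measurable (M \<Otimes>\<^sub>M borel)"
  unfolding third_moment_def inner_vec_def split_def by (simp add: borel_measurable_sum borel_measurable_times nth T)
 have bB: "AE w in M. \<forall>h. norm h <= R \<longrightarrow> \<bar>h \<bullet> third_moment (u t w) h\<bar> <= R * 72 * cube_moment t w"
  using AE_L3[OF t]
 proof eventually_elim
  case (elim w)
  show ?case
  proof (intro allI impI)
   fix h :: "real^3" assume h: "norm h <= R"
   have "\<bar>h \<bullet> third_moment (u t w) h\<bar> <= norm h * norm (third_moment (u t w) h)" by (rule Cauchy_Schwarz_ineq2)
   also have "... <= R * (72 * cube_moment t w)"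
    using norm_third_moment_le[of "u t w" h] elim h R by (intro mult_mono) (auto simp: cube_moment_def)
   finally show "\<bar>h \<bullet> third_moment (u t w) h\<bar> <= R * 72 * cube_moment t w" by (simp add: mult.assoc)
  qed
 qed
 have bA: "AE w in M. \<forall>h. norm h <= R \<longrightarrow> \<bar>longitudinal_moment (u t w) h\<bar> <= R ^ 3 * 8 * cube_moment t w"
  using AE_L3[OF t]
 proof eventually_elim
  case (elim w)
  show ?case
  proof (intro allI impI)
   fix h :: "real^3" assume h: "norm h <= R"
   have L: "u t w \<in> L2" and L3: "integrable torus (%x. norm (u t w x) ^ 3)" using elim by auto
   let ?d = "increment h (u t w)"
   have "\<bar>longitudinal_moment (u t w) h\<bar> <= (AV x. \<bar>(h \<bullet> ?d x) ^ 3\<bar>)"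
    unfolding longitudinal_moment_eq(1)[OF L L3] by (rule integral_abs_bound)
   also have "... <= (AV x. R ^ 3 * norm (?d x) ^ 3)"
   proof (rule integral_mono)
    show "integrable torus (%x. \<bar>(h \<bullet> ?d x) ^ 3\<bar>)" by (intro integrable_abs longitudinal_moment_eq(2)[OF L L3])
    show "integrable torus (%x. R ^ 3 * norm (?d x) ^ 3)" by (intro integrable_mult_right increment_L3[OF L L3])
    show "\<bar>(h \<bullet> ?d x) ^ 3\<bar> <= R ^ 3 * norm (?d x) ^ 3" for x
    proof -
     have "\<bar>h \<bullet> ?d x\<bar> <= R * norm (?d x)"
      by (rule order_trans[OF Cauchy_Schwarz_ineq2]) (use h in \<open>simp add: mult_right_mono\<close>)
     from power_mono[OF this abs_ge_zero, of 3] show ?thesis by (simp add: power_abs power_mult_distrib)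
    qed
   qed
   also have "... <= R ^ 3 * (8 * cube_moment t w)"
    using increment_L3_le[OF L L3, of h] R by (simp add: cube_moment_def mult_left_mono)
   finally show "\<bar>longitudinal_moment (u t w) h\<bar> <= R ^ 3 * 8 * cube_moment t w" by (simp add: mult.assoc)
  qed
 qed
 note mom = integrable_mult_right[OF cube_moment_integrable[OF t]]
 note EA = bump_expectation[OF ka R mA mom bA] and EB = bump_expectation[OF th(1) R mB mom bB]
 have "expectation (%w. 2 * (LI h. ka (sq h) * longitudinal_moment (u t w) h)) = expectation (%w. 3 * (LI h. th (sq h) * (h \<bullet> third_moment (u t w) h)))"
 proof (rule integral_cong_AE)
  show "AE w in M. 2 * (LI h. ka (sq h) * longitudinal_moment (u t w) h) = 3 * (LI h. th (sq h) * (h \<bullet> third_moment (u t w) h))"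
   using AE_H1[OF t] by eventually_elim (rule kinematic_identity[OF ka th R has_H1_gradient_grad])
 qed (intro borel_measurable_times borel_measurable_const borel_measurable_integrable EA(2) EB(2))+
 then show ?thesis unfolding mean_longitudinal_def EA(1) inner_mean_flux[OF t] EB(1) by simp
qed

text \<open>The flux balance is used with the tail \<open>th\<close> as its profile in place of
  \<open>ka\<close>, so that the kinematic identity can convert it into a statement on the
  longitudinal moment weighted by \<open>ka\<close>, which is then localized.\<close>

lemma averaged_45:
 assumes t: "0 <= t" and near: "!!h. norm h < R ==> \<bar>forcing_correlation h - 2 * energy_input \<sigma>\<bar> <= \<eta>"
  and r: "0 < r" "r < R"
 shows "\<bar>(LINT n|sphere_measure. mean_longitudinal t (r *\<^sub>R n)) / (4 * pi * r ^ 4) + 4/5 * energy_input \<sigma>\<bar> <= 2/5 * \<eta> + 48/5 * (\<nu> * lipschitz_constant t) / r"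
proof -
 define \<epsilon> L I where "\<epsilon> = energy_input \<sigma>" and "L = \<nu> * lipschitz_constant t" and "I = (LINT n|sphere_measure. mean_longitudinal t (r *\<^sub>R n))"
 have R: "0 <= R" using r by simp
 have cL: "cts (mean_longitudinal t)" and cF: "cts (%h. h \<bullet> mean_flux t h)"
  by (intro continuous_intros continuous_mean_longitudinal continuous_mean_flux t)+
 have "\<bar>LI h. ka (sq h) * (mean_longitudinal t h + 4/5 * \<epsilon> * (sq h)^2)\<bar>
  <= (LI h. ka (sq h) * (2/5 * \<eta> * (sq h)^2 + (6 * L * r * (sq h) + 18/5 * L / r * (sq h)^2)))"
  if ka: "bump R ka" for ka
 proof -
  obtain th where th: "bump R th" "!!z. (th has_real_derivative - ka z) (at z)" by (rule bump_tail[OF ka]) blast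
  note scale = bump_integral_scale[of ka] bump_integral_scale[of th]
  note add = bump_integral_add[OF ka R] bump_integral_add[OF th(1) R]
  define m2 m4 where "m2 = (LI h. ka (sq h) * (sq h))" and "m4 = (LI h. ka (sq h) * (sq h)^2)"
  define A B where "A = (LI h. ka (sq h) * mean_longitudinal t h)" and "B = (LI h. th (sq h) * (h \<bullet> mean_flux t h))"
  have T: "(LI h. th (sq h) * 1) = 2/3 * m2" "(LI h. th (sq h) * (sq h)) = 2/5 * m4"
   using bump_tail_moment[OF ka th R, of 0] bump_tail_moment[OF ka th R, of 1] by (simp_all add: m2_def m4_def power2_eq_square)
  have "(LI h. th (sq h) * (h \<bullet> mean_flux t h + 4/3 * \<epsilon> * (sq h))) = B + 4/3 * \<epsilon> * (2/5 * m4)"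
   unfolding B_def T(2)[symmetric] scale[symmetric] by (intro add cF continuous_intros)
  moreover have "(LI h. th (sq h) * (2/3 * \<eta> * (sq h) + 6 * \<nu> * lipschitz_constant t * (r + (sq h) / r)))
    = 2/3 * \<eta> * (2/5 * m4) + (6 * L * r * (2/3 * m2) + 6 * L / r * (2/5 * m4))"
  proof -
   have "(LI h. th (sq h) * (2/3 * \<eta> * (sq h) + (6 * L * r * 1 + 6 * L / r * (sq h))))
    = 2/3 * \<eta> * (2/5 * m4) + (6 * L * r * (2/3 * m2) + 6 * L / r * (2/5 * m4))"
    unfolding T[symmetric] scale[symmetric] by (subst add(2), (intro continuous_intros)+, subst add(2), (intro continuous_intros)+) simp
   then show ?thesis by (simp add: L_def algebra_simps)
  qed
  ultimately have "\<bar>B + 4/3 * \<epsilon> * (2/5 * m4)\<bar> <= 2/3 * \<eta> * (2/5 * m4) + (6 * L * r * (2/3 * m2) + 6 * L / r * (2/5 * m4))"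
   using flux_balance[OF t near R r(1) th(1)] unfolding \<epsilon>_def by simp
  \<comment> \<open>Here 3/2 is the kinematic factor and 2/5 the moment ratio of \<open>th\<close>
    and \<open>ka\<close>: 3/2 times 4/3 times 2/5 is 4/5.\<close>
  moreover have "A + 4/5 * \<epsilon> * m4 = 3/2 * (B + 4/3 * \<epsilon> * (2/5 * m4))"
   using longitudinal_balance[OF t ka th R, folded A_def B_def] by simp
  moreover have "2/5 * \<eta> * m4 + (6 * L * r * m2 + 18/5 * L / r * m4) = 3/2 * (2/3 * \<eta> * (2/5 * m4) + (6 * L * r * (2/3 * m2) + 6 * L / r * (2/5 * m4)))"
   by (simp add: algebra_simps)
  ultimately have "\<bar>A + 4/5 * \<epsilon> * m4\<bar> <= 2/5 * \<eta> * m4 + (6 * L * r * m2 + 18/5 * L / r * m4)" by (simp only: abs_mult) simp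
  moreover have "(LI h. ka (sq h) * (mean_longitudinal t h + 4/5 * \<epsilon> * (sq h)^2)) = A + 4/5 * \<epsilon> * m4"
   unfolding A_def m4_def scale[symmetric] by (intro add cL continuous_intros)
  moreover have "(LI h. ka (sq h) * (2/5 * \<eta> * (sq h)^2 + (6 * L * r * (sq h) + 18/5 * L / r * (sq h)^2))) = 2/5 * \<eta> * m4 + (6 * L * r * m2 + 18/5 * L / r * m4)"
   unfolding m2_def m4_def scale[symmetric] by (subst add(1), (intro continuous_intros)+, subst add(1), (intro continuous_intros)+) simp
  ultimately show ?thesis by simp
 qed
 then have "\<bar>I / (4 * pi) + 4/5 * \<epsilon> * (r^2)^2\<bar> <= 2/5 * \<eta> * (r^2)^2 + (6 * L * r * r^2 + 18/5 * L / r * (r^2)^2)"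
  unfolding I_def
  by (intro sphere_average_bound[where p="%z. 4/5 * \<epsilon> * z^2" and g="%z. 2/5 * \<eta> * z^2 + (6 * L * r * z + 18/5 * L / r * z^2)", OF cL _ _ r])
    (use r in \<open>auto intro!: continuous_intros\<close>)
 moreover have "I / (4 * pi) + 4/5 * \<epsilon> * (r^2)^2 = r ^ 4 * (I / (4 * pi * r ^ 4) + 4/5 * \<epsilon>)" using r by (simp add: field_simps)
 moreover have "2/5 * \<eta> * (r^2)^2 + (6 * L * r * r^2 + 18/5 * L / r * (r^2)^2) = r ^ 4 * (2/5 * \<eta> + 48/5 * L / r)"
  using r by (simp add: field_simps power2_eq_square power4_eq_xxxx)
 ultimately show ?thesis using r unfolding \<epsilon>_def L_def I_def by (simp add: abs_mult mult_le_cancel_left)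
qed

end

section \<open>The structure functions\<close>

context stationary_solution
begin

lemma increment_measurable:
 assumes "0 <= t" "w \<in> N \<rightarrow>\<^sub>M M" "x \<in> borel_measurable N" "h \<in> borel_measurable N"
 shows "(%p. increment (h p) (u t (w p)) (x p)) \<in> borel_measurable N"
 unfolding increment_def using assms by (intro borel_measurable_diff u_pair_measurable borel_measurable_add)

text \<open>Moves the spherical integral outermost, since the mean tensors belong to a fixed
  separation. Fubini applies because a cubic integrand is dominated in mean by
  \<open>cube_moment\<close>, uniformly over unit vectors, and the sphere has finite
  measure.\<close>

lemma structure_swap:
 fixes c :: "real^3 => sfield"
 assumes t: "0 <= t" and cm: "(%(n, d). c n d) \<in> borel_measurable (borel \<Otimes>\<^sub>M borel)"
  and b: "!!n d. norm n = 1 ==> \<bar>c n d\<bar> <= norm d ^ 3"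
 shows "(AV x. LINT w|M. C * (LINT n|sphere_measure. c n (increment (r *\<^sub>R n) (u t w) x)))
  = C * (LINT n|sphere_measure. expectation (%w. AV x. c n (increment (r *\<^sub>R n) (u t w) x)))"
proof -
 interpret TM: pair_sigma_finite torus M ..
 interpret MT: pair_sigma_finite M torus ..
 interpret Q: pair_sigma_finite "torus \<Otimes>\<^sub>M M" sphere_measure ..
 let ?P = "torus \<Otimes>\<^sub>M M"
 define g where "g x w n = c n (increment (r *\<^sub>R n) (u t w) x)" for x w n
 note inc = increment_measurable[OF t]
 have gm: "(%p. g (x p) (w p) (n p)) \<in> borel_measurable N"
  if "w \<in> N \<rightarrow>\<^sub>M M" "x \<in> borel_measurable N" "n \<in> borel_measurable N" for N :: "'z measure" and w x n
 proof -
  have "(%p. (n p, increment (r *\<^sub>R n p) (u t (w p)) (x p))) \<in> N \<rightarrow>\<^sub>M borel \<Otimes>\<^sub>M borel"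
   using that by (intro measurable_Pair inc borel_measurable_scaleR borel_measurable_const)
  from measurable_compose[OF this cm] show ?thesis by (simp add: g_def)
 qed
 have xt: "(%p. fst p) \<in> borel_measurable ?P" by (rule measurable_compose[OF measurable_fst torus_ident])
 have mQ: "(%(p, n). g (fst p) (snd p) n) \<in> borel_measurable (?P \<Otimes>\<^sub>M sphere_measure)"
  unfolding split_def
  by (intro gm measurable_compose[OF measurable_fst measurable_snd] measurable_compose[OF measurable_fst xt]) simp
 have mP: "(%(x, w). g x w n) \<in> borel_measurable ?P" for n
  unfolding split_def by (intro gm measurable_snd xt borel_measurable_const)
 have bound: "AE w in M. \<forall>n. norm n = 1 \<longrightarrow> (\<integral>\<^sup>+x. norm (g x w n) \<partial>torus) <= ennreal (8 * cube_moment t w)"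
  using AE_L3[OF t]
 proof eventually_elim
  case (elim w)
  show ?case
  proof (intro allI impI)
   fix n :: "real^3" assume n: "norm n = 1"
   let ?d = "%x. norm (increment (r *\<^sub>R n) (u t w) x) ^ 3"
   have "(\<integral>\<^sup>+x. norm (g x w n) \<partial>torus) <= (\<integral>\<^sup>+x. ?d x \<partial>torus)"
    unfolding g_def real_norm_def by (intro nn_integral_mono ennreal_leI b[OF n])
   also have "... = ennreal (AV x. ?d x)" using elim by (intro nn_integral_eq_integral increment_L3) auto
   also have "... <= ennreal (8 * cube_moment t w)"
    using increment_L3_le[of "u t w" "r *\<^sub>R n"] elim by (intro ennreal_leI) (simp add: cube_moment_def)
   finally show "(\<integral>\<^sup>+x. norm (g x w n) \<partial>torus) <= ennreal (8 * cube_moment t w)" .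
  qed
 qed
 have iQ: "integrable (?P \<Otimes>\<^sub>M sphere_measure) (%(p, n). g (fst p) (snd p) n)"
 proof (rule integrableI_bounded[OF mQ])
  have "(\<integral>\<^sup>+q. norm (case q of (p, n) => g (fst p) (snd p) n) \<partial>(?P \<Otimes>\<^sub>M sphere_measure))
    = (\<integral>\<^sup>+n. \<integral>\<^sup>+p. norm (g (fst p) (snd p) n) \<partial>?P \<partial>sphere_measure)"
   using mQ by (subst Q.nn_integral_snd[symmetric]) simp_all
  also have "... = (\<integral>\<^sup>+n. \<integral>\<^sup>+w. \<integral>\<^sup>+x. norm (g x w n) \<partial>torus \<partial>M \<partial>sphere_measure)"
   using mP by (intro nn_integral_cong, subst TM.nn_integral_snd[symmetric]) (simp_all add: split_def)
  also have "... <= (\<integral>\<^sup>+n. \<integral>\<^sup>+w. ennreal (8 * cube_moment t w) \<partial>M \<partial>sphere_measure)"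
  proof (rule nn_integral_mono_AE)
   show "AE n in sphere_measure. (\<integral>\<^sup>+w. \<integral>\<^sup>+x. norm (g x w n) \<partial>torus \<partial>M) <= (\<integral>\<^sup>+w. ennreal (8 * cube_moment t w) \<partial>M)"
    using AE_sphere_measure
   proof eventually_elim
    case (elim n)
    show ?case by (rule nn_integral_mono_AE) (use bound elim in \<open>auto elim: eventually_mono\<close>)
   qed
  qed
  also have "... < \<infinity>"
  proof -
   have "(\<integral>\<^sup>+w. ennreal (8 * cube_moment t w) \<partial>M) <= (\<integral>\<^sup>+w. norm (8 * cube_moment t w) \<partial>M)"
    by (intro nn_integral_mono ennreal_leI) simp
   also have "... < \<infinity>"
    using integrable_mult_right[OF cube_moment_integrable[OF t], of 8] unfolding integrable_iff_bounded by blast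
   finally have "(\<integral>\<^sup>+w. ennreal (8 * cube_moment t w) \<partial>M) < \<infinity>" .
   then show ?thesis by (simp add: emeasure_sphere_measure ennreal_mult_less_top)
  qed
  finally show "(\<integral>\<^sup>+q. norm (case q of (p, n) => g (fst p) (snd p) n) \<partial>(?P \<Otimes>\<^sub>M sphere_measure)) < \<infinity>" .
 qed
 have iP: "integrable ?P (%p. LINT n|sphere_measure. g (fst p) (snd p) n)"
  using Q.integrable_fst'[OF iQ] by simp
 have "(AV x. LINT w|M. (LINT n|sphere_measure. g x w n)) = (LINT p|?P. LINT n|sphere_measure. g (fst p) (snd p) n)"
  using TM.integral_fst'[OF iP] by simp
 also have "... = (LINT n|sphere_measure. LINT p|?P. g (fst p) (snd p) n)"
  using Q.Fubini_integral[OF iQ] by simp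
 also have "... = (LINT n|sphere_measure. expectation (%w. AV x. g x w n))"
 proof (rule integral_cong_AE)
  show "(%n. LINT p|?P. g (fst p) (snd p) n) \<in> borel_measurable sphere_measure"
   using Q.integrable_snd[OF iQ] by (rule borel_measurable_integrable)
  have "(%p. AV x. g x (snd p) (fst p)) \<in> borel_measurable (sphere_measure \<Otimes>\<^sub>M M)"
  proof -
   have "(%q. g (snd q) (snd (fst q)) (fst (fst q))) \<in> borel_measurable ((sphere_measure \<Otimes>\<^sub>M M) \<Otimes>\<^sub>M torus)"
    by (intro gm measurable_compose[OF measurable_fst measurable_snd] measurable_compose[OF measurable_snd torus_ident] measurable_fst'')
      (simp_all add: measurable_compose[OF measurable_fst])
   then show ?thesis by (intro torus.borel_measurable_lebesgue_integral) (simp add: split_def)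
  qed
  then show "(%n. expectation (%w. AV x. g x w n)) \<in> borel_measurable sphere_measure"
   by (intro borel_measurable_lebesgue_integral) (simp add: split_def)
  show "AE n in sphere_measure. (LINT p|?P. g (fst p) (snd p) n) = expectation (%w. AV x. g x w n)"
   using Q.AE_integrable_snd[OF iQ]
  proof eventually_elim
   case (elim n)
   then have "integrable ?P (%(x, w). g x w n)" by (simp add: split_def)
   from TM.integral_snd[OF this] show ?case by (simp add: split_def)
  qed
 qed
 finally show ?thesis by (simp add: g_def)
qed

lemma structure_43_eq:
 assumes t: "0 <= t"
 shows "structure_43 M u t r = (LINT n|sphere_measure. n \<bullet> mean_flux t (r *\<^sub>R n)) / (4 * pi * r)"
proof -
 have S: "structure_43 M u t r = 1 / (4 * pi * r) * (LINT n|sphere_measure. expectation (%w. LINT x|torus.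
   (norm (increment (r *\<^sub>R n) (u t w) x))^2 * (increment (r *\<^sub>R n) (u t w) x \<bullet> n)))"
  unfolding structure_43_def
 proof (rule structure_swap[OF t, where c="%n d. (norm d)^2 * (d \<bullet> n)"])
  show "\<bar>(norm d)^2 * (d \<bullet> n)\<bar> <= norm d ^ 3" if "norm n = 1" for n d :: "real^3"
   using mult_left_mono[OF Cauchy_Schwarz_ineq2[of d n], of "(norm d)^2"] that by (simp add: abs_mult power2_eq_square power3_eq_cube)
  show "(%(n, d). (norm d)^2 * (d \<bullet> n)) \<in> borel_measurable (borel \<Otimes>\<^sub>M (borel :: (real^3) measure))"
   by measurable
 qed
 have key: "expectation (%w. AV x. (norm (increment (r *\<^sub>R n) (u t w) x))^2 * (increment (r *\<^sub>R n) (u t w) x \<bullet> n))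
   = n \<bullet> mean_flux t (r *\<^sub>R n)" for n
  unfolding inner_mean_flux[OF t]
 proof (rule integral_cong_AE)
  have "(%p. (norm (increment (r *\<^sub>R n) (u t (fst p)) (snd p)))^2 * (increment (r *\<^sub>R n) (u t (fst p)) (snd p) \<bullet> n)) \<in> borel_measurable (M \<Otimes>\<^sub>M torus)"
   by (intro borel_measurable_times borel_measurable_power borel_measurable_norm[THEN measurable_compose[rotated]] borel_measurable_inner
      increment_measurable[OF t] measurable_fst measurable_compose[OF measurable_snd torus_ident] borel_measurable_const)
  then show "(%w. AV x. (norm (increment (r *\<^sub>R n) (u t w) x))^2 * (increment (r *\<^sub>R n) (u t w) x \<bullet> n)) \<in> borel_measurable M"
   by (intro torus.borel_measurable_lebesgue_integral) (simp add: split_def)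
  show "(%w. n \<bullet> third_moment (u t w) (r *\<^sub>R n)) \<in> borel_measurable M"
   using measurable_compose[OF measurable_Pair2' third_moment_measurable[OF t], of "r *\<^sub>R n" n] by simp
  show "AE w in M. (AV x. (norm (increment (r *\<^sub>R n) (u t w) x))^2 * (increment (r *\<^sub>R n) (u t w) x \<bullet> n)) = n \<bullet> third_moment (u t w) (r *\<^sub>R n)"
   using AE_L3[OF t] by eventually_elim (simp add: inner_third_moment inner_commute)
 qed
 show ?thesis unfolding S key by simp
qed

text \<open>The power r^4 is the normalizing r times the r^3 that comes from writing the
  longitudinal moment with h = r n instead of the unit vector n.\<close>

lemma structure_45_eq:
 assumes t: "0 <= t" and r: "0 < r"
 shows "structure_45 M u t r = (LINT n|sphere_measure. mean_longitudinal t (r *\<^sub>R n)) / (4 * pi * r ^ 4)"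
proof -
 have S: "structure_45 M u t r = 1 / (4 * pi * r) * (LINT n|sphere_measure. expectation (%w. LINT x|torus.
   (increment (r *\<^sub>R n) (u t w) x \<bullet> n) ^ 3))"
  unfolding structure_45_def
 proof (rule structure_swap[OF t, where c="%n d. (d \<bullet> n) ^ 3"])
  show "\<bar>(d \<bullet> n) ^ 3\<bar> <= norm d ^ 3" if "norm n = 1" for n d :: "real^3"
   using power_mono[OF Cauchy_Schwarz_ineq2[of d n] abs_ge_zero, of 3] that by (simp add: power_abs)
  show "(%(n, d). (d \<bullet> n) ^ 3) \<in> borel_measurable (borel \<Otimes>\<^sub>M (borel :: (real^3) measure))"
   by measurable
 qed
 have key: "expectation (%w. AV x. (increment (r *\<^sub>R n) (u t w) x \<bullet> n) ^ 3) = mean_longitudinal t (r *\<^sub>R n) / r ^ 3" for n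
 proof -
  have "expectation (%w. AV x. (increment (r *\<^sub>R n) (u t w) x \<bullet> n) ^ 3) = expectation (%w. longitudinal_moment (u t w) (r *\<^sub>R n) / r ^ 3)"
  proof (rule integral_cong_AE)
   have "(%p. (increment (r *\<^sub>R n) (u t (fst p)) (snd p) \<bullet> n) ^ 3) \<in> borel_measurable (M \<Otimes>\<^sub>M torus)"
    by (intro borel_measurable_power borel_measurable_inner
       increment_measurable[OF t] measurable_fst measurable_compose[OF measurable_snd torus_ident] borel_measurable_const)
   then show "(%w. AV x. (increment (r *\<^sub>R n) (u t w) x \<bullet> n) ^ 3) \<in> borel_measurable M"
    by (intro torus.borel_measurable_lebesgue_integral) (simp add: split_def)
   show "(%w. longitudinal_moment (u t w) (r *\<^sub>R n) / r ^ 3) \<in> borel_measurable M"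
    unfolding longitudinal_moment_def
    by (intro borel_measurable_divide borel_measurable_sum borel_measurable_times borel_measurable_const tensor_measurable[OF t])
   show "AE w in M. (AV x. (increment (r *\<^sub>R n) (u t w) x \<bullet> n) ^ 3) = longitudinal_moment (u t w) (r *\<^sub>R n) / r ^ 3"
    using AE_L3[OF t] by eventually_elim (use r in \<open>simp add: longitudinal_moment_eq(1) inner_commute power_mult_distrib\<close>)
  qed
  then show ?thesis by (simp add: mean_longitudinal_def)
 qed
 show ?thesis unfolding S key using r by (simp add: power3_eq_cube power4_eq_xxxx)
qed

end

text \<open>The order of quantifiers is the point: \<open>R\<close> depends on \<eta> alone and the
  remainder \<open>m\<close> on \<nu> alone, so the inner limit in \<nu> removes \<open>m\<close>
  and the outer limit needs only \<open>l\<^sub>I < R\<close>. For an empty range of scales the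
  supremum in \<open>ennreal\<close> is 0.\<close>

lemma law_limit:
 fixes S :: "real => real => real"
 assumes m: "(m \<longlongrightarrow> 0) (at_right 0)"
  and bound: "!!\<eta>. 0 < \<eta> ==> \<exists>R>0. \<forall>\<nu>>0. \<forall>l. l\<^sub>D \<nu> <= l \<and> l < R \<longrightarrow> \<bar>S \<nu> l\<bar> <= \<eta> + m \<nu>"
 shows "((%l\<^sub>I. Limsup (at_right 0) (%\<nu>. SUP l\<in>{l\<^sub>D \<nu>..l\<^sub>I}. ennreal \<bar>S \<nu> l\<bar>)) \<longlongrightarrow> 0) (at_right 0)"
proof (rule order_tendstoI)
 fix a :: ennreal assume "0 < a"
 then obtain b where b: "0 < b" "b < a" using dense by blast
 then obtain e where e: "b = ennreal e" "0 < e" by (cases b) auto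
 obtain R where R: "R > 0" "!!\<nu> l. 0 < \<nu> ==> l\<^sub>D \<nu> <= l ==> l < R ==> \<bar>S \<nu> l\<bar> <= e / 2 + m \<nu>"
  using bound[of "e / 2"] e by auto
 have "\<forall>\<^sub>F l\<^sub>I in at_right 0. l\<^sub>I < R" using R(1) by (rule eventually_at_right_real[THEN eventually_mono]) auto
 then show "\<forall>\<^sub>F l\<^sub>I in at_right 0. Limsup (at_right 0) (%\<nu>. SUP l\<in>{l\<^sub>D \<nu>..l\<^sub>I}. ennreal \<bar>S \<nu> l\<bar>) < a"
 proof eventually_elim
  case (elim l\<^sub>I)
  have "Limsup (at_right 0) (%\<nu>. SUP l\<in>{l\<^sub>D \<nu>..l\<^sub>I}. ennreal \<bar>S \<nu> l\<bar>) <= b"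
  proof (rule Limsup_bounded)
   have "\<forall>\<^sub>F \<nu> in at_right 0. m \<nu> < e / 2" by (rule order_tendstoD(2)[OF m]) (use e(2) in simp)
   moreover have "\<forall>\<^sub>F \<nu> in at_right (0::real). 0 < \<nu>" by (rule eventually_at_right_less)
   ultimately show "\<forall>\<^sub>F \<nu> in at_right 0. (SUP l\<in>{l\<^sub>D \<nu>..l\<^sub>I}. ennreal \<bar>S \<nu> l\<bar>) <= b"
   proof eventually_elim
    case (elim \<nu>)
    show ?case
    proof (rule SUP_least)
     fix l assume "l \<in> {l\<^sub>D \<nu>..l\<^sub>I}"
     then have "\<bar>S \<nu> l\<bar> <= e" using R(2)[of \<nu> l] elim \<open>l\<^sub>I < R\<close> by auto
     then show "ennreal \<bar>S \<nu> l\<bar> <= b" unfolding e(1) by (rule ennreal_leI)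
    qed
   qed
  qed
  then show ?case using b(2) by simp
 qed
qed simp

theorem theorem1p8:
  fixes \<sigma> :: "nat \<Rightarrow> real" and e :: "nat \<Rightarrow> vfield"
    and M :: "real \<Rightarrow> 'w measure"
    and F :: "real \<Rightarrow> real \<Rightarrow> 'w measure"
    and \<beta> :: "real \<Rightarrow> nat \<Rightarrow> real \<Rightarrow> 'w \<Rightarrow> real"
    and u :: "real \<Rightarrow> real \<Rightarrow> 'w \<Rightarrow> vfield"
  assumes noise: "noise_coefficients \<sigma> e"
    and solution: "\<And>\<nu>. \<nu> > 0 \<Longrightarrow>
      stationary_martingale_solution \<sigma> e \<nu> (M \<nu>) (F \<nu>) (\<beta> \<nu>) (u \<nu>)"
    and homogeneous: "\<And>\<nu>. \<nu> > 0 \<Longrightarrow> homogeneous (M \<nu>) (u \<nu>)"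
    and energy: "\<And>\<nu>. \<nu> > 0 \<Longrightarrow> energy_bounds \<sigma> \<nu> (M \<nu>) (u \<nu>)"
    and weak_anomalous_dissipation: "\<And>t. t \<ge> 0 \<Longrightarrow>
      ((\<lambda>\<nu>. ennreal \<nu> * mean_L2_normsq (M \<nu>) (u \<nu>) t) \<longlongrightarrow> 0) (at_right 0)"
  shows
    "(\<exists>l\<^sub>D :: real \<Rightarrow> real. (\<forall>\<nu>>0. l\<^sub>D \<nu> > 0) \<and> (l\<^sub>D \<longlongrightarrow> 0) (at_right 0) \<and>
        (\<forall>t\<ge>0. ((\<lambda>l\<^sub>I. Limsup (at_right 0) (\<lambda>\<nu>. SUP l\<in>{l\<^sub>D \<nu>..l\<^sub>I}.
            ennreal \<bar>structure_43 (M \<nu>) (u \<nu>) t l + 4/3 * energy_input \<sigma>\<bar>)) \<longlongrightarrow> 0) (at_right 0))) \<and>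
     (\<exists>l\<^sub>D :: real \<Rightarrow> real. (\<forall>\<nu>>0. l\<^sub>D \<nu> > 0) \<and> (l\<^sub>D \<longlongrightarrow> 0) (at_right 0) \<and>
        (\<forall>t\<ge>0. ((\<lambda>l\<^sub>I. Limsup (at_right 0) (\<lambda>\<nu>. SUP l\<in>{l\<^sub>D \<nu>..l\<^sub>I}.
            ennreal \<bar>structure_45 (M \<nu>) (u \<nu>) t l + 4/5 * energy_input \<sigma>\<bar>)) \<longlongrightarrow> 0) (at_right 0)))"
proof -
 have loc: "stationary_solution \<sigma> e \<nu> (M \<nu>) (F \<nu>) (\<beta> \<nu>) (u \<nu>)" if "\<nu> > 0" for \<nu>
  using that noise solution energy by (simp add: stationary_solution_def)
 \<comment> \<open>Read off at time 0. By stationarity it has the same value at all times, and the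
   lower scale built from it serves every t.\<close>
 define m where "m \<nu> = enn2real (ennreal \<nu> * mean_L2_normsq (M \<nu>) (u \<nu>) 0)" for \<nu>
 have m0: "(m \<longlongrightarrow> 0) (at_right 0)"
 proof -
  have "((%\<nu>. ennreal \<nu> * mean_L2_normsq (M \<nu>) (u \<nu>) 0) \<longlongrightarrow> ennreal 0) (at_right 0)"
   using weak_anomalous_dissipation[of 0] by simp
  from tendsto_enn2real[OF this] show ?thesis by (simp add: m_def[abs_def])
 qed
 have m: "m \<nu> = \<nu> * (LINT w|M \<nu>. (L2_norm (u \<nu> t w))^2)" "0 <= m \<nu>" if "\<nu> > 0" "0 <= t" for \<nu> t
 proof -
  interpret stationary_solution \<sigma> e \<nu> "M \<nu>" "F \<nu>" "\<beta> \<nu>" "u \<nu>" by (rule loc[OF that(1)])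
  have "mean_L2_normsq (M \<nu>) (u \<nu>) 0 = ennreal (expectation (%w. (L2_norm (u \<nu> 0 w))^2))"
   unfolding mean_L2_normsq_def by (rule nn_integral_eq_integral[OF L2_norm_moment]) auto
  also have "expectation (%w. (L2_norm (u \<nu> 0 w))^2) = expectation (%w. (L2_norm (u \<nu> t w))^2)"
   by (rule stationary_expectation[OF that(2), symmetric]) (intro borel_measurable_power L2_norm_measurable)
  finally show "m \<nu> = \<nu> * (LINT w|M \<nu>. (L2_norm (u \<nu> t w))^2)"
   using that by (simp add: m_def enn2real_mult)
  show "0 <= m \<nu>" by (simp add: m_def)
 qed
 \<comment> \<open>With this fourth root, for l >= \<open>s \<nu>\<close> the viscous error sqrt
   (\<open>m \<nu>\<close>) / l is at most \<open>s \<nu>\<close>. The summand \<nu> in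
   \<open>l\<^sub>D\<close> keeps the scale positive when \<open>m \<nu>\<close> is zero.\<close>
 define s where "s \<nu> = sqrt (sqrt (m \<nu>))" for \<nu>
 have s0: "(s \<longlongrightarrow> 0) (at_right 0)"
  unfolding s_def using tendsto_real_sqrt[OF tendsto_real_sqrt[OF m0]] by simp
 have sn: "0 <= s \<nu>" for \<nu> by (simp add: s_def m_def)
 define l\<^sub>D where "l\<^sub>D \<nu> = s \<nu> + \<nu>" for \<nu>
 have l\<^sub>D: "\<forall>\<nu>>0. l\<^sub>D \<nu> > 0" "(l\<^sub>D \<longlongrightarrow> 0) (at_right 0)"
 proof -
  show "\<forall>\<nu>>0. l\<^sub>D \<nu> > 0" using sn by (simp add: l\<^sub>D_def add_nonneg_pos)
  have "((%\<nu>. s \<nu> + \<nu>) \<longlongrightarrow> 0 + 0) (at_right 0)" by (intro tendsto_intros s0)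
  then show "(l\<^sub>D \<longlongrightarrow> 0) (at_right 0)" by (simp add: l\<^sub>D_def[abs_def])
 qed
 let ?w = "stationary_solution.forcing_correlation \<sigma> e" and ?\<epsilon> = "energy_input \<sigma>"
 \<comment> \<open>The forcing correlation is the same for all viscosities, so the instance \<nu> =
   1 provides its continuity once and for all.\<close>
 have near: "\<exists>R>0. \<forall>h. norm h < R \<longrightarrow> \<bar>?w h - 2 * ?\<epsilon>\<bar> <= \<eta>" if "0 < \<eta>" for \<eta>
 proof -
  interpret stationary_solution \<sigma> e 1 "M 1" "F 1" "\<beta> 1" "u 1" by (rule loc) simp
  have "\<exists>d>0. \<forall>h. dist h 0 < d \<longrightarrow> dist (?w h) (?w 0) < \<eta>"
   using continuous_forcing_correlation that unfolding continuous_on_iff by (metis UNIV_I)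
  then show ?thesis by (auto simp: dist_norm forcing_correlation_0 intro: less_imp_le)
 qed
 have err: "(\<nu> * stationary_solution.lipschitz_constant (M \<nu>) (u \<nu>) t) / l <= sqrt ?\<epsilon> * s \<nu>"
  if \<nu>: "\<nu> > 0" and t: "0 <= t" and l: "l\<^sub>D \<nu> <= l" for \<nu> t l
 proof -
  interpret stationary_solution \<sigma> e \<nu> "M \<nu>" "F \<nu>" "\<beta> \<nu>" "u \<nu>" by (rule loc[OF \<nu>])
  have l0: "0 < l" "s \<nu> <= l" using l \<nu> sn[of \<nu>] by (auto simp: l\<^sub>D_def)
  have \<epsilon>: "0 <= sqrt ?\<epsilon>"
   unfolding energy_input_def using \<sigma>_summable by (auto intro!: real_sqrt_ge_zero suminf_nonneg)
  have "\<nu> * lipschitz_constant t <= sqrt (m \<nu>) * sqrt ?\<epsilon>" using dissipation_bound[OF t] m(1)[OF \<nu> t] by simp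
  also have "sqrt (m \<nu>) = s \<nu> * s \<nu>" using m(2)[OF \<nu> t] by (simp add: s_def)
  also have "s \<nu> * s \<nu> * sqrt ?\<epsilon> <= l * s \<nu> * sqrt ?\<epsilon>" using l0(2) sn[of \<nu>] \<epsilon> by (intro mult_right_mono)
  finally show ?thesis using l0(1) by (simp add: pos_divide_le_eq mult_ac)
 qed
 \<comment> \<open>The constant 12 of the 4/3 law also covers the smaller constant 48/5 of the 4/5
   law.\<close>
 define C where "C \<nu> = 12 * (sqrt ?\<epsilon> * s \<nu>)" for \<nu>
 have C0: "(C \<longlongrightarrow> 0) (at_right 0)"
  unfolding C_def using tendsto_mult_right_zero[OF tendsto_mult_right_zero[OF s0, of "sqrt ?\<epsilon>"], of 12] by simp
 have law43: "\<exists>R>0. \<forall>\<nu>>0. \<forall>l. l\<^sub>D \<nu> <= l \<and> l < R \<longrightarrow> \<bar>structure_43 (M \<nu>) (u \<nu>) t l + 4/3 * ?\<epsilon>\<bar> <= \<eta> + C \<nu>"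
  and law45: "\<exists>R>0. \<forall>\<nu>>0. \<forall>l. l\<^sub>D \<nu> <= l \<and> l < R \<longrightarrow> \<bar>structure_45 (M \<nu>) (u \<nu>) t l + 4/5 * ?\<epsilon>\<bar> <= \<eta> + C \<nu>"
  if t: "0 <= t" and \<eta>: "0 < \<eta>" for t \<eta>
 proof -
  obtain R where R: "R > 0" "!!h. norm h < R ==> \<bar>?w h - 2 * ?\<epsilon>\<bar> <= \<eta>" using near[OF \<eta>] by blast
  have "\<bar>structure_43 (M \<nu>) (u \<nu>) t l + 4/3 * ?\<epsilon>\<bar> <= \<eta> + C \<nu> \<and> \<bar>structure_45 (M \<nu>) (u \<nu>) t l + 4/5 * ?\<epsilon>\<bar> <= \<eta> + C \<nu>"
   if \<nu>: "\<nu> > 0" and l: "l\<^sub>D \<nu> <= l" "l < R" for \<nu> l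
  proof -
   interpret stationary_solution \<sigma> e \<nu> "M \<nu>" "F \<nu>" "\<beta> \<nu>" "u \<nu>" by (rule loc[OF \<nu>])
   have l0: "0 < l" using l(1) l\<^sub>D(1) \<nu> less_le_trans by blast
   define X where "X = (\<nu> * lipschitz_constant t) / l"
   have X: "0 <= X" "X <= sqrt ?\<epsilon> * s \<nu>"
    using \<nu> l0 lipschitz_constant_nonneg[of t] err[OF \<nu> t l(1)] by (auto simp: X_def)
   have "\<bar>structure_43 (M \<nu>) (u \<nu>) t l + 4/3 * ?\<epsilon>\<bar> <= 2/3 * \<eta> + 12 * X"
    using averaged_43[OF t R(2) l0 l(2)] unfolding structure_43_eq[OF t] X_def by simp
   moreover have "\<bar>structure_45 (M \<nu>) (u \<nu>) t l + 4/5 * ?\<epsilon>\<bar> <= 2/5 * \<eta> + 48/5 * X"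
    using averaged_45[OF t R(2) l0 l(2)] unfolding structure_45_eq[OF t l0] X_def by simp
   ultimately show ?thesis using X \<eta> unfolding C_def by auto
  qed
  then show "\<exists>R>0. \<forall>\<nu>>0. \<forall>l. l\<^sub>D \<nu> <= l \<and> l < R \<longrightarrow> \<bar>structure_43 (M \<nu>) (u \<nu>) t l + 4/3 * ?\<epsilon>\<bar> <= \<eta> + C \<nu>"
   "\<exists>R>0. \<forall>\<nu>>0. \<forall>l. l\<^sub>D \<nu> <= l \<and> l < R \<longrightarrow> \<bar>structure_45 (M \<nu>) (u \<nu>) t l + 4/5 * ?\<epsilon>\<bar> <= \<eta> + C \<nu>"
   using R(1) by blast+
 qed
 show ?thesis
  by (intro conjI exI[of _ l\<^sub>D] l\<^sub>D allI impI law_limit[OF C0] law43 law45)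
qed

end
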